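(* Let $\rho:\widehat G\to G$ be a central extension of a Lie group $G$ by $U(1)$, and let $\theta$ be a connection form on the principal $U(1)$-bundle $\widehat G\to G$. Fix any trivialization $\delta\widehat G\cong (G\times G)\times U(1)$ of the $U(1)$-bundle $\delta\widehat G\to G\times G$, and let $\hat s$ be the global section of $\delta\widehat G$ corresponding to the constant section $1$. Then the simplicial Dixmier–Douady cocycle associated to $\theta$ and this trivialization, $$c_1(\theta)-\Big(\frac{-1}{2\pi i}\Big)\hat s^{*}(\delta\theta)\ \in\ \Omega^2(NG(1))\oplus\Omega^1(NG(2))\subset\Omega^3(NG),$$ represents the universal Dixmier–Douady class associated to $\rho$. That is, for every principal $G$-bundle $Y\to M$ and Leray covering $\{U_\alpha\}$ of $M$ with transition functions $g_{\alpha\beta}$, the class of $$\{g_{\alpha\beta}^{*}c_1(\theta)\}+\Big\{-\Big(\frac{-1}{2\pi i}\Big)(g_{\alpha\beta},g_{\beta\gamma})^{*}\hat s^{*}(\delta\theta)\Big\}$$ equals, as a Čech–de Rham cohomology class of $M$, the class of $\big\{\big(\frac{-1}{2\pi i}\big)\,d\log c_{\alpha\beta\gamma}\big\}$, where $\{c_{\alpha\beta\gamma}\}$ is the Dixmier–Douady cocycle of $Y$ defined using the fixed trivialization.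
   Context: Lie groups: $G$ is a Lie group; it may be infinite dimensional provided it has partitions of unity (so that connection forms on $U(1)$-bundles over $G$ can be considered). A central extension $1\to U(1)\to\widehat G\xrightarrow{\rho}G\to1$ is regarded as a principal $U(1)$-bundle $\rho:\widehat G\to G$. Simplicial manifold: $NG(p)=G^p$, with face maps $\varepsilon_i:NG(p)\to NG(p-1)$, $\varepsilon_0(g_1,\dots,g_p)=(g_2,\dots,g_p)$, $\varepsilon_i(g_1,\dots,g_p)=(g_1,\dots,g_ig_{i+1},\dots,g_p)$ for $1\le i\le p-1$, $\varepsilon_p(g_1,\dots,g_p)=(g_1,\dots,g_{p-1})$. The double complex is $\Omega^{p,q}(NG)=\Omega^q(NG(p))$ with $d'=\sum_{i=0}^{p+1}(-1)^i\varepsilon_i^*$ and $d''=(-1)^p d$; $\Omega^n(NG)=\bigoplus_{p+q=n}\Omega^{p,q}(NG)$ is the total complex. Its cohomology is isomorphic to $H^*(BG)$. $U(1)$-bundles: for principal $U(1)$-bundles $S,T$ over $X$, $S\otimes T=\bigcup_{x}(S_x\times T_x)/(s,t)\sim(su,tu^{-1})$, $u\in U(1)$; $S^{\otimes-1}$ is $S$ with the inverse $U(1)$-action. Connections $\theta_S,\theta_T$ induce the connection on $S\otimes T$ that pulls back to $\theta_S+\theta_T$ on $S\times_XT$, and $-\theta_S$ on $S^{\otimes-1}$. Put $\delta\widehat G=\varepsilon_0^*\widehat G\otimes(\varepsilon_1^*\widehat G)^{\otimes-1}\otimes\varepsilon_2^*\widehat G$ over $NG(2)=G\times G$, which is a trivial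 bundle, and let $\delta\theta$ be the connection on it induced by $\theta$. $c_1(\theta)\in\Omega^2(G)$ is the 2-form with $\rho^*c_1(\theta)=\frac{-1}{2\pi i}d\theta$. Dixmier–Douady class: let $Y\to M$ be a principal $G$-bundle and $\{U_\alpha\}$ a Leray covering of $M$ (in particular each $U_{\alpha\beta}$ is contractible), with transition functions $g_{\alpha\beta}:U_{\alpha\beta}\to G$. Choose lifts $\hat g_{\alpha\beta}:U_{\alpha\beta}\to\widehat G$ with $\rho\circ\hat g_{\alpha\beta}=g_{\alpha\beta}$, smooth so that $d\log c_{\alpha\beta\gamma}$ below is defined. The bundle $g_{\beta\gamma}^*\widehat G\otimes(g_{\alpha\gamma}^*\widehat G)^{\otimes-1}\otimes g_{\alpha\beta}^*\widehat G$ is the pull-back of $\delta\widehat G$ by $(g_{\alpha\beta},g_{\beta\gamma}):U_{\alpha\beta\gamma}\to G\times G$, so the fixed trivialization of $\delta\widehat G$ identifies it with $U_{\alpha\beta\gamma}\times U(1)$. Under this identification $c_{\alpha\beta\gamma}=\hat g_{\beta\gamma}\hat g_{\alpha\gamma}^{-1}\hat g_{\alpha\beta}:U_{\alpha\beta\gamma}\to U(1)$, i.e. $\big(\hat s\circ(g_{\alpha\beta},g_{\beta\gamma})\big)\cdot c_{\alpha\beta\gamma}=\hat g_{\beta\gamma}\otimes\hat g_{\alpha\gamma}^{\otimes-1}\otimes\hat g_{\alpha\beta}$. The Dixmier–Douady class of $Y$ is the class of the Čech cocycle $\{c_{\alpha\beta\gamma}\}$ in $H^2(M,\underline{U(1)})\cong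 H^3(M,\mathbb Z)$, where $\underline{U(1)}$ is the sheaf of continuous $U(1)$-valued functions; as a Čech–de Rham class it is given by $\{\frac{-1}{2\pi i}d\log c_{\alpha\beta\gamma}\}$. A class in $H^n(\Omega^*(NG))$ induces a characteristic class of $Y$ in the Čech–de Rham cohomology of $M$ by pulling back forms on $NG(p)$ along $(g_{\alpha_0\alpha_1},\dots,g_{\alpha_{p-1}\alpha_p}):U_{\alpha_0\cdots\alpha_p}\to NG(p)$.
   Formalization: For an arbitrary trivialization neither the simplicial cochain nor c_{αβγ} need be closed; the cocycle property is therefore asserted only when δŝ = 1, while equality of classes (the difference is a coboundary) is proved for every trivialization. *)

theory Defs
  imports "HOL-Analysis.Analysis" "HOL-Algebra.Coset"
begin

section \<open>Calculus in locally convex spaces\<close>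

text \<open>Model spaces of manifolds: Hausdorff locally convex real topological vector spaces.
  Euclidean, Banach and Frechet spaces are covered.  The constant \<open>convex\<close> is unfolded in the class axiom
  because it cannot be used at the type of the class being declared.\<close>

class locally_convex = real_vector + topological_ab_group_add + t2_space +
  assumes tendsto_scaleR_prod:
      "((\<lambda>z. fst z *\<^sub>R snd z) \<longlongrightarrow> a *\<^sub>R x) (nhds a \<times>\<^sub>F nhds x)"
    and convex_nhd_raw: "open S \<Longrightarrow> x \<in> S \<Longrightarrow> \<exists>T. open T \<and> x \<in> T \<and> T \<subseteq> S \<and>
      (\<forall>y\<in>T. \<forall>z\<in>T. \<forall>u\<ge>0. \<forall>v\<ge>0. u + v = 1 \<longrightarrow> u *\<^sub>R y + v *\<^sub>R z \<in> T)"

lemma convex_nhd: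
  fixes x :: "'a::locally_convex"
  shows "open S \<Longrightarrow> x \<in> S \<Longrightarrow> \<exists>T. open T \<and> convex T \<and> x \<in> T \<and> T \<subseteq> S"
  using convex_nhd_raw[of S x] unfolding convex_def by blast

lemma tendsto_fst_nhds: "(fst \<longlongrightarrow> fst z) (nhds z)"
  and tendsto_snd_nhds: "(snd \<longlongrightarrow> snd z) (nhds z)"
  using tendsto_fst[OF filterlim_ident[of "nhds z"]] tendsto_snd[OF filterlim_ident[of "nhds z"]]
  by simp_all

instance real_normed_vector \<subseteq> locally_convex
proof
  fix a :: real and x :: 'a and S :: "'a set"
  show "((\<lambda>z. fst z *\<^sub>R snd z) \<longlongrightarrow> a *\<^sub>R x) (nhds a \<times>\<^sub>F nhds x)"
    unfolding nhds_prod[symmetric]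
    using tendsto_scaleR[OF tendsto_fst_nhds tendsto_snd_nhds, of "(a, x)"] by simp
  have "open S \<Longrightarrow> x \<in> S \<Longrightarrow> \<exists>T. open T \<and> convex T \<and> x \<in> T \<and> T \<subseteq> S"
    by (metis centre_in_ball convex_ball open_ball openE)
  then show "open S \<Longrightarrow> x \<in> S \<Longrightarrow> \<exists>T. open T \<and> x \<in> T \<and> T \<subseteq> S \<and>
      (\<forall>y\<in>T. \<forall>z\<in>T. \<forall>u\<ge>0. \<forall>v\<ge>0. u + v = 1 \<longrightarrow> u *\<^sub>R y + v *\<^sub>R z \<in> T)"
    unfolding convex_def by blast
qed

instance prod :: (topological_monoid_add, topological_monoid_add) topological_monoid_add
proof
  fix x y :: "'a \<times> 'b"
  have "((\<lambda>z. (fst (fst z) + fst (snd z), snd (fst z) + snd (snd z))) \<longlongrightarrow>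
      (fst x + fst y, snd x + snd y)) (nhds (x, y))"
    using tendsto_Pair[OF
      tendsto_add[OF tendsto_fst[OF tendsto_fst_nhds] tendsto_fst[OF tendsto_snd_nhds]]
      tendsto_add[OF tendsto_snd[OF tendsto_fst_nhds] tendsto_snd[OF tendsto_snd_nhds]],
      of "(x, y)"] by simp
  then show "((\<lambda>z. fst z + snd z) \<longlongrightarrow> x + y) (nhds x \<times>\<^sub>F nhds y)"
    by (simp add: nhds_prod plus_prod_def)
qed

instance prod :: (topological_comm_monoid_add, topological_comm_monoid_add)
  topological_comm_monoid_add ..

instance prod :: (topological_group_add, topological_group_add) topological_group_add
proof
  fix x :: "'a \<times> 'b"
  show "(uminus \<longlongrightarrow> - x) (nhds x)"
    using tendsto_Pair[OF tendsto_minus[OF tendsto_fst_nhds] tendsto_minus[OF tendsto_snd_nhds]]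
    by (simp add: uminus_prod_def[abs_def])
qed

instance prod :: (topological_ab_group_add, topological_ab_group_add) topological_ab_group_add ..

instance prod :: (locally_convex, locally_convex) locally_convex
proof
  fix x :: "'a \<times> 'b" and a :: real and S :: "('a \<times> 'b) set"
  have sc: "((\<lambda>z. f z *\<^sub>R g z) \<longlongrightarrow> c *\<^sub>R d) F"
    if "(f \<longlongrightarrow> c) F" "(g \<longlongrightarrow> d) F"
    for f :: "real \<times> ('a \<times> 'b) \<Rightarrow> real" and g :: "_ \<Rightarrow> 'd::locally_convex" and c d F
    using filterlim_compose[OF tendsto_scaleR_prod[of c d] filterlim_Pair[OF that]] by simp
  have "((\<lambda>z. (fst z *\<^sub>R fst (snd z), fst z *\<^sub>R snd (snd z))) \<longlongrightarrow> (a *\<^sub>R fst x, a *\<^sub>R snd x))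
      (nhds (a, x))"
    using tendsto_Pair[OF sc[OF tendsto_fst_nhds tendsto_fst[OF tendsto_snd_nhds]]
      sc[OF tendsto_fst_nhds tendsto_snd[OF tendsto_snd_nhds]], of "(a, x)"] by simp
  then show "((\<lambda>z. fst z *\<^sub>R snd z) \<longlongrightarrow> a *\<^sub>R x) (nhds a \<times>\<^sub>F nhds x)"
    by (simp add: nhds_prod scaleR_prod_def)
  assume "open S" "x \<in> S"
  then obtain A B where AB: "open A" "open B" "x \<in> A \<times> B" "A \<times> B \<subseteq> S"
    by (rule open_prod_elim)
  obtain T where T: "open T" "convex T" "fst x \<in> T" "T \<subseteq> A"
    using convex_nhd[OF AB(1), of "fst x"] AB(3) by auto
  obtain T' where T': "open T'" "convex T'" "snd x \<in> T'" "T' \<subseteq> B"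
    using convex_nhd[OF AB(2), of "snd x"] AB(3) by auto
  have "\<exists>T. open T \<and> convex T \<and> x \<in> T \<and> T \<subseteq> S"
  proof (intro exI conjI)
    show "open (T \<times> T')" using T(1) T'(1) by (rule open_Times)
    show "convex (T \<times> T')" using T(2) T'(2) by (rule convex_Times)
    show "x \<in> T \<times> T'" using T(3) T'(3) by (simp add: mem_Times_iff)
    show "T \<times> T' \<subseteq> S" using Sigma_mono[OF T(4) T'(4)] AB(4) by (rule subset_trans)
  qed
  then show "\<exists>T. open T \<and> x \<in> T \<and> T \<subseteq> S \<and>
      (\<forall>y\<in>T. \<forall>z\<in>T. \<forall>u\<ge>0. \<forall>v\<ge>0. u + v = 1 \<longrightarrow> u *\<^sub>R y + v *\<^sub>R z \<in> T)"
    unfolding convex_def by blast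
qed

definition dir_quot :: "('a::locally_convex \<Rightarrow> 'b::locally_convex) \<Rightarrow> 'a \<Rightarrow> 'a \<Rightarrow> real \<Rightarrow> 'b" where
  "dir_quot f v x t = (f (x + t *\<^sub>R v) - f x) /\<^sub>R t"

definition dir_deriv :: "('a::locally_convex \<Rightarrow> 'b::locally_convex) \<Rightarrow> 'a \<Rightarrow> 'a \<Rightarrow> 'b" where
  "dir_deriv f v x = Lim (at 0) (dir_quot f v x)"

definition dir_differentiable :: "('a::locally_convex \<Rightarrow> 'b::locally_convex) \<Rightarrow> 'a \<Rightarrow> 'a \<Rightarrow> bool" where
  "dir_differentiable f v x \<longleftrightarrow> (\<exists>l. (dir_quot f v x \<longlongrightarrow> l) (at 0))"

fun iter_deriv :: "('a::locally_convex \<Rightarrow> 'b::locally_convex) \<Rightarrow> 'a list \<Rightarrow> 'a \<Rightarrow> 'b" where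
  "iter_deriv f [] = f"
| "iter_deriv f (v # vs) = dir_deriv (iter_deriv f vs) v"

text \<open>Smoothness in the sense of Michal-Bastiani (Hamilton, Milnor): all iterated directional
  derivatives exist and are jointly continuous in the point and the directions.  The parameter
  \<open>q\<close> counts additional vector arguments (for the coefficients of \<open>q\<close>-forms) in which the
  derivatives have to be jointly continuous, too; the vectors \<open>w 0, w 1, \<dots>\<close> of a sequence
  serve as these arguments and as the directions, so that a single type carries all tuples.\<close>

definition smooth_family ::
    "nat \<Rightarrow> 'a::locally_convex set \<Rightarrow> ('a list \<Rightarrow> 'a \<Rightarrow> 'b::locally_convex) \<Rightarrow> bool" where
  "smooth_family q S F \<longleftrightarrow>
     (\<forall>us vs v. length us = q \<longrightarrow> (\<forall>x\<in>S. dir_differentiable (iter_deriv (F us) vs) v x)) \<and>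
     (\<forall>k. continuous_on (S \<times> UNIV)
        (\<lambda>(x, w :: nat \<Rightarrow> 'a). iter_deriv (F (map w [0..<q])) (map w [q..<q + k]) x))"

definition smooth_on :: "'a::locally_convex set \<Rightarrow> ('a \<Rightarrow> 'b::locally_convex) \<Rightarrow> bool" where
  "smooth_on S f \<longleftrightarrow> smooth_family 0 S (\<lambda>_. f)"

section \<open>Manifolds\<close>

text \<open>A manifold is given by an atlas; carrier and topology are those determined by the charts.\<close>

type_synonym ('m, 'e) chart = "'m set \<times> ('m \<Rightarrow> 'e)"
type_synonym ('m, 'e) atlas = "('m, 'e) chart set"

definition mcarrier :: "('m, 'e) atlas \<Rightarrow> 'm set" where
  "mcarrier A = \<Union> (fst ` A)"

definition mopen :: "('m, 'e::locally_convex) atlas \<Rightarrow> 'm set \<Rightarrow> bool" where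
  "mopen A W \<longleftrightarrow> W \<subseteq> mcarrier A \<and> (\<forall>(U, \<phi>)\<in>A. open (\<phi> ` (W \<inter> U)))"

definition mtopology :: "('m, 'e::locally_convex) atlas \<Rightarrow> 'm topology" where
  "mtopology A = topology (mopen A)"

definition smooth_manifold :: "('m, 'e::locally_convex) atlas \<Rightarrow> bool" where
  "smooth_manifold A \<longleftrightarrow>
     (\<forall>(U, \<phi>)\<in>A. inj_on \<phi> U) \<and>
     (\<forall>(U, \<phi>)\<in>A. \<forall>(V, \<psi>)\<in>A. open (\<phi> ` (U \<inter> V)) \<and>
        smooth_on (\<phi> ` (U \<inter> V)) (\<psi> \<circ> inv_into U \<phi>)) \<and>
     Hausdorff_space (mtopology A)"

definition smooth_map ::
    "('m, 'e::locally_convex) atlas \<Rightarrow> 'm set \<Rightarrow> ('n, 'f::locally_convex) atlas \<Rightarrow> ('m \<Rightarrow> 'n) \<Rightarrow> bool" where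
  "smooth_map A W B f \<longleftrightarrow> mopen A W \<and> f ` W \<subseteq> mcarrier B \<and>
     (\<forall>p\<in>W. \<forall>(U, \<phi>)\<in>A. \<forall>(V, \<psi>)\<in>B. p \<in> U \<and> f p \<in> V \<longrightarrow>
        (\<exists>N. mopen A N \<and> p \<in> N \<and> N \<subseteq> U \<inter> W \<and> f ` N \<subseteq> V \<and>
             smooth_on (\<phi> ` N) (\<psi> \<circ> f \<circ> inv_into U \<phi>)))"

definition prod_atlas :: "('m, 'e) atlas \<Rightarrow> ('n, 'f) atlas \<Rightarrow> ('m \<times> 'n, 'e \<times> 'f) atlas" where
  "prod_atlas A B = {(U \<times> V, map_prod \<phi> \<psi>) | U \<phi> V \<psi>. (U, \<phi>) \<in> A \<and> (V, \<psi>) \<in> B}"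

definition smooth_partitions_of_unity :: "('m, 'e::locally_convex) atlas \<Rightarrow> bool" where
  "smooth_partitions_of_unity A \<longleftrightarrow>
     (\<forall>\<W>. (\<forall>W\<in>\<W>. mopen A W) \<and> \<Union>\<W> = mcarrier A \<longrightarrow>
       (\<exists>f :: 'm set \<Rightarrow> 'm \<Rightarrow> real.
          (\<forall>W\<in>\<W>. smooth_map A (mcarrier A) {(UNIV, id)} (f W) \<and>
             (\<forall>x\<in>mcarrier A. 0 \<le> f W x) \<and>
             mtopology A closure_of {x \<in> mcarrier A. f W x \<noteq> 0} \<subseteq> W) \<and>
          (\<forall>x\<in>mcarrier A. \<exists>N. mopen A N \<and> x \<in> N \<and> finite {W \<in> \<W>. \<exists>y\<in>N. f W y \<noteq> 0}) \<and>
          (\<forall>x\<in>mcarrier A. (\<Sum>W | W \<in> \<W> \<and> f W x \<noteq> 0. f W x) = 1)))"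

section \<open>Differential forms\<close>

text \<open>A form assigns to a chart, a point of its domain and a list of tangent vectors, written in the
  coordinates of that chart, a complex number.  A \<open>q\<close>-form on an open set \<open>W\<close> is evaluated only at
  points of \<open>W\<close> and lists of length \<open>q\<close>; elsewhere its values are irrelevant, whence equality
  of forms is expressed by \<open>form_eq\<close>.\<close>

type_synonym ('m, 'e) form = "('m, 'e) chart \<Rightarrow> 'm \<Rightarrow> 'e list \<Rightarrow> complex"

definition diff_form ::
    "('m, 'e::locally_convex) atlas \<Rightarrow> 'm set \<Rightarrow> nat \<Rightarrow> ('m, 'e) form \<Rightarrow> bool" where
  "diff_form A W q \<omega> \<longleftrightarrow> mopen A W \<and>
     (\<forall>(U, \<phi>)\<in>A. \<forall>p\<in>U \<inter> W. \<forall>vs. length vs = q \<longrightarrow>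
        (\<forall>i<q. linear (\<lambda>v. \<omega> (U, \<phi>) p (vs[i := v]))) \<and>
        (\<forall>i<q. \<forall>j<q. i \<noteq> j \<and> vs ! i = vs ! j \<longrightarrow> \<omega> (U, \<phi>) p vs = 0)) \<and>
     (\<forall>(U, \<phi>)\<in>A. \<forall>(V, \<psi>)\<in>A. \<forall>p\<in>U \<inter> V \<inter> W. \<forall>vs. length vs = q \<longrightarrow>
        \<omega> (U, \<phi>) p vs =
        \<omega> (V, \<psi>) p (map (\<lambda>v. dir_deriv (\<psi> \<circ> inv_into U \<phi>) v (\<phi> p)) vs)) \<and>
     (\<forall>(U, \<phi>)\<in>A. smooth_family q (\<phi> ` (U \<inter> W)) (\<lambda>vs x. \<omega> (U, \<phi>) (inv_into U \<phi> x) vs))"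

definition real_form ::
    "('m, 'e::locally_convex) atlas \<Rightarrow> 'm set \<Rightarrow> nat \<Rightarrow> ('m, 'e) form \<Rightarrow> bool" where
  "real_form A W q \<omega> \<longleftrightarrow> diff_form A W q \<omega> \<and>
     (\<forall>c\<in>A. \<forall>p\<in>fst c \<inter> W. \<forall>vs. length vs = q \<longrightarrow> \<omega> c p vs \<in> \<real>)"

definition form_eq ::
    "('m, 'e) atlas \<Rightarrow> 'm set \<Rightarrow> nat \<Rightarrow> ('m, 'e) form \<Rightarrow> ('m, 'e) form \<Rightarrow> bool" where
  "form_eq A W q \<omega> \<eta> \<longleftrightarrow> (\<forall>c\<in>A. \<forall>p\<in>fst c \<inter> W. \<forall>vs. length vs = q \<longrightarrow> \<omega> c p vs = \<eta> c p vs)"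

definition zero_form :: "('m, 'e) form" where
  "zero_form c p vs = 0"

definition pullback_form ::
    "('n, 'f::locally_convex) atlas \<Rightarrow> ('m \<Rightarrow> 'n) \<Rightarrow> ('n, 'f) form \<Rightarrow> ('m, 'e::locally_convex) form" where
  "pullback_form B f \<omega> c p vs =
     (let d = (SOME d. d \<in> B \<and> f p \<in> fst d) in
      \<omega> d (f p) (map (\<lambda>v. dir_deriv (snd d \<circ> f \<circ> inv_into (fst c) (snd c)) v (snd c p)) vs))"

definition omit :: "nat \<Rightarrow> 'a list \<Rightarrow> 'a list" where
  "omit i xs = take i xs @ drop (Suc i) xs"

definition ext_d :: "('m, 'e::locally_convex) form \<Rightarrow> ('m, 'e) form" where
  "ext_d \<omega> c p vs =
     (\<Sum>i<length vs. (-1) ^ i *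
        dir_deriv (\<lambda>x. \<omega> c (inv_into (fst c) (snd c) x) (omit i vs)) (vs ! i) (snd c p))"

definition dlog :: "('m \<Rightarrow> complex) \<Rightarrow> ('m, 'e::locally_convex) form" where
  "dlog f c p vs = dir_deriv (f \<circ> inv_into (fst c) (snd c)) (hd vs) (snd c p) / f p"

section \<open>Lie groups and principal bundles\<close>

definition lie_group :: "'g monoid \<Rightarrow> ('g, 'e::locally_convex) atlas \<Rightarrow> bool" where
  "lie_group G A \<longleftrightarrow> group G \<and> smooth_manifold A \<and> mcarrier A = carrier G \<and>
     smooth_map (prod_atlas A A) (carrier G \<times> carrier G) A (\<lambda>(g, h). g \<otimes>\<^bsub>G\<^esub> h) \<and>
     smooth_map A (carrier G) A (\<lambda>g. inv\<^bsub>G\<^esub> g)"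

definition circle_group :: "complex monoid" where
  "circle_group = \<lparr>carrier = sphere 0 1, monoid.mult = (*), one = 1\<rparr>"

definition circle_atlas :: "(complex, real) atlas" where
  "circle_atlas = {(cis ` {a<..<a + 2 * pi}, the_inv_into {a<..<a + 2 * pi} cis) | a. True}"

text \<open>The smooth structure of a bundle is given by a family \<open>lsecs\<close> of local sections which cover the
  base and whose transition functions are smooth.\<close>

record ('x, 'p, 'g) pbundle =
  tot :: "'p set"
  proj :: "'p \<Rightarrow> 'x"
  act :: "'p \<Rightarrow> 'g \<Rightarrow> 'p"
  lsecs :: "('x set \<times> ('x \<Rightarrow> 'p)) set"

definition principal_bundle ::
    "'g monoid \<Rightarrow> ('g, 'k::locally_convex) atlas \<Rightarrow> ('x, 'e::locally_convex) atlas \<Rightarrow>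
     ('x, 'p, 'g) pbundle \<Rightarrow> bool" where
  "principal_bundle G AG A P \<longleftrightarrow> lie_group G AG \<and> smooth_manifold A \<and>
     proj P ` tot P \<subseteq> mcarrier A \<and>
     (\<forall>p\<in>tot P. act P p \<one>\<^bsub>G\<^esub> = p \<and>
        (\<forall>g\<in>carrier G. act P p g \<in> tot P \<and> proj P (act P p g) = proj P p \<and>
           (\<forall>h\<in>carrier G. act P (act P p g) h = act P p (g \<otimes>\<^bsub>G\<^esub> h)))) \<and>
     (\<forall>p\<in>tot P. \<forall>q\<in>tot P. proj P p = proj P q \<longrightarrow> (\<exists>!g. g \<in> carrier G \<and> q = act P p g)) \<and>
     \<Union> (fst ` lsecs P) = mcarrier A \<and>
     (\<forall>(V, \<sigma>)\<in>lsecs P. mopen A V \<and> (\<forall>x\<in>V. \<sigma> x \<in> tot P \<and> proj P (\<sigma> x) = x)) \<and>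
     (\<forall>(V, \<sigma>)\<in>lsecs P. \<forall>(W, \<tau>)\<in>lsecs P.
        \<exists>g. smooth_map A (V \<inter> W) AG g \<and> (\<forall>x\<in>V \<inter> W. \<tau> x = act P (\<sigma> x) (g x)))"

definition fibre_div :: "'g monoid \<Rightarrow> ('x, 'p, 'g) pbundle \<Rightarrow> 'p \<Rightarrow> 'p \<Rightarrow> 'g" where
  "fibre_div G P p q = (THE g. g \<in> carrier G \<and> q = act P p g)"

text \<open>The manifold structure of the total space: a local section \<open>\<sigma>\<close> identifies the part of the
  total space over its domain with a product by \<open>(x, g) \<mapsto> \<sigma> x \<cdot> g\<close>.\<close>

definition total_atlas ::
    "'g monoid \<Rightarrow> ('g, 'k) atlas \<Rightarrow> ('x, 'e) atlas \<Rightarrow> ('x, 'p, 'g) pbundle \<Rightarrow> ('p, 'e \<times> 'k) atlas" where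
  "total_atlas G AG A P =
     {({act P (\<sigma> x) g | x g. x \<in> U \<inter> V \<and> g \<in> K},
       \<lambda>p. (\<phi> (proj P p), \<psi> (fibre_div G P (\<sigma> (proj P p)) p))) | U \<phi> V \<sigma> K \<psi>.
      (U, \<phi>) \<in> A \<and> (V, \<sigma>) \<in> lsecs P \<and> (K, \<psi>) \<in> AG}"

definition pullback_bundle :: "'y set \<Rightarrow> ('y \<Rightarrow> 'x) \<Rightarrow> ('x, 'p, 'g) pbundle \<Rightarrow> ('y, 'y \<times> 'p, 'g) pbundle" where
  "pullback_bundle Y f P =
     \<lparr>tot = {(y, p). y \<in> Y \<and> p \<in> tot P \<and> f y = proj P p},
      proj = fst,
      act = (\<lambda>(y, p) g. (y, act P p g)),
      lsecs = {({y \<in> Y. f y \<in> V}, \<lambda>y. (y, \<sigma> (f y))) | V \<sigma>. (V, \<sigma>) \<in> lsecs P}\<rparr>"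

text \<open>\<open>transition_functions\<close>: the cocycle \<open>g\<close> is obtained from smooth sections \<open>s \<alpha>\<close> of \<open>Y\<close> over
  \<open>U \<alpha>\<close> by \<open>s \<beta> = s \<alpha> \<cdot> g \<alpha> \<beta>\<close>, so that \<open>g \<alpha> \<beta> \<otimes> g \<beta> \<gamma> = g \<alpha> \<gamma>\<close> in accordance with the
  face map \<open>\<epsilon>\<^sub>1\<close>.\<close>

definition transition_functions ::
    "'g monoid \<Rightarrow> ('g, 'k::locally_convex) atlas \<Rightarrow> ('m, 'e::locally_convex) atlas \<Rightarrow>
     ('m, 'y, 'g) pbundle \<Rightarrow> 'i set \<Rightarrow> ('i \<Rightarrow> 'm set) \<Rightarrow> ('i \<Rightarrow> 'i \<Rightarrow> 'm \<Rightarrow> 'g) \<Rightarrow> bool" where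
  "transition_functions G AG A Y I U g \<longleftrightarrow>
     (\<exists>s. (\<forall>\<alpha>\<in>I. smooth_map A (U \<alpha>) (total_atlas G AG A Y) (s \<alpha>) \<and>
                  (\<forall>x\<in>U \<alpha>. proj Y (s \<alpha> x) = x)) \<and>
          (\<forall>\<alpha>\<in>I. \<forall>\<beta>\<in>I. \<forall>x\<in>U \<alpha> \<inter> U \<beta>.
             g \<alpha> \<beta> x \<in> carrier G \<and> s \<beta> x = act Y (s \<alpha> x) (g \<alpha> \<beta> x)))"

section \<open>Circle bundles\<close>

abbreviation circle_bundle :: "('x, 'e::locally_convex) atlas \<Rightarrow> ('x, 'p, complex) pbundle \<Rightarrow> bool" where
  "circle_bundle \<equiv> principal_bundle circle_group circle_atlas"

abbreviation ctotal :: "('x, 'e) atlas \<Rightarrow> ('x, 'p, complex) pbundle \<Rightarrow> ('p, 'e \<times> real) atlas" where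
  "ctotal \<equiv> total_atlas circle_group circle_atlas"

text \<open>Connection forms take values in the Lie algebra \<open>\<i>\<real>\<close> of \<open>U(1)\<close>; the last conjunct
  normalizes them on the fundamental vector field, the velocity of \<open>t \<mapsto> p \<cdot> exp(\<i>t)\<close>.\<close>

definition connection_form ::
    "('x, 'e::locally_convex) atlas \<Rightarrow> ('x, 'p, complex) pbundle \<Rightarrow> ('p, 'e \<times> real) form \<Rightarrow> bool" where
  "connection_form A P \<theta> \<longleftrightarrow>
     diff_form (ctotal A P) (tot P) 1 \<theta> \<and>
     (\<forall>(W, \<xi>)\<in>ctotal A P. \<forall>p\<in>W. \<forall>v. Re (\<theta> (W, \<xi>) p [v]) = 0) \<and>
     (\<forall>u\<in>carrier circle_group.
        form_eq (ctotal A P) (tot P) 1 (pullback_form (ctotal A P) (\<lambda>p. act P p u) \<theta>) \<theta>) \<and>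
     (\<forall>(W, \<xi>)\<in>ctotal A P. \<forall>p\<in>W.
        \<theta> (W, \<xi>) p [dir_deriv (\<lambda>t::real. \<xi> (act P p (cis t))) 1 0] = \<i>)"

definition chern_const :: complex where
  "chern_const = -1 / (2 * complex_of_real pi * \<i>)"

text \<open>\<open>\<kappa>\<close> is the form \<open>c\<^sub>1(\<theta>)\<close> on the base; it is unique because the projection is a submersion.\<close>

definition chern_form ::
    "('x, 'e::locally_convex) atlas \<Rightarrow> ('x, 'p, complex) pbundle \<Rightarrow> ('p, 'e \<times> real) form \<Rightarrow>
     ('x, 'e) form \<Rightarrow> bool" where
  "chern_form A P \<theta> \<kappa> \<longleftrightarrow> real_form A (mcarrier A) 2 \<kappa> \<and>
     form_eq (ctotal A P) (tot P) 2 (pullback_form A (proj P) \<kappa>)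
       (\<lambda>c p vs. chern_const * ext_d \<theta> c p vs)"

definition inverse_bundle :: "('x, 'p, complex) pbundle \<Rightarrow> ('x, 'p, complex) pbundle" where
  "inverse_bundle P = P\<lparr>act := (\<lambda>p u. act P p (inverse u))\<rparr>"

definition tensor_elt ::
    "('x, 'p, complex) pbundle \<Rightarrow> ('x, 'q, complex) pbundle \<Rightarrow> 'p \<Rightarrow> 'q \<Rightarrow> ('p \<times> 'q) set" where
  "tensor_elt S T s t = {(act S s u, act T t (inverse u)) | u. u \<in> carrier circle_group}"

definition tensor_bundle ::
    "('x, 'p, complex) pbundle \<Rightarrow> ('x, 'q, complex) pbundle \<Rightarrow> ('x, ('p \<times> 'q) set, complex) pbundle" where
  "tensor_bundle S T =
     \<lparr>tot = {tensor_elt S T s t | s t. s \<in> tot S \<and> t \<in> tot T \<and> proj S s = proj T t},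
      proj = (\<lambda>z. proj S (fst (SOME st. st \<in> z))),
      act = (\<lambda>z u. (\<lambda>(s, t). (act S s u, t)) ` z),
      lsecs = {(V \<inter> W, \<lambda>x. tensor_elt S T (\<sigma> x) (\<tau> x)) | V \<sigma> W \<tau>.
               (V, \<sigma>) \<in> lsecs S \<and> (W, \<tau>) \<in> lsecs T}\<rparr>"

text \<open>The fibre product of \<open>S\<close> and \<open>T\<close> over the base, seen as the pull-back of \<open>T\<close> to the total
  space of \<open>S\<close>; its points are the pairs \<open>(s, t)\<close>.\<close>

definition fibre_prod ::
    "('x, 'p, complex) pbundle \<Rightarrow> ('x, 'q, complex) pbundle \<Rightarrow> ('p, 'p \<times> 'q, complex) pbundle" where
  "fibre_prod S T = pullback_bundle (tot S) (proj S) T"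

definition tensor_connection ::
    "('x, 'e::locally_convex) atlas \<Rightarrow> ('x, 'p, complex) pbundle \<Rightarrow> ('x, 'q, complex) pbundle \<Rightarrow>
     ('p, 'e \<times> real) form \<Rightarrow> ('q, 'e \<times> real) form \<Rightarrow> (('p \<times> 'q) set, 'e \<times> real) form \<Rightarrow> bool" where
  "tensor_connection A S T \<theta>S \<theta>T \<eta> \<longleftrightarrow>
     connection_form A (tensor_bundle S T) \<eta> \<and>
     form_eq (ctotal (ctotal A S) (fibre_prod S T)) (tot (fibre_prod S T)) 1
       (pullback_form (ctotal A (tensor_bundle S T)) (\<lambda>(s, t). tensor_elt S T s t) \<eta>)
       (\<lambda>c p vs. pullback_form (ctotal A S) fst \<theta>S c p vs + pullback_form (ctotal A T) snd \<theta>T c p vs)"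

definition trivialization ::
    "('x, 'e::locally_convex) atlas \<Rightarrow> ('x, 'p, complex) pbundle \<Rightarrow> ('p \<Rightarrow> 'x \<times> complex) \<Rightarrow> bool" where
  "trivialization A P \<Phi> \<longleftrightarrow>
     bij_betw \<Phi> (tot P) (mcarrier A \<times> carrier circle_group) \<and>
     smooth_map (ctotal A P) (tot P) (prod_atlas A circle_atlas) \<Phi> \<and>
     smooth_map (prod_atlas A circle_atlas) (mcarrier A \<times> carrier circle_group) (ctotal A P)
       (inv_into (tot P) \<Phi>) \<and>
     (\<forall>p\<in>tot P. fst (\<Phi> p) = proj P p \<and>
        (\<forall>u\<in>carrier circle_group. \<Phi> (act P p u) = (proj P p, snd (\<Phi> p) * u)))"

definition triv_section :: "('x, 'p, complex) pbundle \<Rightarrow> ('p \<Rightarrow> 'x \<times> complex) \<Rightarrow> 'x \<Rightarrow> 'p" where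
  "triv_section P \<Phi> x = inv_into (tot P) \<Phi> (x, 1)"

section \<open>Central extensions and the simplicial Dixmier--Douady cochain\<close>

text \<open>\<open>H\<close> is the extension of \<open>G\<close>, with \<open>\<iota>\<close> the inclusion of \<open>U(1)\<close> and \<open>proj P\<close> the projection to
  \<open>G\<close>; the smooth structure of \<open>H\<close> is the one of the total space of the bundle \<open>P\<close>.\<close>

definition central_extension ::
    "'g monoid \<Rightarrow> ('g, 'e::locally_convex) atlas \<Rightarrow> 'h monoid \<Rightarrow> (complex \<Rightarrow> 'h) \<Rightarrow>
     ('g, 'h, complex) pbundle \<Rightarrow> bool" where
  "central_extension G AG H \<iota> P \<longleftrightarrow>
     lie_group G AG \<and> circle_bundle AG P \<and> tot P = carrier H \<and> lie_group H (ctotal AG P) \<and>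
     proj P \<in> hom H G \<and> proj P ` carrier H = carrier G \<and>
     \<iota> \<in> hom circle_group H \<and> inj_on \<iota> (carrier circle_group) \<and>
     \<iota> ` carrier circle_group = kernel H G (proj P) \<and>
     (\<forall>h\<in>carrier H. \<forall>u\<in>carrier circle_group.
        \<iota> u \<otimes>\<^bsub>H\<^esub> h = h \<otimes>\<^bsub>H\<^esub> \<iota> u \<and> act P h u = h \<otimes>\<^bsub>H\<^esub> \<iota> u)"

abbreviation NG2 :: "('g, 'e) atlas \<Rightarrow> ('g \<times> 'g, 'e \<times> 'e) atlas" where
  "NG2 AG \<equiv> prod_atlas AG AG"

abbreviation NG3 :: "('g, 'e) atlas \<Rightarrow> ('g \<times> 'g \<times> 'g, 'e \<times> 'e \<times> 'e) atlas" where
  "NG3 AG \<equiv> prod_atlas AG (prod_atlas AG AG)"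

definition face2 :: "'g monoid \<Rightarrow> nat \<Rightarrow> 'g \<times> 'g \<Rightarrow> 'g" where
  "face2 G i = (\<lambda>(g1, g2). if i = 0 then g2 else if i = 1 then g1 \<otimes>\<^bsub>G\<^esub> g2 else g1)"

definition face3 :: "'g monoid \<Rightarrow> nat \<Rightarrow> 'g \<times> 'g \<times> 'g \<Rightarrow> 'g \<times> 'g" where
  "face3 G i = (\<lambda>(g1, g2, g3).
     if i = 0 then (g2, g3) else if i = 1 then (g1 \<otimes>\<^bsub>G\<^esub> g2, g3)
     else if i = 2 then (g1, g2 \<otimes>\<^bsub>G\<^esub> g3) else (g1, g2))"

definition face_bundle ::
    "'g monoid \<Rightarrow> ('g, 'h, complex) pbundle \<Rightarrow> nat \<Rightarrow> ('g \<times> 'g, ('g \<times> 'g) \<times> 'h, complex) pbundle" where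
  "face_bundle G P i = pullback_bundle (carrier G \<times> carrier G) (face2 G i) P"

type_synonym ('g, 'h) delta =
  "(((('g \<times> 'g) \<times> 'h) \<times> (('g \<times> 'g) \<times> 'h)) set \<times> (('g \<times> 'g) \<times> 'h)) set"

definition delta_bundle ::
    "'g monoid \<Rightarrow> ('g, 'h, complex) pbundle \<Rightarrow> ('g \<times> 'g, ('g, 'h) delta, complex) pbundle" where
  "delta_bundle G P =
     tensor_bundle (tensor_bundle (face_bundle G P 0) (inverse_bundle (face_bundle G P 1)))
       (face_bundle G P 2)"

text \<open>The element \<open>a \<otimes> b\<^sup>-\<^sup>1 \<otimes> c\<close> over \<open>(proj P c, proj P a)\<close>, where
  \<open>proj P b = proj P c \<otimes> proj P a\<close>.\<close>

definition delta_elt ::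
    "'g monoid \<Rightarrow> ('g, 'h, complex) pbundle \<Rightarrow> 'h \<Rightarrow> 'h \<Rightarrow> 'h \<Rightarrow> ('g, 'h) delta" where
  "delta_elt G P a b c =
     (let x = (proj P c, proj P a) in
      tensor_elt (tensor_bundle (face_bundle G P 0) (inverse_bundle (face_bundle G P 1)))
        (face_bundle G P 2)
        (tensor_elt (face_bundle G P 0) (inverse_bundle (face_bundle G P 1)) (x, a) (x, b))
        (x, c))"

text \<open>\<open>\<eta>\<close> is the connection \<open>\<delta>\<theta>\<close> induced by \<open>\<theta>\<close>; note the sign at the inverse bundle.\<close>

definition delta_connection ::
    "'g monoid \<Rightarrow> ('g, 'e::locally_convex) atlas \<Rightarrow> ('g, 'h, complex) pbundle \<Rightarrow>
     ('h, 'e \<times> real) form \<Rightarrow> (('g, 'h) delta, ('e \<times> 'e) \<times> real) form \<Rightarrow> bool" where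
  "delta_connection G AG P \<theta> \<eta> \<longleftrightarrow>
     (\<exists>\<zeta>. tensor_connection (NG2 AG) (face_bundle G P 0) (inverse_bundle (face_bundle G P 1))
            (pullback_form (ctotal AG P) snd \<theta>)
            (\<lambda>c p vs. - pullback_form (ctotal AG P) snd \<theta> c p vs) \<zeta> \<and>
          tensor_connection (NG2 AG)
            (tensor_bundle (face_bundle G P 0) (inverse_bundle (face_bundle G P 1)))
            (face_bundle G P 2)
            \<zeta> (pullback_form (ctotal AG P) snd \<theta>) \<eta>)"

text \<open>The component of the simplicial cochain in degree \<open>(2, 1)\<close>; the one in degree \<open>(1, 2)\<close> is
  \<open>c\<^sub>1(\<theta>)\<close>.\<close>

definition dd_one_form ::
    "'g monoid \<Rightarrow> ('g, 'e::locally_convex) atlas \<Rightarrow> ('g, 'h, complex) pbundle \<Rightarrow>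
     (('g, 'h) delta, ('e \<times> 'e) \<times> real) form \<Rightarrow> (('g, 'h) delta \<Rightarrow> ('g \<times> 'g) \<times> complex) \<Rightarrow>
     ('g \<times> 'g, 'e \<times> 'e) form" where
  "dd_one_form G AG P \<eta> \<Phi> c p vs =
     - (chern_const *
        pullback_form (ctotal (NG2 AG) (delta_bundle G P)) (triv_section (delta_bundle G P) \<Phi>) \<eta> c p vs)"

text \<open>The components in degrees \<open>(1, 3)\<close>, \<open>(2, 2)\<close> and \<open>(3, 1)\<close> of the total differential
  \<open>d' + d''\<close> of the cochain \<open>\<kappa> + \<mu>\<close> with \<open>\<kappa>\<close> in degree \<open>(1, 2)\<close> and \<open>\<mu>\<close> in degree \<open>(2, 1)\<close>.\<close>

definition simpl_D13 :: "('g, 'e::locally_convex) form \<Rightarrow> ('g, 'e) form" where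
  "simpl_D13 \<kappa> c p vs = - ext_d \<kappa> c p vs"

definition simpl_D22 ::
    "'g monoid \<Rightarrow> ('g, 'e::locally_convex) atlas \<Rightarrow> ('g, 'e) form \<Rightarrow> ('g \<times> 'g, 'e \<times> 'e) form \<Rightarrow>
     ('g \<times> 'g, 'e \<times> 'e) form" where
  "simpl_D22 G AG \<kappa> \<mu> c p vs =
     (\<Sum>i\<le>2. (-1) ^ i * pullback_form AG (face2 G i) \<kappa> c p vs) + ext_d \<mu> c p vs"

definition simpl_D31 ::
    "'g monoid \<Rightarrow> ('g, 'e::locally_convex) atlas \<Rightarrow> ('g \<times> 'g, 'e \<times> 'e) form \<Rightarrow>
     ('g \<times> 'g \<times> 'g, 'e \<times> 'e \<times> 'e) form" where
  "simpl_D31 G AG \<mu> c p vs = (\<Sum>i\<le>3. (-1) ^ i * pullback_form (NG2 AG) (face3 G i) \<mu> c p vs)"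

text \<open>The value of \<open>a \<otimes> b\<^sup>-\<^sup>1 \<otimes> c\<close> in \<open>U(1)\<close> under the trivialization \<open>\<Phi>\<close> of the bundle
  \<open>delta_bundle G P\<close>.\<close>

definition dd_value ::
    "'g monoid \<Rightarrow> ('g, 'h, complex) pbundle \<Rightarrow> (('g, 'h) delta \<Rightarrow> ('g \<times> 'g) \<times> complex) \<Rightarrow>
     'h \<Rightarrow> 'h \<Rightarrow> 'h \<Rightarrow> complex" where
  "dd_value G P \<Phi> a b c = snd (\<Phi> (delta_elt G P a b c))"

text \<open>A trivialization is multiplicative if the section \<open>s\<close> corresponding to \<open>1\<close> satisfies
  \<open>\<delta>s = 1\<close> under the canonical trivialization of the bundle \<open>\<delta>\<delta>\<close> over \<open>G \<times> G \<times> G\<close>.  Written out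
  with elements \<open>h\<^sub>i\<^sub>j\<close> of the extension over the edges of a 3-simplex this is precisely the
  Cech cocycle identity.  The trivialization defined by the multiplication of the extension is
  multiplicative; an arbitrary trivialization need not be.\<close>

definition multiplicative_triv ::
    "'g monoid \<Rightarrow> ('g, 'h, complex) pbundle \<Rightarrow> (('g, 'h) delta \<Rightarrow> ('g \<times> 'g) \<times> complex) \<Rightarrow> bool" where
  "multiplicative_triv G P \<Phi> \<longleftrightarrow>
     (\<forall>h01\<in>tot P. \<forall>h12\<in>tot P. \<forall>h23\<in>tot P. \<forall>h02\<in>tot P. \<forall>h13\<in>tot P. \<forall>h03\<in>tot P.
        proj P h02 = proj P h01 \<otimes>\<^bsub>G\<^esub> proj P h12 \<and>
        proj P h13 = proj P h12 \<otimes>\<^bsub>G\<^esub> proj P h23 \<and>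
        proj P h03 = proj P h02 \<otimes>\<^bsub>G\<^esub> proj P h23 \<longrightarrow>
        dd_value G P \<Phi> h23 h13 h12 * dd_value G P \<Phi> h13 h03 h01 =
        dd_value G P \<Phi> h23 h03 h02 * dd_value G P \<Phi> h12 h02 h01)"

section \<open>The Cech--de Rham complex of a covering\<close>

definition leray_covering ::
    "('m, 'e::locally_convex) atlas \<Rightarrow> 'i set \<Rightarrow> ('i \<Rightarrow> 'm set) \<Rightarrow> bool" where
  "leray_covering A I U \<longleftrightarrow> (\<forall>\<alpha>\<in>I. mopen A (U \<alpha>)) \<and> \<Union> (U ` I) = mcarrier A \<and>
     (\<forall>J. J \<subseteq> I \<and> finite J \<and> J \<noteq> {} \<longrightarrow>
        contractible_space (subtopology (mtopology A) (\<Inter> (U ` J))))"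

text \<open>A cochain assigns to a list of \<open>p + 1\<close> indices a form on the intersection of the corresponding
  sets; in total degree \<open>n\<close> this form has degree \<open>n - p\<close>.  Lists with \<open>p > n\<close> are disregarded.\<close>

type_synonym ('i, 'm, 'e) cochain = "'i list \<Rightarrow> ('m, 'e) form"

definition cech_cochain ::
    "('m, 'e::locally_convex) atlas \<Rightarrow> 'i set \<Rightarrow> ('i \<Rightarrow> 'm set) \<Rightarrow> nat \<Rightarrow> ('i, 'm, 'e) cochain \<Rightarrow> bool" where
  "cech_cochain A I U n C \<longleftrightarrow>
     (\<forall>p\<le>n. \<forall>\<alpha>s. length \<alpha>s = Suc p \<and> set \<alpha>s \<subseteq> I \<longrightarrow>
        real_form A (\<Inter> (U ` set \<alpha>s)) (n - p) (C \<alpha>s))"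

definition cochain_eq ::
    "('m, 'e) atlas \<Rightarrow> 'i set \<Rightarrow> ('i \<Rightarrow> 'm set) \<Rightarrow> nat \<Rightarrow> ('i, 'm, 'e) cochain \<Rightarrow>
     ('i, 'm, 'e) cochain \<Rightarrow> bool" where
  "cochain_eq A I U n C C' \<longleftrightarrow>
     (\<forall>p\<le>n. \<forall>\<alpha>s. length \<alpha>s = Suc p \<and> set \<alpha>s \<subseteq> I \<longrightarrow>
        form_eq A (\<Inter> (U ` set \<alpha>s)) (n - p) (C \<alpha>s) (C' \<alpha>s))"

text \<open>The total differential \<open>\<delta> + (-1)\<^sup>p d\<close> on cochains of total degree \<open>n\<close>, evaluated at a list of
  \<open>p + 1\<close> indices.  The Cech part vanishes for \<open>p = 0\<close>, the de Rham part for \<open>p = n + 1\<close>.\<close>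

definition cech_D :: "nat \<Rightarrow> ('i, 'm, 'e::locally_convex) cochain \<Rightarrow> ('i, 'm, 'e) cochain" where
  "cech_D n C \<alpha>s c x vs =
     (let p = length \<alpha>s - 1 in
      (if p = 0 then 0 else (\<Sum>i\<le>p. (-1) ^ i * C (omit i \<alpha>s) c x vs)) +
      (if p \<le> n then (-1) ^ p * ext_d (C \<alpha>s) c x vs else 0))"

definition cech_cocycle ::
    "('m, 'e::locally_convex) atlas \<Rightarrow> 'i set \<Rightarrow> ('i \<Rightarrow> 'm set) \<Rightarrow> nat \<Rightarrow> ('i, 'm, 'e) cochain \<Rightarrow> bool" where
  "cech_cocycle A I U n C \<longleftrightarrow> cech_cochain A I U n C \<and>
     cochain_eq A I U (Suc n) (cech_D n C) (\<lambda>\<alpha>s. zero_form)"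

definition cohomologous ::
    "('m, 'e::locally_convex) atlas \<Rightarrow> 'i set \<Rightarrow> ('i \<Rightarrow> 'm set) \<Rightarrow> nat \<Rightarrow>
     ('i, 'm, 'e) cochain \<Rightarrow> ('i, 'm, 'e) cochain \<Rightarrow> bool" where
  "cohomologous A I U n C C' \<longleftrightarrow>
     (\<exists>E. cech_cochain A I U (n - 1) E \<and>
        cochain_eq A I U n (\<lambda>\<alpha>s c x vs. C \<alpha>s c x vs - C' \<alpha>s c x vs) (cech_D (n - 1) E))"

definition simpl_pullback ::
    "('g, 'e::locally_convex) atlas \<Rightarrow> ('i \<Rightarrow> 'i \<Rightarrow> 'm \<Rightarrow> 'g) \<Rightarrow>
     ('g, 'e) form \<Rightarrow> ('g \<times> 'g, 'e \<times> 'e) form \<Rightarrow> ('i, 'm, 'f::locally_convex) cochain" where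
  "simpl_pullback AG g \<kappa> \<mu> \<alpha>s =
     (case \<alpha>s of
        [\<alpha>, \<beta>] \<Rightarrow> pullback_form AG (g \<alpha> \<beta>) \<kappa>
      | [\<alpha>, \<beta>, \<gamma>] \<Rightarrow> pullback_form (NG2 AG) (\<lambda>x. (g \<alpha> \<beta> x, g \<beta> \<gamma> x)) \<mu>
      | _ \<Rightarrow> zero_form)"

text \<open>The lifts of transition functions to the extension, and the Dixmier--Douady cocycle
  \<open>c \<alpha> \<beta> \<gamma> = gh \<beta> \<gamma> \<otimes> gh \<alpha> \<gamma>\<^sup>-\<^sup>1 \<otimes> gh \<alpha> \<beta>\<close> formed by means of the trivialization \<open>\<Phi>\<close>.\<close>

definition smooth_lifts ::
    "('g, 'e::locally_convex) atlas \<Rightarrow> ('g, 'h, complex) pbundle \<Rightarrow> ('m, 'f::locally_convex) atlas \<Rightarrow>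
     'i set \<Rightarrow> ('i \<Rightarrow> 'm set) \<Rightarrow> ('i \<Rightarrow> 'i \<Rightarrow> 'm \<Rightarrow> 'g) \<Rightarrow> ('i \<Rightarrow> 'i \<Rightarrow> 'm \<Rightarrow> 'h) \<Rightarrow> bool" where
  "smooth_lifts AG P A I U g gh \<longleftrightarrow>
     (\<forall>\<alpha>\<in>I. \<forall>\<beta>\<in>I. smooth_map A (U \<alpha> \<inter> U \<beta>) (ctotal AG P) (gh \<alpha> \<beta>) \<and>
        (\<forall>x\<in>U \<alpha> \<inter> U \<beta>. proj P (gh \<alpha> \<beta> x) = g \<alpha> \<beta> x))"

definition dd_cocycle ::
    "'g monoid \<Rightarrow> ('g, 'h, complex) pbundle \<Rightarrow> (('g, 'h) delta \<Rightarrow> ('g \<times> 'g) \<times> complex) \<Rightarrow>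
     ('i \<Rightarrow> 'i \<Rightarrow> 'm \<Rightarrow> 'h) \<Rightarrow> 'i \<Rightarrow> 'i \<Rightarrow> 'i \<Rightarrow> 'm \<Rightarrow> complex" where
  "dd_cocycle G P \<Phi> gh \<alpha> \<beta> \<gamma> x = dd_value G P \<Phi> (gh \<beta> \<gamma> x) (gh \<alpha> \<gamma> x) (gh \<alpha> \<beta> x)"

definition dd_cochain ::
    "('i \<Rightarrow> 'i \<Rightarrow> 'i \<Rightarrow> 'm \<Rightarrow> complex) \<Rightarrow> ('i, 'm, 'f::locally_convex) cochain" where
  "dd_cochain k \<alpha>s =
     (case \<alpha>s of
        [\<alpha>, \<beta>, \<gamma>] \<Rightarrow> (\<lambda>c x vs. chern_const * dlog (k \<alpha> \<beta> \<gamma>) c x vs)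
      | _ \<Rightarrow> zero_form)"

end

theory Submission
  imports Defs
begin

text \<open>Put \<open>\<lambda> = -1/(2\<pi>i)\<close> and let \<open>s\<close> be the section of the bundle \<open>\<delta>\<close> over \<open>G \<times> G\<close> given by the
  trivialization.  If \<open>a\<close>, \<open>b\<close>, \<open>c\<close> are smooth maps into the extension with \<open>\<rho> b = \<rho> c \<cdot> \<rho> a\<close>, then
  \<open>a \<otimes> b\<^sup>-\<^sup>1 \<otimes> c = (s \<circ> (\<rho> c, \<rho> a)) \<cdot> k\<close> with a function \<open>k\<close> into \<open>U(1)\<close>.  A connection satisfies
  \<open>(h \<cdot> u)\<^sup>*\<theta> = h\<^sup>*\<theta> + dlog u\<close>, and hence
  \<open>a\<^sup>*\<theta> - b\<^sup>*\<theta> + c\<^sup>*\<theta> = (\<rho> c, \<rho> a)\<^sup>*s\<^sup>*\<delta>\<theta> + dlog k\<close>; moreover \<open>\<lambda> d(h\<^sup>*\<theta>) = (\<rho> h)\<^sup>*c\<^sub>1(\<theta>)\<close>.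
  For \<open>a\<close>, \<open>b\<close>, \<open>c\<close> the lifts of the transition functions these identities say that the total
  differential of the Cech--de Rham cochain with components \<open>-\<lambda> gh \<alpha> \<beta>\<^sup>*\<theta>\<close> in degree \<open>(1, 1)\<close> is the
  difference of the two cochains of the theorem.  For local lifts of the face maps of \<open>NG\<close> they give
  the cocycle condition: in degree \<open>(2, 2)\<close> since \<open>d dlog k = 0\<close>, and in degree \<open>(3, 1)\<close> since the
  functions \<open>k\<close> multiply to \<open>1\<close> if the trivialization is multiplicative.

  Tangent vectors in a smooth family of forms are tuples of varying length.  To keep
  a single type, the calculus is carried out for functions of a point and a sequence of vectors.\<close>

section \<open>Directional derivatives\<close>

text \<open>The model spaces are arbitrary locally convex spaces, in which no norm measures the
  error of a linear approximation. The chain rule and the symmetry of second derivatives therefore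
  rest on a mean value theorem that locates difference quotients in convex open sets. The extension
  need not have a global section over \<open>G\<close>, so that the face maps can be lifted only
  locally. This suffices, since equality of forms and exterior derivatives are local. The connection
  of a tensor product is specified only after pull-back to the fibre product, and the charts of a
  total space are made from local sections. Hence a map into a total space is written locally as a
  section times a circle-valued function, and \<delta>\<theta> is evaluated along maps that factor
  through the fibre product. Multiplicativity enters in degree (3, 1): multiplying the section by a
  circle-valued function f on G x G adds dlog f to the pulled back connection, and the alternating
  sum of the four pull-backs of dlog f need not vanish. The factor -1/(2 pi i) = i/(2 pi) is
  imaginary, as is \<theta>; this makes the one-forms of the cochains real.\<close>

definition has_dir_deriv ::
    "('a::locally_convex \<Rightarrow> 'b::locally_convex) \<Rightarrow> 'a \<Rightarrow> 'a \<Rightarrow> 'b \<Rightarrow> bool" where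
  "has_dir_deriv f v x l \<longleftrightarrow> (dir_quot f v x \<longlongrightarrow> l) (at 0)"

section \<open>Limits and elementary rules for directional derivatives\<close>

lemma tendsto_scaleR_lc:
  fixes g :: "'c \<Rightarrow> 'a::locally_convex"
  assumes "(f \<longlongrightarrow> a) F" "(g \<longlongrightarrow> x) F"
  shows "((\<lambda>z. f z *\<^sub>R g z) \<longlongrightarrow> a *\<^sub>R x) F"
  using filterlim_compose[OF tendsto_scaleR_prod[of a x] filterlim_Pair[OF assms]] by simp

lemma tendsto_funI:
  fixes g :: "'c \<Rightarrow> 'i \<Rightarrow> 'a::topological_space"
  assumes "\<And>i. ((\<lambda>t. g t i) \<longlongrightarrow> l i) F"
  shows "(g \<longlongrightarrow> l) F"
proof -
  have "limitin (product_topology (\<lambda>i::'i. euclidean :: 'a topology) UNIV) g l F"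
    using assms by (simp add: limitin_componentwise)
  then show ?thesis
    by (simp add: euclidean_product_topology)
qed

lemma tendsto_fun_component:
  fixes g :: "'c \<Rightarrow> 'i \<Rightarrow> 'a::topological_space"
  assumes "(g \<longlongrightarrow> l) F"
  shows "((\<lambda>t. g t i) \<longlongrightarrow> l i) F"
proof -
  have "limitin (product_topology (\<lambda>i::'i. euclidean :: 'a topology) UNIV) g l F"
    using assms by (simp add: euclidean_product_topology)
  then show ?thesis
    by (simp add: limitin_componentwise)
qed

lemma continuous_on_nhds_iff:
  assumes "open S"
  shows "continuous_on S f \<longleftrightarrow> (\<forall>x\<in>S. (f \<longlongrightarrow> f x) (nhds x))"
  by (simp add: continuous_on_def at_within_open[OF _ assms] tendsto_at_iff_tendsto_nhds)

lemma has_dir_derivI: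
  assumes "(q \<longlongrightarrow> l) (at 0)" "\<And>t. dir_quot f v x t = q t"
  shows "has_dir_deriv f v x l"
proof -
  have "dir_quot f v x = q"
    using assms(2) by (rule ext)
  then show ?thesis
    using assms(1) by (simp add: has_dir_deriv_def)
qed

lemma has_dir_deriv_unique: "has_dir_deriv f v x l \<Longrightarrow> has_dir_deriv f v x l' \<Longrightarrow> l = l'"
  unfolding has_dir_deriv_def by (rule tendsto_unique) auto

lemma has_dir_deriv_dir_deriv: "has_dir_deriv f v x l \<Longrightarrow> dir_deriv f v x = l"
  unfolding has_dir_deriv_def dir_deriv_def by (rule tendsto_Lim) auto

lemma dir_differentiable_iff: "dir_differentiable f v x \<longleftrightarrow> has_dir_deriv f v x (dir_deriv f v x)"
  unfolding dir_differentiable_def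
  by (metis has_dir_deriv_def has_dir_deriv_dir_deriv)

lemma tendsto_line:
  fixes x :: "'a::locally_convex"
  shows "((\<lambda>t. x + t *\<^sub>R v) \<longlongrightarrow> x) (nhds (0::real))"
  using tendsto_add[OF tendsto_const[of x] tendsto_scaleR_lc[OF filterlim_ident[of "nhds 0"] tendsto_const[of v]]]
  by simp

lemma eventually_line_in:
  fixes x :: "'a::locally_convex"
  assumes "open S" "x \<in> S"
  shows "eventually (\<lambda>t::real. x + t *\<^sub>R v \<in> S) (at 0)"
  using topological_tendstoD[OF tendsto_line[of x v] assms]
  by (simp add: eventually_nhds_conv_at)

lemma has_dir_deriv_cong:
  assumes "open S" "x \<in> S" "\<And>y. y \<in> S \<Longrightarrow> f y = g y"
  shows "has_dir_deriv f v x l \<longleftrightarrow> has_dir_deriv g v x l"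
  unfolding has_dir_deriv_def
  by (rule tendsto_cong, rule eventually_mono[OF eventually_line_in[OF assms(1,2), of v]])
     (simp add: dir_quot_def assms)

text \<open>The difference quotients agree for small parameters, so that both \<open>Lim\<close>
  terms describe the same limits. The equation therefore holds even at points where no limit
  exists.\<close>

lemma dir_deriv_cong:
  assumes "open S" "x \<in> S" "\<And>y. y \<in> S \<Longrightarrow> f y = g y"
  shows "dir_deriv f v x = dir_deriv g v x"
proof -
  have "(dir_quot f v x \<longlongrightarrow> l) (at 0) \<longleftrightarrow> (dir_quot g v x \<longlongrightarrow> l) (at 0)" for l
    using has_dir_deriv_cong[of S x f g v l] assms by (simp add: has_dir_deriv_def)
  then show ?thesis
    by (simp add: dir_deriv_def Topological_Spaces.Lim_def)
qed

lemma has_dir_deriv_const: "has_dir_deriv (\<lambda>x. c) v x 0"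
  by (simp add: has_dir_deriv_def dir_quot_def[abs_def])

lemma dir_deriv_const [simp]: "dir_deriv (\<lambda>x. c) v x = 0"
  by (rule has_dir_deriv_dir_deriv[OF has_dir_deriv_const])

lemma has_dir_deriv_add:
  assumes "has_dir_deriv f v x l" "has_dir_deriv g v x m"
  shows "has_dir_deriv (\<lambda>x. f x + g x) v x (l + m)"
proof -
  have "dir_quot (\<lambda>x. f x + g x) v x t = dir_quot f v x t + dir_quot g v x t" for t
    by (simp add: dir_quot_def scaleR_right_distrib[symmetric])
  then show ?thesis
    by (rule has_dir_derivI[OF tendsto_add[OF assms[unfolded has_dir_deriv_def]]])
qed

lemma has_dir_deriv_Pair:
  assumes "has_dir_deriv f v x l" "has_dir_deriv g v x m"
  shows "has_dir_deriv (\<lambda>x. (f x, g x)) v x (l, m)"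
proof -
  have "dir_quot (\<lambda>x. (f x, g x)) v x t = (dir_quot f v x t, dir_quot g v x t)" for t
    by (simp add: dir_quot_def)
  then show ?thesis
    by (rule has_dir_derivI[OF tendsto_Pair[OF assms[unfolded has_dir_deriv_def]]])
qed

lemma has_dir_deriv_linear:
  assumes "linear L" "continuous_on UNIV L" "has_dir_deriv f v x l"
  shows "has_dir_deriv (\<lambda>x. L (f x)) v x (L l)"
proof -
  have "dir_quot (\<lambda>x. L (f x)) v x t = L (dir_quot f v x t)" for t
    by (simp add: dir_quot_def linear_diff[OF assms(1)] linear_scale[OF assms(1)])
  moreover have "(L \<longlongrightarrow> L l) (nhds l)"
    using assms(2) by (simp add: continuous_on_nhds_iff)
  ultimately show ?thesis
    using filterlim_compose[of L "nhds (L l)" "nhds l"] assms(3)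
    unfolding has_dir_deriv_def by (intro has_dir_derivI[unfolded has_dir_deriv_def])
qed

lemma has_dir_deriv_ident: "has_dir_deriv (\<lambda>x. x) v x v"
  unfolding has_dir_deriv_def
  by (rule tendsto_eventually) (auto simp: eventually_at dir_quot_def intro: exI[of _ 1])

lemma has_dir_deriv_scaleR_dir:
  assumes "has_dir_deriv f v x l"
  shows "has_dir_deriv f (c *\<^sub>R v) x (c *\<^sub>R l)"
proof (cases "c = 0")
  case True
  then show ?thesis
    by (simp add: has_dir_deriv_def dir_quot_def[abs_def])
next
  case False
  \<comment> \<open>Reparametrizing by \<open>t * c\<close> turns difference quotients in direction
    \<open>v\<close> into those in direction \<open>c *\<^sub>R v\<close>, up to the factor
    \<open>c\<close>.\<close>
  have lim: "filterlim (\<lambda>t. t * c) (at 0) (at (0::real))"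
    unfolding filterlim_at
    using False by (auto intro!: tendsto_eq_intros simp: eventually_at intro: exI[of _ 1])
  have "((\<lambda>t. c *\<^sub>R dir_quot f v x (t * c)) \<longlongrightarrow> c *\<^sub>R l) (at 0)"
    using tendsto_scaleR_lc[OF tendsto_const filterlim_compose[OF assms[unfolded has_dir_deriv_def] lim]] .
  moreover have "c *\<^sub>R dir_quot f v x (t * c) = dir_quot f (c *\<^sub>R v) x t" for t
    using False by (simp add: dir_quot_def)
  ultimately show ?thesis
    by (intro has_dir_derivI) (auto intro: sym)
qed

text \<open>The mean value theorem in the form that needs no dual space: difference quotients over adjacent
  intervals combine convexly, so membership in a convex open set propagates from small intervals.\<close>

lemma convex_mean_value:
  fixes \<gamma> :: "real \<Rightarrow> 'b::locally_convex"
  assumes O: "open O'" "convex O'"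
    and der: "\<And>s. 0 \<le> s \<Longrightarrow> s \<le> 1 \<Longrightarrow> \<exists>l\<in>O'. ((\<lambda>h. (\<gamma> (s + h) - \<gamma> s) /\<^sub>R h) \<longlongrightarrow> l) (at 0)"
  shows "\<gamma> 1 - \<gamma> 0 \<in> O'"
proof -
  define Q where "Q a b = (\<gamma> b - \<gamma> a) /\<^sub>R (b - a)" for a b
  have comb: "Q a c \<in> O'" if "Q a b \<in> O'" "Q b c \<in> O'" "a < b" "b < c" for a b c
  proof -
    let ?u = "(b - a) / (c - a)" and ?v = "(c - b) / (c - a)"
    have "?u + ?v = 1" "?u \<ge> 0" "?v \<ge> 0"
      using that by (simp_all add: add_divide_distrib[symmetric])
    then have "?u *\<^sub>R Q a b + ?v *\<^sub>R Q b c \<in> O'"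
      using O(2) that by (meson convexD)
    moreover have "?u * inverse (b - a) = inverse (c - a)" "?v * inverse (c - b) = inverse (c - a)"
      using that by (simp_all add: field_simps)
    then have "?u *\<^sub>R Q a b + ?v *\<^sub>R Q b c = (\<gamma> b - \<gamma> a) /\<^sub>R (c - a) + (\<gamma> c - \<gamma> b) /\<^sub>R (c - a)"
      by (simp only: Q_def scaleR_scaleR)
    moreover have "\<dots> = Q a c"
      unfolding Q_def scaleR_right_distrib[symmetric] by simp
    ultimately show ?thesis
      by simp
  qed
  define R where "R a b \<longleftrightarrow> (a < b \<longrightarrow> Q a b \<in> O')" for a b
  have "R 0 1"
  proof (rule Bolzano)
    show "(0::real) \<le> 1" by simp
    fix a b c assume "R a b" "R b c" "a \<le> b" "b \<le> c"
    then show "R a c"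
      unfolding R_def using comb[of a b c] by (cases "a = b"; cases "b = c") auto
  next
    fix x :: real assume "0 \<le> x" "x \<le> 1"
    then obtain l where l: "l \<in> O'" "((\<lambda>h. (\<gamma> (x + h) - \<gamma> x) /\<^sub>R h) \<longlongrightarrow> l) (at 0)"
      using der[of x] by auto
    obtain d where d: "d > 0" "\<And>h. h \<noteq> 0 \<Longrightarrow> dist h 0 < d \<Longrightarrow> (\<gamma> (x + h) - \<gamma> x) /\<^sub>R h \<in> O'"
      using topological_tendstoD[OF l(2) O(1) l(1)] unfolding eventually_at by auto
    have right: "Q x b \<in> O'" if "x < b" "b - x < d" for b
      using d(2)[of "b - x"] that by (simp add: Q_def)
    have left: "Q a x \<in> O'" if "a < x" "x - a < d" for a
    proof -
      have "(\<gamma> a - \<gamma> x) /\<^sub>R (a - x) = (\<gamma> x - \<gamma> a) /\<^sub>R (x - a)"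
        by (metis minus_diff_eq inverse_minus_eq scaleR_minus_left scaleR_minus_right minus_minus)
      then show ?thesis
        using d(2)[of "a - x"] that by (simp add: Q_def)
    qed
    \<comment> \<open>The derivative at \<open>x\<close> controls only intervals with
      \<open>x\<close> as an end point; an interval with \<open>x\<close> in its interior is cut
      there and reassembled by \<open>comb\<close>.\<close>
    have "Q a b \<in> O'" if "a \<le> x" "x \<le> b" "b - a < d" "a < b" for a b
      using left[of a] right[of b] comb[of a x b] that by (cases "a = x"; cases "x = b") auto
    then show "\<exists>d>0. \<forall>a b. a \<le> x \<and> x \<le> b \<and> b - a < d \<longrightarrow> R a b"
      unfolding R_def using d(1) by blast
  qed
  then show ?thesis
    by (simp add: Q_def R_def)
qed

text \<open>By the mean value theorem the quotient lies in every convex open set that contains the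
  derivatives along the segment, and joint continuity keeps these close to
  \<open>f' (y0, q0, p0)\<close>. This is strict differentiability: base point, direction and
  parameter may all move along the filter, as the chain rule requires.\<close>

lemma strict_dir_deriv:
  fixes f :: "'p::topological_space \<Rightarrow> 'a::locally_convex \<Rightarrow> 'b::locally_convex"
  assumes "open S" "y0 \<in> S"
    and der: "\<And>p y v. y \<in> S \<Longrightarrow> has_dir_deriv (f p) v y (f' (y, v, p))"
    and cont: "(f' \<longlongrightarrow> f' (y0, q0, p0)) (nhds (y0, q0, p0))"
    and lim: "(y \<longlongrightarrow> y0) F" "(q \<longlongrightarrow> q0) F" "(p \<longlongrightarrow> p0) F" "(t \<longlongrightarrow> (0::real)) F"
    and t: "eventually (\<lambda>i. t i \<noteq> 0) F"
  shows "((\<lambda>i. (f (p i) (y i + t i *\<^sub>R q i) - f (p i) (y i)) /\<^sub>R t i) \<longlongrightarrow> f' (y0, q0, p0)) F"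
proof (rule topological_tendstoI)
  fix O1 assume "open O1" "f' (y0, q0, p0) \<in> O1"
  then obtain O' where O': "open O'" "convex O'" "f' (y0, q0, p0) \<in> O'" "O' \<subseteq> O1"
    using convex_nhd by metis
  obtain D where D: "open D" "(y0, q0, p0) \<in> D" "\<And>z. z \<in> D \<Longrightarrow> f' z \<in> O'"
    using topological_tendstoD[OF cont O'(1,3)] unfolding eventually_nhds by auto
  obtain A BC where A: "open A" "open BC" "(y0, q0, p0) \<in> A \<times> BC" "A \<times> BC \<subseteq> D"
    using D(1,2) by (rule open_prod_elim)
  obtain B C where B: "open B" "open C" "(q0, p0) \<in> B \<times> C" "B \<times> C \<subseteq> BC"
    using A(2,3) open_prod_elim[of BC "(q0, p0)"] by auto
  obtain A' where A': "open A'" "convex A'" "y0 \<in> A'" "A' \<subseteq> A \<inter> S"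
    using convex_nhd[of "A \<inter> S" y0] A(1,3) assms(1,2) by auto
  have lim': "((\<lambda>i. y i + t i *\<^sub>R q i) \<longlongrightarrow> y0) F"
    using tendsto_add[OF lim(1) tendsto_scaleR_lc[OF lim(4,2)]] by simp
  have "eventually (\<lambda>i. y i \<in> A' \<and> y i + t i *\<^sub>R q i \<in> A' \<and> q i \<in> B \<and> p i \<in> C \<and> t i \<noteq> 0) F"
    using topological_tendstoD[OF lim(1) A'(1,3)] topological_tendstoD[OF lim' A'(1,3)]
      topological_tendstoD[OF lim(2) B(1)] topological_tendstoD[OF lim(3) B(2)] B(3) t
    by (auto simp: eventually_conj_iff)
  then show "eventually (\<lambda>i. (f (p i) (y i + t i *\<^sub>R q i) - f (p i) (y i)) /\<^sub>R t i \<in> O1) F"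
  proof (rule eventually_mono)
    fix i assume i: "y i \<in> A' \<and> y i + t i *\<^sub>R q i \<in> A' \<and> q i \<in> B \<and> p i \<in> C \<and> t i \<noteq> 0"
    \<comment> \<open>Dividing by \<open>t i\<close> makes the derivative of \<gamma> at
      \<open>s\<close> the value of \<open>f'\<close> at a point of the segment in direction
      \<open>q i\<close>, with no factor \<open>t i\<close> left.\<close>
    define \<gamma> where "\<gamma> s = f (p i) (y i + s *\<^sub>R (t i *\<^sub>R q i)) /\<^sub>R t i" for s
    have "\<gamma> 1 - \<gamma> 0 \<in> O'"
    proof (rule convex_mean_value[OF O'(1,2)])
      fix s :: real assume s: "0 \<le> s" "s \<le> 1"
      let ?y = "y i + s *\<^sub>R (t i *\<^sub>R q i)"
      have "(1 - s) *\<^sub>R y i + s *\<^sub>R (y i + t i *\<^sub>R q i) \<in> A'"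
        using A'(2) i s by (intro convexD) auto
      also have "(1 - s) *\<^sub>R y i + s *\<^sub>R (y i + t i *\<^sub>R q i) = ?y"
        by (simp add: algebra_simps)
      finally have y: "?y \<in> A'" .
      have "f' (?y, q i, p i) \<in> O'"
        using y A'(4) i A(4) B(4) by (intro D(3)) auto
      moreover have "((\<lambda>h. (\<gamma> (s + h) - \<gamma> s) /\<^sub>R h) \<longlongrightarrow> f' (?y, q i, p i)) (at 0)"
      proof -
        have l: "filterlim (\<lambda>h. h * t i) (at 0) (at (0::real))"
          unfolding filterlim_at
          using i by (auto intro!: tendsto_eq_intros simp: eventually_at intro: exI[of _ 1])
        have "((\<lambda>h. dir_quot (f (p i)) (q i) ?y (h * t i)) \<longlongrightarrow> f' (?y, q i, p i)) (at 0)"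
          using filterlim_compose[OF der[unfolded has_dir_deriv_def, of ?y "p i" "q i"] l] y A'(4) by auto
        moreover have "dir_quot (f (p i)) (q i) ?y (h * t i) = (\<gamma> (s + h) - \<gamma> s) /\<^sub>R h" for h
          by (simp add: dir_quot_def \<gamma>_def algebra_simps)
        ultimately show ?thesis by simp
      qed
      ultimately show "\<exists>l\<in>O'. ((\<lambda>h. (\<gamma> (s + h) - \<gamma> s) /\<^sub>R h) \<longlongrightarrow> l) (at 0)" by blast
    qed
    then show "(f (p i) (y i + t i *\<^sub>R q i) - f (p i) (y i)) /\<^sub>R t i \<in> O1"
      using O'(4) by (auto simp: \<gamma>_def scaleR_diff_right)
  qed
qed

text \<open>A step along \<open>u + v\<close> is a step along \<open>u\<close> followed by a step
  along \<open>v\<close> from the displaced point \<open>x + t *\<^sub>R u\<close>. Strict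
  differentiability gives the limit of the second quotient although its base point moves. Additivity
  in the direction is thus a consequence of joint continuity and no part of the notion of
  smoothness.\<close>

lemma has_dir_deriv_add_dir:
  fixes f :: "'a::locally_convex \<Rightarrow> 'b::locally_convex"
  assumes "open S" "x \<in> S"
    and der: "\<And>y v. y \<in> S \<Longrightarrow> has_dir_deriv f v y (f' (y, v))"
    and cont: "(f' \<longlongrightarrow> f' (x, v)) (nhds (x, v))"
  shows "f' (x, u + v) = f' (x, u) + f' (x, v)"
proof -
  \<comment> \<open>The third component is a dummy parameter that brings \<open>f'\<close> into the
    form asked for by \<open>strict_dir_deriv\<close>.\<close>
  let ?g = "\<lambda>z::'a \<times> 'a \<times> real. f' (fst z, fst (snd z))"
  have c: "(?g \<longlongrightarrow> ?g (x, v, 0)) (nhds (x, v, 0))"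
  proof -
    have "((\<lambda>z::'a \<times> 'a \<times> real. (fst z, fst (snd z))) \<longlongrightarrow> (x, v)) (nhds (x, v, 0))"
      using tendsto_Pair[OF tendsto_fst_nhds tendsto_fst[OF tendsto_snd_nhds], of "(x, v, 0)"] by simp
    then show ?thesis
      using filterlim_compose[OF cont] by simp
  qed
  have line: "((\<lambda>t. x + t *\<^sub>R u) \<longlongrightarrow> x) (at 0)"
    by (rule tendsto_mono[OF _ tendsto_line]) (simp add: at_within_def)
  have "((\<lambda>t. (f ((x + t *\<^sub>R u) + t *\<^sub>R v) - f (x + t *\<^sub>R u)) /\<^sub>R t) \<longlongrightarrow> f' (x, v)) (at 0)"
    using strict_dir_deriv[where f = "\<lambda>_. f" and f' = ?g and y = "\<lambda>t. x + t *\<^sub>R u" and q = "\<lambda>_. v"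
        and p = "\<lambda>_. 0" and t = "\<lambda>t. t" and F = "at 0", OF assms(1,2) _ c line]
    by (simp add: der eventually_at_filter)
  then have "((\<lambda>t. (f ((x + t *\<^sub>R u) + t *\<^sub>R v) - f (x + t *\<^sub>R u)) /\<^sub>R t + dir_quot f u x t)
      \<longlongrightarrow> f' (x, v) + f' (x, u)) (at 0)"
    using der[OF assms(2), of u] unfolding has_dir_deriv_def by (rule tendsto_add)
  moreover have "(f ((x + t *\<^sub>R u) + t *\<^sub>R v) - f (x + t *\<^sub>R u)) /\<^sub>R t + dir_quot f u x t
      = dir_quot f (u + v) x t" for t
    unfolding dir_quot_def scaleR_right_distrib[symmetric]
    by (simp add: scaleR_right_distrib add.assoc)
  ultimately have "has_dir_deriv f (u + v) x (f' (x, v) + f' (x, u))"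
    by (intro has_dir_derivI) (auto intro: sym)
  then show ?thesis
    using has_dir_deriv_unique[OF der[OF assms(2)]] by (metis add.commute)
qed

section \<open>Smooth functions with parameters\<close>

text \<open>Functions of a point \<open>x\<close> and a sequence \<open>w\<close> of vectors.  Differentiation in \<open>x\<close> prepends the
  direction to the sequence, so that the derivative has the same type.\<close>

definition param_deriv ::
    "('a::locally_convex \<times> (nat \<Rightarrow> 'a) \<Rightarrow> 'b::locally_convex) \<Rightarrow> 'a \<times> (nat \<Rightarrow> 'a) \<Rightarrow> 'b" where
  "param_deriv \<Phi> = (\<lambda>(x, w). dir_deriv (\<lambda>x. \<Phi> (x, w \<circ> Suc)) (w 0) x)"

text \<open>A finite order \<open>k\<close> lets the closure rules be proved by induction:
  differentiating a sum, pair or composite gives functions of the same shape and of one order less.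
  Smoothness is \<open>param_smooth\<close> for all \<open>k\<close>.\<close>

primrec param_smooth ::
    "'a::locally_convex set \<Rightarrow> nat \<Rightarrow> ('a \<times> (nat \<Rightarrow> 'a) \<Rightarrow> 'b::locally_convex) \<Rightarrow> bool" where
  "param_smooth S 0 \<Phi> \<longleftrightarrow> continuous_on (S \<times> UNIV) \<Phi>"
| "param_smooth S (Suc k) \<Phi> \<longleftrightarrow> continuous_on (S \<times> UNIV) \<Phi> \<and>
     (\<forall>x\<in>S. \<forall>w v. dir_differentiable (\<lambda>x. \<Phi> (x, w)) v x) \<and> param_smooth S k (param_deriv \<Phi>)"

lemma case_nat_Suc_comp [simp]: "case_nat v w \<circ> Suc = w"
  by auto

lemma case_nat_eta [simp]: "case_nat (w 0) (w \<circ> Suc) = w"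
  by (auto split: nat.split)

lemma param_smooth_continuous: "param_smooth S k \<Phi> \<Longrightarrow> continuous_on (S \<times> UNIV) \<Phi>"
  by (cases k) auto

lemma param_smooth_tendsto:
  "open S \<Longrightarrow> param_smooth S k \<Phi> \<Longrightarrow> x \<in> S \<Longrightarrow> (\<Phi> \<longlongrightarrow> \<Phi> (x, w)) (nhds (x, w))"
  using param_smooth_continuous[of S k \<Phi>] by (simp add: continuous_on_nhds_iff open_Times)

lemma param_smooth_has_dir_deriv:
  "param_smooth S (Suc k) \<Phi> \<Longrightarrow> x \<in> S \<Longrightarrow>
    has_dir_deriv (\<lambda>x. \<Phi> (x, w)) v x (param_deriv \<Phi> (x, case_nat v w))"
  by (auto simp: dir_differentiable_iff param_deriv_def)

lemma param_smooth_cong_aux: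
  assumes "open S"
  shows "(\<And>x w. x \<in> S \<Longrightarrow> \<Phi> (x, w) = \<Psi> (x, w)) \<Longrightarrow> param_smooth S k \<Phi> \<Longrightarrow> param_smooth S k \<Psi>"
proof (induction k arbitrary: \<Phi> \<Psi>)
  case 0
  have "continuous_on (S \<times> UNIV) \<Phi> \<longleftrightarrow> continuous_on (S \<times> UNIV) \<Psi>"
    using 0 by (intro continuous_on_cong) auto
  then show ?case
    using 0 by simp
next
  case (Suc k)
  have "continuous_on (S \<times> UNIV) \<Phi> \<longleftrightarrow> continuous_on (S \<times> UNIV) \<Psi>"
    using Suc.prems by (intro continuous_on_cong) auto
  then have "continuous_on (S \<times> UNIV) \<Psi>"
    using Suc.prems by simp
  moreover have "dir_differentiable (\<lambda>x. \<Psi> (x, w)) v x" if "x \<in> S" for x w v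
    using param_smooth_has_dir_deriv[OF Suc.prems(2) that, of w v]
      has_dir_deriv_cong[OF assms that, of "\<lambda>x. \<Phi> (x, w)" "\<lambda>x. \<Psi> (x, w)"] Suc.prems(1)
    by (auto simp: dir_differentiable_def has_dir_deriv_def)
  moreover have "param_smooth S k (param_deriv \<Psi>)"
  proof (rule Suc.IH)
    show "param_smooth S k (param_deriv \<Phi>)" using Suc.prems(2) by simp
    show "param_deriv \<Phi> (x, w) = param_deriv \<Psi> (x, w)" if "x \<in> S" for x w
      unfolding param_deriv_def using Suc.prems(1) by (auto intro: dir_deriv_cong[OF assms that])
  qed
  ultimately show ?case by simp
qed

lemma param_smooth_cong:
  assumes "open S" "\<And>x w. x \<in> S \<Longrightarrow> \<Phi> (x, w) = \<Psi> (x, w)"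
  shows "param_smooth S k \<Phi> \<longleftrightarrow> param_smooth S k \<Psi>"
  using param_smooth_cong_aux[OF assms(1), of \<Phi> \<Psi>] param_smooth_cong_aux[OF assms(1), of \<Psi> \<Phi>] assms(2)
  by metis

text \<open>The derivative is supplied as a formula \<open>\<Phi>'\<close> that agrees with
  \<open>param_deriv\<close> on \<open>S\<close> only; the congruence rule over the open set
  \<open>S\<close> absorbs the difference elsewhere.\<close>

lemma param_smooth_SucI:
  assumes "open S" "continuous_on (S \<times> UNIV) \<Phi>"
    and der: "\<And>x w v. x \<in> S \<Longrightarrow> has_dir_deriv (\<lambda>x. \<Phi> (x, w)) v x (\<Phi>' (x, case_nat v w))"
    and "param_smooth S k \<Phi>'"
  shows "param_smooth S (Suc k) \<Phi>"
proof -
  have "param_deriv \<Phi> (x, w) = \<Phi>' (x, w)" if "x \<in> S" for x w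
    using has_dir_deriv_dir_deriv[OF der[OF that, where w = "w \<circ> Suc" and v = "w 0"]]
    by (simp add: param_deriv_def)
  then have "param_smooth S k (param_deriv \<Phi>)"
    using assms(4) param_smooth_cong[OF assms(1), of "param_deriv \<Phi>" \<Phi>'] by simp
  moreover have "dir_differentiable (\<lambda>x. \<Phi> (x, w)) v x" if "x \<in> S" for x w v
    using der[OF that] by (auto simp: dir_differentiable_def has_dir_deriv_def)
  ultimately show ?thesis
    using assms(2) by simp
qed

lemma param_smooth_Suc_imp: "param_smooth S (Suc k) \<Phi> \<Longrightarrow> param_smooth S k \<Phi>"
  by (induction k arbitrary: \<Phi>) auto

lemma param_smooth_subset: "param_smooth S k \<Phi> \<Longrightarrow> T \<subseteq> S \<Longrightarrow> param_smooth T k \<Phi>"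
  by (induction k arbitrary: \<Phi>) (auto elim: continuous_on_subset)

lemma param_smooth_const: "open S \<Longrightarrow> param_smooth S k (\<lambda>_. c)"
proof (induction k arbitrary: c)
  case (Suc k)
  show ?case
    by (rule param_smooth_SucI[where \<Phi>' = "\<lambda>_. 0"]) (use Suc in \<open>auto intro: has_dir_deriv_const\<close>)
qed simp

lemma param_smooth_param:
  assumes "open S" "continuous_on UNIV g"
  shows "param_smooth S k (\<lambda>(x, w). g w)"
proof -
  have c: "continuous_on (S \<times> UNIV) (\<lambda>(x, w). g w)"
    unfolding case_prod_beta
    by (rule continuous_on_compose2[OF assms(2) continuous_on_snd[OF continuous_on_id]]) auto
  show ?thesis
  proof (cases k)
    case 0
    then show ?thesis using c by simp
  next
    case (Suc j)
    show ?thesis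
      unfolding Suc
      by (rule param_smooth_SucI[OF assms(1) c, where \<Phi>' = "\<lambda>_. 0"])
         (auto intro: param_smooth_const assms(1) has_dir_deriv_const)
  qed
qed

lemma param_smooth_add:
  assumes "open S"
  shows "param_smooth S k \<Phi> \<Longrightarrow> param_smooth S k \<Psi> \<Longrightarrow> param_smooth S k (\<lambda>z. \<Phi> z + \<Psi> z)"
proof (induction k arbitrary: \<Phi> \<Psi>)
  case 0
  then show ?case by (auto intro!: continuous_on_add)
next
  case (Suc k)
  have "continuous_on (S \<times> UNIV) (\<lambda>z. \<Phi> z + \<Psi> z)"
    using Suc.prems by (auto intro!: continuous_on_add)
  moreover have "has_dir_deriv (\<lambda>x. \<Phi> (x, w) + \<Psi> (x, w)) v x
      (param_deriv \<Phi> (x, case_nat v w) + param_deriv \<Psi> (x, case_nat v w))" if "x \<in> S" for x w v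
    using has_dir_deriv_add[OF param_smooth_has_dir_deriv[OF Suc.prems(1) that]
        param_smooth_has_dir_deriv[OF Suc.prems(2) that]] .
  moreover have "param_smooth S k (\<lambda>z. param_deriv \<Phi> z + param_deriv \<Psi> z)"
    using Suc by simp
  ultimately show ?case
    by (intro param_smooth_SucI[where \<Phi>' = "\<lambda>z. param_deriv \<Phi> z + param_deriv \<Psi> z"] assms)
qed

lemma param_smooth_sum:
  assumes "open S" "\<And>i. i \<in> I \<Longrightarrow> param_smooth S k (\<Phi> i)"
  shows "param_smooth S k (\<lambda>z. \<Sum>i\<in>I. \<Phi> i z)"
  using assms(2)
  by (induction I rule: infinite_finite_induct)
     (auto intro: param_smooth_add param_smooth_const assms(1))

lemma param_smooth_Pair:
  assumes "open S"
  shows "param_smooth S k \<Phi> \<Longrightarrow> param_smooth S k \<Psi> \<Longrightarrow> param_smooth S k (\<lambda>z. (\<Phi> z, \<Psi> z))"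
proof (induction k arbitrary: \<Phi> \<Psi>)
  case 0
  then show ?case by (auto intro!: continuous_on_Pair)
next
  case (Suc k)
  have "continuous_on (S \<times> UNIV) (\<lambda>z. (\<Phi> z, \<Psi> z))"
    using Suc.prems by (auto intro!: continuous_on_Pair)
  moreover have "has_dir_deriv (\<lambda>x. (\<Phi> (x, w), \<Psi> (x, w))) v x
      (param_deriv \<Phi> (x, case_nat v w), param_deriv \<Psi> (x, case_nat v w))" if "x \<in> S" for x w v
    using has_dir_deriv_Pair[OF param_smooth_has_dir_deriv[OF Suc.prems(1) that]
        param_smooth_has_dir_deriv[OF Suc.prems(2) that]] .
  moreover have "param_smooth S k (\<lambda>z. (param_deriv \<Phi> z, param_deriv \<Psi> z))"
    using Suc by simp
  ultimately show ?case
    by (intro param_smooth_SucI[where \<Phi>' = "\<lambda>z. (param_deriv \<Phi> z, param_deriv \<Psi> z)"] assms)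
qed

lemma param_smooth_linear:
  assumes "open S" "linear L" "continuous_on UNIV L"
  shows "param_smooth S k \<Phi> \<Longrightarrow> param_smooth S k (\<lambda>z. L (\<Phi> z))"
proof (induction k arbitrary: \<Phi>)
  case 0
  then show ?case by (auto intro: continuous_on_compose2[OF assms(3)])
next
  case (Suc k)
  have "continuous_on (S \<times> UNIV) (\<lambda>z. L (\<Phi> z))"
    using Suc.prems by (auto intro: continuous_on_compose2[OF assms(3)])
  moreover have "has_dir_deriv (\<lambda>x. L (\<Phi> (x, w))) v x (L (param_deriv \<Phi> (x, case_nat v w)))"
    if "x \<in> S" for x w v
    using has_dir_deriv_linear[OF assms(2,3) param_smooth_has_dir_deriv[OF Suc.prems that]] .
  moreover have "param_smooth S k (\<lambda>z. L (param_deriv \<Phi> z))"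
    using Suc by simp
  ultimately show ?case
    by (intro param_smooth_SucI[where \<Phi>' = "\<lambda>z. L (param_deriv \<Phi> z)"] assms)
qed

lemma continuous_on_reindex: "continuous_on UNIV (\<lambda>w :: nat \<Rightarrow> 'a::topological_space. w \<circ> r)"
  by (rule continuous_on_coordinatewise_then_product)
     (simp add: continuous_on_product_then_coordinatewise)

lemma continuous_on_reindex_param:
  assumes "continuous_on (S \<times> UNIV) \<Phi>"
  shows "continuous_on (S \<times> UNIV) (\<lambda>(x, w :: nat \<Rightarrow> 'a::topological_space). \<Phi> (x, w \<circ> r))"
  unfolding case_prod_beta
  by (rule continuous_on_compose2[OF assms])
     (auto intro!: continuous_on_Pair continuous_on_fst continuous_on_id
        continuous_on_compose2[OF continuous_on_reindex continuous_on_snd[OF continuous_on_id]])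

lemma param_smooth_reindex:
  assumes "open S"
  shows "param_smooth S k \<Phi> \<Longrightarrow> param_smooth S k (\<lambda>(x, w). \<Phi> (x, w \<circ> r))"
proof (induction k arbitrary: \<Phi> r)
  case 0
  then show ?case
    unfolding param_smooth.simps by (rule continuous_on_reindex_param)
next
  case (Suc k)
  have c: "continuous_on (S \<times> UNIV) (\<lambda>(x, w). \<Phi> (x, w \<circ> r))"
    using Suc.prems by (intro continuous_on_reindex_param) simp
  \<comment> \<open>Differentiation puts its direction at place 0, so the reindexing of the
    derivative fixes 0 and acts as \<open>r\<close> on the shifted rest.\<close>
  let ?r = "case_nat 0 (Suc \<circ> r)"
  have r: "case_nat v w \<circ> ?r = case_nat v (w \<circ> r)" for v :: 'a and w
    by (auto split: nat.split)
  show ?case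
  proof (rule param_smooth_SucI[OF assms c])
    show "has_dir_deriv (\<lambda>x. case (x, w) of (x, w) \<Rightarrow> \<Phi> (x, w \<circ> r)) v x
        ((\<lambda>(x, w). param_deriv \<Phi> (x, w \<circ> ?r)) (x, case_nat v w))" if "x \<in> S" for x w v
      using param_smooth_has_dir_deriv[OF Suc.prems that, of "w \<circ> r" v] by (simp add: r)
    show "param_smooth S k (\<lambda>(x, w). param_deriv \<Phi> (x, w \<circ> ?r))"
      using Suc.prems by (intro Suc.IH) simp
  qed
qed

section \<open>Multilinear vector arguments and the chain rule\<close>

definition multilin ::
    "'a::real_vector set \<Rightarrow> nat \<Rightarrow> ('a \<times> (nat \<Rightarrow> 'a) \<Rightarrow> 'b::real_vector) \<Rightarrow> bool" where
  "multilin S m \<Phi> \<longleftrightarrow> (\<forall>x\<in>S. (\<forall>w w'. (\<forall>i<m. w i = w' i) \<longrightarrow> \<Phi> (x, w) = \<Phi> (x, w')) \<and>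
     (\<forall>i<m. \<forall>w. linear (\<lambda>u. \<Phi> (x, w(i := u)))))"

text \<open>Linearity in the new argument, the direction at place 0, is
  \<open>has_dir_deriv_add_dir\<close> together with homogeneity. In an old argument, now one place
  higher, it arises by differentiating the linearity identity of \<open>\<Phi>\<close>, which holds
  at all points of the open set \<open>S\<close>.\<close>

lemma multilin_param_deriv:
  assumes "open S" "param_smooth S (Suc 0) \<Phi>" "multilin S m \<Phi>"
  shows "multilin S (Suc m) (param_deriv \<Phi>)"
  unfolding multilin_def
proof (intro ballI conjI allI impI)
  fix x assume x: "x \<in> S"
  note der = param_smooth_has_dir_deriv[OF assms(2)]
  show "param_deriv \<Phi> (x, w) = param_deriv \<Phi> (x, w')" if "\<forall>i<Suc m. w i = w' i" for w w'
  proof -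
    have "\<Phi> (y, w \<circ> Suc) = \<Phi> (y, w' \<circ> Suc)" if "y \<in> S" for y
      using assms(3) that \<open>\<forall>i<Suc m. w i = w' i\<close> by (simp add: multilin_def)
    then show ?thesis
      using that dir_deriv_cong[OF assms(1) x, of "\<lambda>x. \<Phi> (x, w \<circ> Suc)" "\<lambda>x. \<Phi> (x, w' \<circ> Suc)"]
      by (simp add: param_deriv_def)
  qed
  fix i w assume i: "i < Suc m"
  show "linear (\<lambda>u. param_deriv \<Phi> (x, w(i := u)))"
  proof (cases i)
    case 0
    let ?D = "\<lambda>(y, v). param_deriv \<Phi> (y, case_nat v (w \<circ> Suc))"
    have e: "w(i := u) = case_nat u (w \<circ> Suc)" for u
      using 0 by (auto split: nat.split)
    have c: "(?D \<longlongrightarrow> ?D (x, v)) (nhds (x, v))" for v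
    proof -
      have "((\<lambda>z. case_nat (snd z) (w \<circ> Suc)) \<longlongrightarrow> case_nat v (w \<circ> Suc)) (nhds (x, v))"
        using tendsto_snd_nhds[of "(x, v)"] by (intro tendsto_funI) (simp split: nat.split)
      then have "((\<lambda>z. (fst z, case_nat (snd z) (w \<circ> Suc))) \<longlongrightarrow> (x, case_nat v (w \<circ> Suc))) (nhds (x, v))"
        using tendsto_fst_nhds[of "(x, v)"] by (intro tendsto_Pair) simp_all
      then show ?thesis
        using filterlim_compose[OF param_smooth_tendsto[OF assms(1) _ x, of 0 "param_deriv \<Phi>"]] assms(2)
        unfolding case_prod_beta by simp
    qed
    have "?D (x, u + v) = ?D (x, u) + ?D (x, v)" for u v
      by (rule has_dir_deriv_add_dir[where f = "\<lambda>y. \<Phi> (y, w \<circ> Suc)", OF assms(1) x _ c])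
         (use der in auto)
    moreover have "?D (x, a *\<^sub>R u) = a *\<^sub>R ?D (x, u)" for a u
      using has_dir_deriv_unique[OF der[OF x] has_dir_deriv_scaleR_dir[OF der[OF x]]] by simp
    ultimately show ?thesis
      unfolding e by (intro linearI) simp_all
  next
    case (Suc j)
    have e: "w(i := u) = case_nat (w 0) ((w \<circ> Suc)(j := u))" for u
      using Suc by (auto split: nat.split)
    have lin: "linear (\<lambda>u. \<Phi> (y, (w \<circ> Suc)(j := u)))" if "y \<in> S" for y
      using assms(3) that Suc i by (auto simp: multilin_def)
    have add: "\<Phi> (y, (w \<circ> Suc)(j := u)) + \<Phi> (y, (w \<circ> Suc)(j := v)) = \<Phi> (y, (w \<circ> Suc)(j := u + v))"
      if "y \<in> S" for y u v
      using linear_add[OF lin[OF that]] by simp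
    have scale: "a *\<^sub>R \<Phi> (y, (w \<circ> Suc)(j := u)) = \<Phi> (y, (w \<circ> Suc)(j := a *\<^sub>R u))"
      if "y \<in> S" for y u a
      using linear_scale[OF lin[OF that]] by simp
    show ?thesis
      unfolding e
    proof (rule linearI)
      fix u v
      have "has_dir_deriv (\<lambda>y. \<Phi> (y, (w \<circ> Suc)(j := u + v))) (w 0) x
        (param_deriv \<Phi> (x, case_nat (w 0) ((w \<circ> Suc)(j := u))) +
         param_deriv \<Phi> (x, case_nat (w 0) ((w \<circ> Suc)(j := v))))"
        using has_dir_deriv_add[OF der[OF x] der[OF x]]
          has_dir_deriv_cong[OF assms(1) x, of "\<lambda>y. \<Phi> (y, (w \<circ> Suc)(j := u)) + \<Phi> (y, (w \<circ> Suc)(j := v))"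
            "\<lambda>y. \<Phi> (y, (w \<circ> Suc)(j := u + v))"] add
        by blast
      then show "param_deriv \<Phi> (x, case_nat (w 0) ((w \<circ> Suc)(j := u + v))) =
        param_deriv \<Phi> (x, case_nat (w 0) ((w \<circ> Suc)(j := u))) +
        param_deriv \<Phi> (x, case_nat (w 0) ((w \<circ> Suc)(j := v)))"
        using has_dir_deriv_unique[OF der[OF x]] by blast
    next
      fix a u
      have "linear ((*\<^sub>R) a :: 'b \<Rightarrow> 'b)" "continuous_on UNIV ((*\<^sub>R) a :: 'b \<Rightarrow> 'b)"
        by (auto simp: linear_iff scaleR_right_distrib continuous_on_nhds_iff
            intro!: tendsto_scaleR_lc filterlim_ident)
      from has_dir_deriv_linear[OF this der[OF x]]
      have "has_dir_deriv (\<lambda>y. \<Phi> (y, (w \<circ> Suc)(j := a *\<^sub>R u))) (w 0) x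
        (a *\<^sub>R param_deriv \<Phi> (x, case_nat (w 0) ((w \<circ> Suc)(j := u))))"
        using has_dir_deriv_cong[OF assms(1) x, of "\<lambda>y. a *\<^sub>R \<Phi> (y, (w \<circ> Suc)(j := u))"
            "\<lambda>y. \<Phi> (y, (w \<circ> Suc)(j := a *\<^sub>R u))"] scale
        by blast
      then show "param_deriv \<Phi> (x, case_nat (w 0) ((w \<circ> Suc)(j := a *\<^sub>R u))) =
        a *\<^sub>R param_deriv \<Phi> (x, case_nat (w 0) ((w \<circ> Suc)(j := u)))"
        using has_dir_deriv_unique[OF der[OF x]] by blast
    qed
  qed
qed

text \<open>Differentiability in one direction yields continuity along the corresponding line, which
  is all that the product rules below ask for.\<close>

lemma has_dir_deriv_tendsto:
  assumes "has_dir_deriv f v x l"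
  shows "((\<lambda>t. f (x + t *\<^sub>R v)) \<longlongrightarrow> f x) (at 0)"
proof -
  have "((\<lambda>t. f x + t *\<^sub>R dir_quot f v x t) \<longlongrightarrow> f x + 0 *\<^sub>R l) (at 0)"
    using assms unfolding has_dir_deriv_def
    by (intro tendsto_add tendsto_const tendsto_scaleR_lc tendsto_ident_at)
  moreover have "eventually (\<lambda>t. f x + t *\<^sub>R dir_quot f v x t = f (x + t *\<^sub>R v)) (at 0)"
    unfolding dir_quot_def eventually_at by (auto intro: exI[of _ 1])
  ultimately show ?thesis
    using tendsto_cong by fastforce
qed

lemma scaleR_add_eq: "x + y = z \<Longrightarrow> a *\<^sub>R x + a *\<^sub>R y = a *\<^sub>R (z :: 'a::real_vector)"
  by (auto simp only: scaleR_right_distrib)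

text \<open>The increment is split in two. Moving the base point with the vectors at their new
  values is governed by strict differentiability and gives the \<open>param_deriv\<close> term.
  Replacing the old vectors by the new ones at the fixed point \<open>f x\<close> is governed by
  multilinearity, which takes the place of differentiability in the vectors, and gives the
  sum.\<close>

lemma has_dir_deriv_compose:
  assumes "open T" "param_smooth T (Suc 0) \<Phi>" "multilin T m \<Phi>" "f x \<in> T"
    and f: "has_dir_deriv f v x f'"
    and U: "\<And>i. has_dir_deriv (U i) v x (U' i)"
  shows "has_dir_deriv (\<lambda>x. \<Phi> (f x, \<lambda>i. U i x)) v x
    (param_deriv \<Phi> (f x, case_nat f' (\<lambda>i. U i x)) + (\<Sum>j<m. \<Phi> (f x, (\<lambda>i. U i x)(j := U' j))))"
proof -
  define W where "W t = (\<lambda>i. U i (x + t *\<^sub>R v))" for t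
  have W0: "W 0 = (\<lambda>i. U i x)" by (simp add: W_def)
  have Wlim: "((\<lambda>t. W t i) \<longlongrightarrow> W 0 i) (at 0)" for i
    using has_dir_deriv_tendsto[OF U[of i]] by (simp add: W_def)
  \<comment> \<open>The increment of \<open>f\<close> is \<open>t\<close> times its difference
    quotient. So the base point stays at \<open>f x\<close>, the direction is that quotient, which
    tends to \<open>f'\<close>, and the parameter is \<open>W t\<close>.\<close>
  have "((\<lambda>t. (\<Phi> (f x + t *\<^sub>R dir_quot f v x t, W t) - \<Phi> (f x, W t)) /\<^sub>R t)
     \<longlongrightarrow> (\<lambda>(y, v, w). param_deriv \<Phi> (y, case_nat v w)) (f x, f', W 0)) (at 0)"
  proof (rule strict_dir_deriv[OF assms(1,4), where f = "\<lambda>w y. \<Phi> (y, w)"])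
    show "has_dir_deriv (\<lambda>y. \<Phi> (y, p)) v y ((\<lambda>(y, v, w). param_deriv \<Phi> (y, case_nat v w)) (y, v, p))"
      if "y \<in> T" for p y v
      using param_smooth_has_dir_deriv[OF assms(2) that] by simp
    have "((\<lambda>z. case_nat (fst (snd z)) (snd (snd z))) \<longlongrightarrow> case_nat f' (W 0)) (nhds (f x, f', W 0))"
      using tendsto_fst[OF tendsto_snd_nhds[of "(f x, f', W 0)"]]
        tendsto_snd[OF tendsto_snd_nhds[of "(f x, f', W 0)"]]
      by (intro tendsto_funI) (auto split: nat.split dest: tendsto_fun_component)
    then have "((\<lambda>z. (fst z, case_nat (fst (snd z)) (snd (snd z)))) \<longlongrightarrow> (f x, case_nat f' (W 0)))
        (nhds (f x, f', W 0))"
      using tendsto_fst_nhds[of "(f x, f', W 0)"] by (intro tendsto_Pair) simp_all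
    then show "((\<lambda>(y, v, w). param_deriv \<Phi> (y, case_nat v w)) \<longlongrightarrow>
        (\<lambda>(y, v, w). param_deriv \<Phi> (y, case_nat v w)) (f x, f', W 0)) (nhds (f x, f', W 0))"
      using filterlim_compose[OF param_smooth_tendsto[OF assms(1) _ assms(4), of 0 "param_deriv \<Phi>"]] assms(2)
      unfolding case_prod_beta by simp
    show "(dir_quot f v x \<longlongrightarrow> f') (at 0)"
      using f by (simp add: has_dir_deriv_def)
    show "(W \<longlongrightarrow> W 0) (at 0)"
      by (rule tendsto_funI[OF Wlim])
  qed (auto simp: eventually_at_filter tendsto_const)
  moreover have "((\<lambda>t. \<Sum>j<m. \<Phi> (f x, (\<lambda>i. if i < j then W t i else W 0 i)(j := dir_quot (U j) v x t)))
     \<longlongrightarrow> (\<Sum>j<m. \<Phi> (f x, (W 0)(j := U' j)))) (at 0)"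
  proof (rule tendsto_sum)
    fix j
    have "((\<lambda>t. (\<lambda>i. if i < j then W t i else W 0 i)(j := dir_quot (U j) v x t))
        \<longlongrightarrow> (W 0)(j := U' j)) (at 0)"
    proof (rule tendsto_funI)
      fix i
      show "((\<lambda>t. ((\<lambda>i. if i < j then W t i else W 0 i)(j := dir_quot (U j) v x t)) i)
          \<longlongrightarrow> ((W 0)(j := U' j)) i) (at 0)"
        using U[of j] Wlim[of i] by (cases "i = j"; cases "i < j") (auto simp: has_dir_deriv_def)
    qed
    then have "((\<lambda>t. (f x, (\<lambda>i. if i < j then W t i else W 0 i)(j := dir_quot (U j) v x t)))
        \<longlongrightarrow> (f x, (W 0)(j := U' j))) (at 0)"
      by (intro tendsto_Pair tendsto_const)
    then show "((\<lambda>t. \<Phi> (f x, (\<lambda>i. if i < j then W t i else W 0 i)(j := dir_quot (U j) v x t)))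
        \<longlongrightarrow> \<Phi> (f x, (W 0)(j := U' j))) (at 0)"
      by (rule filterlim_compose[OF param_smooth_tendsto[OF assms(1,2,4)]])
  qed
  ultimately have lim: "((\<lambda>t. (\<Phi> (f x + t *\<^sub>R dir_quot f v x t, W t) - \<Phi> (f x, W t)) /\<^sub>R t +
      (\<Sum>j<m. \<Phi> (f x, (\<lambda>i. if i < j then W t i else W 0 i)(j := dir_quot (U j) v x t))))
     \<longlongrightarrow> param_deriv \<Phi> (f x, case_nat f' (W 0)) + (\<Sum>j<m. \<Phi> (f x, (W 0)(j := U' j)))) (at 0)"
    by (auto intro: tendsto_add)
  \<comment> \<open>The vectors are exchanged one at a time: below place \<open>j\<close> the new
    ones, from \<open>j\<close> on the old ones. Each exchange is linear in the place concerned, and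
    the differences telescope.\<close>
  have tele: "(\<Sum>j<m. \<Phi> (f x, (\<lambda>i. if i < j then W t i else W 0 i)(j := dir_quot (U j) v x t)))
      = (\<Phi> (f x, W t) - \<Phi> (f x, W 0)) /\<^sub>R t" if "t \<noteq> 0" for t
  proof -
    define V where "V j = (\<lambda>i. if i < j then W t i else W 0 i)" for j
    have "\<Phi> (f x, (V j)(j := dir_quot (U j) v x t)) = (\<Phi> (f x, V (Suc j)) - \<Phi> (f x, V j)) /\<^sub>R t"
      if "j < m" for j
    proof -
      have lin: "linear (\<lambda>u. \<Phi> (f x, (V j)(j := u)))"
        using assms(3,4) that by (simp add: multilin_def)
      have "V (Suc j) = (V j)(j := W t j)" "V j = (V j)(j := W 0 j)"
        by (auto simp: V_def)
      then have "\<Phi> (f x, V (Suc j)) - \<Phi> (f x, V j) = \<Phi> (f x, (V j)(j := W t j)) - \<Phi> (f x, (V j)(j := W 0 j))"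
        by metis
      also have "\<dots> = \<Phi> (f x, (V j)(j := W t j - W 0 j))"
        by (simp add: linear_diff[OF lin])
      finally show ?thesis
        using linear_scale[OF lin, of "inverse t" "W t j - W 0 j"]
        by (simp add: dir_quot_def W_def)
    qed
    then have "(\<Sum>j<m. \<Phi> (f x, (V j)(j := dir_quot (U j) v x t))) =
        (\<Sum>j<m. \<Phi> (f x, V (Suc j)) - \<Phi> (f x, V j)) /\<^sub>R t"
      by (simp add: scaleR_right.sum)
    also have "\<dots> = (\<Phi> (f x, V m) - \<Phi> (f x, V 0)) /\<^sub>R t"
      by (simp add: sum_lessThan_telescope[of "\<lambda>j. \<Phi> (f x, V j)"])
    also have "\<Phi> (f x, V m) = \<Phi> (f x, W t)"
      using assms(3,4) by (simp add: multilin_def V_def)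
    also have "V 0 = W 0" by (simp add: V_def)
    finally show ?thesis unfolding V_def .
  qed
  have ev: "eventually (\<lambda>t. (\<Phi> (f x + t *\<^sub>R dir_quot f v x t, W t) - \<Phi> (f x, W t)) /\<^sub>R t +
      (\<Sum>j<m. \<Phi> (f x, (\<lambda>i. if i < j then W t i else W 0 i)(j := dir_quot (U j) v x t)))
     = dir_quot (\<lambda>x. \<Phi> (f x, \<lambda>i. U i x)) v x t) (at 0)"
  proof (rule eventually_mono)
    show "eventually (\<lambda>t::real. t \<noteq> 0) (at 0)" by (simp add: eventually_at_filter)
    fix t :: real assume t: "t \<noteq> 0"
    show "(\<Phi> (f x + t *\<^sub>R dir_quot f v x t, W t) - \<Phi> (f x, W t)) /\<^sub>R t +
      (\<Sum>j<m. \<Phi> (f x, (\<lambda>i. if i < j then W t i else W 0 i)(j := dir_quot (U j) v x t)))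
     = dir_quot (\<lambda>x. \<Phi> (f x, \<lambda>i. U i x)) v x t"
    proof -
      have "f x + t *\<^sub>R dir_quot f v x t = f (x + t *\<^sub>R v)"
        using t by (simp add: dir_quot_def)
      then have "\<Phi> (f x + t *\<^sub>R dir_quot f v x t, W t) - \<Phi> (f x, W t) + (\<Phi> (f x, W t) - \<Phi> (f x, W 0)) =
          \<Phi> (f (x + t *\<^sub>R v), \<lambda>i. U i (x + t *\<^sub>R v)) - \<Phi> (f x, \<lambda>i. U i x)"
        by (simp add: W_def)
      then show ?thesis
        unfolding tele[OF t] dir_quot_def[of "\<lambda>x. \<Phi> (f x, \<lambda>i. U i x)"]
        by (rule scaleR_add_eq)
    qed
  qed
  show ?thesis
    using Lim_transform_eventually[OF lim ev] unfolding has_dir_deriv_def W0 .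
qed

lemma continuous_on_param_compose:
  fixes f :: "'a::topological_space \<Rightarrow> 'c::topological_space" and U :: "nat \<Rightarrow> 'a \<times> (nat \<Rightarrow> 'a) \<Rightarrow> 'd::topological_space"
  assumes "f ` S \<subseteq> T" "continuous_on (T \<times> UNIV) \<Phi>"
    "continuous_on (S \<times> UNIV) (\<lambda>(x, w :: nat \<Rightarrow> 'a). f x)"
    "\<And>i :: nat. continuous_on (S \<times> UNIV) (U i)"
  shows "continuous_on (S \<times> UNIV) (\<lambda>(x, w). \<Phi> (f x, \<lambda>i. U i (x, w)))"
proof -
  have "continuous_on (S \<times> UNIV) (\<lambda>z. (f (fst z), \<lambda>i. U i z))"
    using assms(3,4)
    by (intro continuous_on_Pair continuous_on_coordinatewise_then_product) (simp_all add: case_prod_beta)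
  moreover have "(\<lambda>z. (f (fst z), \<lambda>i. U i z)) ` (S \<times> UNIV) \<subseteq> T \<times> UNIV"
    using assms(1) by auto
  ultimately have "continuous_on (S \<times> UNIV) (\<lambda>z. \<Phi> (f (fst z), \<lambda>i. U i z))"
    by (rule continuous_on_compose2[OF assms(2)])
  then show ?thesis
    unfolding case_prod_beta by simp
qed

lemma param_smooth_Suc_0: "param_smooth S (Suc k) \<Phi> \<Longrightarrow> param_smooth S (Suc 0) \<Phi>"
  using param_smooth_continuous[of S k "param_deriv \<Phi>"] by simp

text \<open>By the chain rule the derivative of such a composite is a sum of composites of the same
  shape: one has \<open>\<Phi>\<close> replaced by its derivative, with the derivative of
  \<open>f\<close> as an additional vector, and in the others one vector is differentiated. This is
  why \<open>\<Phi>\<close>, the vectors and the number \<open>m\<close> are all general in the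
  induction.\<close>

lemma param_smooth_compose:
  assumes "open S" "open T" "f ` S \<subseteq> T"
  shows "param_smooth T k \<Phi> \<Longrightarrow> multilin T m \<Phi> \<Longrightarrow> param_smooth S k (\<lambda>(x, w). f x) \<Longrightarrow>
    (\<And>i. param_smooth S k (U i)) \<Longrightarrow> param_smooth S k (\<lambda>(x, w). \<Phi> (f x, \<lambda>i. U i (x, w)))"
proof (induction k arbitrary: \<Phi> U m)
  case (0 \<Phi> U)
  then show ?case
    using continuous_on_param_compose[OF assms(3), of \<Phi> U] by simp
next
  case (Suc k)
  have f: "param_smooth S k (\<lambda>(x, w). f x)" and \<Phi>: "param_smooth T k \<Phi>" and U: "param_smooth S k (U i)" for i
    using Suc.prems by (auto intro: param_smooth_Suc_imp)
  define f' where "f' = param_deriv (\<lambda>(x, w). f x)"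
  have f': "param_smooth S k f'"
    using Suc.prems(3) by (simp add: f'_def)
  \<comment> \<open>After differentiation the sequence begins with the direction; the
    undifferentiated vectors \<open>U i\<close> read the sequence behind it.\<close>
  define V where "V i = (\<lambda>(x, w). U i (x, w \<circ> Suc))" for i
  have V: "param_smooth S k (V i)" for i
    unfolding V_def by (rule param_smooth_reindex[OF assms(1) U])
  have multi: "multilin T (Suc m) (param_deriv \<Phi>)"
    by (rule multilin_param_deriv[OF assms(2) param_smooth_Suc_0[OF Suc.prems(1)] Suc.prems(2)])
  have c: "continuous_on (S \<times> UNIV) (\<lambda>(x, w). \<Phi> (f x, \<lambda>i. U i (x, w)))"
    using continuous_on_param_compose[OF assms(3), of \<Phi> U]
      param_smooth_continuous[OF f] param_smooth_continuous[OF \<Phi>] param_smooth_continuous[OF U] by simp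
  let ?A = "\<lambda>(x, w). param_deriv \<Phi> (f x, \<lambda>i. case_nat f' V i (x, w))"
  let ?B = "\<lambda>j (x, w). \<Phi> (f x, \<lambda>i. (V(j := param_deriv (U j))) i (x, w))"
  show ?case
  proof (rule param_smooth_SucI[OF assms(1) c])
    show "has_dir_deriv (\<lambda>x. case (x, w) of (x, w) \<Rightarrow> \<Phi> (f x, \<lambda>i. U i (x, w))) v x
        ((\<lambda>z. ?A z + (\<Sum>j<m. ?B j z)) (x, case_nat v w))" if "x \<in> S" for x w v
    proof -
      have "has_dir_deriv f v x (f' (x, case_nat v w))"
        using param_smooth_has_dir_deriv[OF Suc.prems(3) that] by (simp add: f'_def)
      moreover have "param_smooth T (Suc 0) \<Phi>"
        by (rule param_smooth_Suc_0[OF Suc.prems(1)])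
      ultimately have "has_dir_deriv (\<lambda>x. \<Phi> (f x, \<lambda>i. U i (x, w))) v x
        (param_deriv \<Phi> (f x, case_nat (f' (x, case_nat v w)) (\<lambda>i. U i (x, w))) +
         (\<Sum>j<m. \<Phi> (f x, (\<lambda>i. U i (x, w))(j := param_deriv (U j) (x, case_nat v w)))))"
        using assms(3) that param_smooth_has_dir_deriv[OF Suc.prems(4) that]
        by (intro has_dir_deriv_compose[OF assms(2) _ Suc.prems(2), where U = "\<lambda>i x. U i (x, w)"]) auto
      moreover have "case_nat (f' (x, case_nat v w)) (\<lambda>i. U i (x, w)) = (\<lambda>i. case_nat f' V i (x, case_nat v w))"
        by (auto simp: V_def split: nat.split)
      moreover have "(\<lambda>i. U i (x, w))(j := param_deriv (U j) (x, case_nat v w)) =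
          (\<lambda>i. (V(j := param_deriv (U j))) i (x, case_nat v w))" for j
        by (auto simp: V_def)
      ultimately show ?thesis by simp
    qed
    have "param_smooth S k ?A"
      using Suc.prems(1) f' V by (intro Suc.IH[OF _ multi f]) (auto split: nat.split)
    moreover have "param_smooth S k (?B j)" for j
      using V Suc.prems(4)[of j] by (intro Suc.IH[OF \<Phi> Suc.prems(2) f]) auto
    ultimately show "param_smooth S k (\<lambda>z. ?A z + (\<Sum>j<m. ?B j z))"
      by (intro param_smooth_add param_smooth_sum assms(1))
  qed
qed

section \<open>Agreement with iterated derivatives and \<open>smooth_family\<close>\<close>

lemma param_deriv_apply: "param_deriv \<Phi> (x, w) = dir_deriv (\<lambda>x. \<Phi> (x, w \<circ> Suc)) (w 0) x"
  by (simp add: param_deriv_def)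

text \<open>Every derivative prepends its direction. After \<open>k\<close> of them the directions
  fill the places below \<open>k\<close>, the outermost derivative having place 0, and the original
  vectors have moved up by \<open>k\<close>.\<close>

lemma funpow_param_deriv:
  "(param_deriv ^^ k) \<Phi> (x, w) = iter_deriv (\<lambda>x. \<Phi> (x, \<lambda>i. w (i + k))) (map w [0..<k]) x"
proof (induction k arbitrary: x w)
  case (Suc k)
  have "(\<lambda>x. (param_deriv ^^ k) \<Phi> (x, w \<circ> Suc)) =
      iter_deriv (\<lambda>x. \<Phi> (x, \<lambda>i. w (Suc (i + k)))) (map (w \<circ> Suc) [0..<k])"
    by (rule ext) (simp add: Suc.IH comp_def)
  then show ?case
    by (simp add: param_deriv_apply map_upt_Suc comp_def del: upt_Suc)
qed simp

lemma param_smooth_iff_funpow: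
  "param_smooth S k \<Phi> \<longleftrightarrow> continuous_on (S \<times> UNIV) ((param_deriv ^^ k) \<Phi>) \<and>
    (\<forall>j<k. continuous_on (S \<times> UNIV) ((param_deriv ^^ j) \<Phi>) \<and>
      (\<forall>x\<in>S. \<forall>w v. dir_differentiable (\<lambda>x. (param_deriv ^^ j) \<Phi> (x, w)) v x))"
proof (induction k arbitrary: \<Phi>)
  case (Suc k)
  have "(\<forall>j<Suc k. P j) \<longleftrightarrow> P 0 \<and> (\<forall>j<k. P (Suc j))" for P
    using less_Suc_eq_0_disj by auto
  then show ?case
    by (simp only: param_smooth.simps Suc.IH funpow_0 funpow_Suc_right comp_apply) blast
qed simp

text \<open>\<open>smooth_family\<close> reads the arguments of the form first and the directions
  behind them, iterated \<open>param_deriv\<close> the other way round. The two encodings differ by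
  a reindexing of the sequence, which is continuous, so that continuity passes in both directions
  (\<open>AB\<close> and \<open>BA\<close>).\<close>

lemma smooth_family_iff:
  "smooth_family q S F \<longleftrightarrow> (\<forall>k. param_smooth S k (\<lambda>(x, w). F (map w [0..<q]) x))" (is "_ \<longleftrightarrow> (\<forall>k. param_smooth S k ?\<Phi>)")
proof -
  have shift: "map (\<lambda>i. w (i + k)) [0..<q] = map w [k..<k + q]" for w :: "nat \<Rightarrow> 'a" and k
    by (rule nth_equalityI) (simp_all add: add.commute)
  have A: "(param_deriv ^^ k) ?\<Phi> (x, w) = iter_deriv (F (map w [k..<k + q])) (map w [0..<k]) x" for k x w
    by (simp add: funpow_param_deriv shift)
  define B where "B k = (\<lambda>(x, w :: nat \<Rightarrow> 'a). iter_deriv (F (map w [0..<q])) (map w [q..<q + k]) x)" for k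
  have AB: "(param_deriv ^^ k) ?\<Phi> = (\<lambda>(x, w). B k (x, w \<circ> (\<lambda>i. if i < q then i + k else i - q)))" for k
  proof -
    have "map (w \<circ> (\<lambda>i. if i < q then i + k else i - q)) [0..<q] = map w [k..<k + q]"
      "map (w \<circ> (\<lambda>i. if i < q then i + k else i - q)) [q..<q + k] = map w [0..<k]" for w :: "nat \<Rightarrow> 'a"
      by (auto intro!: nth_equalityI simp: add.commute)
    then show ?thesis
      by (intro ext) (clarsimp simp only: A B_def split_paired_all prod.case)
  qed
  have BA: "B k = (\<lambda>(x, w). (param_deriv ^^ k) ?\<Phi> (x, w \<circ> (\<lambda>i. if i < k then i + q else i - k)))" for k
  proof -
    have "map (w \<circ> (\<lambda>i. if i < k then i + q else i - k)) [0..<k] = map w [q..<q + k]"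
      "map (w \<circ> (\<lambda>i. if i < k then i + q else i - k)) [k..<k + q] = map w [0..<q]" for w :: "nat \<Rightarrow> 'a"
      by (auto intro!: nth_equalityI simp: add.commute)
    then show ?thesis
      by (intro ext) (clarsimp simp only: A B_def split_paired_all prod.case)
  qed
  have c: "continuous_on (S \<times> UNIV) ((param_deriv ^^ k) ?\<Phi>) \<longleftrightarrow> continuous_on (S \<times> UNIV) (B k)" for k
  proof
    show "continuous_on (S \<times> UNIV) (B k)" if "continuous_on (S \<times> UNIV) ((param_deriv ^^ k) ?\<Phi>)"
      unfolding BA by (rule continuous_on_reindex_param[OF that])
    show "continuous_on (S \<times> UNIV) ((param_deriv ^^ k) ?\<Phi>)" if "continuous_on (S \<times> UNIV) (B k)"
      unfolding AB by (rule continuous_on_reindex_param[OF that])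
  qed
  have d: "(\<forall>us vs v. length us = q \<longrightarrow> (\<forall>x\<in>S. dir_differentiable (iter_deriv (F us) vs) v x)) \<longleftrightarrow>
     (\<forall>k. \<forall>x\<in>S. \<forall>w v. dir_differentiable (\<lambda>x. (param_deriv ^^ k) ?\<Phi> (x, w)) v x)"
  proof (intro iffI allI ballI impI)
    fix us vs :: "'a list" and v x
    assume h: "\<forall>k. \<forall>x\<in>S. \<forall>w v. dir_differentiable (\<lambda>x. (param_deriv ^^ k) ?\<Phi> (x, w)) v x"
      and us: "length us = q" and x: "x \<in> S"
    define w where "w i = (vs @ us) ! i" for i
    have "map w [0..<length vs] = vs" "map w [length vs..<length vs + q] = us"
      using us by (auto intro!: nth_equalityI simp: w_def nth_append)
    then show "dir_differentiable (iter_deriv (F us) vs) v x"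
      using h[rule_format, OF x, of "length vs" w v] by (simp add: A)
  qed (simp add: A)
  have e: "(\<forall>k. P k \<and> (\<forall>j<k. P j \<and> Q j)) \<longleftrightarrow> (\<forall>k. Q k) \<and> (\<forall>k. P k)" for P Q :: "nat \<Rightarrow> bool"
    by (meson lessI)
  show ?thesis
    unfolding smooth_family_def d B_def[symmetric] c[symmetric] param_smooth_iff_funpow e ..
qed

section \<open>Smooth maps between locally convex spaces\<close>

lemma smooth_on_iff: "smooth_on S f \<longleftrightarrow> (\<forall>k. param_smooth S k (\<lambda>(x, w). f x))"
  by (simp add: smooth_on_def smooth_family_iff)

lemma smooth_on_param_smooth: "smooth_on S f \<Longrightarrow> param_smooth S k (\<lambda>(x, w). f x)"
  by (simp add: smooth_on_iff)

lemma smooth_on_subset: "smooth_on S f \<Longrightarrow> T \<subseteq> S \<Longrightarrow> smooth_on T f"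
  by (auto simp: smooth_on_iff intro: param_smooth_subset)

lemma smooth_on_cong_imp:
  assumes "open S" "smooth_on S f" "\<And>x. x \<in> S \<Longrightarrow> f x = g x"
  shows "smooth_on S g"
  using assms(2) param_smooth_cong[OF assms(1), of "\<lambda>(x, w). f x" "\<lambda>(x, w). g x"] assms(3)
  by (simp add: smooth_on_iff)

lemma smooth_on_has_dir_deriv:
  "smooth_on S f \<Longrightarrow> x \<in> S \<Longrightarrow> has_dir_deriv f v x (dir_deriv f v x)"
  using param_smooth_has_dir_deriv[of S 0 "\<lambda>(x, w). f x" x "\<lambda>_. 0" v] smooth_on_param_smooth[of S f "Suc 0"]
  by (simp add: param_deriv_def)

lemma smooth_on_continuous_on:
  assumes "smooth_on S f"
  shows "continuous_on S f"
proof -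
  have "continuous_on S (\<lambda>x. (x, \<lambda>_ :: nat. x))"
    by (intro continuous_on_Pair continuous_on_id continuous_on_coordinatewise_then_product)
  then have "continuous_on S (\<lambda>x. (\<lambda>(x, w :: nat \<Rightarrow> 'a). f x) (x, \<lambda>_. x))"
    using param_smooth_continuous[OF smooth_on_param_smooth[OF assms, of 0]]
    by (intro continuous_on_compose2[of "S \<times> UNIV" "\<lambda>(x, w :: nat \<Rightarrow> 'a). f x" S "\<lambda>x. (x, \<lambda>_. x)"]) auto
  then show ?thesis by simp
qed

lemma smooth_on_linear_dir_deriv:
  assumes "open S" "smooth_on S f" "x \<in> S"
  shows "linear (\<lambda>v. dir_deriv f v x)"
proof -
  have "multilin S (Suc 0) (param_deriv (\<lambda>(x, w). f x))"
    using smooth_on_param_smooth[OF assms(2)]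
    by (intro multilin_param_deriv[OF assms(1)]) (auto simp: multilin_def simp del: param_smooth.simps)
  then show ?thesis
    using assms(3) by (simp add: multilin_def param_deriv_def)
qed

lemma param_smooth_dir_deriv:
  assumes "open S" "smooth_on S f"
  shows "param_smooth S k (\<lambda>(x, w). dir_deriv f (w i) x)"
proof -
  have "param_smooth S k (param_deriv (\<lambda>(x, w). f x))"
    using smooth_on_param_smooth[OF assms(2), of "Suc k"] by simp
  from param_smooth_reindex[OF assms(1) this, of "\<lambda>_. i"]
  show ?thesis by (simp add: param_deriv_def comp_def)
qed

lemma smooth_on_has_dir_deriv2:
  assumes "open S" "smooth_on S f" "x \<in> S"
  shows "has_dir_deriv (dir_deriv f v) u x (dir_deriv (dir_deriv f v) u x)"
  using param_smooth_has_dir_deriv[OF param_smooth_dir_deriv[OF assms(1,2), of "Suc 0" 0] assms(3), of "\<lambda>_. v" u]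
  by (simp add: param_deriv_def)

lemma smooth_on_const: "open S \<Longrightarrow> smooth_on S (\<lambda>_. c)"
  unfolding smooth_on_iff case_prod_beta by (simp add: param_smooth_const)

lemma param_smooth_vec: "open S \<Longrightarrow> param_smooth S k (\<lambda>(x, w). w i)"
  by (rule param_smooth_param) (auto intro: continuous_on_product_coordinates)

lemma smooth_on_ident:
  assumes "open S"
  shows "smooth_on S (\<lambda>x. x)"
  unfolding smooth_on_iff
proof
  fix k
  have c: "continuous_on (S \<times> UNIV) (\<lambda>(x, w :: nat \<Rightarrow> 'a). x)"
    unfolding case_prod_beta by (intro continuous_on_fst continuous_on_id)
  show "param_smooth S k (\<lambda>(x, w). x)"
  proof (cases k)
    case (Suc j)
    show ?thesis
      unfolding Suc using param_smooth_vec[OF assms, of j 0]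
      by (intro param_smooth_SucI[OF assms c, where \<Phi>' = "\<lambda>(x, w). w 0"]) (simp_all add: has_dir_deriv_ident)
  qed (use c in simp)
qed

lemma smooth_on_linear_comp:
  assumes "open S" "linear L" "continuous_on UNIV L" "smooth_on S f"
  shows "smooth_on S (\<lambda>x. L (f x))"
  using param_smooth_linear[OF assms(1-3), of _ "\<lambda>(x, w). f x"] assms(4)
  unfolding smooth_on_iff case_prod_beta by simp

lemma smooth_on_linear: "open S \<Longrightarrow> linear L \<Longrightarrow> continuous_on UNIV L \<Longrightarrow> smooth_on S L"
  using smooth_on_linear_comp[OF _ _ _ smooth_on_ident] by blast

lemma smooth_on_fst: "open S \<Longrightarrow> smooth_on S fst"
  by (rule smooth_on_linear) (auto simp: linear_iff intro: continuous_on_fst continuous_on_id)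

lemma smooth_on_snd: "open S \<Longrightarrow> smooth_on S snd"
  by (rule smooth_on_linear) (auto simp: linear_iff intro: continuous_on_snd continuous_on_id)

lemma smooth_on_Pair:
  "open S \<Longrightarrow> smooth_on S f \<Longrightarrow> smooth_on S g \<Longrightarrow> smooth_on S (\<lambda>x. (f x, g x))"
  using param_smooth_Pair[of S _ "\<lambda>(x, w). f x" "\<lambda>(x, w). g x"]
  unfolding smooth_on_iff case_prod_beta by simp

lemma smooth_on_compose:
  assumes "open S" "open T" "f ` S \<subseteq> T" "smooth_on T g" "smooth_on S f"
  shows "smooth_on S (\<lambda>x. g (f x))"
  unfolding smooth_on_iff
proof
  fix k
  show "param_smooth S k (\<lambda>(x, w). g (f x))"
    using param_smooth_compose[OF assms(1-3), where \<Phi> = "\<lambda>(x, w). g x" and m = 0 and U = "\<lambda>i _. 0" and k = k,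
        OF smooth_on_param_smooth[OF assms(4)] _ smooth_on_param_smooth[OF assms(5)] param_smooth_const[OF assms(1)]]
    by (simp add: multilin_def)
qed

lemma has_dir_deriv_chain:
  assumes "open T" "smooth_on T g" "f x \<in> T" "has_dir_deriv f v x l"
  shows "has_dir_deriv (\<lambda>x. g (f x)) v x (dir_deriv g l (f x))"
  using has_dir_deriv_compose[OF assms(1) smooth_on_param_smooth[OF assms(2)], of 0 f x v l "\<lambda>i _. 0" "\<lambda>_. 0"] assms(3,4)
  by (simp add: multilin_def param_deriv_def has_dir_deriv_const)

lemma dir_deriv_chain:
  assumes "open S" "open T" "smooth_on T g" "smooth_on S f" "x \<in> S" "f x \<in> T"
  shows "dir_deriv (\<lambda>x. g (f x)) v x = dir_deriv g (dir_deriv f v x) (f x)"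
  using has_dir_deriv_dir_deriv[OF has_dir_deriv_chain[OF assms(2,3,6) smooth_on_has_dir_deriv[OF assms(4,5)]]] .

section \<open>Coefficients of forms: substitution, linear operations, locality\<close>

definition multilin_list :: "'a set \<Rightarrow> nat \<Rightarrow> ('v::real_vector list \<Rightarrow> 'a \<Rightarrow> 'b::real_vector) \<Rightarrow> bool" where
  "multilin_list S q F \<longleftrightarrow> (\<forall>x\<in>S. \<forall>vs. length vs = q \<longrightarrow> (\<forall>i<q. linear (\<lambda>v. F (vs[i := v]) x)))"

lemma multilin_of_list:
  assumes "multilin_list S q F"
  shows "multilin S q (\<lambda>(x, w). F (map w [0..<q]) x)"
  unfolding multilin_def
proof (intro ballI conjI allI impI)
  fix x and w w' :: "nat \<Rightarrow> 'a" assume "\<forall>i<q. w i = w' i"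
  then have "map w [0..<q] = map w' [0..<q]" by (intro map_cong) auto
  then show "(\<lambda>(x, w). F (map w [0..<q]) x) (x, w) = (\<lambda>(x, w). F (map w [0..<q]) x) (x, w')"
    by (simp only: prod.case)
next
  fix x i and w :: "nat \<Rightarrow> 'a" assume x: "x \<in> S" and i: "i < q"
  have "map (w(i := u)) [0..<q] = (map w [0..<q])[i := u]" for u
    by (auto intro!: nth_equalityI simp: nth_list_update)
  then show "linear (\<lambda>u. (\<lambda>(x, w). F (map w [0..<q]) x) (x, w(i := u)))"
    using assms x i by (simp add: multilin_list_def)
qed

text \<open>These are the coefficients of a pulled back form. Its vectors
  \<open>dir_deriv f v x\<close> vary with the point, and it is for this case that
  \<open>param_smooth_compose\<close> admits vectors depending on the point.\<close>

lemma smooth_family_pullback: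
  assumes "open S" "open T" "f ` S \<subseteq> T" "smooth_on S f" "smooth_family q T F" "multilin_list T q F"
  shows "smooth_family q S (\<lambda>vs x. F (map (\<lambda>v. dir_deriv f v x) vs) (f x))"
  unfolding smooth_family_iff
proof
  fix k
  have "param_smooth S k (\<lambda>(x, w). (\<lambda>(y, w). F (map w [0..<q]) y)
      (f x, \<lambda>i. (\<lambda>i (x, w). dir_deriv f (w i) x) i (x, w)))"
    using assms smooth_on_param_smooth[OF assms(4)]
    by (intro param_smooth_compose[OF assms(1-3) _ multilin_of_list[OF assms(6)]] param_smooth_dir_deriv)
       (auto simp: smooth_family_iff)
  then show "param_smooth S k (\<lambda>(x, w). F (map (\<lambda>v. dir_deriv f v x) (map w [0..<q])) (f x))"
    by (simp add: comp_def case_prod_beta)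
qed

lemma smooth_family_cong:
  assumes "open S" "\<And>x vs. x \<in> S \<Longrightarrow> length vs = q \<Longrightarrow> F vs x = G vs x"
  shows "smooth_family q S F \<longleftrightarrow> smooth_family q S G"
  unfolding smooth_family_iff
  using param_smooth_cong[OF assms(1), of "\<lambda>(x, w). F (map w [0..<q]) x" "\<lambda>(x, w). G (map w [0..<q]) x"] assms(2)
  by simp

lemma smooth_family_linear:
  assumes "open S" "linear L" "continuous_on UNIV L" "smooth_family q S F"
  shows "smooth_family q S (\<lambda>vs x. L (F vs x))"
  using param_smooth_linear[OF assms(1-3), of _ "\<lambda>(x, w). F (map w [0..<q]) x"] assms(4)
  unfolding smooth_family_iff case_prod_beta by simp

lemma smooth_family_zero: "open S \<Longrightarrow> smooth_family q S (\<lambda>vs x. 0)"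
  unfolding smooth_family_iff case_prod_beta by (simp add: param_smooth_const)

lemma smooth_family_add:
  assumes "open S" "smooth_family q S F" "smooth_family q S G"
  shows "smooth_family q S (\<lambda>vs x. F vs x + G vs x)"
  using param_smooth_add[OF assms(1), of _ "\<lambda>(x, w). F (map w [0..<q]) x" "\<lambda>(x, w). G (map w [0..<q]) x"]
    assms(2,3)
  unfolding smooth_family_iff case_prod_beta by simp

text \<open>With frozen vectors a coefficient becomes an ordinary smooth function, which is the kind
  of function that \<open>ext_d\<close> differentiates.\<close>

lemma smooth_family_fixed:
  assumes "smooth_family q S F" "length us = q"
  shows "smooth_on S (F us)"
  unfolding smooth_on_def smooth_family_def
proof (intro conjI allI impI ballI)
  show "dir_differentiable (iter_deriv (F us) vs) v x" if "x \<in> S" for vs v x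
    using assms that by (simp add: smooth_family_def)
  fix k
  let ?B = "\<lambda>(x, w :: nat \<Rightarrow> 'a). iter_deriv (F (map w [0..<q])) (map w [q..<q + k]) x"
  let ?g = "\<lambda>(x, w :: nat \<Rightarrow> 'a). (x, \<lambda>i. if i < q then us ! i else w (i - q))"
  have g: "continuous_on (S \<times> UNIV) ?g"
    unfolding case_prod_beta
  proof (intro continuous_on_Pair continuous_on_fst continuous_on_id continuous_on_coordinatewise_then_product)
    show "continuous_on (S \<times> UNIV) (\<lambda>z. if i < q then us ! i else snd z (i - q))" for i
      using continuous_on_product_then_coordinatewise[OF continuous_on_snd[OF continuous_on_id]]
      by (cases "i < q") auto
  qed
  have B: "continuous_on (S \<times> UNIV) ?B"
    using assms(1) by (simp add: smooth_family_def)
  have "continuous_on (S \<times> UNIV) (\<lambda>z. ?B (?g z))"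
    by (rule continuous_on_compose2[OF B g]) auto
  moreover have "?B (?g (x, w)) = iter_deriv (F us) (map w [0..<0 + k]) x" for x w
  proof -
    have "map (\<lambda>i. if i < q then us ! i else w (i - q)) [0..<q] = us"
      "map (\<lambda>i. if i < q then us ! i else w (i - q)) [q..<q + k] = map w [0..<0 + k]"
      using assms(2) by (auto intro!: nth_equalityI)
    then show ?thesis by simp
  qed
  ultimately show "continuous_on (S \<times> UNIV) (\<lambda>(x, w). iter_deriv (F us) (map w [0..<0 + k]) x)"
    by (simp add: case_prod_beta)
qed

lemma smooth_family_local:
  assumes "\<And>x. x \<in> S \<Longrightarrow> \<exists>N. open N \<and> x \<in> N \<and> N \<subseteq> S \<and> smooth_family q N F"
  shows "smooth_family q S F"
  unfolding smooth_family_def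
proof (intro conjI allI impI ballI)
  show "dir_differentiable (iter_deriv (F us) vs) v x" if "length us = q" "x \<in> S" for us vs v x
    using assms[OF that(2)] that(1) unfolding smooth_family_def by blast
  fix k
  let ?A = "\<lambda>(x, w :: nat \<Rightarrow> 'a). iter_deriv (F (map w [0..<q])) (map w [q..<q + k]) x"
  let ?N = "{N. open N \<and> N \<subseteq> S \<and> smooth_family q N F}"
  have "x \<in> S \<longleftrightarrow> (\<exists>N\<in>?N. x \<in> N)" for x
    using assms[of x] by (simp only: mem_Collect_eq Bex_def) blast
  then have "S \<times> UNIV = (\<Union>N\<in>?N. N \<times> (UNIV :: (nat \<Rightarrow> 'a) set))"
    by (simp only: set_eq_iff split_paired_all mem_Times_iff UN_iff fst_conv snd_conv UNIV_I simp_thms)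
  moreover have "continuous_on (\<Union>N\<in>?N. N \<times> UNIV) ?A"
  proof (rule continuous_on_open_UN)
    show "open (N \<times> (UNIV :: (nat \<Rightarrow> 'a) set))" if "N \<in> ?N" for N
      using that by (simp add: open_Times)
    show "continuous_on (N \<times> UNIV) ?A" if "N \<in> ?N" for N
      using that unfolding smooth_family_def by blast
  qed
  ultimately show "continuous_on (S \<times> UNIV) ?A" by simp
qed

lemma smooth_on_local:
  "(\<And>x. x \<in> S \<Longrightarrow> \<exists>N. open N \<and> x \<in> N \<and> N \<subseteq> S \<and> smooth_on N f) \<Longrightarrow> smooth_on S f"
  unfolding smooth_on_def by (rule smooth_family_local)

text \<open>A product rule: the coefficient of a pulled back one-form depends on the point through
  the base point and through the transported vector. The second summand contains a second derivative
  of \<open>f\<close>, symmetric in \<open>u\<close> and \<open>v\<close>, and will cancel in the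
  exterior derivative.\<close>

lemma has_dir_deriv_pullback_1:
  assumes "open S" "open T" "f ` S \<subseteq> T" "smooth_on S f" "x \<in> S"
    and "smooth_family (Suc 0) T F" "multilin_list T (Suc 0) F"
  shows "has_dir_deriv (\<lambda>x. F [dir_deriv f v x] (f x)) u x
    (dir_deriv (F [dir_deriv f v x]) (dir_deriv f u x) (f x) + F [dir_deriv (dir_deriv f v) u x] (f x))"
proof -
  define \<Phi> where "\<Phi> = (\<lambda>(y, w). F (map w [0..<Suc 0]) y)"
  define U where "U i = (if i = 0 then dir_deriv f v else (\<lambda>_. 0))" for i :: nat
  define U' where "U' i = (if i = 0 then dir_deriv (dir_deriv f v) u x else 0)" for i :: nat
  have U: "has_dir_deriv (U i) u x (U' i)" for i
    using smooth_on_has_dir_deriv2[OF assms(1,4,5)] by (simp add: U_def U'_def has_dir_deriv_const)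
  have s: "param_smooth T (Suc 0) \<Phi>"
    using assms(6) unfolding smooth_family_iff \<Phi>_def by blast
  have m: "multilin T (Suc 0) \<Phi>"
    unfolding \<Phi>_def by (rule multilin_of_list[OF assms(7)])
  have "f x \<in> T" using assms by auto
  from has_dir_deriv_compose[OF assms(2) s m, where f = f and U = U and U' = U', OF this smooth_on_has_dir_deriv[OF assms(4,5)] U]
  show ?thesis
    by (simp add: \<Phi>_def U_def U'_def param_deriv_apply)
qed

text \<open>The mean value theorem is applied twice, first in direction \<open>u\<close>, then in
  direction \<open>v\<close>; this places the second difference quotient in a convex neighbourhood
  of the mixed derivative. As the quotient is symmetric in \<open>u\<close> and \<open>v\<close>,
  symmetry of second derivatives follows.\<close>

lemma second_difference_tendsto:
  fixes f :: "'a::locally_convex \<Rightarrow> 'b::locally_convex"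
  assumes S: "open S" "x \<in> S" and f: "smooth_on S f"
  shows "((\<lambda>t. (f (x + t *\<^sub>R u + t *\<^sub>R v) - f (x + t *\<^sub>R u) - f (x + t *\<^sub>R v) + f x) /\<^sub>R (t * t))
    \<longlongrightarrow> dir_deriv (dir_deriv f u) v x) (at 0)"
proof (rule topological_tendstoI)
  let ?D = "\<lambda>y. dir_deriv (dir_deriv f u) v y"
  have Du: "has_dir_deriv (dir_deriv f u) v y (?D y)" if "y \<in> S" for y
    by (rule smooth_on_has_dir_deriv2[OF S(1) f that])
  have D: "(?D \<longlongrightarrow> ?D x) (nhds x)"
  proof -
    have "param_smooth S 0 (param_deriv (\<lambda>(x, w). dir_deriv f (w 0) x))"
      using param_smooth_dir_deriv[OF S(1) f, of "Suc 0" 0] by simp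
    from param_smooth_tendsto[OF S(1) this S(2)]
    have "(param_deriv (\<lambda>(x, w). dir_deriv f (w 0) x) \<longlongrightarrow>
       param_deriv (\<lambda>(x, w). dir_deriv f (w 0) x) (x, case_nat v (\<lambda>_. u))) (nhds (x, case_nat v (\<lambda>_. u)))" .
    from filterlim_compose[OF this tendsto_Pair[OF filterlim_ident tendsto_const]]
    show ?thesis by (simp add: param_deriv_def)
  qed
  fix O1 assume "open O1" "?D x \<in> O1"
  then obtain O' where O': "open O'" "convex O'" "?D x \<in> O'" "O' \<subseteq> O1"
    using convex_nhd by metis
  obtain A where A: "open A" "x \<in> A" "\<And>y. y \<in> A \<Longrightarrow> ?D y \<in> O'"
    using topological_tendstoD[OF D O'(1,3)] unfolding eventually_nhds by auto
  obtain A' where A': "open A'" "convex A'" "x \<in> A'" "A' \<subseteq> A \<inter> S"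
    using convex_nhd[of "A \<inter> S" x] A S by auto
  have "eventually (\<lambda>t. x + t *\<^sub>R u \<in> A' \<and> x + t *\<^sub>R v \<in> A' \<and> x + t *\<^sub>R (u + v) \<in> A' \<and> t \<noteq> 0) (at 0)"
    using eventually_line_in[OF A'(1,3)] by (auto simp: eventually_conj_iff eventually_at_filter)
  then show "eventually (\<lambda>t. (f (x + t *\<^sub>R u + t *\<^sub>R v) - f (x + t *\<^sub>R u) - f (x + t *\<^sub>R v) + f x) /\<^sub>R (t * t) \<in> O1) (at 0)"
  proof (rule eventually_mono)
    fix t :: real assume t: "x + t *\<^sub>R u \<in> A' \<and> x + t *\<^sub>R v \<in> A' \<and> x + t *\<^sub>R (u + v) \<in> A' \<and> t \<noteq> 0"
    have seg: "y + s *\<^sub>R (t *\<^sub>R w) \<in> A'" if "y \<in> A'" "y + t *\<^sub>R w \<in> A'" "0 \<le> s" "s \<le> 1" for y w s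
    proof -
      have "(1 - s) *\<^sub>R y + s *\<^sub>R (y + t *\<^sub>R w) \<in> A'"
        using A'(2) that by (intro convexD) auto
      then show ?thesis by (simp add: algebra_simps)
    qed
    have line: "((\<lambda>h. (g (y + (s + h) *\<^sub>R (t *\<^sub>R w)) - g (y + s *\<^sub>R (t *\<^sub>R w))) /\<^sub>R (h * t)) \<longlongrightarrow> l) (at 0)"
      if "has_dir_deriv g w (y + s *\<^sub>R (t *\<^sub>R w)) l" for g :: "'a \<Rightarrow> 'b" and w y s l
    proof -
      have l: "filterlim (\<lambda>h. h * t) (at 0) (at (0::real))"
        unfolding filterlim_at
        using t by (auto intro!: tendsto_eq_intros simp: eventually_at intro: exI[of _ 1])
      have "((\<lambda>h. dir_quot g w (y + s *\<^sub>R (t *\<^sub>R w)) (h * t)) \<longlongrightarrow> l) (at 0)"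
        using filterlim_compose[OF that[unfolded has_dir_deriv_def] l] .
      moreover have "y + s *\<^sub>R (t *\<^sub>R w) + (h * t) *\<^sub>R w = y + (s + h) *\<^sub>R (t *\<^sub>R w)" for h
        by (simp add: algebra_simps)
      ultimately show ?thesis by (simp only: dir_quot_def)
    qed
    \<comment> \<open>The second difference is the increment over the unit interval of a first
      difference in direction \<open>v\<close>, moved along \<open>u\<close>.\<close>
    define \<gamma> where "\<gamma> s = (f (x + t *\<^sub>R v + s *\<^sub>R (t *\<^sub>R u)) - f (x + s *\<^sub>R (t *\<^sub>R u))) /\<^sub>R (t * t)" for s
    have "\<gamma> 1 - \<gamma> 0 \<in> O'"
    proof (rule convex_mean_value[OF O'(1,2)])
      fix s :: real assume s: "0 \<le> s" "s \<le> 1"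
      let ?y = "x + s *\<^sub>R (t *\<^sub>R u)" and ?z = "x + t *\<^sub>R v + s *\<^sub>R (t *\<^sub>R u)"
      have y: "?y \<in> A'" and z: "?z \<in> A'"
        using seg[of x u s] seg[of "x + t *\<^sub>R v" u s] t s A'(3) by (simp_all add: algebra_simps)
      \<comment> \<open>The derivative of \<gamma> at \<open>s\<close> is in turn the increment of
        \<eta> over the unit interval, and the derivative of \<eta> is the mixed second
        derivative.\<close>
      define \<eta> where "\<eta> r = dir_deriv f u (?y + r *\<^sub>R (t *\<^sub>R v)) /\<^sub>R t" for r
      have "\<eta> 1 - \<eta> 0 \<in> O'"
      proof (rule convex_mean_value[OF O'(1,2)])
        fix r :: real assume r: "0 \<le> r" "r \<le> 1"
        have m: "?y + r *\<^sub>R (t *\<^sub>R v) \<in> A'"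
          using seg[of ?y v r] y z r by (simp add: algebra_simps)
        have "((\<lambda>h. (\<eta> (r + h) - \<eta> r) /\<^sub>R h) \<longlongrightarrow> ?D (?y + r *\<^sub>R (t *\<^sub>R v))) (at 0)"
          using line[OF Du, of ?y r] m A'(4)
          by (auto simp: \<eta>_def scaleR_diff_right[symmetric] mult.commute)
        then show "\<exists>l\<in>O'. ((\<lambda>h. (\<eta> (r + h) - \<eta> r) /\<^sub>R h) \<longlongrightarrow> l) (at 0)"
          using A(3) m A'(4) by blast
      qed
      then have e: "(dir_deriv f u ?z - dir_deriv f u ?y) /\<^sub>R t \<in> O'"
        by (simp add: \<eta>_def scaleR_diff_right algebra_simps)
      have "((\<lambda>h. ((f (x + t *\<^sub>R v + (s + h) *\<^sub>R (t *\<^sub>R u)) - f ?z) /\<^sub>R (h * t) -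
           (f (x + (s + h) *\<^sub>R (t *\<^sub>R u)) - f ?y) /\<^sub>R (h * t)) /\<^sub>R t) \<longlongrightarrow>
           (dir_deriv f u ?z - dir_deriv f u ?y) /\<^sub>R t) (at 0)"
        using y z A'(4)
        by (intro tendsto_scaleR_lc tendsto_const tendsto_diff line smooth_on_has_dir_deriv[OF f]) auto
      moreover have "((f (x + t *\<^sub>R v + (s + h) *\<^sub>R (t *\<^sub>R u)) - f ?z) /\<^sub>R (h * t) -
           (f (x + (s + h) *\<^sub>R (t *\<^sub>R u)) - f ?y) /\<^sub>R (h * t)) /\<^sub>R t = (\<gamma> (s + h) - \<gamma> s) /\<^sub>R h" for h
        by (simp add: \<gamma>_def algebra_simps)
      ultimately show "\<exists>l\<in>O'. ((\<lambda>h. (\<gamma> (s + h) - \<gamma> s) /\<^sub>R h) \<longlongrightarrow> l) (at 0)"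
        using e by auto
    qed
    moreover have "\<gamma> 1 - \<gamma> 0 = (f (x + t *\<^sub>R u + t *\<^sub>R v) - f (x + t *\<^sub>R u) - f (x + t *\<^sub>R v) + f x) /\<^sub>R (t * t)"
      by (simp add: \<gamma>_def algebra_simps)
    ultimately show "(f (x + t *\<^sub>R u + t *\<^sub>R v) - f (x + t *\<^sub>R u) - f (x + t *\<^sub>R v) + f x) /\<^sub>R (t * t) \<in> O1"
      using O'(4) by auto
  qed
qed

lemma dir_deriv_commute:
  assumes "open S" "x \<in> S" "smooth_on S f"
  shows "dir_deriv (dir_deriv f u) v x = dir_deriv (dir_deriv f v) u x"
proof (rule tendsto_unique)
  let ?Q = "\<lambda>u v t. (f (x + t *\<^sub>R u + t *\<^sub>R v) - f (x + t *\<^sub>R u) - f (x + t *\<^sub>R v) + f x) /\<^sub>R (t * t)"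
  show "((\<lambda>t. ?Q u v t) \<longlongrightarrow> dir_deriv (dir_deriv f u) v x) (at 0)"
    by (rule second_difference_tendsto[OF assms])
  have "?Q v u t = ?Q u v t" for t :: real
    by (simp only: add.assoc add.commute[of "t *\<^sub>R u"]) (simp add: algebra_simps)
  then show "((\<lambda>t. ?Q u v t) \<longlongrightarrow> dir_deriv (dir_deriv f v) u x) (at 0)"
    using second_difference_tendsto[OF assms, of v u] by (simp only:)
qed simp

section \<open>Manifolds\<close>

text \<open>Hausdorffness plays no role in the calculus of forms; without it, it need not be checked for
  products and total spaces.\<close>

definition smooth_atlas :: "('m, 'e::locally_convex) atlas \<Rightarrow> bool" where
  "smooth_atlas A \<longleftrightarrow>
     (\<forall>(U, \<phi>)\<in>A. inj_on \<phi> U) \<and>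
     (\<forall>(U, \<phi>)\<in>A. \<forall>(V, \<psi>)\<in>A. open (\<phi> ` (U \<inter> V)) \<and>
        smooth_on (\<phi> ` (U \<inter> V)) (\<psi> \<circ> inv_into U \<phi>))"

lemma smooth_atlas_defI:
  assumes "\<And>U \<phi>. (U, \<phi>) \<in> A \<Longrightarrow> inj_on \<phi> U"
    "\<And>U \<phi> V \<psi>. (U, \<phi>) \<in> A \<Longrightarrow> (V, \<psi>) \<in> A \<Longrightarrow>
      open (\<phi> ` (U \<inter> V)) \<and> smooth_on (\<phi> ` (U \<inter> V)) (\<psi> \<circ> inv_into U \<phi>)"
  shows "smooth_atlas A"
  using assms unfolding smooth_atlas_def by blast

lemma smooth_manifold_atlas: "smooth_manifold A \<Longrightarrow> smooth_atlas A"
  by (simp add: smooth_manifold_def smooth_atlas_def)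

lemma smooth_atlas_inj: "smooth_atlas A \<Longrightarrow> (U, \<phi>) \<in> A \<Longrightarrow> inj_on \<phi> U"
  by (auto simp: smooth_atlas_def)

lemma smooth_atlas_transition:
  "smooth_atlas A \<Longrightarrow> (U, \<phi>) \<in> A \<Longrightarrow> (V, \<psi>) \<in> A \<Longrightarrow>
    open (\<phi> ` (U \<inter> V)) \<and> smooth_on (\<phi> ` (U \<inter> V)) (\<psi> \<circ> inv_into U \<phi>)"
  unfolding smooth_atlas_def by blast

lemma open_chart_image: "smooth_atlas A \<Longrightarrow> (U, \<phi>) \<in> A \<Longrightarrow> open (\<phi> ` U)"
  using smooth_atlas_transition[of A U \<phi> U \<phi>] by simp

lemma mcarrierI: "(U, \<phi>) \<in> A \<Longrightarrow> p \<in> U \<Longrightarrow> p \<in> mcarrier A"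
  by (force simp: mcarrier_def)

lemma mcarrierE:
  assumes "p \<in> mcarrier A"
  obtains U \<phi> where "(U, \<phi>) \<in> A" "p \<in> U"
  using assms by (force simp: mcarrier_def)

lemma mopen_subset: "mopen A W \<Longrightarrow> W \<subseteq> mcarrier A"
  by (simp add: mopen_def)

lemma mopen_image: "mopen A W \<Longrightarrow> (U, \<phi>) \<in> A \<Longrightarrow> open (\<phi> ` (W \<inter> U))"
  by (auto simp: mopen_def)

lemma mopen_image_subset: "mopen A W \<Longrightarrow> (U, \<phi>) \<in> A \<Longrightarrow> W \<subseteq> U \<Longrightarrow> open (\<phi> ` W)"
  using mopen_image[of A W U \<phi>] by (simp add: Int_absorb2)

lemma mopen_Int:
  assumes "smooth_atlas A" "mopen A W" "mopen A W'"
  shows "mopen A (W \<inter> W')"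
  unfolding mopen_def
proof (intro conjI ballI, safe)
  fix U \<phi> assume c: "(U, \<phi>) \<in> A"
  have "\<phi> ` (W \<inter> W' \<inter> U) = \<phi> ` (W \<inter> U) \<inter> \<phi> ` (W' \<inter> U)"
    using smooth_atlas_inj[OF assms(1) c] by (auto simp: inj_on_def)
  then show "open (\<phi> ` (W \<inter> W' \<inter> U))"
    using mopen_image[OF assms(2) c] mopen_image[OF assms(3) c] by (simp add: open_Int)
qed (use mopen_subset[OF assms(2)] in auto)

lemma mopen_local:
  assumes "\<And>p. p \<in> W \<Longrightarrow> \<exists>N. mopen A N \<and> p \<in> N \<and> N \<subseteq> W"
  shows "mopen A W"
  unfolding mopen_def
proof (intro conjI ballI, safe)
  fix p assume "p \<in> W" then show "p \<in> mcarrier A"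
    using assms mopen_subset by blast
next
  fix U \<phi> assume c: "(U, \<phi>) \<in> A"
  show "open (\<phi> ` (W \<inter> U))"
  proof (subst open_subopen, safe)
    fix p assume p: "p \<in> W" "p \<in> U"
    then obtain N where "mopen A N" "p \<in> N" "N \<subseteq> W" using assms by blast
    then show "\<exists>T. open T \<and> \<phi> p \<in> T \<and> T \<subseteq> \<phi> ` (W \<inter> U)"
      using mopen_image[OF _ c, of N] p by (intro exI[of _ "\<phi> ` (N \<inter> U)"]) auto
  qed
qed

lemma chart_image_vimage:
  assumes "inj_on \<phi> U" "inj_on \<psi> V" "N \<subseteq> U" "f ` N \<subseteq> V" "X \<subseteq> V"
  shows "\<phi> ` {x \<in> N. f x \<in> X} = \<phi> ` N \<inter> (\<psi> \<circ> f \<circ> inv_into U \<phi>) -` (\<psi> ` X)"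
proof -
  have "(\<psi> \<circ> f \<circ> inv_into U \<phi>) (\<phi> x) \<in> \<psi> ` X \<longleftrightarrow> f x \<in> X" if "x \<in> N" for x
    using that assms inj_on_image_mem_iff[OF assms(2) _ assms(5), of "f x"] by (auto simp: subset_iff)
  then show ?thesis by blast
qed

lemma mopen_chartI:
  assumes A: "smooth_atlas A" "(U, \<phi>) \<in> A" "N \<subseteq> U" "open (\<phi> ` N)"
  shows "mopen A N"
  unfolding mopen_def
proof (intro conjI ballI, safe)
  fix V \<psi> assume c: "(V, \<psi>) \<in> A"
  note t = smooth_atlas_transition[OF A(1) c A(2)]
  have inj: "inj_on \<phi> U" "inj_on \<psi> V"
    using smooth_atlas_inj A(1,2) c by blast+
  have "\<psi> ` (N \<inter> V) = \<psi> ` (V \<inter> U) \<inter> (\<phi> \<circ> inv_into V \<psi>) -` (\<phi> ` N)"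
  proof -
    have "{x \<in> V \<inter> U. x \<in> N} = N \<inter> V" using A(3) by auto
    then show ?thesis
      using chart_image_vimage[OF inj(2,1), of "V \<inter> U" "\<lambda>x. x" N] A(3) by (simp add: comp_def)
  qed
  then show "open (\<psi> ` (N \<inter> V))"
    using continuous_open_preimage[OF smooth_on_continuous_on[OF conjunct2[OF t]] conjunct1[OF t] A(4)]
    by (simp only:)
qed (use A in \<open>auto intro: mcarrierI\<close>)

lemma mopen_chart: "smooth_atlas A \<Longrightarrow> (U, \<phi>) \<in> A \<Longrightarrow> mopen A U"
  by (rule mopen_chartI) (auto intro: open_chart_image)

lemma mopen_mcarrier: "smooth_atlas A \<Longrightarrow> mopen A (mcarrier A)"
  by (rule mopen_local) (meson mcarrierE mcarrierI mopen_chart subsetI)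

lemma mopen_INT:
  assumes "smooth_atlas A" "finite I" "I \<noteq> {}" "\<And>i. i \<in> I \<Longrightarrow> mopen A (W i)"
  shows "mopen A (\<Inter>i\<in>I. W i)"
  using assms(2-4)
  by (induction I rule: finite_ne_induct) (auto intro: mopen_Int[OF assms(1)])

section \<open>Smooth maps between manifolds\<close>

lemma smooth_map_mopen: "smooth_map A W B f \<Longrightarrow> mopen A W"
  by (simp add: smooth_map_def)

lemma smooth_map_image: "smooth_map A W B f \<Longrightarrow> p \<in> W \<Longrightarrow> f p \<in> mcarrier B"
  by (auto simp: smooth_map_def)

lemma smooth_map_defI:
  assumes "mopen A W" "\<And>p. p \<in> W \<Longrightarrow> f p \<in> mcarrier B"
    "\<And>p U \<phi> V \<psi>. p \<in> W \<Longrightarrow> (U, \<phi>) \<in> A \<Longrightarrow> (V, \<psi>) \<in> B \<Longrightarrow> p \<in> U \<Longrightarrow> f p \<in> V \<Longrightarrow>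
      \<exists>N. mopen A N \<and> p \<in> N \<and> N \<subseteq> U \<inter> W \<and> f ` N \<subseteq> V \<and> smooth_on (\<phi> ` N) (\<psi> \<circ> f \<circ> inv_into U \<phi>)"
  shows "smooth_map A W B f"
proof -
  have "f ` W \<subseteq> mcarrier B" using assms(2) by auto
  moreover have "\<forall>p\<in>W. \<forall>(U, \<phi>)\<in>A. \<forall>(V, \<psi>)\<in>B. p \<in> U \<and> f p \<in> V \<longrightarrow> (\<exists>N. mopen A N \<and> p \<in> N \<and>
      N \<subseteq> U \<inter> W \<and> f ` N \<subseteq> V \<and> smooth_on (\<phi> ` N) (\<psi> \<circ> f \<circ> inv_into U \<phi>))"
    using assms(3) by blast
  ultimately show ?thesis
    using assms(1) unfolding smooth_map_def by blast
qed

lemma smooth_mapE: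
  assumes "smooth_map A W B f" "(U, \<phi>) \<in> A" "(V, \<psi>) \<in> B" "p \<in> W" "p \<in> U" "f p \<in> V"
  obtains N where "mopen A N" "p \<in> N" "N \<subseteq> U \<inter> W" "f ` N \<subseteq> V" "smooth_on (\<phi> ` N) (\<psi> \<circ> f \<circ> inv_into U \<phi>)"
proof -
  have "\<exists>N. mopen A N \<and> p \<in> N \<and> N \<subseteq> U \<inter> W \<and> f ` N \<subseteq> V \<and> smooth_on (\<phi> ` N) (\<psi> \<circ> f \<circ> inv_into U \<phi>)"
    using assms unfolding smooth_map_def by fast
  then show ?thesis using that by blast
qed

text \<open>The neighbourhoods granted by \<open>smooth_map\<close> at the single points cover
  \<open>D\<close>, and smoothness is local; so one representation is smooth on its largest possible
  domain.\<close>

lemma smooth_map_rep: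
  assumes "smooth_map A W B f" "(U, \<phi>) \<in> A" "(V, \<psi>) \<in> B"
  defines "D \<equiv> {p \<in> W \<inter> U. f p \<in> V}"
  shows "mopen A D" "open (\<phi> ` D)" "smooth_on (\<phi> ` D) (\<psi> \<circ> f \<circ> inv_into U \<phi>)"
proof -
  have ex: "\<exists>N. mopen A N \<and> p \<in> N \<and> N \<subseteq> D \<and> smooth_on (\<phi> ` N) (\<psi> \<circ> f \<circ> inv_into U \<phi>)" if "p \<in> D" for p
  proof -
    obtain N where "mopen A N" "p \<in> N" "N \<subseteq> U \<inter> W" "f ` N \<subseteq> V" "smooth_on (\<phi> ` N) (\<psi> \<circ> f \<circ> inv_into U \<phi>)"
      using smooth_mapE[OF assms(1-3), of p] \<open>p \<in> D\<close> unfolding D_def by auto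
    then show ?thesis unfolding D_def by (intro exI[of _ N]) auto
  qed
  show D: "mopen A D"
    using ex by (intro mopen_local) blast
  show "open (\<phi> ` D)"
    using D assms(2) by (rule mopen_image_subset) (auto simp: D_def)
  show "smooth_on (\<phi> ` D) (\<psi> \<circ> f \<circ> inv_into U \<phi>)"
  proof (rule smooth_on_local, safe)
    fix p assume "p \<in> D"
    then obtain N where N: "mopen A N" "p \<in> N" "N \<subseteq> D" "smooth_on (\<phi> ` N) (\<psi> \<circ> f \<circ> inv_into U \<phi>)"
      using ex by blast
    moreover have "open (\<phi> ` N)"
      using N(1) assms(2) by (rule mopen_image_subset) (use N(3) in \<open>auto simp: D_def\<close>)
    ultimately show "\<exists>N. open N \<and> \<phi> p \<in> N \<and> N \<subseteq> \<phi> ` D \<and> smooth_on N (\<psi> \<circ> f \<circ> inv_into U \<phi>)"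
      by blast
  qed
qed

text \<open>\<open>smooth_map\<close> quantifies over all pairs of charts around a point, while here
  one pair is enough: the representation in another pair arises by composing with smooth transition
  maps on both sides, after shrinking the neighbourhood.\<close>

lemma smooth_mapI:
  assumes A: "smooth_atlas A" and B: "smooth_atlas B" and W: "mopen A W"
    and loc: "\<And>p. p \<in> W \<Longrightarrow> \<exists>U \<phi> V \<psi> N. (U, \<phi>) \<in> A \<and> (V, \<psi>) \<in> B \<and> mopen A N \<and> p \<in> N \<and>
      N \<subseteq> U \<inter> W \<and> f ` N \<subseteq> V \<and> smooth_on (\<phi> ` N) (\<psi> \<circ> f \<circ> inv_into U \<phi>)"
  shows "smooth_map A W B f"
proof (rule smooth_map_defI)
  show "mopen A W" by fact
next
  fix p assume "p \<in> W"
  then obtain V \<psi> where "(V, \<psi>) \<in> B" "f p \<in> V" using loc by blast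
  then show "f p \<in> mcarrier B" by (rule mcarrierI)
next
  fix p U' \<phi>' V' \<psi>'
  assume p: "p \<in> W" and cd: "(U', \<phi>') \<in> A" "(V', \<psi>') \<in> B" and q: "p \<in> U'" "f p \<in> V'"
  obtain U \<phi> V \<psi> N where N: "(U, \<phi>) \<in> A" "(V, \<psi>) \<in> B" "mopen A N" "p \<in> N" "N \<subseteq> U \<inter> W" "f ` N \<subseteq> V"
    "smooth_on (\<phi> ` N) (\<psi> \<circ> f \<circ> inv_into U \<phi>)"
    using loc[OF p] by blast
  have inj: "inj_on \<phi> U" "inj_on \<phi>' U'" "inj_on \<psi> V" "inj_on \<psi>' V'"
    using smooth_atlas_inj A B N cd by blast+
  have oN: "open (\<phi> ` N)"
    using N(1,3,5) by (intro mopen_image_subset[of A]) auto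
  define r where "r = \<psi> \<circ> f \<circ> inv_into U \<phi>"
  have t2: "open (\<psi> ` (V \<inter> V'))" "smooth_on (\<psi> ` (V \<inter> V')) (\<psi>' \<circ> inv_into V \<psi>)"
    using smooth_atlas_transition[OF B N(2) cd(2)] by auto
  have t1: "open (\<phi>' ` (U' \<inter> U))" "smooth_on (\<phi>' ` (U' \<inter> U)) (\<phi> \<circ> inv_into U' \<phi>')"
    using smooth_atlas_transition[OF A cd(1) N(1)] by auto
  define N1 where "N1 = {x \<in> N. f x \<in> V'}"
  have "\<phi> ` N1 = \<phi> ` N \<inter> r -` (\<psi> ` (V \<inter> V'))"
  proof -
    have "N1 = {x \<in> N. f x \<in> V \<inter> V'}" "N \<subseteq> U" using N(5,6) by (auto simp: N1_def)
    then show ?thesis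
      using chart_image_vimage[OF inj(1,3), of N f "V \<inter> V'"] N(6) by (simp add: r_def)
  qed
  then have oN1: "open (\<phi> ` N1)"
    using continuous_open_preimage[OF smooth_on_continuous_on oN t2(1)] N(7) r_def by metis
  have mN1: "mopen A N1"
    using N(5) by (intro mopen_chartI[OF A N(1) _ oN1]) (auto simp: N1_def)
  let ?N = "N1 \<inter> U'"
  have mN: "mopen A ?N"
    by (rule mopen_Int[OF A mN1 mopen_chart[OF A cd(1)]])
  have o: "open (\<phi>' ` ?N)"
    by (rule mopen_image_subset[OF mN cd(1)]) auto
  have s1: "smooth_on (\<phi>' ` ?N) (\<phi> \<circ> inv_into U' \<phi>')"
    using N(5) by (intro smooth_on_subset[OF t1(2)]) (auto simp: N1_def)
  have im1: "(\<phi> \<circ> inv_into U' \<phi>') ` \<phi>' ` ?N \<subseteq> \<phi> ` N1"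
    using inj(2) by (auto simp: N1_def)
  have s2: "smooth_on (\<phi> ` N1) r"
    using N(7) unfolding r_def by (rule smooth_on_subset) (auto simp: N1_def)
  have im2: "r ` \<phi> ` N1 \<subseteq> \<psi> ` (V \<inter> V')"
    using N(5,6) inj(1) by (force simp: N1_def r_def)
  have "smooth_on (\<phi>' ` ?N) (\<lambda>x. r ((\<phi> \<circ> inv_into U' \<phi>') x))"
    by (rule smooth_on_compose[OF o oN1 im1 s2 s1])
  then have "smooth_on (\<phi>' ` ?N) (\<lambda>x. (\<psi>' \<circ> inv_into V \<psi>) (r ((\<phi> \<circ> inv_into U' \<phi>') x)))"
  proof (rule smooth_on_compose[OF o t2(1) _ t2(2), rotated])
    show "(\<lambda>x. r ((\<phi> \<circ> inv_into U' \<phi>') x)) ` \<phi>' ` ?N \<subseteq> \<psi> ` (V \<inter> V')"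
    proof (rule image_subsetI)
      fix x assume "x \<in> \<phi>' ` ?N"
      then have "(\<phi> \<circ> inv_into U' \<phi>') x \<in> \<phi> ` N1" by (rule subsetD[OF im1 imageI])
      then show "r ((\<phi> \<circ> inv_into U' \<phi>') x) \<in> \<psi> ` (V \<inter> V')" by (rule subsetD[OF im2 imageI])
    qed
  qed
  moreover have "(\<psi>' \<circ> inv_into V \<psi>) (r ((\<phi> \<circ> inv_into U' \<phi>') x)) = (\<psi>' \<circ> f \<circ> inv_into U' \<phi>') x"
    if x: "x \<in> \<phi>' ` ?N" for x
  proof -
    obtain y where "y \<in> N" "f y \<in> V'" "y \<in> U'" "x = \<phi>' y"
      using x by (auto simp: N1_def)
    moreover have "y \<in> U" "f y \<in> V" using N(5,6) \<open>y \<in> N\<close> by auto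
    ultimately show ?thesis using inj by (simp add: r_def)
  qed
  ultimately have "smooth_on (\<phi>' ` ?N) (\<psi>' \<circ> f \<circ> inv_into U' \<phi>')"
    using smooth_on_cong_imp[OF o] by blast
  then show "\<exists>N. mopen A N \<and> p \<in> N \<and> N \<subseteq> U' \<inter> W \<and> f ` N \<subseteq> V' \<and>
           smooth_on (\<phi>' ` N) (\<psi>' \<circ> f \<circ> inv_into U' \<phi>')"
    using mN N(4,5) q by (intro exI[of _ ?N]) (auto simp: N1_def)
qed

lemma smooth_map_cong:
  assumes "\<And>p. p \<in> W \<Longrightarrow> f p = g p" "smooth_map A W B f"  "smooth_atlas A"
  shows "smooth_map A W B g"
proof (rule smooth_map_defI)
  show "mopen A W" using assms(2) by (rule smooth_map_mopen)
  show "g p \<in> mcarrier B" if "p \<in> W" for p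
    using smooth_map_image[OF assms(2) that] assms(1)[OF that] by simp
  fix p U \<phi> V \<psi> assume p: "p \<in> W" and c: "(U, \<phi>) \<in> A" "(V, \<psi>) \<in> B" "p \<in> U" "g p \<in> V"
  obtain N where N: "mopen A N" "p \<in> N" "N \<subseteq> U \<inter> W" "f ` N \<subseteq> V"
      "smooth_on (\<phi> ` N) (\<psi> \<circ> f \<circ> inv_into U \<phi>)"
    using smooth_mapE[OF assms(2) c(1,2) p] assms(1)[OF p] c by auto
  have "open (\<phi> ` N)"
    using N(1,3) c by (intro mopen_image_subset[of A]) auto
  moreover have "(\<psi> \<circ> f \<circ> inv_into U \<phi>) x = (\<psi> \<circ> g \<circ> inv_into U \<phi>) x" if x: "x \<in> \<phi> ` N" for x
  proof -
    obtain y where "y \<in> N" "x = \<phi> y" using x by auto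
    moreover have "y \<in> U" "y \<in> W" using N(3) \<open>y \<in> N\<close> by auto
    ultimately show ?thesis
      using inv_into_f_f[OF smooth_atlas_inj[OF assms(3) c(1)], of y] assms(1)[of y] by simp
  qed
  ultimately have "smooth_on (\<phi> ` N) (\<psi> \<circ> g \<circ> inv_into U \<phi>)"
    using smooth_on_cong_imp N(5) by blast
  moreover have "g ` N \<subseteq> V" using N(3,4) assms(1) by force
  ultimately show "\<exists>N. mopen A N \<and> p \<in> N \<and> N \<subseteq> U \<inter> W \<and> g ` N \<subseteq> V \<and>
           smooth_on (\<phi> ` N) (\<psi> \<circ> g \<circ> inv_into U \<phi>)"
    using N by blast
qed

lemma smooth_map_local:
  assumes "\<And>p. p \<in> W \<Longrightarrow> \<exists>N. p \<in> N \<and> N \<subseteq> W \<and> smooth_map A N B f"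
  shows "smooth_map A W B f"
proof (rule smooth_map_defI)
  show "mopen A W"
  proof (rule mopen_local)
    fix p assume "p \<in> W"
    from assms[OF this] show "\<exists>N. mopen A N \<and> p \<in> N \<and> N \<subseteq> W"
      using smooth_map_mopen by blast
  qed
  show "f p \<in> mcarrier B" if "p \<in> W" for p
    using assms[OF that] by (auto intro: smooth_map_image)
  fix p U \<phi> V \<psi> assume p: "p \<in> W" and c: "(U, \<phi>) \<in> A" "(V, \<psi>) \<in> B" "p \<in> U" "f p \<in> V"
  obtain N0 where N0: "p \<in> N0" "N0 \<subseteq> W" "smooth_map A N0 B f" using assms p by blast
  obtain N where "mopen A N" "p \<in> N" "N \<subseteq> U \<inter> N0" "f ` N \<subseteq> V"
      "smooth_on (\<phi> ` N) (\<psi> \<circ> f \<circ> inv_into U \<phi>)"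
    using smooth_mapE[OF N0(3) c(1,2) N0(1) c(3,4)] by blast
  then show "\<exists>N. mopen A N \<and> p \<in> N \<and> N \<subseteq> U \<inter> W \<and> f ` N \<subseteq> V \<and>
           smooth_on (\<phi> ` N) (\<psi> \<circ> f \<circ> inv_into U \<phi>)"
    using N0(2) by blast
qed

lemma smooth_map_subset:
  assumes "smooth_map A W B f" "smooth_atlas A" "mopen A W'" "W' \<subseteq> W"
  shows "smooth_map A W' B f"
proof (rule smooth_map_defI)
  show "mopen A W'" by fact
  show "f p \<in> mcarrier B" if "p \<in> W'" for p
    using assms(4) smooth_map_image[OF assms(1)] that by auto
  fix p U \<phi> V \<psi> assume p: "p \<in> W'" and c: "(U, \<phi>) \<in> A" "(V, \<psi>) \<in> B" "p \<in> U" "f p \<in> V"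
  obtain N where N: "mopen A N" "p \<in> N" "N \<subseteq> U \<inter> W" "f ` N \<subseteq> V"
      "smooth_on (\<phi> ` N) (\<psi> \<circ> f \<circ> inv_into U \<phi>)"
    using smooth_mapE[OF assms(1) c(1,2) _ c(3,4)] p assms(4) by blast
  then show "\<exists>N. mopen A N \<and> p \<in> N \<and> N \<subseteq> U \<inter> W' \<and> f ` N \<subseteq> V \<and>
           smooth_on (\<phi> ` N) (\<psi> \<circ> f \<circ> inv_into U \<phi>)"
    using mopen_Int[OF assms(2) N(1) assms(3)] p
    by (intro exI[of _ "N \<inter> W'"]) (auto intro: smooth_on_subset)
qed

lemma mopen_vimage:
  assumes A: "smooth_atlas A" and B: "smooth_atlas B" and f: "smooth_map A W B f" and W': "mopen B W'"
  shows "mopen A {p \<in> W. f p \<in> W'}"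
proof (rule mopen_local)
  fix p assume "p \<in> {p \<in> W. f p \<in> W'}"
  then have p: "p \<in> W" "f p \<in> W'" by auto
  obtain U \<phi> where U: "(U, \<phi>) \<in> A" "p \<in> U"
    using mcarrierE mopen_subset[OF smooth_map_mopen[OF f]] p(1) by (metis subsetD)
  obtain V \<psi> where V: "(V, \<psi>) \<in> B" "f p \<in> V"
    using mcarrierE mopen_subset[OF W'] p(2) by (metis subsetD)
  define D where "D = {p \<in> W \<inter> U. f p \<in> V}"
  note rep = smooth_map_rep[OF f U(1) V(1), folded D_def]
  have inj: "inj_on \<phi> U" "inj_on \<psi> V" using smooth_atlas_inj A B U V by blast+
  let ?N = "{p \<in> D. f p \<in> W'}"
  have "\<phi> ` ?N = \<phi> ` D \<inter> (\<psi> \<circ> f \<circ> inv_into U \<phi>) -` (\<psi> ` (W' \<inter> V))"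
  proof -
    have "?N = {p \<in> D. f p \<in> W' \<inter> V}" "D \<subseteq> U" "f ` D \<subseteq> V" by (auto simp: D_def)
    then show ?thesis
      using chart_image_vimage[OF inj, of D f "W' \<inter> V"] by simp
  qed
  then have "open (\<phi> ` ?N)"
    using continuous_open_preimage[OF smooth_on_continuous_on[OF rep(3)] rep(2) mopen_image[OF W' V(1)]] by simp
  then have "mopen A ?N"
    by (intro mopen_chartI[OF A U(1)]) (auto simp: D_def)
  then show "\<exists>N. mopen A N \<and> p \<in> N \<and> N \<subseteq> {p \<in> W. f p \<in> W'}"
    using p U V by (intro exI[of _ ?N]) (auto simp: D_def)
qed

text \<open>The tangent map of \<open>f\<close> at \<open>p\<close> in the coordinates of
  \<open>c\<close> and \<open>d\<close>. With the identity for \<open>f\<close> it is the change of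
  coordinates of tangent vectors.\<close>

definition chart_deriv ::
    "('m, 'e::locally_convex) chart \<Rightarrow> ('n, 'f::locally_convex) chart \<Rightarrow> ('m \<Rightarrow> 'n) \<Rightarrow> 'm \<Rightarrow> 'e \<Rightarrow> 'f" where
  "chart_deriv c d f p v = dir_deriv (snd d \<circ> f \<circ> inv_into (fst c) (snd c)) v (snd c p)"

text \<open>On one and the same neighbourhood the representation of the composite factors through
  the chart of \<open>B\<close>; smoothness and the composition of tangent maps are both read off
  from this factorization.\<close>

lemma smooth_map_compose_rep:
  assumes A: "smooth_atlas A" and B: "smooth_atlas B"
    and f: "smooth_map A W B f" and g: "smooth_map B W' C g"
    and c: "(U, \<phi>) \<in> A" "(V, \<psi>) \<in> B" "(X, \<xi>) \<in> C"
    and p: "p \<in> W" "p \<in> U" "f p \<in> V" "f p \<in> W'" "g (f p) \<in> X"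
  shows "\<exists>N. mopen A N \<and> p \<in> N \<and> N \<subseteq> {p \<in> W \<inter> U. f p \<in> V \<inter> W' \<and> g (f p) \<in> X} \<and>
      smooth_on (\<phi> ` N) (\<xi> \<circ> (\<lambda>x. g (f x)) \<circ> inv_into U \<phi>) \<and>
      (\<forall>v. chart_deriv (U, \<phi>) (X, \<xi>) (\<lambda>x. g (f x)) p v =
           chart_deriv (V, \<psi>) (X, \<xi>) g (f p) (chart_deriv (U, \<phi>) (V, \<psi>) f p v))"
proof -
  have inj: "inj_on \<phi> U" "inj_on \<psi> V" using smooth_atlas_inj A B c by blast+
  define E where "E = {q \<in> W' \<inter> V. g q \<in> X}"
  note repg = smooth_map_rep[OF g c(2,3), folded E_def]
  define N where "N = {x \<in> {x \<in> W. f x \<in> E}. x \<in> U}"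
  have mN: "mopen A N"
    using mopen_Int[OF A mopen_vimage[OF A B f repg(1)] mopen_chart[OF A c(1)]]
    by (simp add: N_def Int_def)
  have oN: "open (\<phi> ` N)"
    by (rule mopen_image_subset[OF mN c(1)]) (auto simp: N_def)
  have sf: "smooth_on (\<phi> ` N) (\<psi> \<circ> f \<circ> inv_into U \<phi>)"
    by (rule smooth_on_subset[OF smooth_map_rep(3)[OF f c(1,2)]]) (auto simp: N_def E_def)
  have im: "(\<psi> \<circ> f \<circ> inv_into U \<phi>) ` \<phi> ` N \<subseteq> \<psi> ` E"
    using inj by (auto simp: N_def)
  have eq: "(\<xi> \<circ> g \<circ> inv_into V \<psi>) ((\<psi> \<circ> f \<circ> inv_into U \<phi>) x) = (\<xi> \<circ> (\<lambda>x. g (f x)) \<circ> inv_into U \<phi>) x"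
    if "x \<in> \<phi> ` N" for x
    using that inj by (auto simp: N_def E_def)
  have s: "smooth_on (\<phi> ` N) (\<lambda>x. (\<xi> \<circ> g \<circ> inv_into V \<psi>) ((\<psi> \<circ> f \<circ> inv_into U \<phi>) x))"
    by (rule smooth_on_compose[OF oN repg(2) im repg(3) sf])
  have pN: "p \<in> N" using p by (auto simp: N_def E_def)
  have "chart_deriv (U, \<phi>) (X, \<xi>) (\<lambda>x. g (f x)) p v =
      chart_deriv (V, \<psi>) (X, \<xi>) g (f p) (chart_deriv (U, \<phi>) (V, \<psi>) f p v)" for v
  proof -
    have "chart_deriv (U, \<phi>) (X, \<xi>) (\<lambda>x. g (f x)) p v =
        dir_deriv (\<lambda>x. (\<xi> \<circ> g \<circ> inv_into V \<psi>) ((\<psi> \<circ> f \<circ> inv_into U \<phi>) x)) v (\<phi> p)"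
      unfolding chart_deriv_def fst_conv snd_conv
      using pN eq by (intro dir_deriv_cong[OF oN]) auto
    also have "\<dots> = dir_deriv (\<xi> \<circ> g \<circ> inv_into V \<psi>) (dir_deriv (\<psi> \<circ> f \<circ> inv_into U \<phi>) v (\<phi> p))
        ((\<psi> \<circ> f \<circ> inv_into U \<phi>) (\<phi> p))"
      using pN im by (intro dir_deriv_chain[OF oN repg(2,3) sf]) auto
    also have "(\<psi> \<circ> f \<circ> inv_into U \<phi>) (\<phi> p) = \<psi> (f p)"
      using inj p by simp
    finally show ?thesis unfolding chart_deriv_def fst_conv snd_conv .
  qed
  moreover have "smooth_on (\<phi> ` N) (\<xi> \<circ> (\<lambda>x. g (f x)) \<circ> inv_into U \<phi>)"
    using smooth_on_cong_imp[OF oN s] eq by blast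
  ultimately show ?thesis
    using mN pN by (intro exI[of _ N]) (auto simp: N_def E_def)
qed

lemma smooth_map_compose:
  assumes A: "smooth_atlas A" and B: "smooth_atlas B" and C: "smooth_atlas C"
    and f: "smooth_map A W B f" and g: "smooth_map B W' C g" and im: "\<And>p. p \<in> W \<Longrightarrow> f p \<in> W'"
  shows "smooth_map A W C (\<lambda>x. g (f x))"
proof (rule smooth_mapI[OF A C smooth_map_mopen[OF f]])
  fix p assume p: "p \<in> W"
  obtain U \<phi> where U: "(U, \<phi>) \<in> A" "p \<in> U"
    using mcarrierE mopen_subset[OF smooth_map_mopen[OF f]] p(1) by (metis subsetD)
  obtain V \<psi> where V: "(V, \<psi>) \<in> B" "f p \<in> V"
    using mcarrierE smooth_map_image[OF f p] by metis
  obtain X \<xi> where X: "(X, \<xi>) \<in> C" "g (f p) \<in> X"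
    using mcarrierE smooth_map_image[OF g im[OF p]] by metis
  obtain N where N: "mopen A N" "p \<in> N" "N \<subseteq> {p \<in> W \<inter> U. f p \<in> V \<inter> W' \<and> g (f p) \<in> X}"
      "smooth_on (\<phi> ` N) (\<xi> \<circ> (\<lambda>x. g (f x)) \<circ> inv_into U \<phi>)"
    using smooth_map_compose_rep[OF A B f g U(1) V(1) X(1) p U(2) V(2) im[OF p] X(2)] by blast
  then show "\<exists>U \<phi> V \<psi> N. (U, \<phi>) \<in> A \<and> (V, \<psi>) \<in> C \<and> mopen A N \<and> p \<in> N \<and>
      N \<subseteq> U \<inter> W \<and> (\<lambda>x. g (f x)) ` N \<subseteq> V \<and> smooth_on (\<phi> ` N) (\<psi> \<circ> (\<lambda>x. g (f x)) \<circ> inv_into U \<phi>)"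
    using U X by (intro exI[of _ U] exI[of _ \<phi>] exI[of _ X] exI[of _ \<xi>] exI[of _ N]) auto
qed

lemma chart_deriv_compose:
  assumes "smooth_atlas A" "smooth_atlas B" "smooth_map A W B f" "smooth_map B W' C g"
    "c \<in> A" "d \<in> B" "e \<in> C" "p \<in> W" "p \<in> fst c" "f p \<in> fst d" "f p \<in> W'" "g (f p) \<in> fst e"
  shows "chart_deriv c e (\<lambda>x. g (f x)) p v = chart_deriv d e g (f p) (chart_deriv c d f p v)"
  using smooth_map_compose_rep[OF assms(1-4), of "fst c" "snd c" "fst d" "snd d" "fst e" "snd e" p] assms(5-)
  by auto

lemma linear_chart_deriv:
  assumes "smooth_atlas A" "smooth_map A W B f" "c \<in> A" "d \<in> B" "p \<in> W" "p \<in> fst c" "f p \<in> fst d"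
  shows "linear (chart_deriv c d f p)"
proof -
  obtain U \<phi> V \<psi> where c: "c = (U, \<phi>)" "d = (V, \<psi>)" by (cases c, cases d)
  note rep = smooth_map_rep[OF assms(2-4)[unfolded c]]
  show ?thesis
    unfolding c chart_deriv_def fst_conv snd_conv
    by (rule smooth_on_linear_dir_deriv[OF rep(2,3)]) (use assms c in auto)
qed

lemma smooth_map_id:
  assumes "smooth_atlas A" "mopen A W"
  shows "smooth_map A W A (\<lambda>x. x)"
proof (rule smooth_mapI[OF assms(1,1,2)])
  fix p assume p: "p \<in> W"
  obtain U \<phi> where U: "(U, \<phi>) \<in> A" "p \<in> U"
    using mcarrierE mopen_subset[OF assms(2)] p(1) by (metis subsetD)
  have "mopen A (U \<inter> W)"
    by (rule mopen_Int[OF assms(1) mopen_chart[OF assms(1) U(1)] assms(2)])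
  moreover have "smooth_on (\<phi> ` (U \<inter> W)) (\<phi> \<circ> (\<lambda>x. x) \<circ> inv_into U \<phi>)"
    using smooth_on_subset[of "\<phi> ` U" "\<phi> \<circ> inv_into U \<phi>" "\<phi> ` (U \<inter> W)"]
      smooth_atlas_transition[OF assms(1) U(1) U(1)] by (auto simp: comp_def)
  ultimately show "\<exists>U \<phi> V \<psi> N. (U, \<phi>) \<in> A \<and> (V, \<psi>) \<in> A \<and> mopen A N \<and> p \<in> N \<and>
      N \<subseteq> U \<inter> W \<and> (\<lambda>x. x) ` N \<subseteq> V \<and> smooth_on (\<phi> ` N) (\<psi> \<circ> (\<lambda>x. x) \<circ> inv_into U \<phi>)"
    using U p by (intro exI[of _ U] exI[of _ \<phi>] exI[of _ "U \<inter> W"]) auto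
qed

lemma chart_deriv_id:
  assumes "smooth_atlas A" "c \<in> A" "p \<in> fst c"
  shows "chart_deriv c c (\<lambda>x. x) p v = v"
proof -
  have "dir_deriv (snd c \<circ> (\<lambda>x. x) \<circ> inv_into (fst c) (snd c)) v (snd c p) = dir_deriv (\<lambda>x. x) v (snd c p)"
    using open_chart_image[OF assms(1), of "fst c" "snd c"] assms(2,3)
    by (intro dir_deriv_cong[of "snd c ` fst c"]) (auto simp: f_inv_into_f)
  then show ?thesis
    by (simp add: chart_deriv_def has_dir_deriv_dir_deriv[OF has_dir_deriv_ident])
qed

lemma chart_deriv_cong:
  assumes "smooth_atlas A" "mopen A N" "c \<in> A" "p \<in> N" "p \<in> fst c" "\<And>x. x \<in> N \<Longrightarrow> f x = g x"
  shows "chart_deriv c d f p v = chart_deriv c d g p v"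
  unfolding chart_deriv_def
proof (rule dir_deriv_cong)
  show "open (snd c ` (N \<inter> fst c))"
    using mopen_image[OF assms(2), of "fst c" "snd c"] assms(3) by simp
  show "snd c p \<in> snd c ` (N \<inter> fst c)" using assms by auto
  have "inj_on (snd c) (fst c)" using smooth_atlas_inj[OF assms(1), of "fst c" "snd c"] assms(3) by simp
  then show "(snd d \<circ> f \<circ> inv_into (fst c) (snd c)) y = (snd d \<circ> g \<circ> inv_into (fst c) (snd c)) y"
    if "y \<in> snd c ` (N \<inter> fst c)" for y
    using that assms(6) by auto
qed

section \<open>Products of manifolds\<close>

lemma inv_into_map_prod:
  assumes "inj_on \<phi> U" "inj_on \<psi> V" "x \<in> \<phi> ` U" "y \<in> \<psi> ` V"
  shows "inv_into (U \<times> V) (map_prod \<phi> \<psi>) (x, y) = (inv_into U \<phi> x, inv_into V \<psi> y)"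
  using assms by (intro inv_into_f_eq map_prod_inj_on) (auto simp: f_inv_into_f inv_into_into)

lemma prod_atlasI: "(U, \<phi>) \<in> A \<Longrightarrow> (V, \<psi>) \<in> B \<Longrightarrow> (U \<times> V, map_prod \<phi> \<psi>) \<in> prod_atlas A B"
  by (auto simp: prod_atlas_def)

lemma prod_atlasE:
  assumes "c \<in> prod_atlas A B"
  obtains U \<phi> V \<psi> where "c = (U \<times> V, map_prod \<phi> \<psi>)" "(U, \<phi>) \<in> A" "(V, \<psi>) \<in> B"
  using assms by (auto simp: prod_atlas_def)

lemma mcarrier_prod_atlas: "mcarrier (prod_atlas A B) = mcarrier A \<times> mcarrier B"
  unfolding mcarrier_def prod_atlas_def by force

lemma smooth_on_map_prod:
  assumes "open S" "open T" "smooth_on S f" "smooth_on T g"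
  shows "smooth_on (S \<times> T) (map_prod f g)"
proof -
  note o = open_Times[OF assms(1,2)]
  have "smooth_on (S \<times> T) (\<lambda>z. (f (fst z), g (snd z)))"
    by (rule smooth_on_Pair[OF o smooth_on_compose[OF o assms(1) _ assms(3) smooth_on_fst[OF o]]
          smooth_on_compose[OF o assms(2) _ assms(4) smooth_on_snd[OF o]]]) auto
  then show ?thesis unfolding map_prod_def case_prod_beta .
qed

lemma smooth_atlas_prod:
  assumes A: "smooth_atlas A" and B: "smooth_atlas B"
  shows "smooth_atlas (prod_atlas A B)"
proof (rule smooth_atlas_defI)
  fix W \<xi> assume "(W, \<xi>) \<in> prod_atlas A B"
  then show "inj_on \<xi> W"
    using A B by (auto elim!: prod_atlasE intro!: map_prod_inj_on dest: smooth_atlas_inj)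
next
  fix W \<xi> W' \<xi>' assume "(W, \<xi>) \<in> prod_atlas A B" "(W', \<xi>') \<in> prod_atlas A B"
  then obtain U \<phi> V \<psi> U' \<phi>' V' \<psi>' where c: "(W, \<xi>) = (U \<times> V, map_prod \<phi> \<psi>)" "(U, \<phi>) \<in> A" "(V, \<psi>) \<in> B"
      and d: "(W', \<xi>') = (U' \<times> V', map_prod \<phi>' \<psi>')" "(U', \<phi>') \<in> A" "(V', \<psi>') \<in> B"
    by (elim prod_atlasE)
  have inj: "inj_on \<phi> U" "inj_on \<psi> V" using c A B smooth_atlas_inj by blast+
  note t1 = smooth_atlas_transition[OF A c(2) d(2)] and t2 = smooth_atlas_transition[OF B c(3) d(3)]
  have im: "map_prod \<phi> \<psi> ` (U \<times> V \<inter> U' \<times> V') = \<phi> ` (U \<inter> U') \<times> \<psi> ` (V \<inter> V')"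
    by (force simp: Times_Int_Times)
  have s: "smooth_on (\<phi> ` (U \<inter> U') \<times> \<psi> ` (V \<inter> V')) (map_prod (\<phi>' \<circ> inv_into U \<phi>) (\<psi>' \<circ> inv_into V \<psi>))"
    using t1 t2 by (intro smooth_on_map_prod) auto
  have "smooth_on (\<phi> ` (U \<inter> U') \<times> \<psi> ` (V \<inter> V')) (map_prod \<phi>' \<psi>' \<circ> inv_into (U \<times> V) (map_prod \<phi> \<psi>))"
  proof (rule smooth_on_cong_imp[OF _ s])
    show "open (\<phi> ` (U \<inter> U') \<times> \<psi> ` (V \<inter> V'))" using t1 t2 by (simp add: open_Times)
    fix z assume "z \<in> \<phi> ` (U \<inter> U') \<times> \<psi> ` (V \<inter> V')"
    then show "map_prod (\<phi>' \<circ> inv_into U \<phi>) (\<psi>' \<circ> inv_into V \<psi>) z =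
        (map_prod \<phi>' \<psi>' \<circ> inv_into (U \<times> V) (map_prod \<phi> \<psi>)) z"
      using inv_into_map_prod[OF inj, of "fst z" "snd z"] by (cases z) force
  qed
  then show "open (\<xi> ` (W \<inter> W')) \<and> smooth_on (\<xi> ` (W \<inter> W')) (\<xi>' \<circ> inv_into W \<xi>)"
    using t1 t2 c(1) d(1) by (simp add: im open_Times)
qed

lemma mopen_Times:
  assumes A: "smooth_atlas A" and B: "smooth_atlas B" and W: "mopen A W" and W': "mopen B W'"
  shows "mopen (prod_atlas A B) (W \<times> W')"
  unfolding mopen_def
proof (intro conjI ballI)
  show "W \<times> W' \<subseteq> mcarrier (prod_atlas A B)"
    using mopen_subset[OF W] mopen_subset[OF W'] by (auto simp: mcarrier_prod_atlas)
  fix c assume "c \<in> prod_atlas A B"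
  then obtain U \<phi> V \<psi> where c: "c = (U \<times> V, map_prod \<phi> \<psi>)" "(U, \<phi>) \<in> A" "(V, \<psi>) \<in> B"
    by (elim prod_atlasE)
  have "map_prod \<phi> \<psi> ` ((W \<times> W') \<inter> U \<times> V) = \<phi> ` (W \<inter> U) \<times> \<psi> ` (W' \<inter> V)"
    by (force simp: Times_Int_Times)
  then show "case c of (U, \<phi>) \<Rightarrow> open (\<phi> ` (W \<times> W' \<inter> U))"
    using mopen_image[OF W c(2)] mopen_image[OF W' c(3)] by (simp add: c(1) open_Times)
qed

lemma smooth_map_fst:
  assumes A: "smooth_atlas A" and B: "smooth_atlas B" and W: "mopen (prod_atlas A B) W"
  shows "smooth_map (prod_atlas A B) W A fst"
proof (rule smooth_mapI[OF smooth_atlas_prod[OF A B] A W])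
  fix p assume p: "p \<in> W"
  then obtain c where "c \<in> prod_atlas A B" "p \<in> fst c"
    using mopen_subset[OF W] by (auto simp: mcarrier_def)
  then obtain U \<phi> V \<psi> where c: "(U, \<phi>) \<in> A" "(V, \<psi>) \<in> B" "p \<in> U \<times> V"
    by (auto elim!: prod_atlasE)
  have inj: "inj_on \<phi> U" "inj_on \<psi> V" using c A B smooth_atlas_inj by blast+
  note pc = prod_atlasI[OF c(1,2)]
  have m: "mopen (prod_atlas A B) (U \<times> V \<inter> W)"
    by (rule mopen_Int[OF smooth_atlas_prod[OF A B] mopen_chart[OF smooth_atlas_prod[OF A B] pc] W])
  have o: "open (map_prod \<phi> \<psi> ` (U \<times> V \<inter> W))"
    by (rule mopen_image_subset[OF m pc]) auto
  have "smooth_on (map_prod \<phi> \<psi> ` (U \<times> V \<inter> W)) (\<phi> \<circ> fst \<circ> inv_into (U \<times> V) (map_prod \<phi> \<psi>))"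
    by (rule smooth_on_cong_imp[OF o smooth_on_fst[OF o]]) (auto simp: inv_into_map_prod[OF inj] f_inv_into_f inj)
  then show "\<exists>U \<phi> V \<psi> N. (U, \<phi>) \<in> prod_atlas A B \<and> (V, \<psi>) \<in> A \<and> mopen (prod_atlas A B) N \<and> p \<in> N \<and>
      N \<subseteq> U \<inter> W \<and> fst ` N \<subseteq> V \<and> smooth_on (\<phi> ` N) (\<psi> \<circ> fst \<circ> inv_into U \<phi>)"
    using pc c m p by (intro exI[of _ "U \<times> V"] exI[of _ "map_prod \<phi> \<psi>"] exI[of _ U] exI[of _ \<phi>] exI[of _ "U \<times> V \<inter> W"]) auto
qed

lemma smooth_map_snd:
  assumes A: "smooth_atlas A" and B: "smooth_atlas B" and W: "mopen (prod_atlas A B) W"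
  shows "smooth_map (prod_atlas A B) W B snd"
proof (rule smooth_mapI[OF smooth_atlas_prod[OF A B] B W])
  fix p assume p: "p \<in> W"
  then obtain c where "c \<in> prod_atlas A B" "p \<in> fst c"
    using mopen_subset[OF W] by (auto simp: mcarrier_def)
  then obtain U \<phi> V \<psi> where c: "(U, \<phi>) \<in> A" "(V, \<psi>) \<in> B" "p \<in> U \<times> V"
    by (auto elim!: prod_atlasE)
  have inj: "inj_on \<phi> U" "inj_on \<psi> V" using c A B smooth_atlas_inj by blast+
  note pc = prod_atlasI[OF c(1,2)]
  have m: "mopen (prod_atlas A B) (U \<times> V \<inter> W)"
    by (rule mopen_Int[OF smooth_atlas_prod[OF A B] mopen_chart[OF smooth_atlas_prod[OF A B] pc] W])
  have o: "open (map_prod \<phi> \<psi> ` (U \<times> V \<inter> W))"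
    by (rule mopen_image_subset[OF m pc]) auto
  have "smooth_on (map_prod \<phi> \<psi> ` (U \<times> V \<inter> W)) (\<psi> \<circ> snd \<circ> inv_into (U \<times> V) (map_prod \<phi> \<psi>))"
    by (rule smooth_on_cong_imp[OF o smooth_on_snd[OF o]]) (auto simp: inv_into_map_prod[OF inj] f_inv_into_f inj)
  then show "\<exists>U \<phi> V \<psi> N. (U, \<phi>) \<in> prod_atlas A B \<and> (V, \<psi>) \<in> B \<and> mopen (prod_atlas A B) N \<and> p \<in> N \<and>
      N \<subseteq> U \<inter> W \<and> snd ` N \<subseteq> V \<and> smooth_on (\<phi> ` N) (\<psi> \<circ> snd \<circ> inv_into U \<phi>)"
    using pc c m p by (intro exI[of _ "U \<times> V"] exI[of _ "map_prod \<phi> \<psi>"] exI[of _ V] exI[of _ \<psi>] exI[of _ "U \<times> V \<inter> W"]) auto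
qed

lemma smooth_map_Pair:
  assumes A: "smooth_atlas A" and B: "smooth_atlas B" and C: "smooth_atlas C"
    and f: "smooth_map A W B f" and g: "smooth_map A W C g"
  shows "smooth_map A W (prod_atlas B C) (\<lambda>x. (f x, g x))"
proof (rule smooth_mapI[OF A smooth_atlas_prod[OF B C] smooth_map_mopen[OF f]])
  fix p assume p: "p \<in> W"
  obtain U \<phi> where U: "(U, \<phi>) \<in> A" "p \<in> U"
    using mcarrierE mopen_subset[OF smooth_map_mopen[OF f]] p(1) by (metis subsetD)
  obtain V \<psi> where V: "(V, \<psi>) \<in> B" "f p \<in> V"
    using mcarrierE smooth_map_image[OF f p] by metis
  obtain X \<xi> where X: "(X, \<xi>) \<in> C" "g p \<in> X"
    using mcarrierE smooth_map_image[OF g p] by metis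
  have inj: "inj_on \<phi> U" "inj_on \<psi> V" "inj_on \<xi> X" using smooth_atlas_inj A B C U V X by blast+
  define D E where "D = {p \<in> W \<inter> U. f p \<in> V}" and "E = {p \<in> W \<inter> U. g p \<in> X}"
  note rf = smooth_map_rep[OF f U(1) V(1), folded D_def] and rg = smooth_map_rep[OF g U(1) X(1), folded E_def]
  have m: "mopen A (D \<inter> E)" by (rule mopen_Int[OF A rf(1) rg(1)])
  have o: "open (\<phi> ` (D \<inter> E))" by (rule mopen_image_subset[OF m U(1)]) (auto simp: D_def)
  have "smooth_on (\<phi> ` (D \<inter> E)) (\<lambda>x. ((\<psi> \<circ> f \<circ> inv_into U \<phi>) x, (\<xi> \<circ> g \<circ> inv_into U \<phi>) x))"
    by (intro smooth_on_Pair o smooth_on_subset[OF rf(3)] smooth_on_subset[OF rg(3)]) auto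
  then have s: "smooth_on (\<phi> ` (D \<inter> E)) (map_prod \<psi> \<xi> \<circ> (\<lambda>x. (f x, g x)) \<circ> inv_into U \<phi>)"
    by (simp add: comp_def)
  show "\<exists>U \<phi> V \<psi> N. (U, \<phi>) \<in> A \<and> (V, \<psi>) \<in> prod_atlas B C \<and> mopen A N \<and> p \<in> N \<and>
      N \<subseteq> U \<inter> W \<and> (\<lambda>x. (f x, g x)) ` N \<subseteq> V \<and> smooth_on (\<phi> ` N) (\<psi> \<circ> (\<lambda>x. (f x, g x)) \<circ> inv_into U \<phi>)"
    using U V X p m s prod_atlasI[OF V(1) X(1)]
    by (intro exI[of _ U] exI[of _ \<phi>] exI[of _ "V \<times> X"] exI[of _ "map_prod \<psi> \<xi>"] exI[of _ "D \<inter> E"])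
       (auto simp: D_def E_def)
qed

lemma smooth_map_const:
  assumes A: "smooth_atlas A" and B: "smooth_atlas B" and W: "mopen A W" and b: "b \<in> mcarrier B"
  shows "smooth_map A W B (\<lambda>_. b)"
proof (rule smooth_mapI[OF A B W])
  fix p assume p: "p \<in> W"
  obtain U \<phi> where U: "(U, \<phi>) \<in> A" "p \<in> U"
    using mcarrierE mopen_subset[OF W] p(1) by (metis subsetD)
  obtain V \<psi> where V: "(V, \<psi>) \<in> B" "b \<in> V"
    using mcarrierE[OF b] by metis
  have m: "mopen A (U \<inter> W)" by (rule mopen_Int[OF A mopen_chart[OF A U(1)] W])
  have o: "open (\<phi> ` (U \<inter> W))" by (rule mopen_image_subset[OF m U(1)]) auto
  have "\<psi> \<circ> (\<lambda>_. b) \<circ> inv_into U \<phi> = (\<lambda>_. \<psi> b)" by (simp add: comp_def)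
  then show "\<exists>U \<phi> V \<psi> N. (U, \<phi>) \<in> A \<and> (V, \<psi>) \<in> B \<and> mopen A N \<and> p \<in> N \<and>
      N \<subseteq> U \<inter> W \<and> (\<lambda>_. b) ` N \<subseteq> V \<and> smooth_on (\<phi> ` N) (\<psi> \<circ> (\<lambda>_. b) \<circ> inv_into U \<phi>)"
    using U V p m smooth_on_const[OF o, of "\<psi> b"]
    by (intro exI[of _ U] exI[of _ \<phi>] exI[of _ V] exI[of _ \<psi>] exI[of _ "U \<inter> W"]) auto
qed

section \<open>Differential forms\<close>

lemma has_dir_deriv_uminus: "has_dir_deriv f v x l \<Longrightarrow> has_dir_deriv (\<lambda>x. - f x) v x (- l)"
proof -
  assume "has_dir_deriv f v x l"
  then have "((\<lambda>t. - dir_quot f v x t) \<longlongrightarrow> - l) (at 0)"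
    unfolding has_dir_deriv_def by (rule tendsto_minus)
  then show ?thesis
    by (rule has_dir_derivI) (simp add: dir_quot_def scaleR_right_diff_distrib)
qed

lemma has_dir_deriv_diff:
  "has_dir_deriv f v x l \<Longrightarrow> has_dir_deriv g v x m \<Longrightarrow> has_dir_deriv (\<lambda>x. f x - g x) v x (l - m)"
  using has_dir_deriv_add[of f v x l "\<lambda>x. - g x" "- m"] has_dir_deriv_uminus[of g v x m] by simp

lemma linear_mult_complex: "linear ((*) (a :: complex))" and continuous_mult_complex: "continuous_on UNIV ((*) (a :: complex))"
  by (auto simp: linear_iff distrib_left intro: continuous_intros)

lemma has_dir_deriv_cmult:
  "has_dir_deriv f v x l \<Longrightarrow> has_dir_deriv (\<lambda>x. a * f x) v x (a * l :: complex)"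
  by (rule has_dir_deriv_linear[OF linear_mult_complex continuous_mult_complex])

section \<open>Charts chosen for pull-backs, and the basic operations on forms\<close>

definition the_chart :: "('m, 'e) atlas \<Rightarrow> 'm \<Rightarrow> ('m, 'e) chart" where
  "the_chart B y = (SOME d. d \<in> B \<and> y \<in> fst d)"

lemma the_chart: "y \<in> mcarrier B \<Longrightarrow> the_chart B y \<in> B \<and> y \<in> fst (the_chart B y)"
  unfolding the_chart_def by (rule someI_ex) (auto simp: mcarrier_def)

lemma pullback_form_eq:
  "pullback_form B f \<omega> c p vs =
    \<omega> (the_chart B (f p)) (f p) (map (chart_deriv c (the_chart B (f p)) f p) vs)"
  by (simp add: pullback_form_def chart_deriv_def[abs_def] the_chart_def Let_def)

lemma pullback_form_cong:
  assumes "smooth_atlas A" "mopen A N" "c \<in> A" "p \<in> N" "p \<in> fst c" "\<And>x. x \<in> N \<Longrightarrow> f x = g x"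
  shows "pullback_form B f \<omega> c p vs = pullback_form B g \<omega> c p vs"
proof -
  have "chart_deriv c (the_chart B (g p)) f p = chart_deriv c (the_chart B (g p)) g p"
    by (rule ext) (rule chart_deriv_cong[OF assms])
  then show ?thesis
    using assms by (simp add: pullback_form_eq)
qed

text \<open>Both sides evaluate \<open>\<omega>\<close> in the same chosen chart around
  \<open>g (f p)\<close>, so the chain rule for tangent maps gives the equation for any
  \<open>\<omega>\<close>, in particular for pull-backs and exterior derivatives.\<close>

lemma pullback_form_compose:
  assumes "smooth_atlas A" "smooth_atlas B" "smooth_map A W B f" "smooth_map B W' C g"
    "c \<in> A" "p \<in> W" "p \<in> fst c" "f p \<in> W'"
  shows "pullback_form C (\<lambda>x. g (f x)) \<omega> c p vs = pullback_form B f (pullback_form C g \<omega>) c p vs"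
proof -
  note d = the_chart[OF smooth_map_image[OF assms(3,6)]]
  note e = the_chart[OF smooth_map_image[OF assms(4,8)]]
  have "chart_deriv c (the_chart C (g (f p))) (\<lambda>x. g (f x)) p =
      (\<lambda>v. chart_deriv (the_chart B (f p)) (the_chart C (g (f p))) g (f p) (chart_deriv c (the_chart B (f p)) f p v))"
    by (rule ext) (rule chart_deriv_compose[OF assms(1-4,5) conjunct1[OF d] conjunct1[OF e] assms(6,7)
        conjunct2[OF d] assms(8) conjunct2[OF e]])
  then show ?thesis
    by (simp add: pullback_form_eq comp_def)
qed

lemma diff_form_mopen: "diff_form A W q \<omega> \<Longrightarrow> mopen A W"
  by (simp add: diff_form_def)

lemma diff_form_iff:
  "diff_form A W q \<omega> \<longleftrightarrow> mopen A W \<and>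
     (\<forall>c\<in>A. \<forall>p\<in>fst c \<inter> W. \<forall>vs. length vs = q \<longrightarrow>
        (\<forall>i<q. linear (\<lambda>v. \<omega> c p (vs[i := v]))) \<and>
        (\<forall>i<q. \<forall>j<q. i \<noteq> j \<and> vs ! i = vs ! j \<longrightarrow> \<omega> c p vs = 0)) \<and>
     (\<forall>c\<in>A. \<forall>d\<in>A. \<forall>p\<in>fst c \<inter> fst d \<inter> W. \<forall>vs. length vs = q \<longrightarrow>
        \<omega> c p vs = \<omega> d p (map (chart_deriv c d (\<lambda>x. x) p) vs)) \<and>
     (\<forall>c\<in>A. smooth_family q (snd c ` (fst c \<inter> W)) (\<lambda>vs x. \<omega> c (inv_into (fst c) (snd c) x) vs))"
  unfolding diff_form_def chart_deriv_def[abs_def] case_prod_unfold prod.collapse comp_def ..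

lemma diff_form_linear:
  "diff_form A W q \<omega> \<Longrightarrow> c \<in> A \<Longrightarrow> p \<in> fst c \<Longrightarrow> p \<in> W \<Longrightarrow> length vs = q \<Longrightarrow> i < q \<Longrightarrow>
    linear (\<lambda>v. \<omega> c p (vs[i := v]))"
  unfolding diff_form_iff by blast

lemma diff_form_alternating:
  "diff_form A W q \<omega> \<Longrightarrow> c \<in> A \<Longrightarrow> p \<in> fst c \<Longrightarrow> p \<in> W \<Longrightarrow> length vs = q \<Longrightarrow> i < q \<Longrightarrow> j < q \<Longrightarrow>
    i \<noteq> j \<Longrightarrow> vs ! i = vs ! j \<Longrightarrow> \<omega> c p vs = 0"
  unfolding diff_form_iff by blast

lemma diff_form_chart:
  "diff_form A W q \<omega> \<Longrightarrow> c \<in> A \<Longrightarrow> d \<in> A \<Longrightarrow> p \<in> fst c \<Longrightarrow> p \<in> fst d \<Longrightarrow> p \<in> W \<Longrightarrow> length vs = q \<Longrightarrow>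
    \<omega> c p vs = \<omega> d p (map (chart_deriv c d (\<lambda>x. x) p) vs)"
  unfolding diff_form_iff by blast

lemma diff_form_smooth_family:
  "diff_form A W q \<omega> \<Longrightarrow> (U, \<phi>) \<in> A \<Longrightarrow>
    smooth_family q (\<phi> ` (U \<inter> W)) (\<lambda>vs x. \<omega> (U, \<phi>) (inv_into U \<phi> x) vs)"
  unfolding diff_form_def by blast

lemma diff_formI:
  assumes "mopen A W"
    and "\<And>c p vs i. c \<in> A \<Longrightarrow> p \<in> fst c \<Longrightarrow> p \<in> W \<Longrightarrow> length vs = q \<Longrightarrow> i < q \<Longrightarrow>
      linear (\<lambda>v. \<omega> c p (vs[i := v]))"
    and "\<And>c p vs i j. c \<in> A \<Longrightarrow> p \<in> fst c \<Longrightarrow> p \<in> W \<Longrightarrow> length vs = q \<Longrightarrow> i < q \<Longrightarrow> j < q \<Longrightarrow>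
      i \<noteq> j \<Longrightarrow> vs ! i = vs ! j \<Longrightarrow> \<omega> c p vs = 0"
    and "\<And>c d p vs. c \<in> A \<Longrightarrow> d \<in> A \<Longrightarrow> p \<in> fst c \<Longrightarrow> p \<in> fst d \<Longrightarrow> p \<in> W \<Longrightarrow> length vs = q \<Longrightarrow>
      \<omega> c p vs = \<omega> d p (map (chart_deriv c d (\<lambda>x. x) p) vs)"
    and "\<And>U \<phi>. (U, \<phi>) \<in> A \<Longrightarrow> smooth_family q (\<phi> ` (U \<inter> W)) (\<lambda>vs x. \<omega> (U, \<phi>) (inv_into U \<phi> x) vs)"
  shows "diff_form A W q \<omega>"
  unfolding diff_form_iff
proof (intro conjI ballI allI impI)
  fix c assume "c \<in> A"
  then show "smooth_family q (snd c ` (fst c \<inter> W)) (\<lambda>vs x. \<omega> c (inv_into (fst c) (snd c) x) vs)"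
    using assms(5)[of "fst c" "snd c"] by simp
next
  fix c d p and vs :: "'b list"
  assume "c \<in> A" "d \<in> A" "p \<in> fst c \<inter> fst d \<inter> W" "length vs = q"
  then show "\<omega> c p vs = \<omega> d p (map (chart_deriv c d (\<lambda>x. x) p) vs)"
    by (intro assms(4)) auto
qed (use assms(1-3) in auto)

lemma diff_form_zero: "smooth_atlas A \<Longrightarrow> mopen A W \<Longrightarrow> diff_form A W q zero_form"
proof (rule diff_formI)
  fix U \<phi> assume "mopen A W" "(U, \<phi>) \<in> A"
  then have "open (\<phi> ` (U \<inter> W))"
    using mopen_image[of A W U \<phi>] by (simp add: Int_commute)
  then show "smooth_family q (\<phi> ` (U \<inter> W)) (\<lambda>vs x. zero_form (U, \<phi>) (inv_into U \<phi> x) vs)"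
    unfolding zero_form_def by (rule smooth_family_zero)
qed (auto simp: zero_form_def linear_zero)

text \<open>Values off \<open>W\<close> or on lists of another length are arbitrary, so a form is
  determined only up to \<open>form_eq\<close>. The rule passes to another representative, for
  instance from a pull-back to \<open>dlog\<close>.\<close>

lemma diff_form_cong:
  assumes "smooth_atlas A" "diff_form A W q \<omega>" "form_eq A W q \<omega> \<eta>"
  shows "diff_form A W q \<eta>"
proof -
  have eq: "\<eta> c p vs = \<omega> c p vs" if "c \<in> A" "p \<in> fst c" "p \<in> W" "length vs = q" for c p vs
    using assms(3) that by (auto simp: form_eq_def)
  show ?thesis
  proof (rule diff_formI[OF diff_form_mopen[OF assms(2)]])
    fix U \<phi> assume c: "(U, \<phi>) \<in> A"
    have o: "open (\<phi> ` (U \<inter> W))"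
      using mopen_image[OF diff_form_mopen[OF assms(2)] c] by (simp add: Int_commute)
    show "smooth_family q (\<phi> ` (U \<inter> W)) (\<lambda>vs x. \<eta> (U, \<phi>) (inv_into U \<phi> x) vs)"
    proof (rule iffD1[OF smooth_family_cong[OF o] diff_form_smooth_family[OF assms(2) c]])
      fix x and vs :: "'b list" assume "x \<in> \<phi> ` (U \<inter> W)" "length vs = q"
      then show "\<omega> (U, \<phi>) (inv_into U \<phi> x) vs = \<eta> (U, \<phi>) (inv_into U \<phi> x) vs"
        using eq[OF c] smooth_atlas_inj[OF assms(1) c] by auto
    qed
  next
    fix c d p and vs :: "'b list"
    assume c: "c \<in> A" "d \<in> A" "p \<in> fst c" "p \<in> fst d" "p \<in> W" "length vs = q"
    show "\<eta> c p vs = \<eta> d p (map (chart_deriv c d (\<lambda>x. x) p) vs)"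
      unfolding eq[OF c(1,3,5,6)] using diff_form_chart[OF assms(2) c] c by (subst eq) auto
  next
    fix c p and vs :: "'b list" and i
    assume c: "c \<in> A" "p \<in> fst c" "p \<in> W" "length vs = q" "i < q"
    have "\<eta> c p (vs[i := v]) = \<omega> c p (vs[i := v])" for v
      using c by (intro eq) auto
    then show "linear (\<lambda>v. \<eta> c p (vs[i := v]))"
      using diff_form_linear[OF assms(2) c] by simp
  next
    fix c p and vs :: "'b list" and i j
    assume c: "c \<in> A" "p \<in> fst c" "p \<in> W" "length vs = q" "i < q" "j < q" "i \<noteq> j" "vs ! i = vs ! j"
    show "\<eta> c p vs = 0"
      using eq[OF c(1-4)] diff_form_alternating[OF assms(2) c] by simp
  qed
qed

lemma diff_form_add:
  assumes "smooth_atlas A" "diff_form A W q \<omega>" "diff_form A W q \<eta>"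
  shows "diff_form A W q (\<lambda>c p vs. \<omega> c p vs + \<eta> c p vs)"
proof (rule diff_formI[OF diff_form_mopen[OF assms(2)]])
  fix U \<phi> assume c: "(U, \<phi>) \<in> A"
  have "open (\<phi> ` (U \<inter> W))"
    using mopen_image[OF diff_form_mopen[OF assms(2)] c] by (simp add: Int_commute)
  then show "smooth_family q (\<phi> ` (U \<inter> W)) (\<lambda>vs x. \<omega> (U, \<phi>) (inv_into U \<phi> x) vs + \<eta> (U, \<phi>) (inv_into U \<phi> x) vs)"
    using diff_form_smooth_family[OF assms(2) c] diff_form_smooth_family[OF assms(3) c]
    by (rule smooth_family_add)
next
  show "linear (\<lambda>v. \<omega> c p (vs[i := v]) + \<eta> c p (vs[i := v]))"
    if "c \<in> A" "p \<in> fst c" "p \<in> W" "length vs = q" "i < q" for c p vs i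
    using diff_form_linear[OF assms(2) that] diff_form_linear[OF assms(3) that] by (rule linear_compose_add)
  show "\<omega> c p vs + \<eta> c p vs = \<omega> d p (map (chart_deriv c d (\<lambda>x. x) p) vs) + \<eta> d p (map (chart_deriv c d (\<lambda>x. x) p) vs)"
    if "c \<in> A" "d \<in> A" "p \<in> fst c" "p \<in> fst d" "p \<in> W" "length vs = q" for c d p vs
    using diff_form_chart[OF assms(2) that] diff_form_chart[OF assms(3) that] by simp
  show "\<omega> c p vs + \<eta> c p vs = 0"
    if "c \<in> A" "p \<in> fst c" "p \<in> W" "length vs = q" "i < q" "j < q" "i \<noteq> j" "vs ! i = vs ! j" for c p vs i j
    using diff_form_alternating[OF assms(2) that] diff_form_alternating[OF assms(3) that] by simp
qed

lemma diff_form_cmult: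
  assumes "smooth_atlas A" "diff_form A W q \<omega>"
  shows "diff_form A W q (\<lambda>c p vs. a * \<omega> c p vs)"
proof (rule diff_formI[OF diff_form_mopen[OF assms(2)]])
  fix U \<phi> assume c: "(U, \<phi>) \<in> A"
  have "open (\<phi> ` (U \<inter> W))"
    using mopen_image[OF diff_form_mopen[OF assms(2)] c] by (simp add: Int_commute)
  then show "smooth_family q (\<phi> ` (U \<inter> W)) (\<lambda>vs x. a * \<omega> (U, \<phi>) (inv_into U \<phi> x) vs)"
    using diff_form_smooth_family[OF assms(2) c]
    by (rule smooth_family_linear[OF _ linear_mult_complex continuous_mult_complex])
next
  show "linear (\<lambda>v. a * \<omega> c p (vs[i := v]))"
    if "c \<in> A" "p \<in> fst c" "p \<in> W" "length vs = q" "i < q" for c p vs i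
    using linear_compose[OF diff_form_linear[OF assms(2) that] linear_mult_complex] by (simp add: comp_def)
  show "a * \<omega> c p vs = a * \<omega> d p (map (chart_deriv c d (\<lambda>x. x) p) vs)"
    if "c \<in> A" "d \<in> A" "p \<in> fst c" "p \<in> fst d" "p \<in> W" "length vs = q" for c d p vs
    using diff_form_chart[OF assms(2) that] by simp
  show "a * \<omega> c p vs = 0"
    if "c \<in> A" "p \<in> fst c" "p \<in> W" "length vs = q" "i < q" "j < q" "i \<noteq> j" "vs ! i = vs ! j" for c p vs i j
    using diff_form_alternating[OF assms(2) that] by simp
qed

text \<open>The transformation rule of differential forms absorbs the arbitrary choice of chart in
  \<open>pullback_form\<close>: any chart around \<open>f p\<close> may be used.\<close>

lemma pullback_form_chart:
  assumes A: "smooth_atlas A" and B: "smooth_atlas B" and f: "smooth_map A W B f"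
    and \<omega>: "diff_form B W' q \<omega>"
    and p: "c \<in> A" "d \<in> B" "p \<in> fst c" "p \<in> W" "f p \<in> fst d" "f p \<in> W'" "length vs = q"
  shows "pullback_form B f \<omega> c p vs = \<omega> d (f p) (map (chart_deriv c d f p) vs)"
proof -
  note e = the_chart[OF smooth_map_image[OF f p(4)]]
  have "\<omega> d (f p) (map (chart_deriv c d f p) vs) =
      \<omega> (the_chart B (f p)) (f p) (map (chart_deriv d (the_chart B (f p)) (\<lambda>x. x) (f p)) (map (chart_deriv c d f p) vs))"
    using e p by (intro diff_form_chart[OF \<omega>]) auto
  also have "map (chart_deriv d (the_chart B (f p)) (\<lambda>x. x) (f p)) (map (chart_deriv c d f p) vs) =
      map (chart_deriv c (the_chart B (f p)) f p) vs"
    using chart_deriv_compose[OF A B f smooth_map_id[OF B mopen_mcarrier[OF B]] p(1,2) conjunct1[OF e] p(4,3,5)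
        smooth_map_image[OF f p(4)] conjunct2[OF e]]
    by simp
  finally show ?thesis by (simp add: pullback_form_eq)
qed

lemma diff_form_pullback:
  assumes A: "smooth_atlas A" and B: "smooth_atlas B" and f: "smooth_map A W B f"
    and \<omega>: "diff_form B W' q \<omega>" and im: "\<And>p. p \<in> W \<Longrightarrow> f p \<in> W'"
  shows "diff_form A W q (pullback_form B f \<omega>)"
proof (rule diff_formI[OF smooth_map_mopen[OF f]])
  fix c p and vs :: "'b list" and i
  assume c: "c \<in> A" "p \<in> fst c" "p \<in> W" "length vs = q" "i < q"
  note e = the_chart[OF smooth_map_image[OF f c(3)]]
  let ?L = "chart_deriv c (the_chart B (f p)) f p"
  have "linear ?L"
    using e c by (intro linear_chart_deriv[OF A f]) auto
  moreover have "linear (\<lambda>u. \<omega> (the_chart B (f p)) (f p) ((map ?L vs)[i := u]))"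
    using e c im by (intro diff_form_linear[OF \<omega>]) auto
  ultimately have "linear ((\<lambda>u. \<omega> (the_chart B (f p)) (f p) ((map ?L vs)[i := u])) \<circ> ?L)"
    by (rule linear_compose)
  then show "linear (\<lambda>v. pullback_form B f \<omega> c p (vs[i := v]))"
    by (simp add: pullback_form_eq map_update comp_def)
next
  fix c p and vs :: "'b list" and i j
  assume c: "c \<in> A" "p \<in> fst c" "p \<in> W" "length vs = q" "i < q" "j < q" "i \<noteq> j" "vs ! i = vs ! j"
  note e = the_chart[OF smooth_map_image[OF f c(3)]]
  show "pullback_form B f \<omega> c p vs = 0"
    unfolding pullback_form_eq
    using e c im by (intro diff_form_alternating[OF \<omega>, where i = i and j = j]) auto
next
  fix c d p and vs :: "'b list"
  assume c: "c \<in> A" "d \<in> A" "p \<in> fst c" "p \<in> fst d" "p \<in> W" "length vs = q"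
  note e = the_chart[OF smooth_map_image[OF f c(5)]]
  have "chart_deriv c (the_chart B (f p)) f p =
      (\<lambda>v. chart_deriv d (the_chart B (f p)) f p (chart_deriv c d (\<lambda>x. x) p v))"
    using chart_deriv_compose[OF A A smooth_map_id[OF A mopen_mcarrier[OF A]] f c(1,2) conjunct1[OF e] _ c(3,4,5) conjunct2[OF e]]
      mopen_subset[OF smooth_map_mopen[OF f]] c(5) by (intro ext) auto
  then show "pullback_form B f \<omega> c p vs = pullback_form B f \<omega> d p (map (chart_deriv c d (\<lambda>x. x) p) vs)"
    by (simp add: pullback_form_eq comp_def)
next
  fix U \<phi> assume c: "(U, \<phi>) \<in> A"
  have inj: "inj_on \<phi> U" by (rule smooth_atlas_inj[OF A c])
  show "smooth_family q (\<phi> ` (U \<inter> W)) (\<lambda>vs x. pullback_form B f \<omega> (U, \<phi>) (inv_into U \<phi> x) vs)"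
  proof (rule smooth_family_local, safe)
    fix p assume p: "p \<in> U" "p \<in> W"
    \<comment> \<open>The chart chosen by \<open>pullback_form\<close> may jump from point to point.
      Around \<open>p\<close> it is replaced by this fixed one, in which the coefficients are
      visibly smooth.\<close>
    obtain V \<psi> where V: "(V, \<psi>) \<in> B" "f p \<in> V"
      using mcarrierE smooth_map_image[OF f p(2)] by metis
    have inj': "inj_on \<psi> V" by (rule smooth_atlas_inj[OF B V(1)])
    define D where "D = {p \<in> W \<inter> U. f p \<in> V}"
    define r where "r = \<psi> \<circ> f \<circ> inv_into U \<phi>"
    define T where "T = \<psi> ` (V \<inter> W')"
    define F where "F = (\<lambda>vs x. \<omega> (V, \<psi>) (inv_into V \<psi> x) vs)"
    note rep = smooth_map_rep[OF f c V(1), folded D_def r_def]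
    have T: "open T"
      using mopen_image[OF diff_form_mopen[OF \<omega>] V(1)] by (simp add: T_def Int_commute)
    have im': "r ` \<phi> ` D \<subseteq> T"
      using inj im by (auto simp: r_def T_def D_def)
    have F: "smooth_family q T F"
      unfolding T_def F_def by (rule diff_form_smooth_family[OF \<omega> V(1)])
    have m: "multilin_list T q F"
      unfolding multilin_list_def T_def F_def
    proof (intro ballI allI impI)
      fix x i and vs :: "'d list" assume "x \<in> \<psi> ` (V \<inter> W')" "length vs = q" "i < q"
      then show "linear (\<lambda>v. \<omega> (V, \<psi>) (inv_into V \<psi> x) (vs[i := v]))"
        using inj' by (intro diff_form_linear[OF \<omega> V(1)]) auto
    qed
    have fam: "smooth_family q (\<phi> ` D) (\<lambda>vs x. F (map (\<lambda>v. dir_deriv r v x) vs) (r x))"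
      by (rule smooth_family_pullback[OF rep(2) T im' rep(3) F m])
    have coeff: "F (map (\<lambda>v. dir_deriv r v x) vs) (r x) = pullback_form B f \<omega> (U, \<phi>) (inv_into U \<phi> x) vs"
      if x: "x \<in> \<phi> ` D" and vs: "length vs = q" for x vs
    proof -
      obtain y where y: "y \<in> D" "x = \<phi> y" using x by blast
      then have y': "y \<in> U" "y \<in> W" "f y \<in> V" "f y \<in> W'" using im by (auto simp: D_def)
      have "pullback_form B f \<omega> (U, \<phi>) y vs = \<omega> (V, \<psi>) (f y) (map (chart_deriv (U, \<phi>) (V, \<psi>) f y) vs)"
        using y' vs by (intro pullback_form_chart[OF A B f \<omega> c V(1)]) auto
      then show ?thesis
        using y y' inj inj' by (simp add: F_def r_def chart_deriv_def[abs_def])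
    qed
    have "smooth_family q (\<phi> ` D) (\<lambda>vs x. pullback_form B f \<omega> (U, \<phi>) (inv_into U \<phi> x) vs)"
      by (rule iffD1[OF smooth_family_cong[OF rep(2) coeff] fam])
    then show "\<exists>N. open N \<and> \<phi> p \<in> N \<and> N \<subseteq> \<phi> ` (U \<inter> W) \<and>
        smooth_family q N (\<lambda>vs x. pullback_form B f \<omega> (U, \<phi>) (inv_into U \<phi> x) vs)"
      using rep(2) p V by (intro exI[of _ "\<phi> ` D"]) (auto simp: D_def)
  qed
qed

section \<open>The exterior derivative\<close>

lemma diff_form_has_dir_deriv:
  assumes "diff_form A W q \<omega>" "c \<in> A" "p \<in> fst c" "p \<in> W" "length vs = q"
  shows "has_dir_deriv (\<lambda>x. \<omega> c (inv_into (fst c) (snd c) x) vs) u (snd c p)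
    (dir_deriv (\<lambda>x. \<omega> c (inv_into (fst c) (snd c) x) vs) u (snd c p))"
proof -
  have "smooth_family q (snd c ` (fst c \<inter> W)) (\<lambda>vs x. \<omega> c (inv_into (fst c) (snd c) x) vs)"
    using diff_form_smooth_family[OF assms(1), of "fst c" "snd c"] assms(2) by simp
  from smooth_family_fixed[OF this assms(5)] show ?thesis
    using assms(3,4) by (intro smooth_on_has_dir_deriv) auto
qed

text \<open>Locality of d: agreement on an open neighbourhood of the point suffices. It is used to
  replace a form by an expression in terms of lifts that exist only nearby.\<close>

lemma ext_d_cong:
  assumes "smooth_atlas A" "mopen A N" "c \<in> A" "p \<in> fst c" "p \<in> N" "form_eq A N q \<omega> \<eta>" "length vs = Suc q"
  shows "ext_d \<omega> c p vs = ext_d \<eta> c p vs"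
  unfolding ext_d_def
proof (intro sum.cong refl arg_cong2[where f = "(*)"])
  fix i assume i: "i \<in> {..<length vs}"
  show "dir_deriv (\<lambda>x. \<omega> c (inv_into (fst c) (snd c) x) (omit i vs)) (vs ! i) (snd c p) =
        dir_deriv (\<lambda>x. \<eta> c (inv_into (fst c) (snd c) x) (omit i vs)) (vs ! i) (snd c p)"
  proof (rule dir_deriv_cong)
    show "open (snd c ` (N \<inter> fst c))"
      using mopen_image[OF assms(2), of "fst c" "snd c"] assms(3) by simp
    show "snd c p \<in> snd c ` (N \<inter> fst c)" using assms(4,5) by simp
    have "inj_on (snd c) (fst c)" using smooth_atlas_inj[OF assms(1), of "fst c" "snd c"] assms(3) by simp
    moreover have "length (omit i vs) = q" using i assms(7) by (simp add: omit_def)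
    ultimately show "\<omega> c (inv_into (fst c) (snd c) y) (omit i vs) = \<eta> c (inv_into (fst c) (snd c) y) (omit i vs)"
      if "y \<in> snd c ` (N \<inter> fst c)" for y
      using that assms(3,6) by (auto simp: form_eq_def)
  qed
qed

lemma length_omit: "i < length vs \<Longrightarrow> length vs = Suc q \<Longrightarrow> length (omit i vs) = q"
  by (simp add: omit_def)

lemma ext_d_zero: "ext_d zero_form c p vs = 0"
  by (simp add: ext_d_def zero_form_def)

lemma ext_d_add:
  assumes "diff_form A W q \<omega>" "diff_form A W q \<eta>" "c \<in> A" "p \<in> fst c" "p \<in> W" "length vs = Suc q"
  shows "ext_d (\<lambda>c p vs. \<omega> c p vs + \<eta> c p vs) c p vs = ext_d \<omega> c p vs + ext_d \<eta> c p vs"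
proof -
  let ?D = "\<lambda>\<omega> i. dir_deriv (\<lambda>x. \<omega> c (inv_into (fst c) (snd c) x) (omit i vs)) (vs ! i) (snd c p)"
  have "?D (\<lambda>c p vs. \<omega> c p vs + \<eta> c p vs) i = ?D \<omega> i + ?D \<eta> i" if "i < length vs" for i
    using has_dir_deriv_add[OF diff_form_has_dir_deriv[OF assms(1,3-5)] diff_form_has_dir_deriv[OF assms(2,3-5)]]
      length_omit[OF that assms(6)] by (intro has_dir_deriv_dir_deriv) auto
  then show ?thesis
    by (simp add: ext_d_def distrib_left sum.distrib)
qed

lemma ext_d_cmult:
  assumes "diff_form A W q \<omega>" "c \<in> A" "p \<in> fst c" "p \<in> W" "length vs = Suc q"
  shows "ext_d (\<lambda>c p vs. a * \<omega> c p vs) c p vs = a * ext_d \<omega> c p vs"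
proof -
  let ?D = "\<lambda>\<omega> i. dir_deriv (\<lambda>x. \<omega> c (inv_into (fst c) (snd c) x) (omit i vs)) (vs ! i) (snd c p)"
  have "?D (\<lambda>c p vs. a * \<omega> c p vs) i = a * ?D \<omega> i" if "i < length vs" for i
    using has_dir_deriv_cmult[OF diff_form_has_dir_deriv[OF assms(1-4)]]
      length_omit[OF that assms(5)] by (intro has_dir_deriv_dir_deriv) auto
  then show ?thesis
    by (simp add: ext_d_def sum_distrib_left mult.left_commute)
qed

lemma ext_d_1:
  "ext_d \<omega> c p [u, v] =
    dir_deriv (\<lambda>x. \<omega> c (inv_into (fst c) (snd c) x) [v]) u (snd c p) -
    dir_deriv (\<lambda>x. \<omega> c (inv_into (fst c) (snd c) x) [u]) v (snd c p)"
  by (simp add: ext_d_def omit_def lessThan_Suc)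

text \<open>Besides the expected terms, the derivatives of the pulled back coefficients contain
  \<open>\<omega>\<close> applied to second derivatives of \<open>f\<close>; these are symmetric and
  cancel in the difference.\<close>

lemma ext_d_pullback:
  assumes A: "smooth_atlas A" and B: "smooth_atlas B" and f: "smooth_map A W B f"
    and \<omega>: "diff_form B W' 1 \<omega>" and im: "\<And>p. p \<in> W \<Longrightarrow> f p \<in> W'"
    and p: "c \<in> A" "p \<in> fst c" "p \<in> W" "length vs = 2"
  shows "ext_d (pullback_form B f \<omega>) c p vs = pullback_form B f (ext_d \<omega>) c p vs"
proof -
  obtain U \<phi> where c: "c = (U, \<phi>)" by (cases c)
  \<comment> \<open>The right-hand side reads \<open>ext_d \<omega>\<close> in the chart chosen at
    \<open>f p\<close>, so the computation is done in this very chart.\<close>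
  obtain V \<psi> where d: "the_chart B (f p) = (V, \<psi>)" by (cases "the_chart B (f p)")
  obtain u v where vs: "vs = [u, v]"
    using p(4) by (auto simp: numeral_2_eq_2 length_Suc_conv)
  have V: "(V, \<psi>) \<in> B" "f p \<in> V"
    using the_chart[OF smooth_map_image[OF f p(3)]] d by auto
  have inj: "inj_on \<phi> U" "inj_on \<psi> V" using smooth_atlas_inj A B p V c by blast+
  define D where "D = {p \<in> W \<inter> U. f p \<in> V}"
  define r where "r = \<psi> \<circ> f \<circ> inv_into U \<phi>"
  define T where "T = \<psi> ` (V \<inter> W')"
  define F where "F = (\<lambda>vs x. \<omega> (V, \<psi>) (inv_into V \<psi> x) vs)"
  note rep = smooth_map_rep[OF f p(1)[unfolded c] V(1), folded D_def r_def]
  have T: "open T"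
    using mopen_image[OF diff_form_mopen[OF \<omega>] V(1)] by (simp add: T_def Int_commute)
  have im': "r ` \<phi> ` D \<subseteq> T"
    using inj im by (auto simp: r_def T_def D_def)
  have F: "smooth_family (Suc 0) T F"
    using diff_form_smooth_family[OF \<omega> V(1)] by (simp add: T_def F_def)
  have m: "multilin_list T (Suc 0) F"
    unfolding multilin_list_def T_def F_def
  proof (intro ballI allI impI)
    fix x i and vs :: "'d list" assume "x \<in> \<psi> ` (V \<inter> W')" "length vs = Suc 0" "i < Suc 0"
    then show "linear (\<lambda>v. \<omega> (V, \<psi>) (inv_into V \<psi> x) (vs[i := v]))"
      using inj by (intro diff_form_linear[OF \<omega> V(1)]) auto
  qed
  have pD: "\<phi> p \<in> \<phi> ` D" using p c V by (auto simp: D_def)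
  have rp: "r (\<phi> p) = \<psi> (f p)" using p c inj by (simp add: r_def)
  have co: "pullback_form B f \<omega> (U, \<phi>) (inv_into U \<phi> x) [v] = F [dir_deriv r v x] (r x)"
    if x: "x \<in> \<phi> ` D" for x v
  proof -
    obtain y where y: "y \<in> D" "x = \<phi> y" using x by blast
    then have y': "y \<in> U" "y \<in> W" "f y \<in> V" "f y \<in> W'" using im by (auto simp: D_def)
    have "pullback_form B f \<omega> (U, \<phi>) y [v] = \<omega> (V, \<psi>) (f y) (map (chart_deriv (U, \<phi>) (V, \<psi>) f y) [v])"
      using y' by (intro pullback_form_chart[OF A B f \<omega> p(1)[unfolded c] V(1)]) auto
    then show ?thesis
      using y y' inj by (simp add: F_def r_def chart_deriv_def[abs_def])
  qed
  have der: "dir_deriv (\<lambda>x. pullback_form B f \<omega> (U, \<phi>) (inv_into U \<phi> x) [v]) u (\<phi> p) =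
     dir_deriv (F [dir_deriv r v (\<phi> p)]) (dir_deriv r u (\<phi> p)) (r (\<phi> p)) +
     F [dir_deriv (dir_deriv r v) u (\<phi> p)] (r (\<phi> p))" for u v
    using has_dir_deriv_dir_deriv[OF has_dir_deriv_pullback_1[OF rep(2) T im' rep(3) pD F m]]
      dir_deriv_cong[OF rep(2) pD co] by simp
  have "ext_d (pullback_form B f \<omega>) c p vs =
     dir_deriv (F [dir_deriv r v (\<phi> p)]) (dir_deriv r u (\<phi> p)) (r (\<phi> p)) -
     dir_deriv (F [dir_deriv r u (\<phi> p)]) (dir_deriv r v (\<phi> p)) (r (\<phi> p))"
    unfolding c vs ext_d_1 fst_conv snd_conv der dir_deriv_commute[OF rep(2) pD rep(3), of v u] by simp
  also have "\<dots> = ext_d \<omega> (V, \<psi>) (f p) [dir_deriv r u (\<phi> p), dir_deriv r v (\<phi> p)]"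
    by (simp add: ext_d_1 rp F_def)
  finally show ?thesis
    by (simp add: pullback_form_eq d vs c chart_deriv_def r_def)
qed

text \<open>The expansion has six second derivatives of coefficients, which cancel in pairs by
  \<open>dir_deriv_commute\<close>.\<close>

lemma ext_d_ext_d:
  assumes A: "smooth_atlas A" and \<omega>: "diff_form A W 1 \<omega>"
    and p: "c \<in> A" "p \<in> fst c" "p \<in> W" "length vs = 3"
  shows "ext_d (ext_d \<omega>) c p vs = 0"
proof -
  obtain U \<phi> where c: "c = (U, \<phi>)" by (cases c)
  obtain u v w where vs: "vs = [u, v, w]"
    using p(4) by (auto simp: numeral_3_eq_3 length_Suc_conv)
  have inj: "inj_on \<phi> U" using smooth_atlas_inj A p c by blast
  define S where "S = \<phi> ` (U \<inter> W)"
  define F where "F = (\<lambda>v x. \<omega> (U, \<phi>) (inv_into U \<phi> x) [v])"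
  have S: "open S"
    using mopen_image[OF diff_form_mopen[OF \<omega>] p(1)[unfolded c]] by (simp add: S_def Int_commute)
  have pS: "\<phi> p \<in> S" using p c by (auto simp: S_def)
  have F: "smooth_on S (F v)" for v
    using smooth_family_fixed[OF diff_form_smooth_family[OF \<omega> p(1)[unfolded c]], of "[v]"]
    by (simp add: F_def S_def)
  have e: "ext_d \<omega> (U, \<phi>) (inv_into U \<phi> x) [u, v] = dir_deriv (F v) u x - dir_deriv (F u) v x"
    if "x \<in> S" for x u v
    using that inj by (auto simp: ext_d_1 F_def S_def)
  have d: "dir_deriv (\<lambda>x. ext_d \<omega> (U, \<phi>) (inv_into U \<phi> x) [u, v]) w (\<phi> p) =
     dir_deriv (dir_deriv (F v) u) w (\<phi> p) - dir_deriv (dir_deriv (F u) v) w (\<phi> p)" for u v w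
    using has_dir_deriv_dir_deriv[OF has_dir_deriv_diff[OF smooth_on_has_dir_deriv2[OF S F pS] smooth_on_has_dir_deriv2[OF S F pS]]]
      dir_deriv_cong[OF S pS e] by simp
  have "ext_d (ext_d \<omega>) c p vs =
     dir_deriv (\<lambda>x. ext_d \<omega> (U, \<phi>) (inv_into U \<phi> x) [v, w]) u (\<phi> p) -
     dir_deriv (\<lambda>x. ext_d \<omega> (U, \<phi>) (inv_into U \<phi> x) [u, w]) v (\<phi> p) +
     dir_deriv (\<lambda>x. ext_d \<omega> (U, \<phi>) (inv_into U \<phi> x) [u, v]) w (\<phi> p)"
    unfolding ext_d_def[of "ext_d \<omega>"] c vs by (simp add: omit_def lessThan_Suc)
  then show ?thesis
    unfolding d dir_deriv_commute[OF S pS F, of w v u] dir_deriv_commute[OF S pS F, of v w u]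
      dir_deriv_commute[OF S pS F, of u w v] by simp
qed

lemma real_form_zero: "smooth_atlas A \<Longrightarrow> mopen A W \<Longrightarrow> real_form A W q zero_form"
  by (simp add: real_form_def diff_form_zero) (simp add: zero_form_def)

lemma real_form_cong:
  "smooth_atlas A \<Longrightarrow> real_form A W q \<omega> \<Longrightarrow> form_eq A W q \<omega> \<eta> \<Longrightarrow> real_form A W q \<eta>"
  unfolding real_form_def using diff_form_cong[of A W q \<omega> \<eta>] by (auto simp: form_eq_def)

lemma real_form_pullback:
  assumes "smooth_atlas A" "smooth_atlas B" "smooth_map A W B f" "real_form B W' q \<omega>"
    "\<And>p. p \<in> W \<Longrightarrow> f p \<in> W'"
  shows "real_form A W q (pullback_form B f \<omega>)"
proof -
  have "pullback_form B f \<omega> c p vs \<in> \<real>" if "p \<in> W" "length vs = q" for c :: "('a, 'b) chart" and p vs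
    using the_chart[OF smooth_map_image[OF assms(3) that(1)]] assms(4,5) that
    by (simp add: pullback_form_eq real_form_def)
  then show ?thesis
    using diff_form_pullback[OF assms(1-3) _ assms(5)] assms(4) by (simp add: real_form_def)
qed

section \<open>The circle\<close>

lemma circle_group_simps [simp]:
  "carrier circle_group = sphere 0 1" "x \<otimes>\<^bsub>circle_group\<^esub> y = x * y" "\<one>\<^bsub>circle_group\<^esub> = 1"
  by (simp_all add: circle_group_def)

lemma lie_group_atlas: "lie_group G A \<Longrightarrow> smooth_atlas A"
  by (simp add: lie_group_def smooth_manifold_atlas)

lemma inj_on_cis: "inj_on cis {a<..<a + 2 * pi}"
proof (rule inj_onI)
  fix x y assume xy: "x \<in> {a<..<a + 2 * pi}" "y \<in> {a<..<a + 2 * pi}" "cis x = cis y"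
  then have "sin y = sin x \<and> cos y = cos x" by (simp add: complex_eq_iff)
  then obtain n where n: "y = x + 2 * pi * of_int n"
    using sin_cos_eq_iff[of y x] by (auto simp: ac_simps)
  have "\<bar>y - x\<bar> < 2 * pi" using xy by auto
  then have "\<bar>2 * pi * real_of_int n\<bar> < 2 * pi * 1" using n by simp
  then have "\<bar>real_of_int n\<bar> < 1"
    by (simp add: abs_mult)
  then have "n = 0" by linarith
  then show "x = y" using n by simp
qed

lemma cis_circle_chart:
  assumes "(K, \<psi>) \<in> circle_atlas" "z \<in> K"
  shows "cis (\<psi> z) = z"
  using assms f_the_inv_into_f[OF inj_on_cis] by (auto simp: circle_atlas_def)

lemma circle_chart_subset: "(K, \<psi>) \<in> circle_atlas \<Longrightarrow> K \<subseteq> sphere 0 1"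
  by (auto simp: circle_atlas_def)

section \<open>Circle-valued functions and their logarithmic derivatives\<close>

lemma has_dir_deriv_real_iff:
  fixes h :: "'a::locally_convex \<Rightarrow> real"
  shows "has_dir_deriv h v x l \<longleftrightarrow> ((\<lambda>t. h (x + t *\<^sub>R v)) has_real_derivative l) (at 0)"
  by (simp add: has_dir_deriv_def DERIV_def dir_quot_def[abs_def] divide_inverse mult.commute)

lemma has_dir_deriv_cis:
  assumes "has_dir_deriv h v x l"
  shows "has_dir_deriv (\<lambda>x. cis (h x)) v x (\<i> * cis (h x) * of_real l)"
proof -
  note h = assms[unfolded has_dir_deriv_real_iff]
  have c: "has_dir_deriv (\<lambda>x. cos (h x)) v x (- sin (h x) * l)"
    unfolding has_dir_deriv_real_iff using DERIV_chain2[OF DERIV_cos h] by simp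
  have s: "has_dir_deriv (\<lambda>x. sin (h x)) v x (cos (h x) * l)"
    unfolding has_dir_deriv_real_iff using DERIV_chain2[OF DERIV_sin h] by simp
  have lim: "((\<lambda>t. Complex (dir_quot (\<lambda>x. cos (h x)) v x t) (dir_quot (\<lambda>x. sin (h x)) v x t)) \<longlongrightarrow>
      Complex (- sin (h x) * l) (cos (h x) * l)) (at 0)"
    using c s unfolding has_dir_deriv_def by (intro tendsto_Complex)
  have "Complex (- sin (h x) * l) (cos (h x) * l) = \<i> * cis (h x) * of_real l"
    by (simp add: complex_eq_iff)
  moreover have "has_dir_deriv (\<lambda>x. cis (h x)) v x (Complex (- sin (h x) * l) (cos (h x) * l))"
    by (rule has_dir_derivI[OF lim]) (simp add: dir_quot_def complex_eq_iff)
  ultimately show ?thesis by simp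
qed

lemma has_dir_deriv_mult:
  fixes f g :: "'a::locally_convex \<Rightarrow> complex"
  assumes "has_dir_deriv f v x l" "has_dir_deriv g v x m"
  shows "has_dir_deriv (\<lambda>x. f x * g x) v x (l * g x + f x * m)"
proof -
  have "((\<lambda>t. dir_quot f v x t * g (x + t *\<^sub>R v) + f x * dir_quot g v x t) \<longlongrightarrow> l * g x + f x * m) (at 0)"
    using assms[unfolded has_dir_deriv_def] has_dir_deriv_tendsto[OF assms(2)]
    by (intro tendsto_add tendsto_mult tendsto_const)
  then show ?thesis
    by (rule has_dir_derivI) (simp add: dir_quot_def algebra_simps)
qed

abbreviation circle_smooth :: "('m, 'e::locally_convex) atlas \<Rightarrow> 'm set \<Rightarrow> ('m \<Rightarrow> complex) \<Rightarrow> bool" where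
  "circle_smooth A W u \<equiv> smooth_map A W circle_atlas u"

text \<open>The charts of the circle are angles, so locally \<open>u\<close> is \<open>cis\<close>
  of its own chart representation. A tangent vector of the circle is thus an angular
  velocity.\<close>

lemma circle_smooth_has_dir_deriv:
  assumes "smooth_atlas A" "circle_smooth A W u" "c \<in> A" "d \<in> circle_atlas" "p \<in> fst c" "p \<in> W" "u p \<in> fst d"
  shows "has_dir_deriv (u \<circ> inv_into (fst c) (snd c)) v (snd c p) (\<i> * u p * of_real (chart_deriv c d u p v))"
proof -
  obtain U \<phi> K \<psi> where c: "c = (U, \<phi>)" "d = (K, \<psi>)" by (cases c, cases d)
  define D where "D = {p \<in> W \<inter> U. u p \<in> K}"
  define h where "h = \<psi> \<circ> u \<circ> inv_into U \<phi>"
  note rep = smooth_map_rep[OF assms(2) assms(3)[unfolded c] assms(4)[unfolded c], folded D_def h_def]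
  have inj: "inj_on \<phi> U" using smooth_atlas_inj assms(1,3) c by blast
  have p: "p \<in> D" using assms c by (auto simp: D_def)
  have "has_dir_deriv (\<lambda>x. cis (h x)) v (\<phi> p) (\<i> * cis (h (\<phi> p)) * of_real (dir_deriv h v (\<phi> p)))"
    using p by (intro has_dir_deriv_cis smooth_on_has_dir_deriv[OF rep(3)]) auto
  moreover have "cis (h x) = (u \<circ> inv_into U \<phi>) x" if "x \<in> \<phi> ` D" for x
    using that inj cis_circle_chart[OF assms(4)[unfolded c]] by (auto simp: h_def D_def)
  moreover have "cis (h (\<phi> p)) = u p"
    using p inj cis_circle_chart[OF assms(4)[unfolded c]] by (auto simp: h_def D_def)
  ultimately have "has_dir_deriv (u \<circ> inv_into U \<phi>) v (\<phi> p) (\<i> * u p * of_real (dir_deriv h v (\<phi> p)))"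
    using has_dir_deriv_cong[OF rep(2), of "\<phi> p" "\<lambda>x. cis (h x)" "u \<circ> inv_into U \<phi>"] p by simp
  then show ?thesis
    by (simp add: c chart_deriv_def h_def)
qed

lemma circle_smooth_sphere:
  "lie_group circle_group circle_atlas \<Longrightarrow> circle_smooth A W u \<Longrightarrow> p \<in> W \<Longrightarrow> u p \<in> sphere 0 1"
  using smooth_map_image[of A W circle_atlas u p] by (simp add: lie_group_def)

lemma circle_smooth_nonzero:
  "lie_group circle_group circle_atlas \<Longrightarrow> circle_smooth A W u \<Longrightarrow> p \<in> W \<Longrightarrow> u p \<noteq> 0"
  using circle_smooth_sphere[of A W u p] by auto

lemma dlog_eq:
  assumes "lie_group circle_group circle_atlas" "smooth_atlas A" "circle_smooth A W u" "c \<in> A" "d \<in> circle_atlas"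
    "p \<in> fst c" "p \<in> W" "u p \<in> fst d"
  shows "dlog u c p vs = \<i> * of_real (chart_deriv c d u p (hd vs))"
  using has_dir_deriv_dir_deriv[OF circle_smooth_has_dir_deriv[OF assms(2-)]] circle_smooth_nonzero[OF assms(1,3,7)]
  by (simp add: dlog_def)

lemma circle_smooth_has_dir_deriv_dlog:
  assumes "lie_group circle_group circle_atlas" "smooth_atlas A" "circle_smooth A W u" "c \<in> A" "p \<in> fst c" "p \<in> W"
  shows "has_dir_deriv (u \<circ> inv_into (fst c) (snd c)) v (snd c p) (u p * dlog u c p [v])"
proof -
  note d = the_chart[OF smooth_map_image[OF assms(3,6)]]
  show ?thesis
    using circle_smooth_has_dir_deriv[OF assms(2-4) conjunct1[OF d] assms(5,6) conjunct2[OF d], of v]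
      dlog_eq[OF assms(1-4) conjunct1[OF d] assms(5,6) conjunct2[OF d], of "[v]"]
    by (simp add: mult.assoc mult.left_commute[of "u p"])
qed

lemma dlog_unique:
  assumes "has_dir_deriv (u \<circ> inv_into (fst c) (snd c)) v (snd c p) (u p * l)" "u p \<noteq> 0"
  shows "dlog u c p [v] = l"
  using has_dir_deriv_dir_deriv[OF assms(1)] assms(2) by (simp add: dlog_def)

lemma dlog_mult:
  assumes L: "lie_group circle_group circle_atlas" and A: "smooth_atlas A"
    and u: "circle_smooth A W u" and w: "circle_smooth A W w" and p: "c \<in> A" "p \<in> fst c" "p \<in> W"
  shows "dlog (\<lambda>x. u x * w x) c p [v] = dlog u c p [v] + dlog w c p [v]"
proof (rule dlog_unique)
  have "inj_on (snd c) (fst c)" using smooth_atlas_inj[OF A, of "fst c" "snd c"] p by simp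
  then show "has_dir_deriv ((\<lambda>x. u x * w x) \<circ> inv_into (fst c) (snd c)) v (snd c p)
      (u p * w p * (dlog u c p [v] + dlog w c p [v]))"
    using has_dir_deriv_mult[OF circle_smooth_has_dir_deriv_dlog[OF L A u p] circle_smooth_has_dir_deriv_dlog[OF L A w p]] p
    by (simp add: comp_def algebra_simps)
  show "u p * w p \<noteq> 0"
    using circle_smooth_nonzero[OF L u p(3)] circle_smooth_nonzero[OF L w p(3)] by simp
qed

lemma dlog_cong:
  assumes "smooth_atlas A" "mopen A N" "c \<in> A" "p \<in> N" "p \<in> fst c" "\<And>x. x \<in> N \<Longrightarrow> f x = g x"
  shows "dlog f c p vs = dlog g c p vs"
proof -
  have "inj_on (snd c) (fst c)" using smooth_atlas_inj[OF assms(1), of "fst c" "snd c"] assms(3) by simp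
  then have "dir_deriv (f \<circ> inv_into (fst c) (snd c)) (hd vs) (snd c p) =
      dir_deriv (g \<circ> inv_into (fst c) (snd c)) (hd vs) (snd c p)"
    using mopen_image[OF assms(2), of "fst c" "snd c"] assms(3-6)
    by (intro dir_deriv_cong[of "snd c ` (N \<inter> fst c)"]) auto
  then show ?thesis using assms(4,6) by (simp add: dlog_def)
qed

text \<open>The Maurer--Cartan form of the circle, of which \<open>dlog u\<close> is the pull-back.\<close>

definition circle_mc :: "(complex, real) form" where
  "circle_mc c p vs = \<i> * of_real (hd vs)"

lemma linear_i_of_real: "linear (\<lambda>v::real. \<i> * complex_of_real v)"
  by (simp add: linear_iff distrib_left scaleR_conv_of_real)

lemma diff_form_circle_mc:
  assumes L: "lie_group circle_group circle_atlas"
  shows "diff_form circle_atlas (sphere 0 1) 1 circle_mc"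
proof -
  have A: "smooth_atlas circle_atlas" and m: "mcarrier circle_atlas = sphere 0 1"
    using lie_group_atlas[OF L] L by (auto simp: lie_group_def)
  have id: "smooth_map circle_atlas (sphere 0 1) circle_atlas (\<lambda>x. x)"
    using smooth_map_id[OF A mopen_mcarrier[OF A]] m by simp
  show ?thesis
  proof (rule diff_formI)
    show "mopen circle_atlas (sphere 0 1)" using mopen_mcarrier[OF A] m by simp
  next
    fix c p and vs :: "real list" and i :: nat
    assume "length vs = 1" "i < 1"
    then show "linear (\<lambda>v. circle_mc c p (vs[i := v]))"
      using linear_i_of_real by (auto simp: circle_mc_def length_Suc_conv)
  next
    fix c d p and vs :: "real list"
    assume c: "c \<in> circle_atlas" "d \<in> circle_atlas" "p \<in> fst c" "p \<in> fst d" "p \<in> sphere 0 1" "length vs = 1"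
    \<comment> \<open>\<open>dlog\<close> of the identity, computed with target chart
      \<open>d\<close> and with target chart \<open>c\<close>, has one and the same value. So a
      change of angle has derivative 1 and the Maurer--Cartan form looks alike in all
      charts.\<close>
    have "chart_deriv c d (\<lambda>x. x) p (hd vs) = hd vs"
      using dlog_eq[OF L A id c(1,2,3,5,4), of vs] dlog_eq[OF L A id c(1,1,3,5,3), of vs]
        chart_deriv_id[OF A c(1,3), of "hd vs"] by simp
    then show "circle_mc c p vs = circle_mc d p (map (chart_deriv c d (\<lambda>x. x) p) vs)"
      using c(6) by (cases vs) (auto simp: circle_mc_def)
  next
    fix U \<phi> assume c: "(U, \<phi>) \<in> circle_atlas"
    have o: "open (\<phi> ` (U \<inter> sphere 0 1))"
      using open_chart_image[OF A c] circle_chart_subset[OF c] by (simp add: Int_absorb2)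
    have "param_smooth (\<phi> ` (U \<inter> sphere 0 1)) k (\<lambda>z. \<i> * complex_of_real ((\<lambda>(x, w). w 0) z))" for k
      by (intro param_smooth_linear[OF o linear_i_of_real] param_smooth_vec o continuous_intros)
    then show "smooth_family 1 (\<phi> ` (U \<inter> sphere 0 1)) (\<lambda>vs x. circle_mc (U, \<phi>) (inv_into U \<phi> x) vs)"
      by (simp add: smooth_family_iff circle_mc_def case_prod_unfold)
  qed auto
qed

lemma dlog_pullback:
  assumes "lie_group circle_group circle_atlas" "smooth_atlas A" "circle_smooth A W u" "c \<in> A" "p \<in> fst c" "p \<in> W"
    "length vs = 1"
  shows "dlog u c p vs = pullback_form circle_atlas u circle_mc c p vs"
proof -
  note d = the_chart[OF smooth_map_image[OF assms(3,6)]]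
  show ?thesis
    using dlog_eq[OF assms(1-4) conjunct1[OF d] assms(5,6) conjunct2[OF d], of vs] assms(7)
    by (cases vs) (auto simp: pullback_form_eq circle_mc_def)
qed

lemma diff_form_dlog:
  assumes "lie_group circle_group circle_atlas" "smooth_atlas A" "circle_smooth A W u"
  shows "diff_form A W 1 (dlog u)"
proof (rule diff_form_cong[OF assms(2)])
  show "diff_form A W 1 (pullback_form circle_atlas u circle_mc)"
    using circle_smooth_sphere[OF assms(1,3)]
    by (intro diff_form_pullback[OF assms(2) lie_group_atlas[OF assms(1)] assms(3) diff_form_circle_mc[OF assms(1)]]) auto
  show "form_eq A W 1 (pullback_form circle_atlas u circle_mc) (dlog u)"
    using dlog_pullback[OF assms] by (auto simp: form_eq_def)
qed

text \<open>\<open>dlog u\<close> is the pull-back of \<open>circle_mc\<close>, whose coefficient is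
  constant in every chart of the circle, and d commutes with the pull-back.\<close>

lemma ext_d_dlog:
  assumes "lie_group circle_group circle_atlas" "smooth_atlas A" "circle_smooth A W u" "c \<in> A" "p \<in> fst c" "p \<in> W"
    "length vs = 2"
  shows "ext_d (dlog u) c p vs = 0"
proof -
  have "ext_d (dlog u) c p vs = ext_d (pullback_form circle_atlas u circle_mc) c p vs"
    using dlog_pullback[OF assms(1-3)] assms
    by (intro ext_d_cong[OF assms(2) smooth_map_mopen[OF assms(3)], where q = 1]) (auto simp: form_eq_def)
  also have "\<dots> = pullback_form circle_atlas u (ext_d circle_mc) c p vs"
    using circle_smooth_sphere[OF assms(1,3)] assms
    by (intro ext_d_pullback[OF assms(2) lie_group_atlas[OF assms(1)] assms(3) diff_form_circle_mc[OF assms(1)]]) auto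
  also have "\<dots> = 0"
    by (simp add: pullback_form_eq ext_d_def circle_mc_def)
  finally show ?thesis .
qed

lemma dlog_imaginary:
  assumes "lie_group circle_group circle_atlas" "smooth_atlas A" "circle_smooth A W u" "c \<in> A" "p \<in> fst c" "p \<in> W"
    "length vs = 1"
  shows "Re (dlog u c p vs) = 0"
  using dlog_pullback[OF assms] by (simp add: pullback_form_eq circle_mc_def)

lemma chern_const_eq: "chern_const = \<i> / (2 * pi)"
  by (simp add: chern_const_def field_simps)

lemma chern_const_real: "Re z = 0 \<Longrightarrow> chern_const * z \<in> \<real>"
  by (simp add: chern_const_eq complex_is_Real_iff)

lemma circle_smooth_mult:
  assumes L: "lie_group circle_group circle_atlas" and A: "smooth_atlas A"
    and u: "circle_smooth A W u" and w: "circle_smooth A W w"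
  shows "circle_smooth A W (\<lambda>x. u x * w x)"
proof -
  note C = lie_group_atlas[OF L]
  have m: "smooth_map (prod_atlas circle_atlas circle_atlas) (sphere 0 1 \<times> sphere 0 1) circle_atlas (\<lambda>(g, h). g * h)"
    using L by (simp add: lie_group_def)
  show ?thesis
    using smooth_map_compose[OF A smooth_atlas_prod[OF C C] C smooth_map_Pair[OF A C C u w] m]
      circle_smooth_sphere[OF L u] circle_smooth_sphere[OF L w] by simp
qed

lemma inverse_circle_group: "lie_group circle_group circle_atlas \<Longrightarrow> x \<in> sphere 0 1 \<Longrightarrow> inv\<^bsub>circle_group\<^esub> x = inverse x"
proof -
  assume L: "lie_group circle_group circle_atlas" and x: "x \<in> sphere 0 1"
  then interpret group circle_group by (simp add: lie_group_def)
  have "x \<noteq> 0" using x by auto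
  then show ?thesis
    using x by (intro inv_equality) (auto simp: norm_inverse)
qed

lemma circle_smooth_inverse:
  assumes L: "lie_group circle_group circle_atlas" and A: "smooth_atlas A" and u: "circle_smooth A W u"
  shows "circle_smooth A W (\<lambda>x. inverse (u x))"
proof -
  note C = lie_group_atlas[OF L]
  have m: "smooth_map circle_atlas (sphere 0 1) circle_atlas (\<lambda>g. inv\<^bsub>circle_group\<^esub> g)"
    using L by (simp add: lie_group_def)
  have i: "circle_smooth A W (\<lambda>x. inv\<^bsub>circle_group\<^esub> (u x))"
    by (rule smooth_map_compose[OF A C C u m circle_smooth_sphere[OF L u]])
  show ?thesis
    by (rule smooth_map_cong[OF inverse_circle_group[OF L circle_smooth_sphere[OF L u]] i A])
qed

section \<open>Atlases glued from parametrizations\<close>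

text \<open>If a set is covered by injective images of open subsets of a manifold \<open>B\<close>,
  with smooth transitions, then the charts of \<open>B\<close> can be carried over to it.
  \<open>T1\<close> and \<open>T2\<close> say that \<open>T\<close> consists of the charts obtained
  in this way, the coordinate maps being compared on their domains only. For a bundle,
  \<open>B\<close> is base times circle and \<open>\<Theta> i\<close> sends \<open>(x, u)\<close> to
  the value at \<open>x\<close> of a local section, multiplied by \<open>u\<close>.\<close>

lemma glued_atlas:
  fixes B :: "('b, 'e::locally_convex) atlas" and T :: "('p, 'e) atlas" and \<Theta> :: "'i \<Rightarrow> 'b \<Rightarrow> 'p"
  assumes B: "smooth_atlas B" and D: "\<And>i. i \<in> I \<Longrightarrow> mopen B (D i)"
    and inj: "\<And>i. i \<in> I \<Longrightarrow> inj_on (\<Theta> i) (D i)"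
    and trans: "\<And>i j. i \<in> I \<Longrightarrow> j \<in> I \<Longrightarrow> \<exists>h. smooth_map B {b \<in> D i. \<Theta> i b \<in> \<Theta> j ` D j} B h \<and>
      (\<forall>b\<in>D i. \<Theta> i b \<in> \<Theta> j ` D j \<longrightarrow> h b \<in> D j \<and> \<Theta> j (h b) = \<Theta> i b)"
    and T1: "\<And>W \<xi>. (W, \<xi>) \<in> T \<Longrightarrow> \<exists>i\<in>I. \<exists>U \<psi>. (U, \<psi>) \<in> B \<and> W = \<Theta> i ` (U \<inter> D i) \<and> (\<forall>b\<in>U \<inter> D i. \<xi> (\<Theta> i b) = \<psi> b)"
    and T2: "\<And>i U \<psi>. i \<in> I \<Longrightarrow> (U, \<psi>) \<in> B \<Longrightarrow> \<exists>\<xi>. (\<Theta> i ` (U \<inter> D i), \<xi>) \<in> T \<and> (\<forall>b\<in>U \<inter> D i. \<xi> (\<Theta> i b) = \<psi> b)"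
  shows "smooth_atlas T" and "mcarrier T = (\<Union>i\<in>I. \<Theta> i ` D i)"
    and "\<And>i. i \<in> I \<Longrightarrow> smooth_map B (D i) T (\<Theta> i)"
    and "\<And>i. i \<in> I \<Longrightarrow> smooth_map T (\<Theta> i ` D i) B (inv_into (D i) (\<Theta> i))"
proof -
  have injT: "inj_on \<xi> W" if W\<xi>: "(W, \<xi>) \<in> T" for W \<xi>
  proof -
    obtain i U \<psi> where i: "i \<in> I" "(U, \<psi>) \<in> B" "W = \<Theta> i ` (U \<inter> D i)" "\<forall>b\<in>U \<inter> D i. \<xi> (\<Theta> i b) = \<psi> b"
      using T1[OF W\<xi>] by blast
    show ?thesis
      unfolding i(3) using i(4) smooth_atlas_inj[OF B i(2)] by (auto simp: inj_on_def)
  qed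
  show T: "smooth_atlas T"
  proof (rule smooth_atlas_defI[OF injT])
    fix W \<xi> W' \<xi>' assume c: "(W, \<xi>) \<in> T" "(W', \<xi>') \<in> T"
    obtain i U \<psi> where i: "i \<in> I" "(U, \<psi>) \<in> B" "W = \<Theta> i ` (U \<inter> D i)" "\<And>b. b\<in>U \<inter> D i \<Longrightarrow> \<xi> (\<Theta> i b) = \<psi> b"
      using T1[OF c(1)] by blast
    obtain j U' \<psi>' where j: "j \<in> I" "(U', \<psi>') \<in> B" "W' = \<Theta> j ` (U' \<inter> D j)" "\<And>b. b\<in>U' \<inter> D j \<Longrightarrow> \<xi>' (\<Theta> j b) = \<psi>' b"
      using T1[OF c(2)] by blast
    define E where "E = {b \<in> D i. \<Theta> i b \<in> \<Theta> j ` D j}"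
    obtain h where h: "smooth_map B E B h" "\<And>b. b \<in> E \<Longrightarrow> h b \<in> D j" "\<And>b. b \<in> E \<Longrightarrow> \<Theta> j (h b) = \<Theta> i b"
      using trans[OF i(1) j(1)] unfolding E_def by blast
    define R where "R = {b \<in> E \<inter> U. h b \<in> U'}"
    note rep = smooth_map_rep[OF h(1) i(2) j(2), folded R_def]
    have injU: "inj_on \<psi> U" by (rule smooth_atlas_inj[OF B i(2)])
    \<comment> \<open>By injectivity of \<open>\<Theta> j\<close> a point common to both charts has
      the parameter \<open>h b\<close> in \<open>D j\<close>. Hence the overlap corresponds to the
      domain \<open>R\<close> of the representation of \<open>h\<close>, which becomes the change of
      charts.\<close>
    have WW: "W \<inter> W' = \<Theta> i ` R"
    proof safe
      fix p assume "p \<in> W" "p \<in> W'"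
      then obtain b b' where b: "b \<in> U" "b \<in> D i" "p = \<Theta> i b" "b' \<in> U'" "b' \<in> D j" "p = \<Theta> j b'"
        unfolding i(3) j(3) by blast
      have "\<Theta> i b \<in> \<Theta> j ` D j" using b imageI[of b' "D j" "\<Theta> j"] by simp
      then have E: "b \<in> E" using b by (simp add: E_def)
      have "h b = b'" using inj_onD[OF inj[OF j(1)], of "h b" b'] h(2,3)[OF E] b by simp
      then show "p \<in> \<Theta> i ` R" using b E by (auto simp: R_def)
    next
      fix b assume "b \<in> R"
      then have b: "b \<in> E" "b \<in> U" "h b \<in> U'" "b \<in> D i" by (auto simp: R_def E_def)
      show "\<Theta> i b \<in> W" using b i(3) by blast
      have "\<Theta> j (h b) \<in> W'" using b h(2) j(3) by blast
      then show "\<Theta> i b \<in> W'" using h(3) b by simp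
    qed
    have "\<xi> ` \<Theta> i ` R = \<psi> ` R"
      unfolding image_image using i(4) by (intro image_cong) (auto simp: R_def E_def)
    then have im: "\<xi> ` (W \<inter> W') = \<psi> ` R" using WW by simp
    have eq: "(\<psi>' \<circ> h \<circ> inv_into U \<psi>) x = (\<xi>' \<circ> inv_into W \<xi>) x" if x: "x \<in> \<psi> ` R" for x
    proof -
      obtain b where "b \<in> R" "x = \<psi> b" using x by blast
      then have b: "x = \<psi> b" "b \<in> E" "b \<in> U" "h b \<in> U'" "b \<in> D i" by (auto simp: R_def E_def)
      have "\<Theta> i b \<in> W" using b i(3) by blast
      then have "inv_into W \<xi> x = \<Theta> i b"
        using inv_into_f_f[OF injT[OF c(1)], of "\<Theta> i b"] i(4) b by simp
      moreover have "\<xi>' (\<Theta> i b) = \<psi>' (h b)" using j(4)[of "h b"] h(2,3) b by simp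
      ultimately show ?thesis using injU b by simp
    qed
    show "open (\<xi> ` (W \<inter> W')) \<and> smooth_on (\<xi> ` (W \<inter> W')) (\<xi>' \<circ> inv_into W \<xi>)"
      unfolding im by (intro conjI rep(2) smooth_on_cong_imp[OF rep(2,3)]) (rule eq)
  qed
  show "mcarrier T = (\<Union>i\<in>I. \<Theta> i ` D i)"
  proof safe
    fix p assume "p \<in> mcarrier T"
    then obtain W \<xi> where "(W, \<xi>) \<in> T" "p \<in> W" by (rule mcarrierE)
    with T1 show "p \<in> (\<Union>i\<in>I. \<Theta> i ` D i)" by blast
  next
    fix i b assume i: "i \<in> I" "b \<in> D i"
    then obtain U \<psi> where U: "(U, \<psi>) \<in> B" "b \<in> U"
      using mopen_subset[OF D] mcarrierE by (metis subsetD)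
    then obtain \<xi> where "(\<Theta> i ` (U \<inter> D i), \<xi>) \<in> T" using T2 i by blast
    then show "\<Theta> i b \<in> mcarrier T" using i U by (blast intro: mcarrierI)
  qed
  have chart: "\<exists>U \<psi> \<xi>. (U, \<psi>) \<in> B \<and> b \<in> U \<and> (\<Theta> i ` (U \<inter> D i), \<xi>) \<in> T \<and> (\<forall>b\<in>U \<inter> D i. \<xi> (\<Theta> i b) = \<psi> b)"
    if i: "i \<in> I" "b \<in> D i" for i b
  proof -
    obtain U \<psi> where U: "(U, \<psi>) \<in> B" "b \<in> U"
      using mopen_subset[OF D] mcarrierE i by (metis subsetD)
    then show ?thesis using T2[OF i(1) U(1)] by blast
  qed
  show "smooth_map B (D i) T (\<Theta> i)" if i: "i \<in> I" for i
  proof (rule smooth_mapI[OF B T D[OF i]])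
    fix b assume b: "b \<in> D i"
    obtain U \<psi> \<xi> where U: "(U, \<psi>) \<in> B" "b \<in> U" "(\<Theta> i ` (U \<inter> D i), \<xi>) \<in> T" "\<forall>b\<in>U \<inter> D i. \<xi> (\<Theta> i b) = \<psi> b"
      using chart[OF i b] by blast
    have m: "mopen B (U \<inter> D i)" by (rule mopen_Int[OF B mopen_chart[OF B U(1)] D[OF i]])
    have o: "open (\<psi> ` (U \<inter> D i))" by (rule mopen_image_subset[OF m U(1)]) auto
    have "smooth_on (\<psi> ` (U \<inter> D i)) (\<xi> \<circ> \<Theta> i \<circ> inv_into U \<psi>)"
      by (rule smooth_on_cong_imp[OF o smooth_on_ident[OF o]]) (use U(4) smooth_atlas_inj[OF B U(1)] in auto)
    then show "\<exists>U \<phi> V \<psi> N. (U, \<phi>) \<in> B \<and> (V, \<psi>) \<in> T \<and> mopen B N \<and> b \<in> N \<and>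
      N \<subseteq> U \<inter> D i \<and> \<Theta> i ` N \<subseteq> V \<and> smooth_on (\<phi> ` N) (\<psi> \<circ> \<Theta> i \<circ> inv_into U \<phi>)"
      using U m b by (intro exI[of _ U] exI[of _ \<psi>] exI[of _ "\<Theta> i ` (U \<inter> D i)"] exI[of _ \<xi>] exI[of _ "U \<inter> D i"]) auto
  qed
  show "smooth_map T (\<Theta> i ` D i) B (inv_into (D i) (\<Theta> i))" if i: "i \<in> I" for i
  proof (rule smooth_mapI[OF T B])
    show "mopen T (\<Theta> i ` D i)"
    proof (rule mopen_local, safe)
      fix b assume b: "b \<in> D i"
      obtain U \<psi> \<xi> where U: "(U, \<psi>) \<in> B" "b \<in> U" "(\<Theta> i ` (U \<inter> D i), \<xi>) \<in> T"
        using chart[OF i b] by blast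
      then show "\<exists>N. mopen T N \<and> \<Theta> i b \<in> N \<and> N \<subseteq> \<Theta> i ` D i"
        using mopen_chart[OF T U(3)] b by (intro exI[of _ "\<Theta> i ` (U \<inter> D i)"]) auto
    qed
    fix p assume "p \<in> \<Theta> i ` D i"
    then obtain b where b: "b \<in> D i" "p = \<Theta> i b" by blast
    obtain U \<psi> \<xi> where U: "(U, \<psi>) \<in> B" "b \<in> U" "(\<Theta> i ` (U \<inter> D i), \<xi>) \<in> T" "\<forall>b\<in>U \<inter> D i. \<xi> (\<Theta> i b) = \<psi> b"
      using chart[OF i b(1)] by blast
    let ?W = "\<Theta> i ` (U \<inter> D i)"
    have o: "open (\<xi> ` ?W)" by (rule open_chart_image[OF T U(3)])
    have inv: "inv_into (D i) (\<Theta> i) (\<Theta> i b) = b" if "b \<in> D i" for b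
      using inj[OF i] that by simp
    have "smooth_on (\<xi> ` ?W) (\<psi> \<circ> inv_into (D i) (\<Theta> i) \<circ> inv_into ?W \<xi>)"
    proof (rule smooth_on_cong_imp[OF o smooth_on_ident[OF o]])
      fix x assume "x \<in> \<xi> ` ?W"
      then obtain b where b: "b \<in> U" "b \<in> D i" "x = \<xi> (\<Theta> i b)" by blast
      have "inv_into ?W \<xi> x = \<Theta> i b" using injT[OF U(3)] b by simp
      then show "x = (\<psi> \<circ> inv_into (D i) (\<Theta> i) \<circ> inv_into ?W \<xi>) x" using inv b U(4) by simp
    qed
    then show "\<exists>U \<phi> V \<psi> N. (U, \<phi>) \<in> T \<and> (V, \<psi>) \<in> B \<and> mopen T N \<and> p \<in> N \<and>
      N \<subseteq> U \<inter> \<Theta> i ` D i \<and> inv_into (D i) (\<Theta> i) ` N \<subseteq> V \<and>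
      smooth_on (\<phi> ` N) (\<psi> \<circ> inv_into (D i) (\<Theta> i) \<circ> inv_into U \<phi>)"
      using U b mopen_chart[OF T U(3)] inv
      by (intro exI[of _ ?W] exI[of _ \<xi>] exI[of _ U] exI[of _ \<psi>] exI[of _ ?W]) auto
  qed
qed

section \<open>Circle bundles\<close>

text \<open>The predicate \<open>circle_bundle\<close> without the Hausdorff condition on the base.\<close>

definition cbundle :: "('x, 'e::locally_convex) atlas \<Rightarrow> ('x, 'p, complex) pbundle \<Rightarrow> bool" where
  "cbundle A P \<longleftrightarrow> lie_group circle_group circle_atlas \<and> smooth_atlas A \<and>
     (\<forall>p\<in>tot P. proj P p \<in> mcarrier A) \<and>
     (\<forall>p\<in>tot P. act P p 1 = p) \<and>
     (\<forall>p\<in>tot P. \<forall>g\<in>sphere 0 1. act P p g \<in> tot P \<and> proj P (act P p g) = proj P p) \<and>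
     (\<forall>p\<in>tot P. \<forall>g\<in>sphere 0 1. \<forall>h\<in>sphere 0 1. act P (act P p g) h = act P p (g * h)) \<and>
     (\<forall>p\<in>tot P. \<forall>q\<in>tot P. proj P p = proj P q \<longrightarrow> (\<exists>!g. g \<in> sphere 0 1 \<and> q = act P p g)) \<and>
     \<Union> (fst ` lsecs P) = mcarrier A \<and>
     (\<forall>(V, \<sigma>)\<in>lsecs P. mopen A V \<and> (\<forall>x\<in>V. \<sigma> x \<in> tot P \<and> proj P (\<sigma> x) = x)) \<and>
     (\<forall>(V, \<sigma>)\<in>lsecs P. \<forall>(W, \<tau>)\<in>lsecs P.
        \<exists>g. circle_smooth A (V \<inter> W) g \<and> (\<forall>x\<in>V \<inter> W. \<tau> x = act P (\<sigma> x) (g x)))"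

lemma cbundle_of_circle_bundle:
  assumes "circle_bundle A P"
  shows "cbundle A P"
proof -
  have "\<forall>p\<in>tot P. proj P p \<in> mcarrier A"
    using assms by (auto simp: principal_bundle_def)
  then show ?thesis
    using assms unfolding principal_bundle_def cbundle_def circle_group_simps
    by (simp add: smooth_manifold_atlas)
qed

context
  fixes A :: "('x, 'e::locally_convex) atlas" and P :: "('x, 'p, complex) pbundle"
  assumes P: "cbundle A P"
begin

lemmas cbundleD = P[unfolded cbundle_def]

lemma cb_lie:
  "lie_group circle_group circle_atlas"
  by (rule cbundleD[THEN conjunct1])

lemma cb_atlas:
  "smooth_atlas A"
  by (rule cbundleD[THEN conjunct2, THEN conjunct1])

lemma cb_proj:
  "p \<in> tot P \<Longrightarrow> proj P p \<in> mcarrier A"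
  using cbundleD[THEN conjunct2, THEN conjunct2, THEN conjunct1] by blast

lemma cb_act_one:
  "p \<in> tot P \<Longrightarrow> act P p 1 = p"
  using cbundleD[THEN conjunct2, THEN conjunct2, THEN conjunct2, THEN conjunct1] by blast

lemma cb_act:
  "p \<in> tot P \<Longrightarrow> g \<in> sphere 0 1 \<Longrightarrow> act P p g \<in> tot P"
  using cbundleD[THEN conjunct2, THEN conjunct2, THEN conjunct2, THEN conjunct2, THEN conjunct1] by blast

lemma cb_proj_act:
  "p \<in> tot P \<Longrightarrow> g \<in> sphere 0 1 \<Longrightarrow> proj P (act P p g) = proj P p"
  using cbundleD[THEN conjunct2, THEN conjunct2, THEN conjunct2, THEN conjunct2, THEN conjunct1] by blast

lemma cb_act_act:
  "p \<in> tot P \<Longrightarrow> g \<in> sphere 0 1 \<Longrightarrow> h \<in> sphere 0 1 \<Longrightarrow> act P (act P p g) h = act P p (g * h)"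
  using cbundleD[THEN conjunct2, THEN conjunct2, THEN conjunct2, THEN conjunct2, THEN conjunct2, THEN conjunct1] by blast

lemma cb_transitive:
  "p \<in> tot P \<Longrightarrow> q \<in> tot P \<Longrightarrow> proj P p = proj P q \<Longrightarrow> \<exists>!g. g \<in> sphere 0 1 \<and> q = act P p g"
  by (rule cbundleD[THEN conjunct2, THEN conjunct2, THEN conjunct2, THEN conjunct2, THEN conjunct2, THEN conjunct2, THEN conjunct1, rule_format])

lemma cb_cover:
  "\<Union> (fst ` lsecs P) = mcarrier A"
  by (rule cbundleD[THEN conjunct2, THEN conjunct2, THEN conjunct2, THEN conjunct2, THEN conjunct2, THEN conjunct2, THEN conjunct2, THEN conjunct1])

lemma cb_lsec_mopen:
  "(V, \<sigma>) \<in> lsecs P \<Longrightarrow> mopen A V"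
  using cbundleD[THEN conjunct2, THEN conjunct2, THEN conjunct2, THEN conjunct2, THEN conjunct2, THEN conjunct2, THEN conjunct2, THEN conjunct2, THEN conjunct1] by blast

lemma cb_lsec:
  "(V, \<sigma>) \<in> lsecs P \<Longrightarrow> x \<in> V \<Longrightarrow> \<sigma> x \<in> tot P \<and> proj P (\<sigma> x) = x"
  using cbundleD[THEN conjunct2, THEN conjunct2, THEN conjunct2, THEN conjunct2, THEN conjunct2, THEN conjunct2, THEN conjunct2, THEN conjunct2, THEN conjunct1] by blast

lemma cb_transition:
  "(V, \<sigma>) \<in> lsecs P \<Longrightarrow> (W, \<tau>) \<in> lsecs P \<Longrightarrow>
    \<exists>g. circle_smooth A (V \<inter> W) g \<and> (\<forall>x\<in>V \<inter> W. \<tau> x = act P (\<sigma> x) (g x))"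
  using cbundleD[THEN conjunct2, THEN conjunct2, THEN conjunct2, THEN conjunct2, THEN conjunct2, THEN conjunct2, THEN conjunct2, THEN conjunct2, THEN conjunct2] by blast

lemma cb_lsecE:
  assumes "x \<in> mcarrier A"
  obtains V \<sigma> where "(V, \<sigma>) \<in> lsecs P" "x \<in> V"
  using assms cb_cover by (metis (no_types, lifting) UN_E prod.collapse)

lemma cb_act_inj: "p \<in> tot P \<Longrightarrow> g \<in> sphere 0 1 \<Longrightarrow> h \<in> sphere 0 1 \<Longrightarrow> act P p g = act P p h \<Longrightarrow> g = h"
  using cb_transitive[of p "act P p g"] cb_act[of p g] cb_proj_act[of p g] by metis

lemma cb_fibre_div: "p \<in> tot P \<Longrightarrow> g \<in> sphere 0 1 \<Longrightarrow> fibre_div circle_group P p (act P p g) = g"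
  unfolding fibre_div_def using cb_act_inj[of p] by (intro the_equality) auto

lemma cb_obtain:
  assumes "p \<in> tot P" "q \<in> tot P" "proj P p = proj P q"
  obtains g where "g \<in> sphere 0 1" "q = act P p g"
  using cb_transitive[OF assms] by blast

section \<open>The smooth structure of the total space\<close>

abbreviation (input) "lparam \<equiv> \<lambda>i (x, u). act P (snd i x) u"
abbreviation (input) "ldom \<equiv> \<lambda>i. fst i \<times> (sphere 0 1 :: complex set)"

lemma circle_mopen: "mopen circle_atlas (sphere 0 1)"
  using mopen_mcarrier[OF lie_group_atlas[OF cb_lie]] cb_lie by (simp add: lie_group_def)

lemma prod_circle_atlas: "smooth_atlas (prod_atlas A circle_atlas)"
  by (rule smooth_atlas_prod[OF cb_atlas lie_group_atlas[OF cb_lie]])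

lemma ldom_mopen: "i \<in> lsecs P \<Longrightarrow> mopen (prod_atlas A circle_atlas) (ldom i)"
  using cb_lsec_mopen[of "fst i" "snd i"]
  by (intro mopen_Times[OF cb_atlas lie_group_atlas[OF cb_lie] _ circle_mopen]) simp

lemma lparam_inj: "i \<in> lsecs P \<Longrightarrow> inj_on (lparam i) (ldom i)"
proof (rule inj_onI)
  fix a b assume i: "i \<in> lsecs P" and ab: "a \<in> ldom i" "b \<in> ldom i" "lparam i a = lparam i b"
  obtain x u where a: "a = (x, u)" by (cases a)
  obtain y w where b: "b = (y, w)" by (cases b)
  have x: "snd i x \<in> tot P" "proj P (snd i x) = x" "snd i y \<in> tot P" "proj P (snd i y) = y"
    using cb_lsec[of "fst i" "snd i"] i ab a b by auto
  have "x = y"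
    using cb_proj_act[OF x(1), of u] cb_proj_act[OF x(3), of w] ab a b x by simp
  then show "a = b" using cb_act_inj[OF x(1), of u w] ab a b by simp
qed

lemma lparam_image:
  assumes "i \<in> lsecs P"
  shows "lparam i ` ldom i = {p \<in> tot P. proj P p \<in> fst i}"
proof safe
  fix x u assume "x \<in> fst i" "(u :: complex) \<in> sphere 0 1"
  then show "act P (snd i x) u \<in> tot P" "proj P (act P (snd i x) u) \<in> fst i"
    using cb_lsec[of "fst i" "snd i" x] assms cb_act cb_proj_act by auto
next
  fix p assume p: "p \<in> tot P" "proj P p \<in> fst i"
  have "snd i (proj P p) \<in> tot P" "proj P (snd i (proj P p)) = proj P p"
    using cb_lsec[of "fst i" "snd i"] assms p by auto
  then obtain g where "g \<in> sphere 0 1" "p = act P (snd i (proj P p)) g"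
    using cb_obtain p(1) by metis
  then show "p \<in> lparam i ` ldom i" using p by (intro image_eqI[of _ _ "(proj P p, g)"]) auto
qed

lemma lparam_inv:
  assumes "i \<in> lsecs P" "x \<in> fst i" "u \<in> sphere 0 1"
  shows "inv_into (ldom i) (lparam i) (act P (snd i x) u) = (x, u)"
  using inv_into_f_f[OF lparam_inj[OF assms(1)], of "(x, u)"] assms by simp

text \<open>If the section of \<open>i\<close> is that of \<open>j\<close> times \<open>g\<close>,
  then a point with coordinates \<open>(x, u)\<close> over \<open>i\<close> has coordinates
  \<open>(x, g x * u)\<close> over \<open>j\<close>; this map is smooth since \<open>g\<close> and
  the multiplication of the circle are.\<close>

lemma lparam_transition:
  assumes i: "i \<in> lsecs P" and j: "j \<in> lsecs P"
  shows "\<exists>h. smooth_map (prod_atlas A circle_atlas) {b \<in> ldom i. lparam i b \<in> lparam j ` ldom j} (prod_atlas A circle_atlas) h \<and>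
      (\<forall>b\<in>ldom i. lparam i b \<in> lparam j ` ldom j \<longrightarrow> h b \<in> ldom j \<and> lparam j (h b) = lparam i b)"
proof -
  note C = lie_group_atlas[OF cb_lie] and B = prod_circle_atlas
  obtain g where g: "circle_smooth A (fst j \<inter> fst i) g" "\<And>x. x \<in> fst j \<inter> fst i \<Longrightarrow> snd i x = act P (snd j x) (g x)"
    using cb_transition[of "fst j" "snd j" "fst i" "snd i"] i j by auto
  let ?E = "(fst j \<inter> fst i) \<times> (sphere 0 1 :: complex set)"
  have E: "{b \<in> ldom i. lparam i b \<in> lparam j ` ldom j} = ?E"
    unfolding lparam_image[OF j]
    using cb_lsec[of "fst i" "snd i"] i cb_act cb_proj_act by auto
  have mE: "mopen (prod_atlas A circle_atlas) ?E"
    by (rule mopen_Times[OF cb_atlas C smooth_map_mopen[OF g(1)] circle_mopen])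
  note f = smooth_map_fst[OF cb_atlas C mE] and s = smooth_map_snd[OF cb_atlas C mE]
  have "circle_smooth (prod_atlas A circle_atlas) ?E (\<lambda>b. g (fst b))"
    by (rule smooth_map_compose[OF B cb_atlas C f g(1)]) auto
  then have "circle_smooth (prod_atlas A circle_atlas) ?E (\<lambda>b. g (fst b) * snd b)"
    by (rule circle_smooth_mult[OF cb_lie B _ s])
  then have h: "smooth_map (prod_atlas A circle_atlas) ?E (prod_atlas A circle_atlas) (\<lambda>b. (fst b, g (fst b) * snd b))"
    by (rule smooth_map_Pair[OF B cb_atlas C f])
  have "(fst b, g (fst b) * snd b) \<in> ldom j \<and> lparam j (fst b, g (fst b) * snd b) = lparam i b" if "b \<in> ?E" for b
  proof -
    have u: "g (fst b) \<in> sphere 0 1" using circle_smooth_sphere[OF cb_lie g(1)] that by auto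
    then have "act P (snd j (fst b)) (g (fst b) * snd b) = act P (snd i (fst b)) (snd b)"
      using g(2)[of "fst b"] cb_act_act[of "snd j (fst b)" "g (fst b)" "snd b"] cb_lsec[of "fst j" "snd j" "fst b"] that j
      by (auto simp: mem_Times_iff)
    then show ?thesis using that u by (auto simp: norm_mult case_prod_beta)
  qed
  then show ?thesis
    unfolding E using h E by (intro exI[of _ "\<lambda>b. (fst b, g (fst b) * snd b)"]) blast
qed

lemma ctotal_chart1:
  assumes "(W, \<xi>) \<in> ctotal A P"
  shows "\<exists>i\<in>lsecs P. \<exists>U \<psi>. (U, \<psi>) \<in> prod_atlas A circle_atlas \<and> W = lparam i ` (U \<inter> ldom i) \<and>
      (\<forall>b\<in>U \<inter> ldom i. \<xi> (lparam i b) = \<psi> b)"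
proof -
  obtain U \<phi> V \<sigma> K \<psi> where c: "W = {act P (\<sigma> x) g | x g. x \<in> U \<inter> V \<and> g \<in> K}"
    "\<xi> = (\<lambda>p. (\<phi> (proj P p), \<psi> (fibre_div circle_group P (\<sigma> (proj P p)) p)))"
    "(U, \<phi>) \<in> A" "(V, \<sigma>) \<in> lsecs P" "(K, \<psi>) \<in> circle_atlas"
    using assms unfolding total_atlas_def by blast
  have K: "K \<subseteq> sphere 0 1" by (rule circle_chart_subset[OF c(5)])
  have "W = lparam (V, \<sigma>) ` (U \<times> K \<inter> ldom (V, \<sigma>))"
    unfolding c(1) using K by force
  moreover have "\<xi> (act P (\<sigma> x) u) = (\<phi> x, \<psi> u)" if "x \<in> V" "u \<in> K" for x u
    using cb_lsec[OF c(4) that(1)] K that(2) cb_proj_act[of "\<sigma> x" u] cb_fibre_div[of "\<sigma> x" u] by (auto simp: c(2))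
  ultimately show ?thesis
    using c(4) prod_atlasI[OF c(3,5)]
    by (intro bexI[of _ "(V, \<sigma>)"] exI[of _ "U \<times> K"] exI[of _ "map_prod \<phi> \<psi>"]) auto
qed

lemma ctotal_chart2:
  assumes "i \<in> lsecs P" "(U, \<psi>) \<in> prod_atlas A circle_atlas"
  shows "\<exists>\<xi>. (lparam i ` (U \<inter> ldom i), \<xi>) \<in> ctotal A P \<and> (\<forall>b\<in>U \<inter> ldom i. \<xi> (lparam i b) = \<psi> b)"
proof -
  obtain V \<sigma> where i: "i = (V, \<sigma>)" by (cases i)
  obtain X \<phi> K \<chi>' where c: "U = X \<times> K" "\<psi> = map_prod \<phi> \<chi>'" "(X, \<phi>) \<in> A" "(K, \<chi>') \<in> circle_atlas"
    using prod_atlasE[OF assms(2)] by (metis prod.inject)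
  have K: "K \<subseteq> sphere 0 1" by (rule circle_chart_subset[OF c(4)])
  let ?\<xi> = "\<lambda>p. (\<phi> (proj P p), \<chi>' (fibre_div circle_group P (\<sigma> (proj P p)) p))"
  have "({act P (\<sigma> x) g | x g. x \<in> X \<inter> V \<and> g \<in> K}, ?\<xi>) \<in> ctotal A P"
    unfolding total_atlas_def using c(3,4) assms(1) i by blast
  moreover have "{act P (\<sigma> x) g | x g. x \<in> X \<inter> V \<and> g \<in> K} = lparam i ` (U \<inter> ldom i)"
    using K by (force simp: c i)
  moreover have "?\<xi> (act P (\<sigma> x) u) = (\<phi> x, \<chi>' u)" if "x \<in> V" "u \<in> K" for x u
    using cb_lsec[OF assms(1)[unfolded i] that(1)] K that(2) cb_proj_act[of "\<sigma> x" u] cb_fibre_div[of "\<sigma> x" u] by auto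
  ultimately show ?thesis
    by (intro exI[of _ ?\<xi>]) (auto simp: c i)
qed

lemma smooth_atlas_ctotal: "smooth_atlas (ctotal A P)"
  by (rule glued_atlas(1)[where I = "lsecs P" and \<Theta> = "lparam" and D = "ldom", OF prod_circle_atlas];
      (erule ldom_mopen | erule lparam_inj | erule (1) lparam_transition | erule ctotal_chart1 | erule (1) ctotal_chart2 | assumption))

lemma mcarrier_ctotal_lparam: "mcarrier (ctotal A P) = (\<Union>i\<in>lsecs P. lparam i ` ldom i)"
  by (rule glued_atlas(2)[where I = "lsecs P" and \<Theta> = "lparam" and D = "ldom", OF prod_circle_atlas];
      (erule ldom_mopen | erule lparam_inj | erule (1) lparam_transition | erule ctotal_chart1 | erule (1) ctotal_chart2 | assumption))

lemma smooth_map_lparam: "i \<in> lsecs P \<Longrightarrow> smooth_map (prod_atlas A circle_atlas) (ldom i) (ctotal A P) (lparam i)"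
  by (rule glued_atlas(3)[where I = "lsecs P" and \<Theta> = "lparam" and D = "ldom", OF prod_circle_atlas];
      (erule ldom_mopen | erule lparam_inj | erule (1) lparam_transition | erule ctotal_chart1 | erule (1) ctotal_chart2 | assumption))

lemma smooth_map_inv_lparam:
  "i \<in> lsecs P \<Longrightarrow> smooth_map (ctotal A P) (lparam i ` ldom i) (prod_atlas A circle_atlas) (inv_into (ldom i) (lparam i))"
  by (rule glued_atlas(4)[where I = "lsecs P" and \<Theta> = "lparam" and D = "ldom", OF prod_circle_atlas];
      (erule ldom_mopen | erule lparam_inj | erule (1) lparam_transition | erule ctotal_chart1 | erule (1) ctotal_chart2 | assumption))

lemma mcarrier_ctotal: "mcarrier (ctotal A P) = tot P"
proof -
  have "mcarrier (ctotal A P) = (\<Union>i\<in>lsecs P. {p \<in> tot P. proj P p \<in> fst i})"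
    unfolding mcarrier_ctotal_lparam by (intro SUP_cong refl lparam_image)
  also have "\<dots> = tot P"
    using cb_cover cb_proj by blast
  finally show ?thesis .
qed

lemma mopen_tot: "mopen (ctotal A P) (tot P)"
  using mopen_mcarrier[OF smooth_atlas_ctotal] mcarrier_ctotal by simp

lemma smooth_map_proj: "smooth_map (ctotal A P) (tot P) A (proj P)"
proof (rule smooth_map_local)
  fix p assume p: "p \<in> tot P"
  obtain V \<sigma> where V: "(V, \<sigma>) \<in> lsecs P" "proj P p \<in> V"
    using cb_lsecE[OF cb_proj[OF p]] by blast
  let ?i = "(V, \<sigma>)" and ?N = "{p \<in> tot P. proj P p \<in> V}"
  have im: "lparam ?i ` ldom ?i = ?N" using lparam_image[OF V(1)] by simp
  have "smooth_map (ctotal A P) ?N (prod_atlas A circle_atlas) (inv_into (ldom ?i) (lparam ?i))"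
    using smooth_map_inv_lparam[OF V(1)] im by simp
  then have s: "smooth_map (ctotal A P) ?N A (\<lambda>p. fst (inv_into (ldom ?i) (lparam ?i) p))"
  proof (rule smooth_map_compose[OF smooth_atlas_ctotal prod_circle_atlas cb_atlas _
        smooth_map_fst[OF cb_atlas lie_group_atlas[OF cb_lie] ldom_mopen[OF V(1)]]])
    fix p assume "p \<in> ?N"
    then have "p \<in> lparam ?i ` ldom ?i" using im by blast
    then show "inv_into (ldom ?i) (lparam ?i) p \<in> ldom ?i" by (rule inv_into_into)
  qed
  have e: "fst (inv_into (ldom ?i) (lparam ?i) q) = proj P q" if q: "q \<in> ?N" for q
  proof -
    have "q \<in> lparam ?i ` ldom ?i" using im q by blast
    then obtain x u where x: "x \<in> V" "u \<in> sphere 0 1" "q = act P (\<sigma> x) u" by auto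
    then show ?thesis
      using lparam_inv[OF V(1), of x u] cb_lsec[OF V(1) x(1)] cb_proj_act[of "\<sigma> x" u] by simp
  qed
  show "\<exists>N. p \<in> N \<and> N \<subseteq> tot P \<and> smooth_map (ctotal A P) N A (proj P)"
    using smooth_map_cong[OF e s smooth_atlas_ctotal] p V by (intro exI[of _ ?N]) auto
qed

text \<open>Smoothness into a total space is tested by writing the map locally as a section along
  the base map, multiplied by a smooth circle-valued function. Together with the converse
  \<open>smooth_map_ctotalE\<close> this replaces charts of total spaces in the treatment of
  pull-backs, inverses and tensor products.\<close>

lemma smooth_map_ctotalI:
  assumes A': "smooth_atlas A'" and y: "smooth_map A' W A y"
    and loc: "\<And>p. p \<in> W \<Longrightarrow> \<exists>N V \<sigma> k. p \<in> N \<and> N \<subseteq> W \<and> (V, \<sigma>) \<in> lsecs P \<and> circle_smooth A' N k \<and>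
      (\<forall>x\<in>N. y x \<in> V \<and> f x = act P (\<sigma> (y x)) (k x))"
  shows "smooth_map A' W (ctotal A P) f"
proof (rule smooth_map_local)
  fix p assume "p \<in> W"
  from loc[OF this] obtain N V \<sigma> k where N: "p \<in> N" "N \<subseteq> W" "(V, \<sigma>) \<in> lsecs P" "circle_smooth A' N k"
    and f: "\<And>x. x \<in> N \<Longrightarrow> y x \<in> V" "\<And>x. x \<in> N \<Longrightarrow> act P (\<sigma> (y x)) (k x) = f x" by metis
  note y' = smooth_map_subset[OF y A' smooth_map_mopen[OF N(4)] N(2)]
  have s: "smooth_map A' N (ctotal A P) (\<lambda>x. lparam (V, \<sigma>) (y x, k x))"
    by (rule smooth_map_compose[OF A' prod_circle_atlas smooth_atlas_ctotal
        smooth_map_Pair[OF A' cb_atlas lie_group_atlas[OF cb_lie] y' N(4)] smooth_map_lparam[OF N(3)]])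
       (use f(1) circle_smooth_sphere[OF cb_lie N(4)] in auto)
  have "smooth_map A' N (ctotal A P) f"
    by (rule smooth_map_cong[OF _ s A']) (simp add: f)
  then show "\<exists>N. p \<in> N \<and> N \<subseteq> W \<and> smooth_map A' N (ctotal A P) f" using N by blast
qed

lemma smooth_map_ctotalE:
  assumes A': "smooth_atlas A'" and h: "smooth_map A' W (ctotal A P) h" and p: "p \<in> W"
  obtains N V \<sigma> k where "p \<in> N" "N \<subseteq> W" "(V, \<sigma>) \<in> lsecs P" "circle_smooth A' N k"
    "\<And>x. x \<in> N \<Longrightarrow> proj P (h x) \<in> V \<and> h x = act P (\<sigma> (proj P (h x))) (k x)"
proof -
  have "h p \<in> tot P" using smooth_map_image[OF h p] mcarrier_ctotal by simp
  then obtain V \<sigma> where V: "(V, \<sigma>) \<in> lsecs P" "proj P (h p) \<in> V"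
    using cb_lsecE[OF cb_proj] by blast
  let ?i = "(V, \<sigma>)" and ?N = "{x \<in> W. h x \<in> {p \<in> tot P. proj P p \<in> V}}"
  let ?k = "\<lambda>x. snd (inv_into (ldom ?i) (lparam ?i) (h x))"
  have im: "lparam ?i ` ldom ?i = {p \<in> tot P. proj P p \<in> V}" using lparam_image[OF V(1)] by simp
  note inv = smooth_map_inv_lparam[OF V(1), unfolded im]
  have mN: "mopen A' ?N"
    by (rule mopen_vimage[OF A' smooth_atlas_ctotal h smooth_map_mopen[OF inv]])
  have h': "smooth_map A' ?N (ctotal A P) h"
    by (rule smooth_map_subset[OF h A' mN]) auto
  have "smooth_map A' ?N (prod_atlas A circle_atlas) (\<lambda>x. inv_into (ldom ?i) (lparam ?i) (h x))"
    by (rule smooth_map_compose[OF A' smooth_atlas_ctotal prod_circle_atlas h' inv]) auto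
  then have k: "circle_smooth A' ?N ?k"
  proof (rule smooth_map_compose[OF A' prod_circle_atlas lie_group_atlas[OF cb_lie] _
        smooth_map_snd[OF cb_atlas lie_group_atlas[OF cb_lie] ldom_mopen[OF V(1)]]])
    fix x assume "x \<in> ?N"
    then have "h x \<in> lparam ?i ` ldom ?i" using im by blast
    then show "inv_into (ldom ?i) (lparam ?i) (h x) \<in> ldom ?i" by (rule inv_into_into)
  qed
  have e: "proj P (h x) \<in> V \<and> h x = act P (\<sigma> (proj P (h x))) (?k x)" if x: "x \<in> ?N" for x
  proof -
    have "h x \<in> lparam ?i ` ldom ?i" using im x by blast
    then obtain z u where z: "z \<in> V" "u \<in> sphere 0 1" "h x = act P (\<sigma> z) u" by auto
    then show ?thesis
      using lparam_inv[OF V(1), of z u] cb_lsec[OF V(1) z(1)] cb_proj_act[of "\<sigma> z" u] by simp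
  qed
  have pN: "p \<in> ?N"
    using p V \<open>h p \<in> tot P\<close> by simp
  show ?thesis
    by (rule that[OF pN _ V(1) k e]) auto
qed

lemma smooth_map_proj_compose:
  assumes "smooth_atlas A'" "smooth_map A' W (ctotal A P) h"
  shows "smooth_map A' W A (\<lambda>x. proj P (h x))"
  using smooth_map_image[OF assms(2)] mcarrier_ctotal
  by (intro smooth_map_compose[OF assms(1) smooth_atlas_ctotal cb_atlas assms(2) smooth_map_proj]) auto

lemma smooth_map_lsec:
  assumes "(V, \<sigma>) \<in> lsecs P"
  shows "smooth_map A V (ctotal A P) \<sigma>"
proof (rule smooth_map_ctotalI[OF cb_atlas smooth_map_id[OF cb_atlas cb_lsec_mopen[OF assms]]])
  fix p assume p: "p \<in> V"
  have m: "1 \<in> mcarrier circle_atlas" using cb_lie by (simp add: lie_group_def)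
  show "\<exists>N V' \<sigma>' k. p \<in> N \<and> N \<subseteq> V \<and> (V', \<sigma>') \<in> lsecs P \<and> circle_smooth A N k \<and>
      (\<forall>x\<in>N. x \<in> V' \<and> \<sigma> x = act P (\<sigma>' x) (k x))"
    using p assms smooth_map_const[OF cb_atlas lie_group_atlas[OF cb_lie] cb_lsec_mopen[OF assms] m]
      cb_lsec[OF assms] cb_act_one
    by (intro exI[of _ V] exI[of _ V] exI[of _ \<sigma>] exI[of _ "\<lambda>_. 1"]) auto
qed

lemma smooth_map_act:
  assumes A': "smooth_atlas A'" and h: "smooth_map A' W (ctotal A P) h" and u: "circle_smooth A' W u"
  shows "smooth_map A' W (ctotal A P) (\<lambda>x. act P (h x) (u x))"
proof (rule smooth_map_ctotalI[OF A' smooth_map_proj_compose[OF A' h]])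
  fix p assume p: "p \<in> W"
  obtain N V \<sigma> k where N: "p \<in> N" "N \<subseteq> W" "(V, \<sigma>) \<in> lsecs P" "circle_smooth A' N k"
    "\<And>x. x \<in> N \<Longrightarrow> proj P (h x) \<in> V \<and> h x = act P (\<sigma> (proj P (h x))) (k x)"
    using smooth_map_ctotalE[OF A' h p] by blast
  have uN: "circle_smooth A' N u" by (rule smooth_map_subset[OF u A' smooth_map_mopen[OF N(4)] N(2)])
  have "act P (h x) (u x) = act P (\<sigma> (proj P (h x))) (k x * u x)" if x: "x \<in> N" for x
  proof -
    have "act P (h x) (u x) = act P (act P (\<sigma> (proj P (h x))) (k x)) (u x)"
      using N(5)[OF x] by simp
    also have "\<dots> = act P (\<sigma> (proj P (h x))) (k x * u x)"
      using cb_lsec[OF N(3)] N(5)[OF x] circle_smooth_sphere[OF cb_lie N(4) x] circle_smooth_sphere[OF cb_lie uN x]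
      by (intro cb_act_act) auto
    finally show ?thesis .
  qed
  then show "\<exists>N V \<sigma> k. p \<in> N \<and> N \<subseteq> W \<and> (V, \<sigma>) \<in> lsecs P \<and> circle_smooth A' N k \<and>
      (\<forall>x\<in>N. proj P (h x) \<in> V \<and> act P (h x) (u x) = act P (\<sigma> (proj P (h x))) (k x))"
    using N(1-3) N(5) circle_smooth_mult[OF cb_lie A' N(4) uN]
    by (intro exI[of _ N] exI[of _ V] exI[of _ \<sigma>] exI[of _ "\<lambda>x. k x * u x"]) auto
qed

end

lemma cbundleI:
  assumes "lie_group circle_group circle_atlas" "smooth_atlas A"
    and "\<And>p. p \<in> tot P \<Longrightarrow> proj P p \<in> mcarrier A"
    and "\<And>p. p \<in> tot P \<Longrightarrow> act P p 1 = p"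
    and "\<And>p g. p \<in> tot P \<Longrightarrow> g \<in> sphere 0 1 \<Longrightarrow> act P p g \<in> tot P \<and> proj P (act P p g) = proj P p"
    and "\<And>p g h. p \<in> tot P \<Longrightarrow> g \<in> sphere 0 1 \<Longrightarrow> h \<in> sphere 0 1 \<Longrightarrow> act P (act P p g) h = act P p (g * h)"
    and "\<And>p q. p \<in> tot P \<Longrightarrow> q \<in> tot P \<Longrightarrow> proj P p = proj P q \<Longrightarrow> \<exists>g. g \<in> sphere 0 1 \<and> q = act P p g"
    and "\<And>p g h. p \<in> tot P \<Longrightarrow> g \<in> sphere 0 1 \<Longrightarrow> h \<in> sphere 0 1 \<Longrightarrow> act P p g = act P p h \<Longrightarrow> g = h"
    and "\<And>x. x \<in> mcarrier A \<Longrightarrow> \<exists>V \<sigma>. (V, \<sigma>) \<in> lsecs P \<and> x \<in> V"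
    and "\<And>V \<sigma>. (V, \<sigma>) \<in> lsecs P \<Longrightarrow> mopen A V"
    and "\<And>V \<sigma> x. (V, \<sigma>) \<in> lsecs P \<Longrightarrow> x \<in> V \<Longrightarrow> \<sigma> x \<in> tot P \<and> proj P (\<sigma> x) = x"
    and "\<And>V \<sigma> W \<tau>. (V, \<sigma>) \<in> lsecs P \<Longrightarrow> (W, \<tau>) \<in> lsecs P \<Longrightarrow>
      \<exists>g. circle_smooth A (V \<inter> W) g \<and> (\<forall>x\<in>V \<inter> W. \<tau> x = act P (\<sigma> x) (g x))"
  shows "cbundle A P"
proof -
  have u: "\<exists>!g. g \<in> sphere 0 1 \<and> q = act P p g" if "p \<in> tot P" "q \<in> tot P" "proj P p = proj P q" for p q
    using assms(7)[OF that] assms(8)[OF that(1)] by metis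
  have c: "\<Union> (fst ` lsecs P) = mcarrier A"
  proof (intro equalityI subsetI)
    fix x assume "x \<in> \<Union> (fst ` lsecs P)"
    then obtain V \<sigma> where "(V, \<sigma>) \<in> lsecs P" "x \<in> V" by force
    then show "x \<in> mcarrier A" using mopen_subset[OF assms(10)] by blast
  next
    fix x assume "x \<in> mcarrier A"
    from assms(9)[OF this] show "x \<in> \<Union> (fst ` lsecs P)" by force
  qed
  show ?thesis
    unfolding cbundle_def
  proof (intro conjI)
    show "\<forall>(V, \<sigma>)\<in>lsecs P. mopen A V \<and> (\<forall>x\<in>V. \<sigma> x \<in> tot P \<and> proj P (\<sigma> x) = x)"
      using assms(10,11) by blast
    show "\<forall>(V, \<sigma>)\<in>lsecs P. \<forall>(W, \<tau>)\<in>lsecs P.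
        \<exists>g. circle_smooth A (V \<inter> W) g \<and> (\<forall>x\<in>V \<inter> W. \<tau> x = act P (\<sigma> x) (g x))"
      using assms(12) by blast
    show "\<forall>p\<in>tot P. \<forall>q\<in>tot P. proj P p = proj P q \<longrightarrow> (\<exists>!g. g \<in> sphere 0 1 \<and> q = act P p g)"
      using u by simp
  qed (use assms(1-6) c in auto)
qed

section \<open>Pull-back bundles and inverse bundles\<close>

lemma pullback_bundle_simps [simp]:
  "tot (pullback_bundle Y f P) = {(y, p). y \<in> Y \<and> p \<in> tot P \<and> f y = proj P p}"
  "proj (pullback_bundle Y f P) = fst"
  "act (pullback_bundle Y f P) = (\<lambda>(y, p) g. (y, act P p g))"
  "lsecs (pullback_bundle Y f P) = {({y \<in> Y. f y \<in> V}, \<lambda>y. (y, \<sigma> (f y))) | V \<sigma>. (V, \<sigma>) \<in> lsecs P}"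
  by (simp_all add: pullback_bundle_def)

lemma pullback_lsecsE:
  assumes "(V', \<sigma>') \<in> lsecs (pullback_bundle Y f P)"
  obtains V \<sigma> where "(V, \<sigma>) \<in> lsecs P" "V' = {y \<in> Y. f y \<in> V}" "\<sigma>' = (\<lambda>y. (y, \<sigma> (f y)))"
  using assms by auto

lemma cbundle_pullback:
  assumes P: "cbundle A P" and A': "smooth_atlas A'" and f: "smooth_map A' (mcarrier A') A f"
  shows "cbundle A' (pullback_bundle (mcarrier A') f P)" (is "cbundle A' ?Q")
proof (rule cbundleI[OF cb_lie[OF P] A'])
  fix x assume x: "x \<in> mcarrier A'"
  obtain V \<sigma> where "(V, \<sigma>) \<in> lsecs P" "f x \<in> V"
    using cb_lsecE[OF P smooth_map_image[OF f x]] .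
  then show "\<exists>V \<sigma>. (V, \<sigma>) \<in> lsecs ?Q \<and> x \<in> V"
    using x by (intro exI[of _ "{y \<in> mcarrier A'. f y \<in> V}"] exI[of _ "\<lambda>y. (y, \<sigma> (f y))"]) auto
next
  fix V' \<sigma>' assume "(V', \<sigma>') \<in> lsecs ?Q"
  then obtain V \<sigma> where V: "(V, \<sigma>) \<in> lsecs P" "V' = {y \<in> mcarrier A'. f y \<in> V}" "\<sigma>' = (\<lambda>y. (y, \<sigma> (f y)))"
    by (rule pullback_lsecsE)
  show "mopen A' V'"
    unfolding V(2) by (rule mopen_vimage[OF A' cb_atlas[OF P] f cb_lsec_mopen[OF P V(1)]])
  show "\<sigma>' x \<in> tot ?Q \<and> proj ?Q (\<sigma>' x) = x" if "x \<in> V'" for x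
    using that V cb_lsec[OF P V(1)] by simp
  fix W' \<tau>' assume "(W', \<tau>') \<in> lsecs ?Q"
  then obtain W \<tau> where W: "(W, \<tau>) \<in> lsecs P" "W' = {y \<in> mcarrier A'. f y \<in> W}" "\<tau>' = (\<lambda>y. (y, \<tau> (f y)))"
    by (rule pullback_lsecsE)
  obtain g where g: "circle_smooth A (V \<inter> W) g" "\<forall>x\<in>V \<inter> W. \<tau> x = act P (\<sigma> x) (g x)"
    using cb_transition[OF P V(1) W(1)] by blast
  have m: "mopen A' (V' \<inter> W')"
  proof -
    have "V' \<inter> W' = {y \<in> mcarrier A'. f y \<in> V \<inter> W}" by (auto simp: V W)
    then show ?thesis using mopen_vimage[OF A' cb_atlas[OF P] f smooth_map_mopen[OF g(1)]] by simp
  qed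
  have "circle_smooth A' (V' \<inter> W') (\<lambda>x. g (f x))"
    by (rule smooth_map_compose[OF A' cb_atlas[OF P] lie_group_atlas[OF cb_lie[OF P]]
          smooth_map_subset[OF f A' m mopen_subset[OF m]] g(1)]) (auto simp: V W)
  then show "\<exists>g. circle_smooth A' (V' \<inter> W') g \<and> (\<forall>x\<in>V' \<inter> W'. \<tau>' x = act ?Q (\<sigma>' x) (g x))"
    using g(2) by (intro exI[of _ "\<lambda>x. g (f x)"]) (auto simp: V W)
next
  fix p q assume pq: "p \<in> tot ?Q" "q \<in> tot ?Q" "proj ?Q p = proj ?Q q"
  obtain y a b where ab: "p = (y, a)" "q = (y, b)" "a \<in> tot P" "b \<in> tot P" "proj P a = proj P b"
    using pq by (cases p; cases q) auto
  obtain g where "g \<in> sphere 0 1" "b = act P a g" using cb_obtain[OF P ab(3-5)] .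
  then show "\<exists>g. g \<in> sphere 0 1 \<and> q = act ?Q p g"
    using ab by (intro exI[of _ g]) simp
next
  fix p g h assume "p \<in> tot ?Q" "g \<in> sphere 0 1" "h \<in> sphere 0 1" "act ?Q p g = act ?Q p h"
  then show "g = h"
    using cb_act_inj[OF P, of "snd p" g h] by (cases p) auto
qed (auto simp: cb_act_one[OF P] cb_act[OF P] cb_proj_act[OF P] cb_act_act[OF P])

text \<open>The universal property of the pull-back bundle: relative to a pulled back section the
  pair has the same circle coordinate as \<open>h\<close> relative to the original section.\<close>

lemma smooth_map_pullback_Pair:
  assumes P: "cbundle A P" and A': "smooth_atlas A'" and f: "smooth_map A' (mcarrier A') A f"
    and B: "smooth_atlas B" and y: "smooth_map B W A' y" and h: "smooth_map B W (ctotal A P) h"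
    and eq: "\<And>x. x \<in> W \<Longrightarrow> f (y x) = proj P (h x)"
  shows "smooth_map B W (ctotal A' (pullback_bundle (mcarrier A') f P)) (\<lambda>x. (y x, h x))"
proof (rule smooth_map_ctotalI[OF cbundle_pullback[OF P A' f] B y])
  fix p assume p: "p \<in> W"
  obtain N V \<sigma> k where N: "p \<in> N" "N \<subseteq> W" "(V, \<sigma>) \<in> lsecs P" "circle_smooth B N k"
    "\<And>x. x \<in> N \<Longrightarrow> proj P (h x) \<in> V \<and> h x = act P (\<sigma> (proj P (h x))) (k x)"
    using smooth_map_ctotalE[OF P B h p] by blast
  have "y x \<in> {y \<in> mcarrier A'. f y \<in> V} \<and> (y x, h x) = act (pullback_bundle (mcarrier A') f P) (y x, \<sigma> (f (y x))) (k x)"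
    if "x \<in> N" for x
    using N(5)[OF that] eq[of x] N(2) that smooth_map_image[OF y, of x] by auto
  then show "\<exists>N V \<sigma> k. p \<in> N \<and> N \<subseteq> W \<and> (V, \<sigma>) \<in> lsecs (pullback_bundle (mcarrier A') f P) \<and> circle_smooth B N k \<and>
      (\<forall>x\<in>N. y x \<in> V \<and> (y x, h x) = act (pullback_bundle (mcarrier A') f P) (\<sigma> (y x)) (k x))"
    using N(1-4) by (intro exI[of _ N] exI[of _ "{y \<in> mcarrier A'. f y \<in> V}"] exI[of _ "\<lambda>y. (y, \<sigma> (f y))"] exI[of _ k]) auto
qed

lemma smooth_map_pullback_snd:
  assumes P: "cbundle A P" and A': "smooth_atlas A'" and f: "smooth_map A' (mcarrier A') A f"
  defines "Q \<equiv> pullback_bundle (mcarrier A') f P"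
  shows "smooth_map (ctotal A' Q) (tot Q) (ctotal A P) snd"
proof -
  have Q: "cbundle A' Q" unfolding Q_def by (rule cbundle_pullback[OF P A' f])
  note T = smooth_atlas_ctotal[OF Q]
  have y: "smooth_map (ctotal A' Q) (tot Q) A (\<lambda>z. f (proj Q z))"
    using cb_proj[OF Q] by (intro smooth_map_compose[OF T A' cb_atlas[OF P] smooth_map_proj[OF Q] f]) auto
  show ?thesis
  proof (rule smooth_map_ctotalI[OF P T y])
    fix z assume z: "z \<in> tot Q"
    obtain N V' \<sigma>' k where N: "z \<in> N" "N \<subseteq> tot Q" "(V', \<sigma>') \<in> lsecs Q" "circle_smooth (ctotal A' Q) N k"
      "\<And>x. x \<in> N \<Longrightarrow> proj Q x \<in> V' \<and> x = act Q (\<sigma>' (proj Q x)) (k x)"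
      using smooth_map_ctotalE[OF Q T smooth_map_id[OF T mopen_tot[OF Q]] z] by blast
    obtain V \<sigma> where V: "(V, \<sigma>) \<in> lsecs P" "V' = {y \<in> mcarrier A'. f y \<in> V}" "\<sigma>' = (\<lambda>y. (y, \<sigma> (f y)))"
      using N(3) unfolding Q_def by (rule pullback_lsecsE)
    have "f (proj Q x) \<in> V \<and> snd x = act P (\<sigma> (f (proj Q x))) (k x)" if "x \<in> N" for x
    proof -
      have "snd x = snd (act Q (\<sigma>' (proj Q x)) (k x))" using N(5)[OF that] by simp
      then show ?thesis using N(5)[OF that] by (simp add: V Q_def)
    qed
    then show "\<exists>N V \<sigma> k. z \<in> N \<and> N \<subseteq> tot Q \<and> (V, \<sigma>) \<in> lsecs P \<and> circle_smooth (ctotal A' Q) N k \<and>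
      (\<forall>x\<in>N. f (proj Q x) \<in> V \<and> snd x = act P (\<sigma> (f (proj Q x))) (k x))"
      using N(1,2,4) V(1) by blast
  qed
qed

lemma inverse_bundle_simps [simp]:
  "tot (inverse_bundle P) = tot P" "proj (inverse_bundle P) = proj P"
  "act (inverse_bundle P) = (\<lambda>p u. act P p (inverse u))" "lsecs (inverse_bundle P) = lsecs P"
  by (simp_all add: inverse_bundle_def)

lemma inverse_inverse_bundle [simp]: "inverse_bundle (inverse_bundle P) = P"
  by (simp add: inverse_bundle_def)

lemma cbundle_inverse:
  assumes P: "cbundle A P"
  shows "cbundle A (inverse_bundle P)"
proof (rule cbundleI[OF cb_lie[OF P] cb_atlas[OF P]]; simp only: inverse_bundle_simps)
  show "\<exists>V \<sigma>. (V, \<sigma>) \<in> lsecs P \<and> x \<in> V" if "x \<in> mcarrier A" for x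
    using cb_lsecE[OF P that] by blast
  show "\<exists>g. circle_smooth A (V \<inter> W) g \<and> (\<forall>x\<in>V \<inter> W. \<tau> x = act P (\<sigma> x) (inverse (g x)))"
    if VW: "(V, \<sigma>) \<in> lsecs P" "(W, \<tau>) \<in> lsecs P" for V \<sigma> W \<tau>
  proof -
    obtain g where g: "circle_smooth A (V \<inter> W) g" "\<forall>x\<in>V \<inter> W. \<tau> x = act P (\<sigma> x) (g x)"
      using cb_transition[OF P VW] by blast
    then show ?thesis
      using circle_smooth_inverse[OF cb_lie[OF P] cb_atlas[OF P] g(1)]
      by (intro exI[of _ "\<lambda>x. inverse (g x)"]) simp
  qed
  show "\<exists>g. g \<in> sphere 0 1 \<and> q = act P p (inverse g)" if pq: "p \<in> tot P" "q \<in> tot P" "proj P p = proj P q" for p q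
  proof -
    obtain g where "g \<in> sphere 0 1" "q = act P p g" using cb_obtain[OF P pq] .
    then show ?thesis by (intro exI[of _ "inverse g"]) (simp add: norm_inverse)
  qed
  show "g = h" if "p \<in> tot P" "g \<in> sphere 0 1" "h \<in> sphere 0 1" "act P p (inverse g) = act P p (inverse h)" for p g h
    using cb_act_inj[OF P that(1), of "inverse g" "inverse h"] that by (auto simp: norm_inverse)
qed (auto simp: cb_proj[OF P] cb_act_one[OF P] cb_act[OF P] cb_proj_act[OF P] cb_act_act[OF P] norm_inverse
    cb_lsec[OF P] cb_lsec_mopen[OF P])

text \<open>Points and sections are those of \<open>P\<close>; only the circle coordinate is
  inverted, which is a smooth operation.\<close>

lemma smooth_map_inverse_bundle:
  assumes P: "cbundle A P" and A': "smooth_atlas A'" and h: "smooth_map A' W (ctotal A P) h"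
  shows "smooth_map A' W (ctotal A (inverse_bundle P)) h"
proof (rule smooth_map_ctotalI[OF cbundle_inverse[OF P] A' smooth_map_proj_compose[OF P A' h]])
  fix p assume p: "p \<in> W"
  obtain N V \<sigma> k where N: "p \<in> N" "N \<subseteq> W" "(V, \<sigma>) \<in> lsecs P" "circle_smooth A' N k"
    "\<And>x. x \<in> N \<Longrightarrow> proj P (h x) \<in> V \<and> h x = act P (\<sigma> (proj P (h x))) (k x)"
    using smooth_map_ctotalE[OF P A' h p] by blast
  then show "\<exists>N V \<sigma> k. p \<in> N \<and> N \<subseteq> W \<and> (V, \<sigma>) \<in> lsecs (inverse_bundle P) \<and> circle_smooth A' N k \<and>
      (\<forall>x\<in>N. proj P (h x) \<in> V \<and> h x = act (inverse_bundle P) (\<sigma> (proj P (h x))) (k x))"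
    using circle_smooth_inverse[OF cb_lie[OF P] A' N(4)]
    by (intro exI[of _ N] exI[of _ V] exI[of _ \<sigma>] exI[of _ "\<lambda>x. inverse (k x)"]) simp
qed

section \<open>Tensor products of circle bundles\<close>

context
  fixes A :: "('x, 'e::locally_convex) atlas" and S :: "('x, 'p, complex) pbundle" and T :: "('x, 'q, complex) pbundle"
  assumes S: "cbundle A S" and T: "cbundle A T"
begin

lemma tensor_elt_self: "s \<in> tot S \<Longrightarrow> t \<in> tot T \<Longrightarrow> (s, t) \<in> tensor_elt S T s t"
  unfolding tensor_elt_def using cb_act_one[OF S, of s] cb_act_one[OF T, of t]
  by (auto intro!: exI[of _ 1])

lemma tensor_elt_act_left:
  assumes s: "s \<in> tot S" "u \<in> sphere 0 1"
  shows "tensor_elt S T (act S s u) t = (\<lambda>(s, t). (act S s u, t)) ` tensor_elt S T s t"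
proof -
  have "act S (act S s u) w = act S (act S s w) u" if "w \<in> sphere 0 1" for w
    using cb_act_act[OF S s(1)] s(2) that by (simp add: mult.commute)
  then show ?thesis
    unfolding tensor_elt_def circle_group_simps by (auto simp: image_iff) (metis mem_sphere_0)+
qed

text \<open>The defining relation of the tensor product. Substituting \<open>u * w\<close> for the
  parameter \<open>w\<close> of an equivalence class matches the two classes element by
  element.\<close>

lemma tensor_elt_move:
  assumes s: "s \<in> tot S" "t \<in> tot T" and u: "u \<in> sphere 0 1"
  shows "tensor_elt S T (act S s u) t = tensor_elt S T s (act T t u)"
proof -
  have u0: "u \<noteq> 0" using u by auto
  have 1: "act S (act S s u) w = act S s (u * w)" "act T (act T t u) (inverse (u * w)) = act T t (inverse w)"
    if "w \<in> sphere 0 1" for w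
  proof -
    have w0: "w \<noteq> 0" using that by auto
    show "act S (act S s u) w = act S s (u * w)"
      by (rule cb_act_act[OF S s(1) u that])
    have "act T (act T t u) (inverse (u * w)) = act T t (u * inverse (u * w))"
      using u that by (intro cb_act_act[OF T s(2) u]) (simp add: norm_inverse norm_mult)
    also have "u * inverse (u * w) = inverse w" using u0 w0 by (simp add: field_simps)
    finally show "act T (act T t u) (inverse (u * w)) = act T t (inverse w)" .
  qed
  show ?thesis
    unfolding tensor_elt_def circle_group_simps
  proof (intro equalityI subsetI; clarify)
    fix w :: complex assume w: "w \<in> sphere 0 1"
    then show "\<exists>v. (act S (act S s u) w, act T t (inverse w)) = (act S s v, act T (act T t u) (inverse v)) \<and> v \<in> sphere 0 1"
      using 1[OF w] u by (intro exI[of _ "u * w"]) (simp add: norm_mult)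
    have v: "inverse u * w \<in> sphere 0 1" using u w by (simp add: norm_mult norm_inverse)
    have e: "u * (inverse u * w) = w" using u0 by simp
    then show "\<exists>v. (act S s w, act T (act T t u) (inverse w)) = (act S (act S s u) v, act T t (inverse v)) \<and> v \<in> sphere 0 1"
      using 1[OF v, unfolded e] v by (intro exI[of _ "inverse u * w"]) (simp del: inverse_mult_distrib)
  qed
qed

lemma tensor_proj:
  assumes "s \<in> tot S" "t \<in> tot T"
  shows "proj (tensor_bundle S T) (tensor_elt S T s t) = proj S s"
proof -
  have "(SOME st. st \<in> tensor_elt S T s t) \<in> tensor_elt S T s t"
    using tensor_elt_self[OF assms] by (rule someI)
  then obtain u where "u \<in> sphere 0 1" "(SOME st. st \<in> tensor_elt S T s t) = (act S s u, act T t (inverse u))"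
    unfolding tensor_elt_def by auto
  then show ?thesis
    using cb_proj_act[OF S assms(1)] by (simp add: tensor_bundle_def)
qed

lemma tensor_act:
  assumes "s \<in> tot S" "u \<in> sphere 0 1"
  shows "act (tensor_bundle S T) (tensor_elt S T s t) u = tensor_elt S T (act S s u) t"
  using tensor_elt_act_left[OF assms] by (simp add: tensor_bundle_def)

lemma tensor_tot:
  "tot (tensor_bundle S T) = {tensor_elt S T s t | s t. s \<in> tot S \<and> t \<in> tot T \<and> proj S s = proj T t}"
  by (simp add: tensor_bundle_def)

lemma tensor_totE:
  assumes "z \<in> tot (tensor_bundle S T)"
  obtains s t where "s \<in> tot S" "t \<in> tot T" "proj S s = proj T t" "z = tensor_elt S T s t"
  using assms by (auto simp: tensor_tot)

lemma tensor_lsecsE: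
  assumes "(X, \<rho>) \<in> lsecs (tensor_bundle S T)"
  obtains V \<sigma> W \<tau> where "(V, \<sigma>) \<in> lsecs S" "(W, \<tau>) \<in> lsecs T" "X = V \<inter> W" "\<rho> = (\<lambda>x. tensor_elt S T (\<sigma> x) (\<tau> x))"
  using assms by (auto simp: tensor_bundle_def)

lemma tensor_lsecsI:
  "(V, \<sigma>) \<in> lsecs S \<Longrightarrow> (W, \<tau>) \<in> lsecs T \<Longrightarrow> (V \<inter> W, \<lambda>x. tensor_elt S T (\<sigma> x) (\<tau> x)) \<in> lsecs (tensor_bundle S T)"
  by (auto simp: tensor_bundle_def)

lemma tensor_elt_act_act:
  assumes "s \<in> tot S" "t \<in> tot T" "a \<in> sphere 0 1" "b \<in> sphere 0 1"
  shows "tensor_elt S T (act S s a) (act T t b) = act (tensor_bundle S T) (tensor_elt S T s t) (a * b)"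
proof -
  have "tensor_elt S T (act S s a) (act T t b) = tensor_elt S T (act S (act S s a) b) t"
    using tensor_elt_move[OF cb_act[OF S assms(1,3)] assms(2,4)] by simp
  also have "act S (act S s a) b = act S s (a * b)"
    by (rule cb_act_act[OF S assms(1,3,4)])
  finally show ?thesis
    using assms by (subst tensor_act) (auto simp: norm_mult)
qed

lemma cbundle_tensor: "cbundle A (tensor_bundle S T)"
proof (rule cbundleI[OF cb_lie[OF S] cb_atlas[OF S]])
  fix z assume "z \<in> tot (tensor_bundle S T)"
  then obtain s t where z: "s \<in> tot S" "t \<in> tot T" "proj S s = proj T t" "z = tensor_elt S T s t"
    by (rule tensor_totE)
  show "proj (tensor_bundle S T) z \<in> mcarrier A"
    using z(4) cb_proj[OF S z(1)] tensor_proj[OF z(1,2)] by simp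
  show "act (tensor_bundle S T) z 1 = z"
    using z cb_act_one[OF S] tensor_act[of s 1 t] by simp
  show "act (tensor_bundle S T) z g \<in> tot (tensor_bundle S T) \<and>
      proj (tensor_bundle S T) (act (tensor_bundle S T) z g) = proj (tensor_bundle S T) z" if g: "g \<in> sphere 0 1" for g
  proof -
    have "act (tensor_bundle S T) z g = tensor_elt S T (act S s g) t" using tensor_act z g by simp
    moreover have "act S s g \<in> tot S" "proj S (act S s g) = proj S s"
      using cb_act[OF S z(1) g] cb_proj_act[OF S z(1) g] .
    ultimately show ?thesis
      using z tensor_proj by (auto simp: tensor_tot)
  qed
  show "act (tensor_bundle S T) (act (tensor_bundle S T) z g) h = act (tensor_bundle S T) z (g * h)"
    if g: "g \<in> sphere 0 1" "h \<in> sphere 0 1" for g h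
  proof -
    have "g * h \<in> sphere 0 1" using g by (simp add: norm_mult)
    then show ?thesis
      using z g tensor_act[of s g t] tensor_act[of "act S s g" h t] tensor_act[of s "g * h" t]
        cb_act[OF S z(1) g(1)] cb_act_act[OF S z(1) g] by simp
  qed
  show "g = h" if g: "g \<in> sphere 0 1" "h \<in> sphere 0 1" "act (tensor_bundle S T) z g = act (tensor_bundle S T) z h" for g h
  proof -
    have "tensor_elt S T (act S s g) t = tensor_elt S T (act S s h) t"
      using g z tensor_act by simp
    then have "(act S s g, t) \<in> tensor_elt S T (act S s h) t"
      using tensor_elt_self[OF cb_act[OF S z(1) g(1)] z(2)] by simp
    then obtain u where u: "u \<in> sphere 0 1" "act S s g = act S (act S s h) u" "t = act T t (inverse u)"
      unfolding tensor_elt_def by auto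
    \<comment> \<open>The second components of the representatives coincide, and the action on
      \<open>T\<close> is free; so the first components coincide as well.\<close>
    have "inverse u = 1"
      using cb_act_inj[OF T z(2), of "inverse u" 1] cb_act_one[OF T z(2)] u by (simp add: norm_inverse)
    then have "u = 1" by simp
    then have "act S s g = act S s h" using u cb_act_one[OF S cb_act[OF S z(1) g(2)]] by simp
    then show ?thesis using cb_act_inj[OF S z(1) g(1,2)] by simp
  qed
  fix z' assume "z' \<in> tot (tensor_bundle S T)" "proj (tensor_bundle S T) z = proj (tensor_bundle S T) z'"
  then obtain s' t' where z': "s' \<in> tot S" "t' \<in> tot T" "proj S s' = proj T t'" "z' = tensor_elt S T s' t'"
      "proj S s = proj S s'"
    using z tensor_proj by (auto elim!: tensor_totE)
  obtain a where a: "a \<in> sphere 0 1" "s' = act S s a" using cb_obtain[OF S z(1) z'(1) z'(5)] .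
  obtain b where b: "b \<in> sphere 0 1" "t' = act T t b" using cb_obtain[OF T z(2) z'(2)] z z' by metis
  show "\<exists>g. g \<in> sphere 0 1 \<and> z' = act (tensor_bundle S T) z g"
    using tensor_elt_act_act[OF z(1,2) a(1) b(1)] a b z(4) z'(4)
    by (intro exI[of _ "a * b"]) (simp add: norm_mult)
next
  fix x assume x: "x \<in> mcarrier A"
  obtain V \<sigma> where "(V, \<sigma>) \<in> lsecs S" "x \<in> V" using cb_lsecE[OF S x] .
  moreover obtain W \<tau> where "(W, \<tau>) \<in> lsecs T" "x \<in> W" using cb_lsecE[OF T x] .
  ultimately show "\<exists>V \<sigma>. (V, \<sigma>) \<in> lsecs (tensor_bundle S T) \<and> x \<in> V"
    using tensor_lsecsI by blast
next
  fix X \<rho> assume "(X, \<rho>) \<in> lsecs (tensor_bundle S T)"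
  then obtain V \<sigma> W \<tau> where X: "(V, \<sigma>) \<in> lsecs S" "(W, \<tau>) \<in> lsecs T" "X = V \<inter> W" "\<rho> = (\<lambda>x. tensor_elt S T (\<sigma> x) (\<tau> x))"
    by (rule tensor_lsecsE)
  show m: "mopen A X"
    unfolding X(3) by (rule mopen_Int[OF cb_atlas[OF S] cb_lsec_mopen[OF S X(1)] cb_lsec_mopen[OF T X(2)]])
  have st: "\<sigma> x \<in> tot S" "\<tau> x \<in> tot T" "proj S (\<sigma> x) = x" "proj T (\<tau> x) = x" if "x \<in> X" for x
    using cb_lsec[OF S X(1)] cb_lsec[OF T X(2)] that X(3) by auto
  then show "\<rho> x \<in> tot (tensor_bundle S T) \<and> proj (tensor_bundle S T) (\<rho> x) = x" if "x \<in> X" for x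
    using that tensor_proj[of "\<sigma> x" "\<tau> x"] by (fastforce simp: X(4) tensor_tot)
  fix X' \<rho>' assume "(X', \<rho>') \<in> lsecs (tensor_bundle S T)"
  then obtain V' \<sigma>' W' \<tau>' where X': "(V', \<sigma>') \<in> lsecs S" "(W', \<tau>') \<in> lsecs T" "X' = V' \<inter> W'" "\<rho>' = (\<lambda>x. tensor_elt S T (\<sigma>' x) (\<tau>' x))"
    by (rule tensor_lsecsE)
  have "mopen A X'"
    unfolding X'(3) by (rule mopen_Int[OF cb_atlas[OF S] cb_lsec_mopen[OF S X'(1)] cb_lsec_mopen[OF T X'(2)]])
  then have m': "mopen A (X \<inter> X')" by (rule mopen_Int[OF cb_atlas[OF S] m])
  obtain a where a: "circle_smooth A (V \<inter> V') a" "\<forall>x\<in>V \<inter> V'. \<sigma>' x = act S (\<sigma> x) (a x)"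
    using cb_transition[OF S X(1) X'(1)] by blast
  obtain b where b: "circle_smooth A (W \<inter> W') b" "\<forall>x\<in>W \<inter> W'. \<tau>' x = act T (\<tau> x) (b x)"
    using cb_transition[OF T X(2) X'(2)] by blast
  have a': "circle_smooth A (X \<inter> X') a"
    by (rule smooth_map_subset[OF a(1) cb_atlas[OF S] m']) (auto simp: X X')
  have b': "circle_smooth A (X \<inter> X') b"
    by (rule smooth_map_subset[OF b(1) cb_atlas[OF S] m']) (auto simp: X X')
  have "\<rho>' x = act (tensor_bundle S T) (\<rho> x) (a x * b x)" if x: "x \<in> X \<inter> X'" for x
    using tensor_elt_act_act[OF st(1)[OF IntD1[OF x]] st(2)[OF IntD1[OF x]], of "a x" "b x"] circle_smooth_sphere[OF cb_lie[OF S] a' x]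
      circle_smooth_sphere[OF cb_lie[OF S] b' x] x a(2) b(2) by (simp add: X X')
  then show "\<exists>g. circle_smooth A (X \<inter> X') g \<and> (\<forall>x\<in>X \<inter> X'. \<rho>' x = act (tensor_bundle S T) (\<rho> x) (g x))"
    using circle_smooth_mult[OF cb_lie[OF S] cb_atlas[OF S] a' b'] by blast
qed

lemma smooth_map_tensor_elt:
  assumes A': "smooth_atlas A'" and s: "smooth_map A' X (ctotal A S) s" and t: "smooth_map A' X (ctotal A T) t"
    and eq: "\<And>x. x \<in> X \<Longrightarrow> proj S (s x) = proj T (t x)"
  shows "smooth_map A' X (ctotal A (tensor_bundle S T)) (\<lambda>x. tensor_elt S T (s x) (t x))"
proof (rule smooth_map_ctotalI[OF cbundle_tensor A' smooth_map_proj_compose[OF S A' s]])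
  fix p assume p: "p \<in> X"
  obtain M V \<sigma> a where M: "p \<in> M" "M \<subseteq> X" "(V, \<sigma>) \<in> lsecs S" "circle_smooth A' M a"
    "\<And>x. x \<in> M \<Longrightarrow> proj S (s x) \<in> V \<and> s x = act S (\<sigma> (proj S (s x))) (a x)"
    using smooth_map_ctotalE[OF S A' s p] by blast
  obtain N W \<tau> b where N: "p \<in> N" "N \<subseteq> X" "(W, \<tau>) \<in> lsecs T" "circle_smooth A' N b"
    "\<And>x. x \<in> N \<Longrightarrow> proj T (t x) \<in> W \<and> t x = act T (\<tau> (proj T (t x))) (b x)"
    using smooth_map_ctotalE[OF T A' t p] by blast
  have m: "mopen A' (M \<inter> N)" by (rule mopen_Int[OF A' smooth_map_mopen[OF M(4)] smooth_map_mopen[OF N(4)]])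
  have a: "circle_smooth A' (M \<inter> N) a" and b: "circle_smooth A' (M \<inter> N) b"
    by (auto intro!: smooth_map_subset[OF M(4) A' m] smooth_map_subset[OF N(4) A' m])
  have "proj S (s x) \<in> V \<inter> W \<and> tensor_elt S T (s x) (t x) =
      act (tensor_bundle S T) (tensor_elt S T (\<sigma> (proj S (s x))) (\<tau> (proj S (s x)))) (a x * b x)" if x: "x \<in> M \<inter> N" for x
  proof -
    have y: "proj S (s x) \<in> V" "proj S (s x) \<in> W" "proj T (t x) = proj S (s x)"
      using M(5)[of x] N(5)[of x] eq[of x] x M(2) by auto
    have "tensor_elt S T (s x) (t x) = tensor_elt S T (act S (\<sigma> (proj S (s x))) (a x)) (act T (\<tau> (proj S (s x))) (b x))"
      using M(5)[of x] N(5)[of x] x y(3) by simp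
    also have "\<dots> = act (tensor_bundle S T) (tensor_elt S T (\<sigma> (proj S (s x))) (\<tau> (proj S (s x)))) (a x * b x)"
      using cb_lsec[OF S M(3) y(1)] cb_lsec[OF T N(3) y(2)] circle_smooth_sphere[OF cb_lie[OF S] a x]
        circle_smooth_sphere[OF cb_lie[OF S] b x] by (intro tensor_elt_act_act) auto
    finally show ?thesis using y by blast
  qed
  then show "\<exists>N V \<sigma> k. p \<in> N \<and> N \<subseteq> X \<and> (V, \<sigma>) \<in> lsecs (tensor_bundle S T) \<and> circle_smooth A' N k \<and>
      (\<forall>x\<in>N. proj S (s x) \<in> V \<and> tensor_elt S T (s x) (t x) = act (tensor_bundle S T) (\<sigma> (proj S (s x))) (k x))"
    using tensor_lsecsI[OF M(3) N(3)] circle_smooth_mult[OF cb_lie[OF S] A' a b] M(1,2) N(1)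
    by (intro exI[of _ "M \<inter> N"] exI[of _ "V \<inter> W"] exI[of _ "\<lambda>x. tensor_elt S T (\<sigma> x) (\<tau> x)"] exI[of _ "\<lambda>x. a x * b x"]) auto
qed

text \<open>The pair of \<open>s\<close> and \<open>t\<close> is a smooth map into the fibre
  product, and the three maps in question factor through it. The identity that specifies
  \<open>\<eta>\<close> on the fibre product is pulled back along this pair, so that no local
  section of the fibre product over the tensor product is required.\<close>

lemma pullback_tensor_connection:
  assumes \<eta>: "tensor_connection A S T \<theta>S \<theta>T \<eta>"
    and A': "smooth_atlas A'" and s: "smooth_map A' X (ctotal A S) s" and t: "smooth_map A' X (ctotal A T) t"
    and eq: "\<And>x. x \<in> X \<Longrightarrow> proj S (s x) = proj T (t x)"
    and c: "c \<in> A'" "p \<in> fst c" "p \<in> X" "length vs = 1"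
  shows "pullback_form (ctotal A (tensor_bundle S T)) (\<lambda>x. tensor_elt S T (s x) (t x)) \<eta> c p vs =
    pullback_form (ctotal A S) s \<theta>S c p vs + pullback_form (ctotal A T) t \<theta>T c p vs"
proof -
  note TS = smooth_atlas_ctotal[OF S] and TT = smooth_atlas_ctotal[OF T]
  have pS: "smooth_map (ctotal A S) (mcarrier (ctotal A S)) A (proj S)"
    using smooth_map_proj[OF S] mcarrier_ctotal[OF S] by simp
  let ?F = "fibre_prod S T"
  have F_eq: "?F = pullback_bundle (mcarrier (ctotal A S)) (proj S) T"
    by (simp add: fibre_prod_def mcarrier_ctotal[OF S])
  have F: "cbundle (ctotal A S) ?F"
    unfolding F_eq by (rule cbundle_pullback[OF T TS pS])
  note TF = smooth_atlas_ctotal[OF F]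
  have j: "smooth_map A' X (ctotal (ctotal A S) ?F) (\<lambda>x. (s x, t x))"
    unfolding F_eq using eq by (intro smooth_map_pullback_Pair[OF T TS pS A' s t])
  have jF: "(s p, t p) \<in> tot ?F"
    using smooth_map_image[OF j c(3)] mcarrier_ctotal[OF F] by simp
  have f: "smooth_map (ctotal (ctotal A S) ?F) (tot ?F) (ctotal A S) fst"
    using smooth_map_proj[OF F] by (simp add: fibre_prod_def)
  have g: "smooth_map (ctotal (ctotal A S) ?F) (tot ?F) (ctotal A T) snd"
    unfolding F_eq by (rule smooth_map_pullback_snd[OF T TS pS])
  have te: "smooth_map (ctotal (ctotal A S) ?F) (tot ?F) (ctotal A (tensor_bundle S T)) (\<lambda>(s, t). tensor_elt S T s t)"
    unfolding case_prod_unfold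
    by (rule smooth_map_tensor_elt[OF TF f g]) (auto simp: fibre_prod_def)
  \<comment> \<open>All three pull-backs through the fibre product use the chart chosen at
    \<open>(s p, t p)\<close>. The identity for \<open>\<eta>\<close> is therefore needed only in
    this chart, on the transported vectors \<open>ws\<close>.\<close>
  define d where "d = the_chart (ctotal (ctotal A S) ?F) (s p, t p)"
  define ws where "ws = map (chart_deriv c d (\<lambda>x. (s x, t x)) p) vs"
  have d: "d \<in> ctotal (ctotal A S) ?F" "(s p, t p) \<in> fst d"
    using the_chart[OF smooth_map_image[OF j c(3)]] by (auto simp: d_def)
  have comp: "pullback_form C (\<lambda>x. k (s x, t x)) \<omega> c p vs = pullback_form C k \<omega> d (s p, t p) ws"
    if "smooth_map (ctotal (ctotal A S) ?F) (tot ?F) C k" for C :: "('c, 'd::locally_convex) atlas" and k \<omega>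
    using pullback_form_compose[OF A' TF j that c(1,3,2) jF, of \<omega> vs] by (simp add: pullback_form_eq d_def ws_def)
  have "pullback_form (ctotal A (tensor_bundle S T)) (\<lambda>(s, t). tensor_elt S T s t) \<eta> d (s p, t p) ws =
      pullback_form (ctotal A S) fst \<theta>S d (s p, t p) ws + pullback_form (ctotal A T) snd \<theta>T d (s p, t p) ws"
    using \<eta> d jF c(4) unfolding tensor_connection_def form_eq_def by (simp add: ws_def)
  then show ?thesis
    using comp[OF te, of \<eta>] comp[OF f, of \<theta>S] comp[OF g, of \<theta>T] by simp
qed

end

section \<open>Connections\<close>

lemma chart_deriv_has_dir_deriv:
  assumes "smooth_map A W B f" "c \<in> A" "d \<in> B" "p \<in> W" "p \<in> fst c" "f p \<in> fst d"
  shows "has_dir_deriv (snd d \<circ> f \<circ> inv_into (fst c) (snd c)) v (snd c p) (chart_deriv c d f p v)"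
proof -
  obtain U \<phi> V \<psi> where c: "c = (U, \<phi>)" "d = (V, \<psi>)" by (cases c, cases d)
  note rep = smooth_map_rep[OF assms(1-3)[unfolded c]]
  show ?thesis
    unfolding c chart_deriv_def fst_conv snd_conv
    by (rule smooth_on_has_dir_deriv[OF rep(3)]) (use assms c in auto)
qed

lemma connection_diff_form: "connection_form A P \<theta> \<Longrightarrow> diff_form (ctotal A P) (tot P) 1 \<theta>"
  by (simp add: connection_form_def)

lemma connection_imaginary: "connection_form A P \<theta> \<Longrightarrow> e \<in> ctotal A P \<Longrightarrow> p \<in> fst e \<Longrightarrow> Re (\<theta> e p [v]) = 0"
  unfolding connection_form_def by (cases e) fastforce

lemma connection_invariant:
  "connection_form A P \<theta> \<Longrightarrow> u \<in> sphere 0 1 \<Longrightarrow>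
    form_eq (ctotal A P) (tot P) 1 (pullback_form (ctotal A P) (\<lambda>p. act P p u) \<theta>) \<theta>"
  unfolding connection_form_def circle_group_simps by blast

lemma connection_vertical:
  "connection_form A P \<theta> \<Longrightarrow> e \<in> ctotal A P \<Longrightarrow> p \<in> fst e \<Longrightarrow>
    \<theta> e p [dir_deriv (\<lambda>t::real. snd e (act P p (cis t))) 1 0] = \<i>"
  unfolding connection_form_def by (cases e) fastforce

text \<open>In an angular chart rotation is translation of the angle, so the fundamental vector
  field has the constant coordinate 1.\<close>

lemma circle_chart_rotate:
  assumes "(K, \<psi>) \<in> circle_atlas" "z \<in> K"
  shows "has_dir_deriv (\<lambda>t::real. \<psi> (z * cis t)) 1 0 1"
proof -
  obtain a where a: "K = cis ` {a<..<a + 2 * pi}" "\<psi> = the_inv_into {a<..<a + 2 * pi} cis"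
    using assms(1) by (auto simp: circle_atlas_def)
  let ?I = "{a<..<a + 2 * pi}"
  have inv: "\<psi> (cis s) = s" if "s \<in> ?I" for s
    unfolding a(2) by (rule the_inv_into_f_f[OF inj_on_cis that])
  obtain s where s: "s \<in> ?I" "z = cis s" using assms(2) a(1) by blast
  have "has_dir_deriv (\<lambda>t::real. s + t) 1 0 (0 + 1)"
    by (rule has_dir_deriv_add[OF has_dir_deriv_const has_dir_deriv_ident])
  moreover have "open {a - s<..<a + 2 * pi - s}" "0 \<in> {a - s<..<a + 2 * pi - s}" using s by auto
  moreover have "s + t = \<psi> (z * cis t)" if "t \<in> {a - s<..<a + 2 * pi - s}" for t
    using inv[of "s + t"] that by (auto simp: s(2) cis_mult)
  ultimately show ?thesis
    using has_dir_deriv_cong[of "{a - s<..<a + 2 * pi - s}" 0 "\<lambda>t. s + t" "\<lambda>t. \<psi> (z * cis t)" 1 1] by simp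
qed

lemma circle_smooth_const:
  assumes "lie_group circle_group circle_atlas" "smooth_atlas A" "mopen A W" "u \<in> sphere 0 1"
  shows "circle_smooth A W (\<lambda>_. u)"
  by (rule smooth_map_const[OF assms(2) lie_group_atlas[OF assms(1)] assms(3)]) (use assms in \<open>simp add: lie_group_def\<close>)

lemma dlog_const: "dlog (\<lambda>_. u) c p vs = 0"
  by (simp add: dlog_def comp_def)

text \<open>In bundle coordinates the velocity of \<open>h \<cdot> u\<close> is that of \<open>h \<cdot> u\<^sub>0\<close>, with \<open>u\<^sub>0\<close> the value of \<open>u\<close> at
  the point, plus a multiple of the fundamental vector field.\<close>

lemma pullback_connection_act:
  assumes P: "cbundle A P" and \<theta>: "connection_form A P \<theta>" and A': "smooth_atlas A'"
    and h: "smooth_map A' W (ctotal A P) h" and u: "circle_smooth A' W u"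
    and c: "c \<in> A'" "p \<in> fst c" "p \<in> W"
  shows "pullback_form (ctotal A P) (\<lambda>x. act P (h x) (u x)) \<theta> c p [v] =
    pullback_form (ctotal A P) h \<theta> c p [v] + dlog u c p [v]"
proof -
  note L = cb_lie[OF P] and T = smooth_atlas_ctotal[OF P]
  obtain N V \<sigma> k where N: "p \<in> N" "N \<subseteq> W" "(V, \<sigma>) \<in> lsecs P" "circle_smooth A' N k"
    and hN: "\<And>x. x \<in> N \<Longrightarrow> proj P (h x) \<in> V \<and> h x = act P (\<sigma> (proj P (h x))) (k x)"
    using smooth_map_ctotalE[OF P A' h c(3)] by blast
  have mN: "mopen A' N" by (rule smooth_map_mopen[OF N(4)])
  have hs: "smooth_map A' N (ctotal A P) h" by (rule smooth_map_subset[OF h A' mN N(2)])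
  have us: "circle_smooth A' N u" by (rule smooth_map_subset[OF u A' mN N(2)])
  have ks: "circle_smooth A' N k" by (rule N(4))
  define y where "y = (\<lambda>x. proj P (h x))"
  have ys: "smooth_map A' N A y" unfolding y_def by (rule smooth_map_proj_compose[OF P A' hs])
  have htot: "h x \<in> tot P" if "x \<in> N" for x
    using smooth_map_image[OF hs that] mcarrier_ctotal[OF P] by simp
  have k1: "k x \<in> sphere 0 1" and u1: "u x \<in> sphere 0 1" if "x \<in> N" for x
    using circle_smooth_sphere[OF L ks that] circle_smooth_sphere[OF L us that] .
  have sg: "\<sigma> (y x) \<in> tot P" "proj P (\<sigma> (y x)) = y x" if "x \<in> N" for x
    using cb_lsec[OF P N(3)] hN[OF that] by (auto simp: y_def)
  have hk: "act P (h x) w = act P (\<sigma> (y x)) (k x * w)" if "x \<in> N" "w \<in> sphere 0 1" for x w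
  proof -
    have "act P (h x) w = act P (act P (\<sigma> (y x)) (k x)) w" using hN[OF that(1)] by (simp add: y_def)
    then show ?thesis using cb_act_act[OF P sg(1)[OF that(1)] k1[OF that(1)] that(2)] by simp
  qed
  define u0 where "u0 = u p"
  have u0: "u0 \<in> sphere 0 1" using u1[OF N(1)] by (simp add: u0_def)
  have ku0: "k p * u0 \<in> sphere 0 1" using k1[OF N(1)] u0 by (simp add: norm_mult)
  obtain X \<phi> where X: "(X, \<phi>) \<in> A" "y p \<in> X"
    using mcarrierE smooth_map_image[OF ys N(1)] by metis
  \<comment> \<open>The bundle chart must contain the displaced point \<open>act P (h p) u0\<close>,
    whose circle coordinate is \<open>k p * u0\<close>.\<close>
  have "k p * u0 \<in> mcarrier circle_atlas" using ku0 L by (simp add: lie_group_def)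
  then obtain K \<psi> where K: "(K, \<psi>) \<in> circle_atlas" "k p * u0 \<in> K" by (rule mcarrierE)
  define \<xi> where "\<xi> = (\<lambda>q. (\<phi> (proj P q), \<psi> (fibre_div circle_group P (\<sigma> (proj P q)) q)))"
  define e where "e = ({act P (\<sigma> x) g | x g. x \<in> X \<inter> V \<and> g \<in> K}, \<xi>)"
  have e: "e \<in> ctotal A P"
    unfolding total_atlas_def e_def \<xi>_def using X(1) N(3) K(1) by blast
  have \<xi>: "\<xi> (act P (\<sigma> (y x)) g) = (\<phi> (y x), \<psi> g)" if "x \<in> N" "g \<in> sphere 0 1" for x g
    using sg[OF that(1)] cb_proj_act[OF P sg(1)[OF that(1)] that(2)] cb_fibre_div[OF P sg(1)[OF that(1)] that(2)]
    by (simp add: \<xi>_def)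
  define q where "q = act P (h p) u0"
  have q_eq: "q = act P (\<sigma> (y p)) (k p * u0)" unfolding q_def by (rule hk[OF N(1) u0])
  have qtot: "q \<in> tot P" unfolding q_def by (rule cb_act[OF P htot[OF N(1)] u0])
  have qe: "q \<in> fst e"
    using q_eq X(2) K(2) hN[OF N(1)] by (auto simp: e_def y_def)
  have der: "chart_deriv c e (\<lambda>x. act P (h x) (w x)) p v =
      (chart_deriv c (X, \<phi>) y p v, chart_deriv c (K, \<psi>) (\<lambda>x. k x * w x) p v)"
    if w: "circle_smooth A' N w" and wp: "w p = u0" for w
  proof -
    have kw: "circle_smooth A' N (\<lambda>x. k x * w x)" by (rule circle_smooth_mult[OF L A' ks w])
    have inj: "inj_on (snd c) (fst c)" using smooth_atlas_inj[OF A', of "fst c" "snd c"] c by simp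
    have "has_dir_deriv (\<lambda>z. ((\<phi> \<circ> y \<circ> inv_into (fst c) (snd c)) z, (\<psi> \<circ> (\<lambda>x. k x * w x) \<circ> inv_into (fst c) (snd c)) z))
        v (snd c p) (chart_deriv c (X, \<phi>) y p v, chart_deriv c (K, \<psi>) (\<lambda>x. k x * w x) p v)"
      using chart_deriv_has_dir_deriv[OF ys c(1) X(1) N(1) c(2), of v]
        chart_deriv_has_dir_deriv[OF kw c(1) K(1) N(1) c(2), of v] X(2) K(2) wp
      by (intro has_dir_deriv_Pair) (simp_all add: comp_def)
    moreover have "dir_deriv (\<xi> \<circ> (\<lambda>x. act P (h x) (w x)) \<circ> inv_into (fst c) (snd c)) v (snd c p) =
      dir_deriv (\<lambda>z. ((\<phi> \<circ> y \<circ> inv_into (fst c) (snd c)) z, (\<psi> \<circ> (\<lambda>x. k x * w x) \<circ> inv_into (fst c) (snd c)) z)) v (snd c p)"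
    proof (rule dir_deriv_cong[of "snd c ` (N \<inter> fst c)"])
      show "open (snd c ` (N \<inter> fst c))" using mopen_image[OF mN, of "fst c" "snd c"] c by simp
      show "snd c p \<in> snd c ` (N \<inter> fst c)" using N(1) c by simp
      fix z assume "z \<in> snd c ` (N \<inter> fst c)"
      then obtain x where x: "x \<in> N" "x \<in> fst c" "z = snd c x" by blast
      have "w x \<in> sphere 0 1" by (rule circle_smooth_sphere[OF L w x(1)])
      then have "\<xi> (act P (h x) (w x)) = (\<phi> (y x), \<psi> (k x * w x))"
        using \<xi>[OF x(1), of "k x * w x"] hk[OF x(1)] k1[OF x(1)] by (simp add: norm_mult)
      then show "(\<xi> \<circ> (\<lambda>x. act P (h x) (w x)) \<circ> inv_into (fst c) (snd c)) z =
        ((\<phi> \<circ> y \<circ> inv_into (fst c) (snd c)) z, (\<psi> \<circ> (\<lambda>x. k x * w x) \<circ> inv_into (fst c) (snd c)) z)"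
        using x inj by simp
    qed
    ultimately show ?thesis
      using has_dir_deriv_dir_deriv by (fastforce simp: chart_deriv_def e_def)
  qed
  have cs: "circle_smooth A' N (\<lambda>_. u0)" by (rule circle_smooth_const[OF L A' mN u0])
  define L0 L1 where "L0 = chart_deriv c e (\<lambda>x. act P (h x) u0) p v"
    and "L1 = chart_deriv c e (\<lambda>x. act P (h x) (u x)) p v"
  define r where "r = chart_deriv c (K, \<psi>) (\<lambda>x. k x * u x) p v - chart_deriv c (K, \<psi>) (\<lambda>x. k x * u0) p v"
  have L1: "L1 = L0 + r *\<^sub>R (0, 1)"
    using der[OF us u0_def[symmetric]] der[OF cs refl] by (simp add: L0_def L1_def r_def)
  \<comment> \<open>Both angular velocities contain the contribution of \<open>k\<close>, which
    cancels in \<open>r\<close>; what remains is that of \<open>u\<close>, since the constant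
    \<open>u0\<close> has logarithmic derivative 0.\<close>
  have r: "\<i> * of_real r = dlog u c p [v]"
  proof -
    have "\<i> * of_real (chart_deriv c (K, \<psi>) (\<lambda>x. k x * u x) p v) = dlog k c p [v] + dlog u c p [v]"
      using dlog_eq[OF L A' circle_smooth_mult[OF L A' ks us] c(1) K(1) c(2) N(1), of "[v]"] K(2)
        dlog_mult[OF L A' ks us c(1,2) N(1), of v] by (simp add: u0_def)
    moreover have "\<i> * of_real (chart_deriv c (K, \<psi>) (\<lambda>x. k x * u0) p v) = dlog k c p [v]"
      using dlog_eq[OF L A' circle_smooth_mult[OF L A' ks cs] c(1) K(1) c(2) N(1), of "[v]"] K(2)
        dlog_mult[OF L A' ks cs c(1,2) N(1), of v] by (simp add: dlog_const)
    ultimately show ?thesis by (simp add: r_def algebra_simps)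
  qed
  have vert: "\<theta> e q [(0, 1)] = \<i>"
  proof -
    have "has_dir_deriv (\<lambda>t::real. (\<phi> (y p), \<psi> (k p * u0 * cis t))) 1 0 (0, 1)"
      by (rule has_dir_deriv_Pair[OF has_dir_deriv_const circle_chart_rotate[OF K]])
    moreover have "snd e (act P q (cis t)) = (\<phi> (y p), \<psi> (k p * u0 * cis t))" for t :: real
    proof -
      have "act P q (cis t) = act P (\<sigma> (y p)) (k p * u0 * cis t)"
        unfolding q_eq by (rule cb_act_act[OF P sg(1)[OF N(1)] ku0]) simp
      then show ?thesis
        using \<xi>[OF N(1), of "k p * u0 * cis t"] ku0 by (simp add: e_def norm_mult)
    qed
    ultimately have "dir_deriv (\<lambda>t::real. snd e (act P q (cis t))) 1 0 = (0, 1)"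
      by (simp add: has_dir_deriv_dir_deriv)
    then show ?thesis using connection_vertical[OF \<theta> e qe] by simp
  qed
  have lin: "linear (\<lambda>w. \<theta> e q [w])"
    using diff_form_linear[OF connection_diff_form[OF \<theta>] e qe qtot, of "[0]" 0] by simp
  have hus: "smooth_map A' N (ctotal A P) (\<lambda>x. act P (h x) (u x))" by (rule smooth_map_act[OF P A' hs us])
  have hcs: "smooth_map A' N (ctotal A P) (\<lambda>x. act P (h x) u0)" by (rule smooth_map_act[OF P A' hs cs])
  have "pullback_form (ctotal A P) (\<lambda>x. act P (h x) (u x)) \<theta> c p [v] = \<theta> e q [L1]"
    using pullback_form_chart[OF A' T hus connection_diff_form[OF \<theta>] c(1) e c(2) N(1), of "[v]"] qe qtot
    by (simp add: L1_def q_def u0_def)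
  also have "\<dots> = \<theta> e q [L0] + of_real r * \<i>"
    unfolding L1 using linear_add[OF lin, of L0 "r *\<^sub>R (0, 1)"] linear_scale[OF lin, of r "(0, 1)"] vert
    by (simp add: scaleR_conv_of_real del: scaleR_Pair)
  also have "\<theta> e q [L0] = pullback_form (ctotal A P) (\<lambda>x. act P (h x) u0) \<theta> c p [v]"
    using pullback_form_chart[OF A' T hcs connection_diff_form[OF \<theta>] c(1) e c(2) N(1), of "[v]"] qe qtot
    by (simp add: L0_def q_def)
  also have "\<dots> = pullback_form (ctotal A P) h (pullback_form (ctotal A P) (\<lambda>q. act P q u0) \<theta>) c p [v]"
    using smooth_map_act[OF P T smooth_map_id[OF T mopen_tot[OF P]] circle_smooth_const[OF L T mopen_tot[OF P] u0]]
    by (rule pullback_form_compose[OF A' T hs _ c(1) N(1) c(2) htot[OF N(1)]])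
  \<comment> \<open>Invariance of \<open>\<theta>\<close> under the constant \<open>u0\<close>,
    applied in the chart chosen at \<open>h p\<close>, removes the displacement.\<close>
  also have "\<dots> = pullback_form (ctotal A P) h \<theta> c p [v]"
  proof -
    have "pullback_form (ctotal A P) (\<lambda>q. act P q u0) \<theta> (the_chart (ctotal A P) (h p)) (h p) [w] =
        \<theta> (the_chart (ctotal A P) (h p)) (h p) [w]" for w
      using connection_invariant[OF \<theta> u0, unfolded form_eq_def, rule_format, of "the_chart (ctotal A P) (h p)" "h p" "[w]"]
        the_chart[OF smooth_map_image[OF hs N(1)]] htot[OF N(1)] by simp
    then show ?thesis
      unfolding pullback_form_eq[of "ctotal A P" h] by simp
  qed
  finally show ?thesis using r by (simp add: mult.commute)
qed

text \<open>A connection has imaginary values, and so has the constant \<open>chern_const\<close>;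
  the product is real.\<close>

lemma real_form_pullback_connection:
  fixes A' :: "('m, 'k::locally_convex) atlas"
  assumes P: "cbundle A P" and \<theta>: "connection_form A P \<theta>" and A': "smooth_atlas A'"
    and h: "smooth_map A' W (ctotal A P) h"
  shows "real_form A' W 1 (\<lambda>c p vs. - (chern_const * pullback_form (ctotal A P) h \<theta> c p vs))"
proof -
  have "diff_form A' W 1 (pullback_form (ctotal A P) h \<theta>)"
    using smooth_map_image[OF h] mcarrier_ctotal[OF P]
    by (intro diff_form_pullback[OF A' smooth_atlas_ctotal[OF P] h connection_diff_form[OF \<theta>]]) simp
  from diff_form_cmult[OF A' this, of "- chern_const"]
  have "diff_form A' W 1 (\<lambda>c p vs. - (chern_const * pullback_form (ctotal A P) h \<theta> c p vs))" by simp
  moreover have "- (chern_const * pullback_form (ctotal A P) h \<theta> c p vs) \<in> \<real>"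
    if pvs: "p \<in> W" "length vs = 1" for c :: "('m, 'k) chart" and p vs
  proof -
    note d = the_chart[OF smooth_map_image[OF h pvs(1)]]
    obtain v where "vs = [v]" using pvs(2) by (auto simp: length_Suc_conv)
    then have "Re (pullback_form (ctotal A P) h \<theta> c p vs) = 0"
      using connection_imaginary[OF \<theta> conjunct1[OF d] conjunct2[OF d]] by (simp add: pullback_form_eq)
    then show ?thesis using chern_const_real by simp
  qed
  ultimately show ?thesis by (simp add: real_form_def)
qed

section \<open>Trivializations\<close>

text \<open>For the second claim, both points have the same image under \<open>\<Phi>\<close>:
  equivariance moves the image \<open>(proj D z, 1)\<close> of the section to
  \<open>(proj D z, snd (\<Phi> z))\<close>, and \<open>\<Phi>\<close> is injective.\<close>

lemma triv_section:
  assumes D: "cbundle A D" and \<Phi>: "trivialization A D \<Phi>"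
  shows "smooth_map A (mcarrier A) (ctotal A D) (triv_section D \<Phi>)"
    and "z \<in> tot D \<Longrightarrow> z = act D (triv_section D \<Phi> (proj D z)) (snd (\<Phi> z))"
proof -
  note L = cb_lie[OF D] and A = cb_atlas[OF D]
  note C = lie_group_atlas[OF L]
  have bij: "bij_betw \<Phi> (tot D) (mcarrier A \<times> sphere 0 1)"
    and inv: "smooth_map (prod_atlas A circle_atlas) (mcarrier A \<times> sphere 0 1) (ctotal A D) (inv_into (tot D) \<Phi>)"
    and act: "\<And>p u. p \<in> tot D \<Longrightarrow> u \<in> sphere 0 1 \<Longrightarrow> \<Phi> (act D p u) = (proj D p, snd (\<Phi> p) * u)"
    and fst: "\<And>p. p \<in> tot D \<Longrightarrow> fst (\<Phi> p) = proj D p"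
    using \<Phi> unfolding trivialization_def circle_group_simps by blast+
  have one: "circle_smooth A (mcarrier A) (\<lambda>_. 1)"
    by (rule circle_smooth_const[OF L A mopen_mcarrier[OF A]]) simp
  have "smooth_map A (mcarrier A) (ctotal A D) (\<lambda>x. inv_into (tot D) \<Phi> (x, 1))"
    by (rule smooth_map_compose[OF A smooth_atlas_prod[OF A C] smooth_atlas_ctotal[OF D]
        smooth_map_Pair[OF A A C smooth_map_id[OF A mopen_mcarrier[OF A]] one] inv]) simp
  then show "smooth_map A (mcarrier A) (ctotal A D) (triv_section D \<Phi>)"
    by (simp add: triv_section_def[abs_def])
  assume z: "z \<in> tot D"
  let ?s = "triv_section D \<Phi> (proj D z)"
  have "(proj D z, 1) \<in> \<Phi> ` tot D"
    using cb_proj[OF D z] bij by (simp add: bij_betw_def)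
  then have s: "?s \<in> tot D" "\<Phi> ?s = (proj D z, 1)"
    unfolding triv_section_def by (rule inv_into_into, rule f_inv_into_f)
  have "\<Phi> z \<in> mcarrier A \<times> sphere 0 1" using bij z by (auto simp: bij_betw_def)
  then have u: "snd (\<Phi> z) \<in> sphere 0 1" by auto
  have "\<Phi> (act D ?s (snd (\<Phi> z))) = \<Phi> z"
    using act[OF s(1) u] s fst[OF z] fst[OF s(1)] by (simp add: prod_eq_iff)
  then show "z = act D ?s (snd (\<Phi> z))"
    using inj_onD[OF bij_betw_imp_inj_on[OF bij], of "act D ?s (snd (\<Phi> z))" z] z cb_act[OF D s(1) u] by simp
qed

lemma circle_smooth_trivialization:
  assumes D: "cbundle A D" and \<Phi>: "trivialization A D \<Phi>" and A': "smooth_atlas A'" and z: "smooth_map A' W (ctotal A D) z"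
  shows "circle_smooth A' W (\<lambda>x. snd (\<Phi> (z x)))"
proof -
  note L = cb_lie[OF D] and A = cb_atlas[OF D]
  note C = lie_group_atlas[OF L]
  have s: "smooth_map (ctotal A D) (tot D) (prod_atlas A circle_atlas) \<Phi>"
    using \<Phi> unfolding trivialization_def by blast
  have ps: "smooth_map A' W (prod_atlas A circle_atlas) (\<lambda>x. \<Phi> (z x))"
    using smooth_map_image[OF z] mcarrier_ctotal[OF D]
    by (intro smooth_map_compose[OF A' smooth_atlas_ctotal[OF D] smooth_atlas_prod[OF A C] z s]) simp
  show ?thesis
    by (rule smooth_map_compose[OF A' smooth_atlas_prod[OF A C] C ps
        smooth_map_snd[OF A C mopen_mcarrier[OF smooth_atlas_prod[OF A C]]] smooth_map_image[OF ps]])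
qed

section \<open>The simplicial Dixmier--Douady cocycle\<close>

text \<open>Composing with a local section of the bundle lifts \<open>g\<close> near each point. A
  global lift would amount to a section of the pulled back bundle, which may be nontrivial.\<close>

lemma smooth_map_local_lift:
  assumes P: "cbundle A P" and A': "smooth_atlas A'" and g: "smooth_map A' W A g" and p: "p \<in> W"
  shows "\<exists>N h. mopen A' N \<and> p \<in> N \<and> N \<subseteq> W \<and> smooth_map A' N (ctotal A P) h \<and> (\<forall>x\<in>N. proj P (h x) = g x)"
proof -
  obtain V \<sigma> where V: "(V, \<sigma>) \<in> lsecs P" "g p \<in> V"
    using cb_lsecE[OF P smooth_map_image[OF g p]] .
  have m: "mopen A' {x \<in> W. g x \<in> V}"
    by (rule mopen_vimage[OF A' cb_atlas[OF P] g cb_lsec_mopen[OF P V(1)]])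
  have "smooth_map A' {x \<in> W. g x \<in> V} (ctotal A P) (\<lambda>x. \<sigma> (g x))"
    by (rule smooth_map_compose[OF A' cb_atlas[OF P] smooth_atlas_ctotal[OF P] smooth_map_subset[OF g A' m]
          smooth_map_lsec[OF P V(1)]]) auto
  then show ?thesis
    using m p V cb_lsec[OF P V(1)]
    by (intro exI[of _ "{x \<in> W. g x \<in> V}"] exI[of _ "\<lambda>x. \<sigma> (g x)"]) auto
qed

lemma pullback_form_id:
  assumes A: "smooth_atlas A" and W: "diff_form A W q \<omega>" and c: "c \<in> A" "p \<in> fst c" "p \<in> W" "length vs = q"
  shows "pullback_form A (\<lambda>x. x) \<omega> c p vs = \<omega> c p vs"
proof -
  have "map (chart_deriv c c (\<lambda>x. x) p) vs = vs"
    using chart_deriv_id[OF A c(1,2)] by (simp add: map_idI)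
  then show ?thesis
    using pullback_form_chart[OF A A smooth_map_id[OF A diff_form_mopen[OF W]] W c(1,1,2,3,2,3,4)] by simp
qed

section \<open>The extension with its connection, and the bundle over
  \<open>G \<times> G\<close>\<close>

locale dixmier_douady =
  fixes G :: "'g monoid" and AG :: "('g, 'e::locally_convex) atlas"
    and H :: "'h monoid" and \<iota> :: "complex \<Rightarrow> 'h" and P :: "('g, 'h, complex) pbundle"
    and \<theta> :: "('h, 'e \<times> real) form" and c1 :: "('g, 'e) form"
    and \<delta>\<theta> :: "(('g, 'h) delta, ('e \<times> 'e) \<times> real) form"
    and \<Phi> :: "('g, 'h) delta \<Rightarrow> ('g \<times> 'g) \<times> complex"
  assumes extension: "central_extension G AG H \<iota> P"
    and connection: "connection_form AG P \<theta>"
    and chern: "chern_form AG P \<theta> c1"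
    and delta: "delta_connection G AG P \<theta> \<delta>\<theta>"
    and trivial: "trivialization (NG2 AG) (delta_bundle G P) \<Phi>"
begin

lemma G: "lie_group G AG" and P: "cbundle AG P"
  using extension cbundle_of_circle_bundle by (auto simp: central_extension_def)

lemma AG: "smooth_atlas AG" and carrier: "mcarrier AG = carrier G"
  using lie_group_atlas[OF G] G by (auto simp: lie_group_def)

lemmas L = cb_lie[OF P] and T = smooth_atlas_ctotal[OF P]

lemma N2: "smooth_atlas (NG2 AG)" and N3: "smooth_atlas (NG3 AG)"
  by (intro smooth_atlas_prod AG)+

lemma carrier2: "mcarrier (NG2 AG) = carrier G \<times> carrier G"
  and carrier3: "mcarrier (NG3 AG) = carrier G \<times> carrier G \<times> carrier G"
  by (simp_all add: mcarrier_prod_atlas carrier)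

lemma mopen2: "mopen (NG2 AG) (carrier G \<times> carrier G)" and mopen3: "mopen (NG3 AG) (carrier G \<times> carrier G \<times> carrier G)"
  using mopen_mcarrier[OF N2] mopen_mcarrier[OF N3] by (simp_all add: carrier2 carrier3)

lemma smooth_mult:
  assumes "smooth_atlas A" "smooth_map A W AG f" "smooth_map A W AG g"
  shows "smooth_map A W AG (\<lambda>x. f x \<otimes>\<^bsub>G\<^esub> g x)"
proof -
  have m: "smooth_map (NG2 AG) (carrier G \<times> carrier G) AG (\<lambda>(g, h). g \<otimes>\<^bsub>G\<^esub> h)"
    using G by (simp add: lie_group_def)
  show ?thesis
    using smooth_map_compose[OF assms(1) N2 AG smooth_map_Pair[OF assms(1) AG AG assms(2,3)] m]
      smooth_map_image[OF assms(2)] smooth_map_image[OF assms(3)] by (simp add: carrier)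
qed

lemma smooth_face2: "smooth_map (NG2 AG) (mcarrier (NG2 AG)) AG (face2 G i)"
proof -
  note m = mopen_mcarrier[OF N2]
  note f = smooth_map_fst[OF AG AG m] and s = smooth_map_snd[OF AG AG m]
  have "face2 G i = (if i = 0 then snd else if i = 1 then (\<lambda>x. fst x \<otimes>\<^bsub>G\<^esub> snd x) else fst)"
    by (auto simp: face2_def)
  then show ?thesis
    using f s smooth_mult[OF N2 f s] by simp
qed

lemma face_bundle_eq: "face_bundle G P i = pullback_bundle (mcarrier (NG2 AG)) (face2 G i) P"
  by (simp add: face_bundle_def carrier2)

lemma cbundle_face: "cbundle (NG2 AG) (face_bundle G P i)"
  unfolding face_bundle_eq by (rule cbundle_pullback[OF P N2 smooth_face2])

abbreviation "F0 \<equiv> face_bundle G P 0"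
abbreviation "F1 \<equiv> inverse_bundle (face_bundle G P 1)"
abbreviation "F2 \<equiv> face_bundle G P 2"

lemmas F0 = cbundle_face[of 0] and F1 = cbundle_inverse[OF cbundle_face[of 1]] and F2 = cbundle_face[of 2]
lemmas F01 = cbundle_tensor[OF F0 F1]

lemma D: "cbundle (NG2 AG) (delta_bundle G P)"
  unfolding delta_bundle_def by (rule cbundle_tensor[OF F01 F2])

lemma smooth_face_snd: "smooth_map (ctotal (NG2 AG) (face_bundle G P i)) (tot (face_bundle G P i)) (ctotal AG P) snd"
  unfolding face_bundle_eq by (rule smooth_map_pullback_snd[OF P N2 smooth_face2])

text \<open>The inverse bundle has the same points as the face bundle. That the identity between
  them is smooth is \<open>smooth_map_inverse_bundle\<close>, as inverting twice gives back the face
  bundle.\<close>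

lemma smooth_F1_snd: "smooth_map (ctotal (NG2 AG) F1) (tot F1) (ctotal AG P) snd"
proof -
  note T1 = smooth_atlas_ctotal[OF F1]
  have "smooth_map (ctotal (NG2 AG) F1) (tot F1) (ctotal (NG2 AG) (face_bundle G P 1)) (\<lambda>x. x)"
    using smooth_map_inverse_bundle[OF F1 T1 smooth_map_id[OF T1 mopen_tot[OF F1]]] by simp
  then show ?thesis
    by (rule smooth_map_compose[OF T1 smooth_atlas_ctotal[OF cbundle_face] T _ smooth_face_snd]) simp
qed

section \<open>Lifts \<open>a\<close>, \<open>b\<close>, \<open>c\<close> over the edges 12, 02, 01
  of a 2-simplex\<close>

context
  fixes A :: "('m, 'k::locally_convex) atlas" and W :: "'m set" and a b c :: "'m \<Rightarrow> 'h"
  assumes A: "smooth_atlas A" and a: "smooth_map A W (ctotal AG P) a" and b: "smooth_map A W (ctotal AG P) b"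
    and c: "smooth_map A W (ctotal AG P) c"
    and abc: "\<And>x. x \<in> W \<Longrightarrow> proj P (b x) = proj P (c x) \<otimes>\<^bsub>G\<^esub> proj P (a x)"
begin

abbreviation (input) "edge \<equiv> \<lambda>x. (proj P (c x), proj P (a x))"

lemma smooth_edge: "smooth_map A W (NG2 AG) edge"
  by (intro smooth_map_Pair[OF A AG AG] smooth_map_proj_compose[OF P A] a c)

lemma smooth_face_lifts:
  "smooth_map A W (ctotal (NG2 AG) F0) (\<lambda>x. (edge x, a x))"
  "smooth_map A W (ctotal (NG2 AG) F1) (\<lambda>x. (edge x, b x))"
  "smooth_map A W (ctotal (NG2 AG) F2) (\<lambda>x. (edge x, c x))"
proof -
  show "smooth_map A W (ctotal (NG2 AG) F0) (\<lambda>x. (edge x, a x))"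
    unfolding face_bundle_eq
    by (rule smooth_map_pullback_Pair[OF P N2 smooth_face2 A smooth_edge a]) (simp add: face2_def)
  have "smooth_map A W (ctotal (NG2 AG) (face_bundle G P 1)) (\<lambda>x. (edge x, b x))"
    unfolding face_bundle_eq
    by (rule smooth_map_pullback_Pair[OF P N2 smooth_face2 A smooth_edge b]) (simp add: face2_def abc)
  then show "smooth_map A W (ctotal (NG2 AG) F1) (\<lambda>x. (edge x, b x))"
    by (rule smooth_map_inverse_bundle[OF cbundle_face A])
  show "smooth_map A W (ctotal (NG2 AG) F2) (\<lambda>x. (edge x, c x))"
    unfolding face_bundle_eq
    by (rule smooth_map_pullback_Pair[OF P N2 smooth_face2 A smooth_edge c]) (simp add: face2_def)
qed

lemma face_lifts_tot:
  assumes "x \<in> W"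
  shows "(edge x, a x) \<in> tot F0" "(edge x, b x) \<in> tot F1" "(edge x, c x) \<in> tot F2"
  using smooth_map_image[OF smooth_face_lifts(1) assms] smooth_map_image[OF smooth_face_lifts(2) assms]
    smooth_map_image[OF smooth_face_lifts(3) assms]
  by (simp_all only: mcarrier_ctotal[OF F0] mcarrier_ctotal[OF F1] mcarrier_ctotal[OF F2])

abbreviation (input) "z1 \<equiv> \<lambda>x. tensor_elt F0 F1 (edge x, a x) (edge x, b x)"

lemma smooth_z1: "smooth_map A W (ctotal (NG2 AG) (tensor_bundle F0 F1)) z1"
  by (rule smooth_map_tensor_elt[OF F0 F1 A smooth_face_lifts(1,2)]) (simp add: face_bundle_def)

lemma proj_z1: "x \<in> W \<Longrightarrow> proj (tensor_bundle F0 F1) (z1 x) = edge x"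
  using tensor_proj[OF F0 F1 face_lifts_tot(1,2)] by (simp add: face_bundle_def)

lemma delta_elt_eq: "delta_elt G P (a x) (b x) (c x) = tensor_elt (tensor_bundle F0 F1) F2 (z1 x) (edge x, c x)"
  by (simp add: delta_elt_def Let_def)

lemma smooth_delta_elt: "smooth_map A W (ctotal (NG2 AG) (delta_bundle G P)) (\<lambda>x. delta_elt G P (a x) (b x) (c x))"
  unfolding delta_bundle_def delta_elt_eq
  by (rule smooth_map_tensor_elt[OF F01 F2 A smooth_z1 smooth_face_lifts(3)])
     (subst proj_z1, simp_all add: face_bundle_def)

lemma proj_delta_elt:
  assumes x: "x \<in> W"
  shows "proj (delta_bundle G P) (delta_elt G P (a x) (b x) (c x)) = edge x"
proof -
  have "z1 x \<in> tot (tensor_bundle F0 F1)"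
    using smooth_map_image[OF smooth_z1 x] mcarrier_ctotal[OF F01] by simp
  then show ?thesis
    unfolding delta_bundle_def delta_elt_eq
    using tensor_proj[OF F01 F2 _ face_lifts_tot(3)[OF x]] proj_z1[OF x] by simp
qed

lemma smooth_dd_value: "circle_smooth A W (\<lambda>x. dd_value G P \<Phi> (a x) (b x) (c x))"
  unfolding dd_value_def by (rule circle_smooth_trivialization[OF D trivial A smooth_delta_elt])

text \<open>Two applications of \<open>pullback_tensor_connection\<close>, one for each tensor
  product. The second component of \<open>(edge x, h x)\<close> is the lift itself, so every face
  contributes a pull-back of \<open>\<theta>\<close>; the middle sign is that of the connection on
  the inverse bundle.\<close>

lemma pullback_delta_connection:
  assumes p: "d \<in> A" "p \<in> fst d" "p \<in> W" "length vs = 1"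
  shows "pullback_form (ctotal (NG2 AG) (delta_bundle G P)) (\<lambda>x. delta_elt G P (a x) (b x) (c x)) \<delta>\<theta> d p vs =
    pullback_form (ctotal AG P) a \<theta> d p vs - pullback_form (ctotal AG P) b \<theta> d p vs +
    pullback_form (ctotal AG P) c \<theta> d p vs"
proof -
  obtain \<zeta> where \<zeta>: "tensor_connection (NG2 AG) F0 F1 (pullback_form (ctotal AG P) snd \<theta>)
      (\<lambda>c p vs. - pullback_form (ctotal AG P) snd \<theta> c p vs) \<zeta>"
    "tensor_connection (NG2 AG) (tensor_bundle F0 F1) F2 \<zeta> (pullback_form (ctotal AG P) snd \<theta>) \<delta>\<theta>"
    using delta unfolding delta_connection_def by blast
  have snd: "pullback_form (ctotal (NG2 AG) B) (\<lambda>x. (edge x, h x)) (pullback_form (ctotal AG P) snd \<theta>) d p vs =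
      pullback_form (ctotal AG P) h \<theta> d p vs"
    if "cbundle (NG2 AG) B" "smooth_map A W (ctotal (NG2 AG) B) (\<lambda>x. (edge x, h x))"
      "smooth_map (ctotal (NG2 AG) B) (tot B) (ctotal AG P) snd"
    for B :: "('g \<times> 'g, ('g \<times> 'g) \<times> 'h, complex) pbundle" and h
    using pullback_form_compose[OF A smooth_atlas_ctotal[OF that(1)] that(2,3) p(1,3,2), of \<theta> vs]
      smooth_map_image[OF that(2) p(3)] mcarrier_ctotal[OF that(1)] by simp
  have "pullback_form (ctotal (NG2 AG) (delta_bundle G P)) (\<lambda>x. delta_elt G P (a x) (b x) (c x)) \<delta>\<theta> d p vs =
      pullback_form (ctotal (NG2 AG) (tensor_bundle F0 F1)) z1 \<zeta> d p vs +
      pullback_form (ctotal (NG2 AG) F2) (\<lambda>x. (edge x, c x)) (pullback_form (ctotal AG P) snd \<theta>) d p vs"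
    unfolding delta_bundle_def delta_elt_eq
    by (rule pullback_tensor_connection[OF F01 F2 \<zeta>(2) A smooth_z1 smooth_face_lifts(3) _ p])
       (subst proj_z1, simp_all add: face_bundle_def)
  also have "pullback_form (ctotal (NG2 AG) (tensor_bundle F0 F1)) z1 \<zeta> d p vs =
      pullback_form (ctotal (NG2 AG) F0) (\<lambda>x. (edge x, a x)) (pullback_form (ctotal AG P) snd \<theta>) d p vs +
      pullback_form (ctotal (NG2 AG) F1) (\<lambda>x. (edge x, b x)) (\<lambda>c p vs. - pullback_form (ctotal AG P) snd \<theta> c p vs) d p vs"
    by (rule pullback_tensor_connection[OF F0 F1 \<zeta>(1) A smooth_face_lifts(1,2) _ p]) (simp add: face_bundle_def)
  also have "pullback_form (ctotal (NG2 AG) F1) (\<lambda>x. (edge x, b x)) (\<lambda>c p vs. - pullback_form (ctotal AG P) snd \<theta> c p vs) d p vs =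
      - pullback_form (ctotal (NG2 AG) F1) (\<lambda>x. (edge x, b x)) (pullback_form (ctotal AG P) snd \<theta>) d p vs"
    unfolding pullback_form_eq by (rule refl)
  finally show ?thesis
    using snd[OF F0 smooth_face_lifts(1) smooth_face_snd] snd[OF F1 smooth_face_lifts(2) smooth_F1_snd]
      snd[OF F2 smooth_face_lifts(3) smooth_face_snd] by simp
qed

end

section \<open>The one-form of the simplicial cochain and its pull-backs\<close>

abbreviation "\<mu> \<equiv> dd_one_form G AG P \<delta>\<theta> \<Phi>"

lemma delta_connection: "connection_form (NG2 AG) (delta_bundle G P) \<delta>\<theta>"
  using delta unfolding delta_connection_def tensor_connection_def delta_bundle_def by blast

lemma dd_one_form_eq:
  "\<mu> = (\<lambda>c p vs. - (chern_const * pullback_form (ctotal (NG2 AG) (delta_bundle G P)) (triv_section (delta_bundle G P) \<Phi>) \<delta>\<theta> c p vs))"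
  by (intro ext) (simp add: dd_one_form_def)

lemma real_form_dd_one_form: "real_form (NG2 AG) (carrier G \<times> carrier G) 1 \<mu>"
  unfolding dd_one_form_eq
  using real_form_pullback_connection[OF D delta_connection N2 triv_section(1)[OF D trivial]] by (simp add: carrier2)

text \<open>The key identity: \<open>a \<otimes> b\<^sup>-\<^sup>1 \<otimes> c = (s \<circ> (\<rho> c, \<rho> a)) \<cdot> k\<close>, so that pulling \<open>\<delta>\<theta>\<close> back along both
  sides compares \<open>a\<^sup>*\<theta> - b\<^sup>*\<theta> + c\<^sup>*\<theta>\<close> with \<open>s\<^sup>*\<delta>\<theta>\<close> and \<open>dlog k\<close>.\<close>

lemma pullback_dd_one_form:
  assumes A: "smooth_atlas A" and a: "smooth_map A W (ctotal AG P) a" and b: "smooth_map A W (ctotal AG P) b"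
    and c: "smooth_map A W (ctotal AG P) c"
    and abc: "\<And>x. x \<in> W \<Longrightarrow> proj P (b x) = proj P (c x) \<otimes>\<^bsub>G\<^esub> proj P (a x)"
    and p: "d \<in> A" "p \<in> fst d" "p \<in> W" "length vs = 1"
  shows "pullback_form (NG2 AG) (\<lambda>x. (proj P (c x), proj P (a x))) \<mu> d p vs =
    - (chern_const * pullback_form (ctotal AG P) a \<theta> d p vs) + chern_const * pullback_form (ctotal AG P) b \<theta> d p vs
    - chern_const * pullback_form (ctotal AG P) c \<theta> d p vs
    + chern_const * dlog (\<lambda>x. dd_value G P \<Phi> (a x) (b x) (c x)) d p vs"
proof -
  let ?D = "delta_bundle G P" and ?y = "\<lambda>x. (proj P (c x), proj P (a x))"
  let ?s = "triv_section ?D \<Phi>" and ?z = "\<lambda>x. delta_elt G P (a x) (b x) (c x)"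
  let ?k = "\<lambda>x. dd_value G P \<Phi> (a x) (b x) (c x)"
  have y: "smooth_map A W (NG2 AG) ?y"
    by (rule smooth_edge[OF A a b c abc])
  have z: "smooth_map A W (ctotal (NG2 AG) ?D) ?z"
    by (rule smooth_delta_elt[OF A a b c abc])
  have k: "circle_smooth A W ?k"
    by (rule smooth_dd_value[OF A a b c abc])
  note s = triv_section(1)[OF D trivial]
  have sy: "smooth_map A W (ctotal (NG2 AG) ?D) (\<lambda>x. ?s (?y x))"
    by (rule smooth_map_compose[OF A N2 smooth_atlas_ctotal[OF D] y s smooth_map_image[OF y]])
  obtain v where v: "vs = [v]" using p(4) by (auto simp: length_Suc_conv)
  have "?z x = act ?D (?s (?y x)) (?k x)" if x: "x \<in> W" for x
  proof -
    have "?z x \<in> tot ?D" using smooth_map_image[OF z x] mcarrier_ctotal[OF D] by simp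
    then show ?thesis
      using triv_section(2)[OF D trivial, of "?z x"] proj_delta_elt[OF A a b c abc x] by (simp add: dd_value_def)
  qed
  then have "pullback_form (ctotal (NG2 AG) ?D) ?z \<delta>\<theta> d p vs =
      pullback_form (ctotal (NG2 AG) ?D) (\<lambda>x. act ?D (?s (?y x)) (?k x)) \<delta>\<theta> d p vs"
    by (intro pullback_form_cong[OF A smooth_map_mopen[OF a] p(1,3,2)])
  also have "\<dots> = pullback_form (ctotal (NG2 AG) ?D) (\<lambda>x. ?s (?y x)) \<delta>\<theta> d p vs + dlog ?k d p vs"
    unfolding v by (rule pullback_connection_act[OF D delta_connection A sy k p(1-3)])
  also have "pullback_form (ctotal (NG2 AG) ?D) (\<lambda>x. ?s (?y x)) \<delta>\<theta> d p vs =
      pullback_form (NG2 AG) ?y (pullback_form (ctotal (NG2 AG) ?D) ?s \<delta>\<theta>) d p vs"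
    by (rule pullback_form_compose[OF A N2 y s p(1,3,2) smooth_map_image[OF y p(3)]])
  finally have e: "pullback_form (NG2 AG) ?y (pullback_form (ctotal (NG2 AG) ?D) ?s \<delta>\<theta>) d p vs =
      pullback_form (ctotal (NG2 AG) ?D) ?z \<delta>\<theta> d p vs - dlog ?k d p vs" by simp
  have "pullback_form (NG2 AG) ?y \<mu> d p vs =
      - (chern_const * pullback_form (NG2 AG) ?y (pullback_form (ctotal (NG2 AG) ?D) ?s \<delta>\<theta>) d p vs)"
    unfolding dd_one_form_eq pullback_form_eq by (rule refl)
  moreover have "pullback_form (ctotal (NG2 AG) ?D) ?z \<delta>\<theta> d p vs =
      pullback_form (ctotal AG P) a \<theta> d p vs - pullback_form (ctotal AG P) b \<theta> d p vs +
      pullback_form (ctotal AG P) c \<theta> d p vs"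
    by (rule pullback_delta_connection[OF A a b c abc p])
  ultimately show ?thesis
    unfolding e by (simp add: right_diff_distrib distrib_left)
qed

text \<open>A primitive of the pull-back of \<open>c1\<close> along \<open>proj P \<circ> h\<close>,
  see \<open>pullback_chern_form\<close>; so every lift makes \<open>c1\<close> exact on its
  domain.\<close>

definition connection_pullback :: "('m \<Rightarrow> 'h) \<Rightarrow> ('m, 'k::locally_convex) form" where
  "connection_pullback h = (\<lambda>d p vs. chern_const * pullback_form (ctotal AG P) h \<theta> d p vs)"

lemma diff_form_connection_pullback:
  assumes A: "smooth_atlas A" and h: "smooth_map A W (ctotal AG P) h"
  shows "diff_form A W 1 (pullback_form (ctotal AG P) h \<theta>)" "diff_form A W 1 (connection_pullback h)"
proof -
  show "diff_form A W 1 (pullback_form (ctotal AG P) h \<theta>)"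
    using smooth_map_image[OF h] mcarrier_ctotal[OF P]
    by (intro diff_form_pullback[OF A T h connection_diff_form[OF connection]]) simp
  then show "diff_form A W 1 (connection_pullback h)"
    unfolding connection_pullback_def by (rule diff_form_cmult[OF A])
qed

text \<open>\<open>chern_form\<close> relates \<open>c1\<close> to the differential of
  \<open>\<theta>\<close> on the total space. Pulling this relation back along \<open>h\<close> and
  exchanging d with the pull-back of the one-form \<open>\<theta>\<close> gives the claim.\<close>

lemma pullback_chern_form:
  assumes A: "smooth_atlas A" and h: "smooth_map A W (ctotal AG P) h"
    and p: "d \<in> A" "p \<in> fst d" "p \<in> W" "length vs = 2"
  shows "pullback_form AG (\<lambda>x. proj P (h x)) c1 d p vs = ext_d (connection_pullback h) d p vs"
proof -
  have tot: "h p \<in> tot P" using smooth_map_image[OF h p(3)] mcarrier_ctotal[OF P] by simp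
  have "pullback_form AG (\<lambda>x. proj P (h x)) c1 d p vs = pullback_form (ctotal AG P) h (pullback_form AG (proj P) c1) d p vs"
    by (rule pullback_form_compose[OF A T h smooth_map_proj[OF P] p(1,3,2) tot])
  also have "\<dots> = chern_const * pullback_form (ctotal AG P) h (ext_d \<theta>) d p vs"
  proof -
    note e = the_chart[OF smooth_map_image[OF h p(3)]]
    have "pullback_form AG (proj P) c1 (the_chart (ctotal AG P) (h p)) (h p) ws =
        chern_const * ext_d \<theta> (the_chart (ctotal AG P) (h p)) (h p) ws" if "length ws = 2" for ws
      using chern e tot that unfolding chern_form_def form_eq_def by blast
    then show ?thesis
      unfolding pullback_form_eq[of "ctotal AG P" h] using p(4) by simp
  qed
  also have "pullback_form (ctotal AG P) h (ext_d \<theta>) d p vs = ext_d (pullback_form (ctotal AG P) h \<theta>) d p vs"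
    using smooth_map_image[OF h] mcarrier_ctotal[OF P]
    by (intro ext_d_pullback[OF A T h connection_diff_form[OF connection] _ p, symmetric]) simp
  also have "chern_const * \<dots> = ext_d (connection_pullback h) d p vs"
    unfolding connection_pullback_def
    using p by (intro ext_d_cmult[OF diff_form_connection_pullback(1)[OF A h], symmetric]) auto
  finally show ?thesis .
qed

text \<open>The rule \<open>ext_d_pullback\<close> concerns one-forms, while \<open>c1\<close> is a
  two-form. Closedness is therefore obtained from \<open>d d = 0\<close>, the pull-back being the
  differential of a one-form.\<close>

lemma ext_d_pullback_chern_form:
  assumes A: "smooth_atlas A" and h: "smooth_map A W (ctotal AG P) h"
    and p: "d \<in> A" "p \<in> fst d" "p \<in> W" "length vs = 3"
  shows "ext_d (pullback_form AG (\<lambda>x. proj P (h x)) c1) d p vs = 0"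
proof -
  have "ext_d (pullback_form AG (\<lambda>x. proj P (h x)) c1) d p vs = ext_d (ext_d (connection_pullback h)) d p vs"
    using p pullback_chern_form[OF A h]
    by (intro ext_d_cong[OF A smooth_map_mopen[OF h], where q = 2]) (auto simp: form_eq_def)
  then show ?thesis
    using ext_d_ext_d[OF A diff_form_connection_pullback(2)[OF A h] p] by simp
qed

text \<open>The sum is bracketed, and the signs are written as scalar factors, so that
  \<open>ext_d_add\<close> and \<open>ext_d_cmult\<close> apply to it term by term.\<close>

lemma pullback_dd_one_form_eq:
  assumes A: "smooth_atlas A" and a: "smooth_map A W (ctotal AG P) a" and b: "smooth_map A W (ctotal AG P) b"
    and c: "smooth_map A W (ctotal AG P) c"
    and abc: "\<And>x. x \<in> W \<Longrightarrow> proj P (b x) = proj P (c x) \<otimes>\<^bsub>G\<^esub> proj P (a x)"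
  shows "form_eq A W 1 (pullback_form (NG2 AG) (\<lambda>x. (proj P (c x), proj P (a x))) \<mu>)
    (\<lambda>d p vs. (-1) * connection_pullback a d p vs + (connection_pullback b d p vs +
      ((-1) * connection_pullback c d p vs + chern_const * dlog (\<lambda>x. dd_value G P \<Phi> (a x) (b x) (c x)) d p vs)))"
  unfolding form_eq_def connection_pullback_def using pullback_dd_one_form[OF assms] by simp

lemma ext_d_pullback_dd_one_form:
  assumes A: "smooth_atlas A" and a: "smooth_map A W (ctotal AG P) a" and b: "smooth_map A W (ctotal AG P) b"
    and c: "smooth_map A W (ctotal AG P) c"
    and abc: "\<And>x. x \<in> W \<Longrightarrow> proj P (b x) = proj P (c x) \<otimes>\<^bsub>G\<^esub> proj P (a x)"
    and p: "d \<in> A" "p \<in> fst d" "p \<in> W" "length vs = 2"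
  shows "ext_d (pullback_form (NG2 AG) (\<lambda>x. (proj P (c x), proj P (a x))) \<mu>) d p vs =
    - pullback_form AG (\<lambda>x. proj P (a x)) c1 d p vs + pullback_form AG (\<lambda>x. proj P (b x)) c1 d p vs
    - pullback_form AG (\<lambda>x. proj P (c x)) c1 d p vs"
proof -
  let ?k = "\<lambda>x. dd_value G P \<Phi> (a x) (b x) (c x)"
  have k: "circle_smooth A W ?k"
    by (rule smooth_dd_value[OF A a b c abc])
  note da = diff_form_connection_pullback(2)[OF A a] and db = diff_form_connection_pullback(2)[OF A b]
    and dc = diff_form_connection_pullback(2)[OF A c] and dk = diff_form_dlog[OF L A k]
  note da' = diff_form_cmult[OF A da, of "-1"] and dc' = diff_form_cmult[OF A dc, of "-1"]
    and dk' = diff_form_cmult[OF A dk, of chern_const]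
  note s1 = diff_form_add[OF A dc' dk']
  note s2 = diff_form_add[OF A db s1]
  have q: "length vs = Suc 1" using p(4) by simp
  have "ext_d (pullback_form (NG2 AG) (\<lambda>x. (proj P (c x), proj P (a x))) \<mu>) d p vs =
     ext_d (\<lambda>d p vs. (-1) * connection_pullback a d p vs + (connection_pullback b d p vs +
      ((-1) * connection_pullback c d p vs + chern_const * dlog ?k d p vs))) d p vs"
    by (rule ext_d_cong[OF A smooth_map_mopen[OF a] p(1-3) pullback_dd_one_form_eq[OF A a b c abc] q])
  also have "\<dots> = (-1) * ext_d (connection_pullback a) d p vs + (ext_d (connection_pullback b) d p vs +
      ((-1) * ext_d (connection_pullback c) d p vs + chern_const * ext_d (dlog ?k) d p vs))"
    unfolding ext_d_add[OF da' s2 p(1-3) q] ext_d_add[OF db s1 p(1-3) q] ext_d_add[OF dc' dk' p(1-3) q]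
      ext_d_cmult[OF da p(1-3) q] ext_d_cmult[OF dc p(1-3) q] ext_d_cmult[OF dk p(1-3) q] ..
  also have "ext_d (dlog ?k) d p vs = 0"
    by (rule ext_d_dlog[OF L A k p])
  finally show ?thesis
    using pullback_chern_form[OF A a p] pullback_chern_form[OF A b p] pullback_chern_form[OF A c p] by simp
qed

text \<open>Lifts \<open>h\<^sub>i\<^sub>j\<close> over the edges of a 3-simplex.\<close>

lemma dlog_multiplicative:
  assumes A: "smooth_atlas A" and mult: "multiplicative_triv G P \<Phi>"
    and h: "\<And>i j. i < j \<Longrightarrow> j < (4::nat) \<Longrightarrow> smooth_map A W (ctotal AG P) (h i j)"
    and hh: "\<And>i j k x. i < j \<Longrightarrow> j < k \<Longrightarrow> k < (4::nat) \<Longrightarrow> x \<in> W \<Longrightarrow>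
      proj P (h i k x) = proj P (h i j x) \<otimes>\<^bsub>G\<^esub> proj P (h j k x)"
    and p: "d \<in> A" "p \<in> fst d" "p \<in> W" "length vs = 1"
  defines "K i j k \<equiv> (\<lambda>x. dd_value G P \<Phi> (h j k x) (h i k x) (h i j x))"
  shows "dlog (K 1 2 3) d p vs - dlog (K 0 2 3) d p vs + dlog (K 0 1 3) d p vs - dlog (K 0 1 2) d p vs = 0"
proof -
  obtain v where v: "vs = [v]" using p(4) by (auto simp: length_Suc_conv)
  have K: "circle_smooth A W (K i j k)" if "i < j" "j < k" "k < 4" for i j k
    unfolding K_def using that by (intro smooth_dd_value[OF A h h h hh]) auto
  have m: "mopen A W" by (rule smooth_map_mopen[OF K[of 0 1 2]]) auto
  have tot: "h i j x \<in> tot P" if "i < j" "j < 4" "x \<in> W" for i j x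
    using smooth_map_image[OF h[OF that(1,2)] that(3)] mcarrier_ctotal[OF P] by simp
  \<comment> \<open>The faces opposite to the even vertices stand on one side, those opposite to the
    odd vertices on the other; \<open>dlog\<close> turns the equation into an alternating
    sum.\<close>
  have "K 1 2 3 x * K 0 1 3 x = K 0 2 3 x * K 0 1 2 x" if x: "x \<in> W" for x
    using mult[unfolded multiplicative_triv_def, rule_format, of "h 0 1 x" "h 1 2 x" "h 2 3 x" "h 0 2 x" "h 1 3 x" "h 0 3 x"]
      tot[OF _ _ x] hh[OF _ _ _ x]
    by (simp add: K_def)
  then have "dlog (\<lambda>x. K 1 2 3 x * K 0 1 3 x) d p vs = dlog (\<lambda>x. K 0 2 3 x * K 0 1 2 x) d p vs"
    by (rule dlog_cong[OF A m p(1,3,2)])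
  moreover have "dlog (\<lambda>x. K 1 2 3 x * K 0 1 3 x) d p vs = dlog (K 1 2 3) d p vs + dlog (K 0 1 3) d p vs"
    unfolding v by (rule dlog_mult[OF L A K K p(1-3)]) auto
  moreover have "dlog (\<lambda>x. K 0 2 3 x * K 0 1 2 x) d p vs = dlog (K 0 2 3) d p vs + dlog (K 0 1 2) d p vs"
    unfolding v by (rule dlog_mult[OF L A K K p(1-3)]) auto
  ultimately have "dlog (K 1 2 3) d p vs + dlog (K 0 1 3) d p vs = dlog (K 0 2 3) d p vs + dlog (K 0 1 2) d p vs"
    by (simp only:)
  then show ?thesis by (simp only: diff_eq_eq diff_add_eq) (simp only: add.commute add_0_left)
qed

text \<open>Each of the six edges lies on two faces, in which its lift contributes pull-backs of
  \<open>\<theta>\<close> that cancel in the alternating sum. What remains are the logarithmic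
  terms, treated by \<open>dlog_multiplicative\<close>.\<close>

lemma dd_one_form_multiplicative:
  assumes A: "smooth_atlas A" and mult: "multiplicative_triv G P \<Phi>"
    and h: "\<And>i j. i < j \<Longrightarrow> j < (4::nat) \<Longrightarrow> smooth_map A W (ctotal AG P) (h i j)"
    and hh: "\<And>i j k x. i < j \<Longrightarrow> j < k \<Longrightarrow> k < (4::nat) \<Longrightarrow> x \<in> W \<Longrightarrow>
      proj P (h i k x) = proj P (h i j x) \<otimes>\<^bsub>G\<^esub> proj P (h j k x)"
    and p: "d \<in> A" "p \<in> fst d" "p \<in> W" "length vs = 1"
  defines "M i j k \<equiv> pullback_form (NG2 AG) (\<lambda>x. (proj P (h i j x), proj P (h j k x))) \<mu> d p vs"
  shows "M 1 2 3 - M 0 2 3 + M 0 1 3 - M 0 1 2 = 0"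
proof -
  let ?K = "\<lambda>i j k. (\<lambda>x. dd_value G P \<Phi> (h j k x) (h i k x) (h i j x))"
  let ?t = "\<lambda>i j. chern_const * pullback_form (ctotal AG P) (h i j) \<theta> d p vs"
  have M: "M i j k = - ?t j k + ?t i k - ?t i j + chern_const * dlog (?K i j k) d p vs"
    if "i < j" "j < k" "k < 4" for i j k
    unfolding M_def using that by (intro pullback_dd_one_form[OF A h h h hh p]) auto
  have "M 1 2 3 - M 0 2 3 + M 0 1 3 - M 0 1 2 = chern_const *
      (dlog (?K 1 2 3) d p vs - dlog (?K 0 2 3) d p vs + dlog (?K 0 1 3) d p vs - dlog (?K 0 1 2) d p vs)"
  proof -
    have M': "M 1 2 3 = - ?t 2 3 + ?t 1 3 - ?t 1 2 + chern_const * dlog (?K 1 2 3) d p vs"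
      "M 0 2 3 = - ?t 2 3 + ?t 0 3 - ?t 0 2 + chern_const * dlog (?K 0 2 3) d p vs"
      "M 0 1 3 = - ?t 1 3 + ?t 0 3 - ?t 0 1 + chern_const * dlog (?K 0 1 3) d p vs"
      "M 0 1 2 = - ?t 1 2 + ?t 0 2 - ?t 0 1 + chern_const * dlog (?K 0 1 2) d p vs"
      by (rule M; simp)+
    show ?thesis
      unfolding M' by (simp add: right_diff_distrib distrib_left)
  qed
  also have "dlog (?K 1 2 3) d p vs - dlog (?K 0 2 3) d p vs + dlog (?K 0 1 3) d p vs - dlog (?K 0 1 2) d p vs = 0"
    by (rule dlog_multiplicative[where h = h and W = W, OF A mult _ _ p]) (rule h hh; assumption)+
  finally show ?thesis by simp
qed

end

section \<open>The cocycle condition on the simplicial manifold\<close>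

context dixmier_douady
begin

lemma real_form_c1: "real_form AG (carrier G) 2 c1"
  using chern by (simp add: chern_form_def carrier)

lemma diff_form_c1: "diff_form AG (carrier G) 2 c1"
  using real_form_c1 by (simp add: real_form_def)

text \<open>A local lift of the identity of \<open>G\<close>, that is a local section of the
  extension, exhibits \<open>c1\<close> near each point as an exact form.\<close>

lemma simplicial_13: "form_eq AG (carrier G) 3 (simpl_D13 c1) zero_form"
  unfolding form_eq_def
proof (intro ballI allI impI)
  fix d p and vs :: "'e list" assume d: "d \<in> AG" and p: "p \<in> fst d \<inter> carrier G" and vs: "length vs = 3"
  have m: "mopen AG (carrier G)" using mopen_mcarrier[OF AG] carrier by simp
  obtain N h where N: "mopen AG N" "p \<in> N" "N \<subseteq> carrier G" "smooth_map AG N (ctotal AG P) h" "\<And>x. x \<in> N \<Longrightarrow> proj P (h x) = x"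
    using smooth_map_local_lift[OF P AG smooth_map_id[OF AG m], of p] p by blast
  have "form_eq AG N 2 c1 (pullback_form AG (\<lambda>x. proj P (h x)) c1)"
    unfolding form_eq_def
  proof (intro ballI allI impI)
    fix c x and ws :: "'e list" assume c: "c \<in> AG" "x \<in> fst c \<inter> N" "length ws = 2"
    have "pullback_form AG (\<lambda>x. proj P (h x)) c1 c x ws = pullback_form AG (\<lambda>x. x) c1 c x ws"
      using c N(5) by (intro pullback_form_cong[OF AG N(1)]) auto
    then show "c1 c x ws = pullback_form AG (\<lambda>x. proj P (h x)) c1 c x ws"
      using c N(3) pullback_form_id[OF AG diff_form_c1 c(1) _ _ c(3)] by auto
  qed
  then have "ext_d c1 d p vs = ext_d (pullback_form AG (\<lambda>x. proj P (h x)) c1) d p vs"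
    using p vs N(2) by (intro ext_d_cong[OF AG N(1) d]) auto
  also have "\<dots> = 0"
    using p vs N(2) by (intro ext_d_pullback_chern_form[OF AG N(4) d]) auto
  finally show "simpl_D13 c1 d p vs = zero_form d p vs"
    by (simp add: simpl_D13_def zero_form_def)
qed

text \<open>Near a point the three face maps are lifted simultaneously, on the intersection of three
  neighbourhoods. The lifts \<open>h 0\<close>, \<open>h 1\<close>, \<open>h 2\<close> play the
  roles of \<open>a\<close>, \<open>b\<close>, \<open>c\<close>, so that the alternating sum of face
  pull-backs of \<open>c1\<close> is compared with the differential of the one-form.\<close>

lemma simplicial_22: "form_eq (NG2 AG) (carrier G \<times> carrier G) 2 (simpl_D22 G AG c1 \<mu>) zero_form"
  unfolding form_eq_def
proof (intro ballI allI impI)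
  fix d p and vs :: "('e \<times> 'e) list"
  assume d: "d \<in> NG2 AG" and p: "p \<in> fst d \<inter> carrier G \<times> carrier G" and vs: "length vs = 2"
  have "\<exists>N h. mopen (NG2 AG) N \<and> p \<in> N \<and> N \<subseteq> mcarrier (NG2 AG) \<and> smooth_map (NG2 AG) N (ctotal AG P) h \<and>
      (\<forall>x\<in>N. proj P (h x) = face2 G i x)" for i
    using p by (intro smooth_map_local_lift[OF P N2 smooth_face2]) (auto simp: carrier2)
  then obtain M h where M: "\<And>i. mopen (NG2 AG) (M i)" "\<And>i. p \<in> M i" "\<And>i. M i \<subseteq> mcarrier (NG2 AG)"
    "\<And>i. smooth_map (NG2 AG) (M i) (ctotal AG P) (h i)" "\<And>i x. x \<in> M i \<Longrightarrow> proj P (h i x) = face2 G i x"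
    by metis
  define N where "N = M 0 \<inter> M 1 \<inter> M 2"
  have mN: "mopen (NG2 AG) N" unfolding N_def by (intro mopen_Int[OF N2] M)
  have pN: "p \<in> N" using M(2) by (simp add: N_def)
  have Nc: "N \<subseteq> carrier G \<times> carrier G" using M(3)[of 0] by (auto simp: N_def carrier2)
  have a: "smooth_map (NG2 AG) N (ctotal AG P) (h 0)" and b: "smooth_map (NG2 AG) N (ctotal AG P) (h 1)"
    and c: "smooth_map (NG2 AG) N (ctotal AG P) (h 2)"
    by (rule smooth_map_subset[OF M(4) N2 mN], force simp: N_def)+
  have fa: "proj P (h i x) = face2 G i x" if "x \<in> N" "i \<in> {0, 1, 2}" for i x
    using that by (intro M(5)) (auto simp: N_def)
  have abc: "proj P (h 1 x) = proj P (h 2 x) \<otimes>\<^bsub>G\<^esub> proj P (h 0 x)" if "x \<in> N" for x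
    using fa[OF that] by (simp add: face2_def case_prod_beta)
  \<comment> \<open>The outer faces recover both components, so the edge map of the lifts is the
    identity and \<open>\<mu>\<close> is locally its own pull-back along it.\<close>
  have y: "(proj P (h 2 x), proj P (h 0 x)) = x" if "x \<in> N" for x
    using fa[OF that] by (simp add: face2_def case_prod_beta)
  have "form_eq (NG2 AG) N 1 \<mu> (pullback_form (NG2 AG) (\<lambda>x. (proj P (h 2 x), proj P (h 0 x))) \<mu>)"
    unfolding form_eq_def
  proof (intro ballI allI impI)
    fix c x and ws :: "('e \<times> 'e) list" assume c: "c \<in> NG2 AG" "x \<in> fst c \<inter> N" "length ws = 1"
    have "pullback_form (NG2 AG) (\<lambda>x. (proj P (h 2 x), proj P (h 0 x))) \<mu> c x ws = pullback_form (NG2 AG) (\<lambda>x. x) \<mu> c x ws"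
      using c y by (intro pullback_form_cong[OF N2 mN]) auto
    moreover have "diff_form (NG2 AG) (carrier G \<times> carrier G) 1 \<mu>"
      using real_form_dd_one_form by (simp add: real_form_def)
    ultimately show "\<mu> c x ws = pullback_form (NG2 AG) (\<lambda>x. (proj P (h 2 x), proj P (h 0 x))) \<mu> c x ws"
      using c Nc pullback_form_id[OF N2 _ c(1) _ _ c(3)] by auto
  qed
  then have "ext_d \<mu> d p vs = ext_d (pullback_form (NG2 AG) (\<lambda>x. (proj P (h 2 x), proj P (h 0 x))) \<mu>) d p vs"
    using p vs pN by (intro ext_d_cong[OF N2 mN d]) auto
  also have "\<dots> = - pullback_form AG (\<lambda>x. proj P (h 0 x)) c1 d p vs + pullback_form AG (\<lambda>x. proj P (h 1 x)) c1 d p vs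
    - pullback_form AG (\<lambda>x. proj P (h 2 x)) c1 d p vs"
    using abc p vs pN by (intro ext_d_pullback_dd_one_form[OF N2 a b c _ d]) auto
  also have "pullback_form AG (\<lambda>x. proj P (h 0 x)) c1 d p vs = pullback_form AG (face2 G 0) c1 d p vs"
    using p pN fa by (intro pullback_form_cong[OF N2 mN d]) auto
  also have "pullback_form AG (\<lambda>x. proj P (h 1 x)) c1 d p vs = pullback_form AG (face2 G 1) c1 d p vs"
    using p pN fa by (intro pullback_form_cong[OF N2 mN d]) auto
  also have "pullback_form AG (\<lambda>x. proj P (h 2 x)) c1 d p vs = pullback_form AG (face2 G 2) c1 d p vs"
    using p pN fa by (intro pullback_form_cong[OF N2 mN d]) auto
  finally show "simpl_D22 G AG c1 \<mu> d p vs = zero_form d p vs"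
    by (simp add: simpl_D22_def zero_form_def numeral_2_eq_2)
qed

text \<open>A point of the triple product is a 3-simplex with group elements on its six edges. Local
  lifts of all of them reduce the claim to \<open>dd_one_form_multiplicative\<close>.\<close>

lemma simplicial_31:
  assumes mult: "multiplicative_triv G P \<Phi>"
  shows "form_eq (NG3 AG) (carrier G \<times> carrier G \<times> carrier G) 1 (simpl_D31 G AG \<mu>) zero_form"
  unfolding form_eq_def
proof (intro ballI allI impI)
  fix d p and vs :: "('e \<times> 'e \<times> 'e) list"
  assume d: "d \<in> NG3 AG" and p: "p \<in> fst d \<inter> carrier G \<times> carrier G \<times> carrier G" and vs: "length vs = 1"
  interpret grp: group G using G by (simp add: lie_group_def)
  let ?C = "carrier G \<times> carrier G \<times> carrier G"
  \<comment> \<open>The element on the edge from \<open>i\<close> to \<open>j\<close>: the product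
    of the entries numbered \<open>i + 1\<close> to \<open>j\<close>. It matters for
    \<open>i < j < 4\<close>; the other values only have to depend smoothly on the point.\<close>
  define e :: "nat \<Rightarrow> nat \<Rightarrow> 'g \<times> 'g \<times> 'g \<Rightarrow> 'g" where "e i j = (\<lambda>(x, y, z).
      if i = 0 then if j = 1 then x else if j = 2 then x \<otimes>\<^bsub>G\<^esub> y else x \<otimes>\<^bsub>G\<^esub> (y \<otimes>\<^bsub>G\<^esub> z)
      else if i = 1 then if j = 2 then y else y \<otimes>\<^bsub>G\<^esub> z else z)" for i j
  have c: "smooth_map (NG3 AG) ?C AG fst" "smooth_map (NG3 AG) ?C AG (\<lambda>w. fst (snd w))"
      "smooth_map (NG3 AG) ?C AG (\<lambda>w. snd (snd w))"
  proof -
    have s: "smooth_map (NG3 AG) ?C (NG2 AG) snd" by (rule smooth_map_snd[OF AG N2 mopen3])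
    show "smooth_map (NG3 AG) ?C AG fst" by (rule smooth_map_fst[OF AG N2 mopen3])
    show "smooth_map (NG3 AG) ?C AG (\<lambda>w. fst (snd w))"
      by (rule smooth_map_compose[OF N3 N2 AG s smooth_map_fst[OF AG AG mopen2]]) auto
    show "smooth_map (NG3 AG) ?C AG (\<lambda>w. snd (snd w))"
      by (rule smooth_map_compose[OF N3 N2 AG s smooth_map_snd[OF AG AG mopen2]]) auto
  qed
  have e: "smooth_map (NG3 AG) ?C AG (e i j)" for i j
    unfolding e_def case_prod_unfold
    using c smooth_mult[OF N3 c(1,2)] smooth_mult[OF N3 c(2,3)] smooth_mult[OF N3 c(1) smooth_mult[OF N3 c(2,3)]]
    by (cases "i = 0"; cases "j = 1"; cases "j = 2"; cases "i = 1"; simp)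
  have "\<exists>N h. mopen (NG3 AG) N \<and> p \<in> N \<and> N \<subseteq> ?C \<and> smooth_map (NG3 AG) N (ctotal AG P) h \<and>
      (\<forall>x\<in>N. proj P (h x) = e i j x)" for i j
    using p by (intro smooth_map_local_lift[OF P N3 e]) auto
  then obtain M h where M: "\<And>i j. mopen (NG3 AG) (M i j)" "\<And>i j. p \<in> M i j" "\<And>i j. M i j \<subseteq> ?C"
    "\<And>i j. smooth_map (NG3 AG) (M i j) (ctotal AG P) (h i j)" "\<And>i j x. x \<in> M i j \<Longrightarrow> proj P (h i j x) = e i j x"
    by metis
  define N where "N = (\<Inter>ij\<in>{..<4} \<times> {..<4}. M (fst ij) (snd ij))"
  have mN: "mopen (NG3 AG) N" unfolding N_def by (intro mopen_INT[OF N3] M) (auto simp: lessThan_empty_iff)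
  have pN: "p \<in> N" using M(2) by (simp add: N_def)
  have NM: "N \<subseteq> M i j" if "i < 4" "j < 4" for i j using that by (force simp: N_def)
  have h: "smooth_map (NG3 AG) N (ctotal AG P) (h i j)" if "i < j" "j < 4" for i j
    using that by (intro smooth_map_subset[OF M(4) N3 mN] NM) auto
  have pe: "proj P (h i j x) = e i j x" if "i < j" "j < 4" "x \<in> N" for i j x
    using M(5)[of x i j] NM[of i j] that by auto
  have hh: "proj P (h i k x) = proj P (h i j x) \<otimes>\<^bsub>G\<^esub> proj P (h j k x)"
    if "i < j" "j < k" "k < 4" "x \<in> N" for i j k x
  proof -
    obtain u v w where x: "x = (u, v, w)" "u \<in> carrier G" "v \<in> carrier G" "w \<in> carrier G"
      using M(3)[of 0 0] NM[of 0 0] \<open>x \<in> N\<close> by (cases x) auto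
    have "(i, j, k) \<in> {(0, 1, 2), (0, 1, 3), (0, 2, 3), (1, 2, 3)}"
      using that(1-3) by (auto simp: less_Suc_eq numeral_eq_Suc)
    then show ?thesis
      using that x by (auto simp: pe e_def grp.m_assoc)
  qed
  \<comment> \<open>The face map with number \<open>l\<close> omits the vertex \<open>l\<close>; the
    remaining vertices \<open>i\<close>, \<open>j\<close>, \<open>k\<close> span the face, with
    first edges \<open>ij\<close> and \<open>jk\<close>.\<close>
  have face: "pullback_form (NG2 AG) (face3 G l) \<mu> d p vs =
      pullback_form (NG2 AG) (\<lambda>x. (proj P (h i j x), proj P (h j k x))) \<mu> d p vs"
    if "(l, i, j, k) \<in> {(0, 1, 2, 3), (1, 0, 2, 3), (2, 0, 1, 3), (3, 0, 1, 2)}" for l i j k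
    using p that by (intro pullback_form_cong[OF N3 mN d pN]) (auto simp: pe e_def face3_def)
  have "pullback_form (NG2 AG) (\<lambda>x. (proj P (h 1 2 x), proj P (h 2 3 x))) \<mu> d p vs -
      pullback_form (NG2 AG) (\<lambda>x. (proj P (h 0 2 x), proj P (h 2 3 x))) \<mu> d p vs +
      pullback_form (NG2 AG) (\<lambda>x. (proj P (h 0 1 x), proj P (h 1 3 x))) \<mu> d p vs -
      pullback_form (NG2 AG) (\<lambda>x. (proj P (h 0 1 x), proj P (h 1 2 x))) \<mu> d p vs = 0"
    using p by (intro dd_one_form_multiplicative[where h = h and W = N, OF N3 mult h hh d _ pN vs]) auto
  then show "simpl_D31 G AG \<mu> d p vs = zero_form d p vs"
    using face[of 0 1 2 3] face[of 1 0 2 3] face[of 2 0 1 3] face[of 3 0 1 2]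
    by (simp add: simpl_D31_def zero_form_def numeral_3_eq_3 numeral_2_eq_2)
qed

end

section \<open>The Cech--de Rham classes\<close>

text \<open>The bound 4 covers the index lists, of up to five entries, that occur in the
  differential of a cochain of total degree 3.\<close>

lemma short_list_cases:
  assumes "length xs = Suc p" "p \<le> 4"
  obtains a where "p = 0" "xs = [a]" | a b where "p = 1" "xs = [a, b]" | a b c where "p = 2" "xs = [a, b, c]"
    | a b c d where "p = 3" "xs = [a, b, c, d]" | a b c d e where "p = 4" "xs = [a, b, c, d, e]"
proof -
  have "p = 0 \<or> p = 1 \<or> p = 2 \<or> p = 3 \<or> p = 4" using assms(2) by linarith
  then show ?thesis
    using assms(1) that by (auto simp: length_Suc_conv numeral_eq_Suc)
qed

lemma total_atlas_carrier:
  assumes "principal_bundle G AG A Y"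
  shows "mcarrier (total_atlas G AG A Y) \<subseteq> tot Y"
proof
  fix p assume "p \<in> mcarrier (total_atlas G AG A Y)"
  then obtain W \<xi> where W: "(W, \<xi>) \<in> total_atlas G AG A Y" "p \<in> W" by (rule mcarrierE)
  then obtain V \<sigma> K \<psi> x g where c: "(V, \<sigma>) \<in> lsecs Y" "(K, \<psi>) \<in> AG" "x \<in> V" "g \<in> K" "p = act Y (\<sigma> x) g"
    unfolding total_atlas_def by blast
  have "g \<in> carrier G"
    using c(2,4) mcarrierI[of K \<psi> AG g] assms by (simp add: principal_bundle_def lie_group_def)
  moreover have "\<forall>(V, \<sigma>)\<in>lsecs Y. mopen A V \<and> (\<forall>x\<in>V. \<sigma> x \<in> tot Y \<and> proj Y (\<sigma> x) = x)"
    using assms unfolding principal_bundle_def by blast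
  then have "\<sigma> x \<in> tot Y" using c(1,3) by blast
  moreover have "\<forall>p\<in>tot Y. act Y p \<one>\<^bsub>G\<^esub> = p \<and> (\<forall>g\<in>carrier G. act Y p g \<in> tot Y \<and> proj Y (act Y p g) = proj Y p \<and>
           (\<forall>h\<in>carrier G. act Y (act Y p g) h = act Y p (g \<otimes>\<^bsub>G\<^esub> h)))"
    using assms unfolding principal_bundle_def by (elim conjE)
  ultimately show "p \<in> tot Y" using c(5) by blast
qed

text \<open>Both elements carry \<open>s \<alpha> x\<close> to \<open>s \<gamma> x\<close>, and the
  action of \<open>G\<close> is free. The order of the factors is that of a right action.\<close>

lemma transition_functions_cocycle:
  assumes Y: "principal_bundle G AG A Y" and g: "transition_functions G AG A Y I U g"
    and i: "\<alpha> \<in> I" "\<beta> \<in> I" "\<gamma> \<in> I" and x: "x \<in> U \<alpha>" "x \<in> U \<beta>" "x \<in> U \<gamma>"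
  shows "g \<alpha> \<gamma> x = g \<alpha> \<beta> x \<otimes>\<^bsub>G\<^esub> g \<beta> \<gamma> x"
proof -
  have act_all: "\<forall>p\<in>tot Y. act Y p \<one>\<^bsub>G\<^esub> = p \<and> (\<forall>g\<in>carrier G. act Y p g \<in> tot Y \<and> proj Y (act Y p g) = proj Y p \<and>
           (\<forall>h\<in>carrier G. act Y (act Y p g) h = act Y p (g \<otimes>\<^bsub>G\<^esub> h)))"
    using Y unfolding principal_bundle_def by (elim conjE)
  then have act: "\<And>p g h. p \<in> tot Y \<Longrightarrow> g \<in> carrier G \<Longrightarrow> h \<in> carrier G \<Longrightarrow>
      act Y p g \<in> tot Y \<and> proj Y (act Y p g) = proj Y p \<and> act Y (act Y p g) h = act Y p (g \<otimes>\<^bsub>G\<^esub> h)"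
    by blast
  have free: "\<forall>p\<in>tot Y. \<forall>q\<in>tot Y. proj Y p = proj Y q \<longrightarrow> (\<exists>!g. g \<in> carrier G \<and> q = act Y p g)"
    using Y unfolding principal_bundle_def by (elim conjE)
  interpret group G using Y by (simp add: principal_bundle_def lie_group_def)
  obtain s where s: "\<And>\<alpha>. \<alpha> \<in> I \<Longrightarrow> smooth_map A (U \<alpha>) (total_atlas G AG A Y) (s \<alpha>)"
    and sg: "\<And>\<alpha> \<beta> x. \<alpha> \<in> I \<Longrightarrow> \<beta> \<in> I \<Longrightarrow> x \<in> U \<alpha> \<inter> U \<beta> \<Longrightarrow> g \<alpha> \<beta> x \<in> carrier G \<and> s \<beta> x = act Y (s \<alpha> x) (g \<alpha> \<beta> x)"
    using g unfolding transition_functions_def by blast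
  have t: "s \<alpha> x \<in> tot Y"
    using smooth_map_image[OF s[OF i(1)] x(1)] total_atlas_carrier[OF Y] by blast
  have c: "g \<alpha> \<beta> x \<in> carrier G" "g \<beta> \<gamma> x \<in> carrier G" "g \<alpha> \<gamma> x \<in> carrier G"
    using sg i x by auto
  have "act Y (s \<alpha> x) (g \<alpha> \<gamma> x) = s \<gamma> x" using sg[OF i(1,3), of x] x by simp
  also have "\<dots> = act Y (act Y (s \<alpha> x) (g \<alpha> \<beta> x)) (g \<beta> \<gamma> x)" using sg[OF i(1,2), of x] sg[OF i(2,3), of x] x by simp
  also have "\<dots> = act Y (s \<alpha> x) (g \<alpha> \<beta> x \<otimes>\<^bsub>G\<^esub> g \<beta> \<gamma> x)" using act[OF t c(1,2)] by simp
  finally have eq: "act Y (s \<alpha> x) (g \<alpha> \<gamma> x) = act Y (s \<alpha> x) (g \<alpha> \<beta> x \<otimes>\<^bsub>G\<^esub> g \<beta> \<gamma> x)" .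
  have "\<exists>!h. h \<in> carrier G \<and> act Y (s \<alpha> x) (g \<alpha> \<gamma> x) = act Y (s \<alpha> x) h"
    using free[rule_format, OF t, of "act Y (s \<alpha> x) (g \<alpha> \<gamma> x)"] act[OF t c(3,3)] by simp
  then show ?thesis
    using c eq by blast
qed

section \<open>The cochains of a principal \<open>G\<close>-bundle with lifted transition
  functions\<close>

context dixmier_douady
begin

context
  fixes A :: "('m, 'f::locally_convex) atlas" and Y :: "('m, 'y, 'g) pbundle" and I :: "'i set"
    and U g gh
  assumes manifold: "smooth_manifold A" and Y: "principal_bundle G AG A Y" and leray: "leray_covering A I U"
    and trans: "transition_functions G AG A Y I U g" and lifts: "smooth_lifts AG P A I U g gh"
begin

lemmas A = smooth_manifold_atlas[OF manifold]

abbreviation "Uset \<alpha>s \<equiv> \<Inter> (U ` set \<alpha>s)"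

lemma mopen_Uset:
  assumes "set \<alpha>s \<subseteq> I" "\<alpha>s \<noteq> []"
  shows "mopen A (Uset \<alpha>s)"
  using assms leray by (intro mopen_INT[OF A]) (auto simp: leray_covering_def)

lemma smooth_gh:
  assumes "set \<alpha>s \<subseteq> I" "\<alpha> \<in> set \<alpha>s" "\<beta> \<in> set \<alpha>s"
  shows "smooth_map A (Uset \<alpha>s) (ctotal AG P) (gh \<alpha> \<beta>)"
proof -
  have "smooth_map A (U \<alpha> \<inter> U \<beta>) (ctotal AG P) (gh \<alpha> \<beta>)"
    using lifts assms unfolding smooth_lifts_def by blast
  then show ?thesis
    by (rule smooth_map_subset[OF _ A mopen_Uset[OF assms(1)]]) (use assms in auto)
qed

lemma proj_gh:
  assumes "set \<alpha>s \<subseteq> I" "\<alpha> \<in> set \<alpha>s" "\<beta> \<in> set \<alpha>s" "x \<in> Uset \<alpha>s"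
  shows "proj P (gh \<alpha> \<beta> x) = g \<alpha> \<beta> x"
  using lifts assms unfolding smooth_lifts_def by blast

lemma proj_gh_mult:
  assumes "set \<alpha>s \<subseteq> I" "\<alpha> \<in> set \<alpha>s" "\<beta> \<in> set \<alpha>s" "\<gamma> \<in> set \<alpha>s" "x \<in> Uset \<alpha>s"
  shows "proj P (gh \<alpha> \<gamma> x) = proj P (gh \<alpha> \<beta> x) \<otimes>\<^bsub>G\<^esub> proj P (gh \<beta> \<gamma> x)"
proof -
  have "g \<alpha> \<gamma> x = g \<alpha> \<beta> x \<otimes>\<^bsub>G\<^esub> g \<beta> \<gamma> x"
    using assms by (intro transition_functions_cocycle[OF Y trans]) auto
  then show ?thesis
    using proj_gh[OF assms(1) _ _ assms(5)] assms(2-4) by simp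
qed

lemma dd_cocycle_eq: "dd_cocycle G P \<Phi> gh \<alpha> \<beta> \<gamma> = (\<lambda>x. dd_value G P \<Phi> (gh \<beta> \<gamma> x) (gh \<alpha> \<gamma> x) (gh \<alpha> \<beta> x))"
  by (rule ext) (simp add: dd_cocycle_def)

lemma smooth_dd_cocycle:
  assumes "set \<alpha>s \<subseteq> I" "\<alpha> \<in> set \<alpha>s" "\<beta> \<in> set \<alpha>s" "\<gamma> \<in> set \<alpha>s"
  shows "circle_smooth A (Uset \<alpha>s) (dd_cocycle G P \<Phi> gh \<alpha> \<beta> \<gamma>)"
  unfolding dd_cocycle_eq
  using assms by (intro smooth_dd_value[OF A] smooth_gh proj_gh_mult) auto

text \<open>On the intersection the transition function is the projection of its lift. The latter
  expression is manifestly smooth and is the one to which the identities for lifts apply.\<close>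

lemma pullback_g:
  assumes "set \<alpha>s \<subseteq> I" "\<alpha> \<in> set \<alpha>s" "\<beta> \<in> set \<alpha>s" "d \<in> A" "p \<in> fst d" "p \<in> Uset \<alpha>s"
  shows "pullback_form AG (g \<alpha> \<beta>) \<omega> d p vs = pullback_form AG (\<lambda>x. proj P (gh \<alpha> \<beta> x)) \<omega> d p vs"
  using assms by (intro pullback_form_cong[OF A smooth_map_mopen[OF smooth_gh[OF assms(1-3)]]]) (simp_all add: proj_gh[OF assms(1)])

lemma pullback_gg:
  assumes "set \<alpha>s \<subseteq> I" "\<alpha> \<in> set \<alpha>s" "\<beta> \<in> set \<alpha>s" "\<gamma> \<in> set \<alpha>s" "d \<in> A" "p \<in> fst d" "p \<in> Uset \<alpha>s"
  shows "pullback_form (NG2 AG) (\<lambda>x. (g \<alpha> \<beta> x, g \<beta> \<gamma> x)) \<omega> d p vs =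
    pullback_form (NG2 AG) (\<lambda>x. (proj P (gh \<alpha> \<beta> x), proj P (gh \<beta> \<gamma> x))) \<omega> d p vs"
  using assms by (intro pullback_form_cong[OF A smooth_map_mopen[OF smooth_gh[OF assms(1-3)]]]) (simp_all add: proj_gh[OF assms(1)])

abbreviation "C \<equiv> simpl_pullback AG g c1 \<mu> :: ('i, 'm, 'f) cochain"
abbreviation "C' \<equiv> dd_cochain (dd_cocycle G P \<Phi> gh) :: ('i, 'm, 'f) cochain"

text \<open>The minus sign compensates for the total differential acting as \<open>-d\<close> on
  lists of two indices.\<close>

definition lift_cochain :: "('i, 'm, 'f) cochain" where
  "lift_cochain \<alpha>s = (case \<alpha>s of [\<alpha>, \<beta>] \<Rightarrow> (\<lambda>d x vs. - (chern_const * pullback_form (ctotal AG P) (gh \<alpha> \<beta>) \<theta> d x vs))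
    | _ \<Rightarrow> zero_form)"

lemma real_form_zero_Uset: "set \<alpha>s \<subseteq> I \<Longrightarrow> \<alpha>s \<noteq> [] \<Longrightarrow> real_form A (Uset \<alpha>s) q zero_form"
  by (rule real_form_zero[OF A mopen_Uset])

lemma cech_cochain_lift: "cech_cochain A I U 2 lift_cochain"
  unfolding cech_cochain_def
proof (intro allI impI)
  fix p \<alpha>s assume p: "p \<le> 2" "length \<alpha>s = Suc p \<and> set \<alpha>s \<subseteq> I"
  then have z: "real_form A (Uset \<alpha>s) q zero_form" for q by (intro real_form_zero_Uset) auto
  show "real_form A (Uset \<alpha>s) (2 - p) (lift_cochain \<alpha>s)"
  proof (rule short_list_cases[of \<alpha>s p])
    fix \<alpha> \<beta> assume c: "p = 1" "\<alpha>s = [\<alpha>, \<beta>]"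
    have "smooth_map A (Uset \<alpha>s) (ctotal AG P) (gh \<alpha> \<beta>)"
      using p c by (intro smooth_gh) auto
    from real_form_pullback_connection[OF P connection A this]
    show ?thesis using c by (simp add: lift_cochain_def)
  qed (use p z in \<open>auto simp: lift_cochain_def\<close>)
qed

lemma cech_cochain_C: "cech_cochain A I U 3 C"
  unfolding cech_cochain_def
proof (intro allI impI)
  fix p \<alpha>s assume p: "p \<le> 3" "length \<alpha>s = Suc p \<and> set \<alpha>s \<subseteq> I"
  then have z: "real_form A (Uset \<alpha>s) q zero_form" for q by (intro real_form_zero_Uset) auto
  show "real_form A (Uset \<alpha>s) (3 - p) (C \<alpha>s)"
  proof (rule short_list_cases[of \<alpha>s p])
    fix \<alpha> \<beta> assume c: "p = 1" "\<alpha>s = [\<alpha>, \<beta>]"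
    have s: "smooth_map A (Uset \<alpha>s) (ctotal AG P) (gh \<alpha> \<beta>)"
      using p c by (intro smooth_gh) auto
    note s' = smooth_map_proj_compose[OF P A s]
    have "real_form A (Uset \<alpha>s) 2 (pullback_form AG (\<lambda>x. proj P (gh \<alpha> \<beta> x)) c1)"
      using smooth_map_image[OF s'] carrier by (intro real_form_pullback[OF A AG s' real_form_c1]) auto
    moreover have "form_eq A (Uset \<alpha>s) 2 (pullback_form AG (\<lambda>x. proj P (gh \<alpha> \<beta> x)) c1) (pullback_form AG (g \<alpha> \<beta>) c1)"
      unfolding form_eq_def
    proof (intro ballI allI impI)
      fix d x and vs :: "'f list" assume "d \<in> A" "x \<in> fst d \<inter> Uset \<alpha>s"
      then show "pullback_form AG (\<lambda>x. proj P (gh \<alpha> \<beta> x)) c1 d x vs = pullback_form AG (g \<alpha> \<beta>) c1 d x vs"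
        using p c by (intro pullback_g[of \<alpha>s \<alpha> \<beta>, symmetric]) auto
    qed
    ultimately have "real_form A (Uset \<alpha>s) 2 (pullback_form AG (g \<alpha> \<beta>) c1)"
      by (rule real_form_cong[OF A])
    then show ?thesis using c by (simp add: simpl_pullback_def)
  next
    fix \<alpha> \<beta> \<gamma> assume c: "p = 2" "\<alpha>s = [\<alpha>, \<beta>, \<gamma>]"
    have s: "smooth_map A (Uset \<alpha>s) (ctotal AG P) (gh \<alpha> \<beta>)" "smooth_map A (Uset \<alpha>s) (ctotal AG P) (gh \<beta> \<gamma>)"
      using p c by - (rule smooth_gh; auto)+
    have s': "smooth_map A (Uset \<alpha>s) (NG2 AG) (\<lambda>x. (proj P (gh \<alpha> \<beta> x), proj P (gh \<beta> \<gamma> x)))"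
      by (intro smooth_map_Pair[OF A AG AG] smooth_map_proj_compose[OF P A] s)
    have "real_form A (Uset \<alpha>s) 1 (pullback_form (NG2 AG) (\<lambda>x. (proj P (gh \<alpha> \<beta> x), proj P (gh \<beta> \<gamma> x))) \<mu>)"
      using smooth_map_image[OF s'] carrier2 by (intro real_form_pullback[OF A N2 s' real_form_dd_one_form]) auto
    moreover have "form_eq A (Uset \<alpha>s) 1 (pullback_form (NG2 AG) (\<lambda>x. (proj P (gh \<alpha> \<beta> x), proj P (gh \<beta> \<gamma> x))) \<mu>)
        (pullback_form (NG2 AG) (\<lambda>x. (g \<alpha> \<beta> x, g \<beta> \<gamma> x)) \<mu>)"
      unfolding form_eq_def
    proof (intro ballI allI impI)
      fix d x and vs :: "'f list" assume "d \<in> A" "x \<in> fst d \<inter> Uset \<alpha>s"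
      then show "pullback_form (NG2 AG) (\<lambda>x. (proj P (gh \<alpha> \<beta> x), proj P (gh \<beta> \<gamma> x))) \<mu> d x vs =
          pullback_form (NG2 AG) (\<lambda>x. (g \<alpha> \<beta> x, g \<beta> \<gamma> x)) \<mu> d x vs"
        using p c by (intro pullback_gg[of \<alpha>s \<alpha> \<beta> \<gamma>, symmetric]) auto
    qed
    ultimately have "real_form A (Uset \<alpha>s) 1 (pullback_form (NG2 AG) (\<lambda>x. (g \<alpha> \<beta> x, g \<beta> \<gamma> x)) \<mu>)"
      by (rule real_form_cong[OF A])
    then show ?thesis using c by (simp add: simpl_pullback_def)
  qed (use p z in \<open>auto simp: simpl_pullback_def\<close>)
qed

lemma cech_cochain_C': "cech_cochain A I U 3 C'"
  unfolding cech_cochain_def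
proof (intro allI impI)
  fix p \<alpha>s assume p: "p \<le> 3" "length \<alpha>s = Suc p \<and> set \<alpha>s \<subseteq> I"
  then have z: "real_form A (Uset \<alpha>s) q zero_form" for q by (intro real_form_zero_Uset) auto
  show "real_form A (Uset \<alpha>s) (3 - p) (C' \<alpha>s)"
  proof (rule short_list_cases[of \<alpha>s p])
    fix \<alpha> \<beta> \<gamma> assume c: "p = 2" "\<alpha>s = [\<alpha>, \<beta>, \<gamma>]"
    have k: "circle_smooth A (Uset \<alpha>s) (dd_cocycle G P \<Phi> gh \<alpha> \<beta> \<gamma>)"
      using p c by (intro smooth_dd_cocycle) auto
    have "real_form A (Uset \<alpha>s) 1 (\<lambda>d x vs. chern_const * dlog (dd_cocycle G P \<Phi> gh \<alpha> \<beta> \<gamma>) d x vs)"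
      unfolding real_form_def
      using diff_form_cmult[OF A diff_form_dlog[OF L A k]] dlog_imaginary[OF L A k] chern_const_real by simp
    then show ?thesis using c by (simp add: dd_cochain_def)
  qed (use p z in \<open>auto simp: dd_cochain_def\<close>)
qed

lemma ext_d_lift_cochain:
  assumes "set [\<alpha>, \<beta>] \<subseteq> I" "d \<in> A" "x \<in> fst d" "x \<in> Uset [\<alpha>, \<beta>]" "length vs = 2"
  shows "ext_d (lift_cochain [\<alpha>, \<beta>]) d x vs = - pullback_form AG (g \<alpha> \<beta>) c1 d x vs"
proof -
  have s: "smooth_map A (Uset [\<alpha>, \<beta>]) (ctotal AG P) (gh \<alpha> \<beta>)"
    by (rule smooth_gh[OF assms(1)]) auto
  have "lift_cochain [\<alpha>, \<beta>] = (\<lambda>d x vs. (-1) * connection_pullback (gh \<alpha> \<beta>) d x vs)"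
    by (simp add: lift_cochain_def connection_pullback_def)
  then have "ext_d (lift_cochain [\<alpha>, \<beta>]) d x vs = (-1) * ext_d (connection_pullback (gh \<alpha> \<beta>)) d x vs"
    using ext_d_cmult[OF diff_form_connection_pullback(2)[OF A s] assms(2-4), of vs "-1"] assms(5) by simp
  then show ?thesis
    using pullback_chern_form[OF A s assms(2-5)] pullback_g[OF assms(1) _ _ assms(2-4), of \<alpha> \<beta>] by simp
qed

lemma cohomologous_C_C': "cohomologous A I U 3 C C'"
  unfolding cohomologous_def
proof (intro exI conjI)
  show "cech_cochain A I U (3 - 1) lift_cochain" using cech_cochain_lift by simp
  show "cochain_eq A I U 3 (\<lambda>\<alpha>s c x vs. C \<alpha>s c x vs - C' \<alpha>s c x vs) (cech_D (3 - 1) lift_cochain)"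
    unfolding cochain_eq_def form_eq_def
  proof (intro allI impI ballI)
    fix p \<alpha>s d x and vs :: "'f list"
    assume p: "p \<le> 3" "length \<alpha>s = Suc p \<and> set \<alpha>s \<subseteq> I" and d: "d \<in> A" and x: "x \<in> fst d \<inter> Uset \<alpha>s"
      and vs: "length vs = 3 - p"
    show "C \<alpha>s d x vs - C' \<alpha>s d x vs = cech_D (3 - 1) lift_cochain \<alpha>s d x vs"
    proof (rule short_list_cases[of \<alpha>s p])
      fix \<alpha> assume c: "p = 0" "\<alpha>s = [\<alpha>]"
      then show ?thesis
        by (simp add: simpl_pullback_def dd_cochain_def cech_D_def lift_cochain_def ext_d_zero)
    next
      \<comment> \<open>The primitive is zero on single indices, so only its de Rham differential is
        left; \<open>C'\<close> is zero here.\<close>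
      fix \<alpha> \<beta> assume c: "p = 1" "\<alpha>s = [\<alpha>, \<beta>]"
      have "ext_d (lift_cochain [\<alpha>, \<beta>]) d x vs = - pullback_form AG (g \<alpha> \<beta>) c1 d x vs"
        using p d x vs c by (intro ext_d_lift_cochain) auto
      then show ?thesis
        unfolding c by (simp add: simpl_pullback_def dd_cochain_def cech_D_def omit_def)
          (simp add: lift_cochain_def zero_form_def)
    next
      \<comment> \<open>The primitive is zero on three indices, so only its Cech differential is
        left. The identity to be shown is \<open>pullback_dd_one_form\<close> for the lifts over
        \<beta>\<gamma>, \<alpha>\<gamma> and \<alpha>\<beta>.\<close>
      fix \<alpha> \<beta> \<gamma> assume c: "p = 2" "\<alpha>s = [\<alpha>, \<beta>, \<gamma>]"
      have "pullback_form (NG2 AG) (\<lambda>x. (g \<alpha> \<beta> x, g \<beta> \<gamma> x)) \<mu> d x vs =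
          pullback_form (NG2 AG) (\<lambda>x. (proj P (gh \<alpha> \<beta> x), proj P (gh \<beta> \<gamma> x))) \<mu> d x vs"
        using p d x c by (intro pullback_gg[of \<alpha>s]) auto
      also have "\<dots> = - (chern_const * pullback_form (ctotal AG P) (gh \<beta> \<gamma>) \<theta> d x vs) +
          chern_const * pullback_form (ctotal AG P) (gh \<alpha> \<gamma>) \<theta> d x vs
          - chern_const * pullback_form (ctotal AG P) (gh \<alpha> \<beta>) \<theta> d x vs
          + chern_const * dlog (\<lambda>x. dd_value G P \<Phi> (gh \<beta> \<gamma> x) (gh \<alpha> \<gamma> x) (gh \<alpha> \<beta> x)) d x vs"
      proof (rule pullback_dd_one_form[OF A, where W = "Uset \<alpha>s"])
        show "proj P (gh \<alpha> \<gamma> y) = proj P (gh \<alpha> \<beta> y) \<otimes>\<^bsub>G\<^esub> proj P (gh \<beta> \<gamma> y)" if "y \<in> Uset \<alpha>s" for y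
          using p c that by (intro proj_gh_mult[of \<alpha>s]) auto
        show "smooth_map A (Uset \<alpha>s) (ctotal AG P) (gh \<beta> \<gamma>)" "smooth_map A (Uset \<alpha>s) (ctotal AG P) (gh \<alpha> \<gamma>)"
            "smooth_map A (Uset \<alpha>s) (ctotal AG P) (gh \<alpha> \<beta>)"
          using p c by - (rule smooth_gh; auto)+
      qed (use d x vs c in auto)
      finally show ?thesis
        unfolding c
        by (simp add: simpl_pullback_def dd_cochain_def cech_D_def omit_def dd_cocycle_eq numeral_2_eq_2)
           (simp add: lift_cochain_def ext_d_zero)
    next
      \<comment> \<open>Both cochains are zero on four indices; so is the Cech part, as the
        primitive is zero on three, and the de Rham part is absent since 3 exceeds the degree 2 of
        the primitive.\<close>
      fix \<alpha> \<beta> \<gamma> \<delta> assume c: "p = 3" "\<alpha>s = [\<alpha>, \<beta>, \<gamma>, \<delta>]"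
      show ?thesis
        unfolding c
        by (simp add: simpl_pullback_def dd_cochain_def cech_D_def omit_def numeral_3_eq_3)
           (simp add: lift_cochain_def zero_form_def)
    qed (use p in auto)
  qed
qed

text \<open>The lifts \<open>gh\<close> live on whole intersections and replace the local lifts used
  over the simplicial manifold. The same identities are evaluated for them, instead of pulling back
  the simplicial cocycle condition, which would require d to commute with pull-backs of two-forms as
  well.\<close>

lemma cech_cocycle_C:
  assumes mult: "multiplicative_triv G P \<Phi>"
  shows "cech_cocycle A I U 3 C"
  unfolding cech_cocycle_def
proof (intro conjI cech_cochain_C)
  show "cochain_eq A I U (Suc 3) (cech_D 3 C) (\<lambda>\<alpha>s. zero_form)"
    unfolding cochain_eq_def form_eq_def
  proof (intro allI impI ballI)
    fix p \<alpha>s d x and vs :: "'f list"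
    assume p: "p \<le> Suc 3" "length \<alpha>s = Suc p \<and> set \<alpha>s \<subseteq> I" and d: "d \<in> A" and x: "x \<in> fst d \<inter> Uset \<alpha>s"
      and vs: "length vs = Suc 3 - p"
    show "cech_D 3 C \<alpha>s d x vs = zero_form d x vs"
    proof (rule short_list_cases[of \<alpha>s p])
      fix \<alpha> assume c: "p = 0" "\<alpha>s = [\<alpha>]"
      then show ?thesis
        by (simp add: simpl_pullback_def cech_D_def ext_d_zero) (simp add: zero_form_def)
    next
      fix \<alpha> \<beta> assume c: "p = 1" "\<alpha>s = [\<alpha>, \<beta>]"
      have s: "smooth_map A (Uset \<alpha>s) (ctotal AG P) (gh \<alpha> \<beta>)"
        using p c by (intro smooth_gh) auto
      have "ext_d (pullback_form AG (g \<alpha> \<beta>) c1) d x vs = ext_d (pullback_form AG (\<lambda>x. proj P (gh \<alpha> \<beta> x)) c1) d x vs"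
        using pullback_g[of \<alpha>s \<alpha> \<beta>] p c d x vs
        by (intro ext_d_cong[OF A smooth_map_mopen[OF s], where q = 2]) (auto simp: form_eq_def)
      also have "\<dots> = 0"
        using c d x vs by (intro ext_d_pullback_chern_form[OF A s]) auto
      finally show ?thesis
        unfolding c by (simp add: simpl_pullback_def cech_D_def omit_def) (simp add: zero_form_def)
    next
      fix \<alpha> \<beta> \<gamma> assume c: "p = 2" "\<alpha>s = [\<alpha>, \<beta>, \<gamma>]"
      have s: "smooth_map A (Uset \<alpha>s) (ctotal AG P) (gh \<beta> \<gamma>)" "smooth_map A (Uset \<alpha>s) (ctotal AG P) (gh \<alpha> \<gamma>)"
          "smooth_map A (Uset \<alpha>s) (ctotal AG P) (gh \<alpha> \<beta>)"
        using p c by - (rule smooth_gh; auto)+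
      have m: "proj P (gh \<alpha> \<gamma> y) = proj P (gh \<alpha> \<beta> y) \<otimes>\<^bsub>G\<^esub> proj P (gh \<beta> \<gamma> y)" if "y \<in> Uset \<alpha>s" for y
        using p c that by (intro proj_gh_mult[of \<alpha>s]) auto
      have "ext_d (pullback_form (NG2 AG) (\<lambda>x. (g \<alpha> \<beta> x, g \<beta> \<gamma> x)) \<mu>) d x vs =
          ext_d (pullback_form (NG2 AG) (\<lambda>x. (proj P (gh \<alpha> \<beta> x), proj P (gh \<beta> \<gamma> x))) \<mu>) d x vs"
        using pullback_gg[of \<alpha>s \<alpha> \<beta> \<gamma>] p c d x vs
        by (intro ext_d_cong[OF A smooth_map_mopen[OF s(1)], where q = 1]) (auto simp: form_eq_def)
      also have "\<dots> = - pullback_form AG (\<lambda>x. proj P (gh \<beta> \<gamma> x)) c1 d x vs + pullback_form AG (\<lambda>x. proj P (gh \<alpha> \<gamma> x)) c1 d x vs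
          - pullback_form AG (\<lambda>x. proj P (gh \<alpha> \<beta> x)) c1 d x vs"
        using c d x vs by (intro ext_d_pullback_dd_one_form[OF A s]) (auto intro: m)
      also have "\<dots> = - pullback_form AG (g \<beta> \<gamma>) c1 d x vs + pullback_form AG (g \<alpha> \<gamma>) c1 d x vs - pullback_form AG (g \<alpha> \<beta>) c1 d x vs"
        using pullback_g[of \<alpha>s \<beta> \<gamma>] pullback_g[of \<alpha>s \<alpha> \<gamma>] pullback_g[of \<alpha>s \<alpha> \<beta>] p c d x by simp
      finally show ?thesis
        unfolding c by (simp add: simpl_pullback_def cech_D_def omit_def numeral_2_eq_2) (simp add: zero_form_def)
    next
      fix \<alpha> \<beta> \<gamma> \<delta> assume c: "p = 3" "\<alpha>s = [\<alpha>, \<beta>, \<gamma>, \<delta>]"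
      \<comment> \<open>The four indices become the vertices 0, 1, 2, 3 of a simplex, and
        \<open>h i j\<close> is the lift over the edge from \<open>i\<close> to
        \<open>j\<close>.\<close>
      define h where "h i j = gh (\<alpha>s ! i) (\<alpha>s ! j)" for i j
      have mem: "\<alpha>s ! i \<in> set \<alpha>s" if "i < 4" for i using c that by (intro nth_mem) simp
      have I: "set \<alpha>s \<subseteq> I" using p by simp
      have h: "smooth_map A (Uset \<alpha>s) (ctotal AG P) (h i j)" if "i < j" "j < 4" for i j
        unfolding h_def using that by (intro smooth_gh I mem) auto
      have hh: "proj P (h i k y) = proj P (h i j y) \<otimes>\<^bsub>G\<^esub> proj P (h j k y)" if "i < j" "j < k" "k < 4" "y \<in> Uset \<alpha>s" for i j k y
        unfolding h_def using that by (intro proj_gh_mult[OF I] mem) auto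
      have gg: "pullback_form (NG2 AG) (\<lambda>x. (g (\<alpha>s ! i) (\<alpha>s ! j) x, g (\<alpha>s ! j) (\<alpha>s ! k) x)) \<mu> d x vs =
          pullback_form (NG2 AG) (\<lambda>x. (proj P (h i j x), proj P (h j k x))) \<mu> d x vs" if "i < 4" "j < 4" "k < 4" for i j k
        unfolding h_def using d x that by (intro pullback_gg[OF I] mem) auto
      have "pullback_form (NG2 AG) (\<lambda>x. (proj P (h 1 2 x), proj P (h 2 3 x))) \<mu> d x vs -
          pullback_form (NG2 AG) (\<lambda>x. (proj P (h 0 2 x), proj P (h 2 3 x))) \<mu> d x vs +
          pullback_form (NG2 AG) (\<lambda>x. (proj P (h 0 1 x), proj P (h 1 3 x))) \<mu> d x vs -
          pullback_form (NG2 AG) (\<lambda>x. (proj P (h 0 1 x), proj P (h 1 2 x))) \<mu> d x vs = 0"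
        using x c vs by (intro dd_one_form_multiplicative[where h = h and W = "Uset \<alpha>s", OF A mult h hh d]) auto
      then show ?thesis
        using gg[of 1 2 3] gg[of 0 2 3] gg[of 0 1 3] gg[of 0 1 2]
        by (simp add: c simpl_pullback_def cech_D_def omit_def numeral_3_eq_3 numeral_2_eq_2 ext_d_zero)
           (simp add: zero_form_def)
    next
      \<comment> \<open>Omitting one of five indices leaves four, where the cochain is zero; the de
        Rham part does not occur on lists of this length.\<close>
      fix \<alpha> \<beta> \<gamma> \<delta> \<epsilon> assume c: "p = 4" "\<alpha>s = [\<alpha>, \<beta>, \<gamma>, \<delta>, \<epsilon>]"
      then show ?thesis
        by (simp add: simpl_pullback_def cech_D_def omit_def numeral_eq_Suc)
    qed (use p in auto)
  qed
qed

text \<open>On three indices the condition is closedness of \<open>dlog\<close>; on four it is the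
  logarithmic derivative of the multiplicative Cech identity for the functions
  \<open>dd_cocycle\<close>.\<close>

lemma cech_cocycle_C':
  assumes mult: "multiplicative_triv G P \<Phi>"
  shows "cech_cocycle A I U 3 C'"
  unfolding cech_cocycle_def
proof (intro conjI cech_cochain_C')
  show "cochain_eq A I U (Suc 3) (cech_D 3 C') (\<lambda>\<alpha>s. zero_form)"
    unfolding cochain_eq_def form_eq_def
  proof (intro allI impI ballI)
    fix p \<alpha>s d x and vs :: "'f list"
    assume p: "p \<le> Suc 3" "length \<alpha>s = Suc p \<and> set \<alpha>s \<subseteq> I" and d: "d \<in> A" and x: "x \<in> fst d \<inter> Uset \<alpha>s"
      and vs: "length vs = Suc 3 - p"
    show "cech_D 3 C' \<alpha>s d x vs = zero_form d x vs"
    proof (rule short_list_cases[of \<alpha>s p])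
      fix \<alpha> assume c: "p = 0" "\<alpha>s = [\<alpha>]"
      then show ?thesis
        by (simp add: dd_cochain_def cech_D_def ext_d_zero) (simp add: zero_form_def)
    next
      fix \<alpha> \<beta> assume c: "p = 1" "\<alpha>s = [\<alpha>, \<beta>]"
      then show ?thesis
        by (simp add: dd_cochain_def cech_D_def omit_def ext_d_zero) (simp add: zero_form_def)
    next
      fix \<alpha> \<beta> \<gamma> assume c: "p = 2" "\<alpha>s = [\<alpha>, \<beta>, \<gamma>]"
      have k: "circle_smooth A (Uset \<alpha>s) (dd_cocycle G P \<Phi> gh \<alpha> \<beta> \<gamma>)"
        using p c by (intro smooth_dd_cocycle) auto
      have "ext_d (\<lambda>d x vs. chern_const * dlog (dd_cocycle G P \<Phi> gh \<alpha> \<beta> \<gamma>) d x vs) d x vs =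
          chern_const * ext_d (dlog (dd_cocycle G P \<Phi> gh \<alpha> \<beta> \<gamma>)) d x vs"
        using c d x vs by (intro ext_d_cmult[OF diff_form_dlog[OF L A k]]) auto
      also have "ext_d (dlog (dd_cocycle G P \<Phi> gh \<alpha> \<beta> \<gamma>)) d x vs = 0"
        using c d x vs by (intro ext_d_dlog[OF L A k]) auto
      finally show ?thesis
        unfolding c by (simp add: dd_cochain_def cech_D_def omit_def numeral_2_eq_2)
    next
      fix \<alpha> \<beta> \<gamma> \<delta> assume c: "p = 3" "\<alpha>s = [\<alpha>, \<beta>, \<gamma>, \<delta>]"
      define h where "h i j = gh (\<alpha>s ! i) (\<alpha>s ! j)" for i j
      have mem: "\<alpha>s ! i \<in> set \<alpha>s" if "i < 4" for i using c that by (intro nth_mem) simp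
      have I: "set \<alpha>s \<subseteq> I" using p by simp
      have h: "smooth_map A (Uset \<alpha>s) (ctotal AG P) (h i j)" if "i < j" "j < 4" for i j
        unfolding h_def using that by (intro smooth_gh I mem) auto
      have hh: "proj P (h i k y) = proj P (h i j y) \<otimes>\<^bsub>G\<^esub> proj P (h j k y)" if "i < j" "j < k" "k < 4" "y \<in> Uset \<alpha>s" for i j k y
        unfolding h_def using that by (intro proj_gh_mult[OF I] mem) auto
      let ?K = "\<lambda>i j k. dlog (\<lambda>x. dd_value G P \<Phi> (h j k x) (h i k x) (h i j x)) d x vs"
      have "?K 1 2 3 - ?K 0 2 3 + ?K 0 1 3 - ?K 0 1 2 = 0"
        using x c vs by (intro dlog_multiplicative[where h = h and W = "Uset \<alpha>s", OF A mult h hh d]) auto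
      then have "chern_const * ?K 1 2 3 - chern_const * ?K 0 2 3 + chern_const * ?K 0 1 3 - chern_const * ?K 0 1 2 = 0"
        by (simp only: right_diff_distrib[symmetric] distrib_left[symmetric] mult_zero_right)
      then show ?thesis
        by (simp add: c h_def dd_cochain_def dd_cocycle_eq cech_D_def omit_def numeral_3_eq_3 numeral_2_eq_2 ext_d_zero)
           (simp add: zero_form_def)
    next
      fix \<alpha> \<beta> \<gamma> \<delta> \<epsilon> assume c: "p = 4" "\<alpha>s = [\<alpha>, \<beta>, \<gamma>, \<delta>, \<epsilon>]"
      then show ?thesis
        by (simp add: dd_cochain_def cech_D_def omit_def numeral_eq_Suc)
    qed (use p in auto)
  qed
qed

end

end

text \<open>Closedness in the last degree depends on multiplicativity of the trivialization.
  Equality of the classes is therefore expressed as exactness of the difference of the two cochains,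
  which makes sense for every trivialization, and the cocycle conditions are stated
  separately.\<close>

theorem theorem3p1:
  fixes G :: "'g monoid" and AG :: "('g, 'e::locally_convex) atlas"
    and H :: "'h monoid" and \<iota> :: "complex \<Rightarrow> 'h" and P :: "('g, 'h, complex) pbundle"
    and \<theta> :: "('h, 'e \<times> real) form" and c1 :: "('g, 'e) form"
    and \<delta>\<theta> :: "(('g, 'h) delta, ('e \<times> 'e) \<times> real) form"
    and \<Phi> :: "('g, 'h) delta \<Rightarrow> ('g \<times> 'g) \<times> complex"
  assumes "central_extension G AG H \<iota> P"
    and "smooth_partitions_of_unity AG"
    and "connection_form AG P \<theta>"
    and "chern_form AG P \<theta> c1"
    and "delta_connection G AG P \<theta> \<delta>\<theta>"
    and "trivialization (NG2 AG) (delta_bundle G P) \<Phi>"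
  shows
    "real_form AG (carrier G) 2 c1 \<and>
     real_form (NG2 AG) (carrier G \<times> carrier G) 1 (dd_one_form G AG P \<delta>\<theta> \<Phi>) \<and>
     form_eq AG (carrier G) 3 (simpl_D13 c1) zero_form \<and>
     form_eq (NG2 AG) (carrier G \<times> carrier G) 2
       (simpl_D22 G AG c1 (dd_one_form G AG P \<delta>\<theta> \<Phi>)) zero_form \<and>
     (multiplicative_triv G P \<Phi> \<longrightarrow>
        form_eq (NG3 AG) (carrier G \<times> carrier G \<times> carrier G) 1
          (simpl_D31 G AG (dd_one_form G AG P \<delta>\<theta> \<Phi>)) zero_form) \<and>
     (\<forall>(A :: ('m, 'f::locally_convex) atlas) (Y :: ('m, 'y, 'g) pbundle) (I :: 'i set) U g gh.
        smooth_manifold A \<and> principal_bundle G AG A Y \<and> leray_covering A I U \<and>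
        transition_functions G AG A Y I U g \<and> smooth_lifts AG P A I U g gh \<longrightarrow>
        cech_cochain A I U 3 (simpl_pullback AG g c1 (dd_one_form G AG P \<delta>\<theta> \<Phi>)) \<and>
        cech_cochain A I U 3 (dd_cochain (dd_cocycle G P \<Phi> gh)) \<and>
        cohomologous A I U 3
          (simpl_pullback AG g c1 (dd_one_form G AG P \<delta>\<theta> \<Phi>))
          (dd_cochain (dd_cocycle G P \<Phi> gh)) \<and>
        (multiplicative_triv G P \<Phi> \<longrightarrow>
           cech_cocycle A I U 3 (simpl_pullback AG g c1 (dd_one_form G AG P \<delta>\<theta> \<Phi>)) \<and>
           cech_cocycle A I U 3 (dd_cochain (dd_cocycle G P \<Phi> gh))))"
proof -
  interpret dixmier_douady G AG H \<iota> P \<theta> c1 \<delta>\<theta> \<Phi>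
    using assms by unfold_locales
  have "cech_cochain A I U 3 (simpl_pullback AG g c1 (dd_one_form G AG P \<delta>\<theta> \<Phi>)) \<and>
      cech_cochain A I U 3 (dd_cochain (dd_cocycle G P \<Phi> gh)) \<and>
      cohomologous A I U 3 (simpl_pullback AG g c1 (dd_one_form G AG P \<delta>\<theta> \<Phi>)) (dd_cochain (dd_cocycle G P \<Phi> gh)) \<and>
      (multiplicative_triv G P \<Phi> \<longrightarrow>
         cech_cocycle A I U 3 (simpl_pullback AG g c1 (dd_one_form G AG P \<delta>\<theta> \<Phi>)) \<and>
         cech_cocycle A I U 3 (dd_cochain (dd_cocycle G P \<Phi> gh)))"
    if h: "smooth_manifold A" "principal_bundle G AG A Y" "leray_covering A I U"
      "transition_functions G AG A Y I U g" "smooth_lifts AG P A I U g gh"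
    for A :: "('m, 'f) atlas" and Y :: "('m, 'y, 'g) pbundle" and I :: "'i set" and U g gh
    using cech_cochain_C[OF h] cech_cochain_C'[OF h] cohomologous_C_C'[OF h] cech_cocycle_C[OF h] cech_cocycle_C'[OF h]
    by (intro conjI impI)
  then show ?thesis
    using real_form_c1 real_form_dd_one_form simplicial_13 simplicial_22 simplicial_31
    by (intro conjI impI allI) (elim conjE; assumption | blast)+
qed

end
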